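(* Let $n\ge1$, $w\in\mathbb C$, and let $L_{ij}(w)$, $i,j\in\{1,2\}$, be the admissible difference operators on $\hat E_T(X_n)$, of degree $(\mathcal L_{ij}(w),2(i-j),\epsilon(j))$ with $\epsilon(1)=-1$, $\epsilon(2)=1$, defining the action of the elliptic dynamical quantum group (see context). (i) Let $D$ be the divisor on $\hat E_T(\mathrm{pt})$ whose components are the hypersurfaces defined by the equations $z_a+y=w$ for $1\le a\le n$ and $\lambda+yj=0$ for $j=-n,\dots,n-1,n$. Then $L_{ij}(w)$ maps $H^{\mathrm{ell}}_T(X_n)_{\mathcal L}$ to $H_T^{\mathrm{ell}}(X_n)_{\tau^*_{\epsilon(j)}\mathcal L\otimes\mathcal L_{ij}(w)(D)}$ for any $\mathcal L\in\mathrm{Pic}(\hat E_T(\mathrm{pt}))$; that is, it maps $H^{\mathrm{ell}}_T(X_{k,n})_{\mathcal L}$ to $H_T^{\mathrm{ell}}(X_{k+i-j,n})_{\tau^*_{\epsilon(j)}\mathcal L\otimes\mathcal L^k_{ij}(w)(D)}$ for each $k$. (ii) Let $G=U(n)\times U(1)$ and let $\pi:\hat E_T(\mathrm{pt})\to\hat E_G(\mathrm{pt})=E^{(n)}\times E\times E$ be the canonical projection. View line bundles on $\hat E_G(\mathrm{pt})$ as $S_n$-equivariant line bundles on $\hat E_T(\mathrm{pt})$. Then the operators $L_{ij}(w)$ induce well-defined operators from $H^{\mathrm{ell}}_G(X_n)_{\mathcal L}$ to $H^{\mathrm{ell}}_G(X_n)_{\tau^*_{\epsilon(j)}\mathcal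 L\otimes\mathcal L_{ij}(w)(\pi(D))}$ for each $\mathcal L\in\mathrm{Pic}(\hat E_G(\mathrm{pt}))$.
   Context: **Theta function and line bundles.** Fix $\tau$ in the upper half plane, $q=e^{2\pi i\tau}$, $\Lambda=\mathbb Z+\tau\mathbb Z$, $E=\mathbb C/\Lambda$, $\theta(z)=\frac{\sin\pi z}{\pi}\prod_{j\ge1}\frac{(1-q^je^{2\pi iz})(1-q^je^{-2\pi iz})}{(1-q^j)^2}$. For an integral symmetric $p\times p$ matrix $N$ (identified with the quadratic form $N(x)=x^tNx$) and $v\in\mathbb C^p$ let $\mathcal L(N,v)$ be the line bundle on $E^p$ whose sections are functions $f$ on $\mathbb C^p$ with $f(x+e_j)=(-1)^{N_{jj}}f(x)$ and $f(x+\tau e_j)=(-1)^{N_{jj}}e^{-2\pi i(\sum_kN_{jk}x_k+v_j)-\pi i\tau N_{jj}}f(x)$. For a divisor $D$, $\mathcal L(D)$ is the sheaf of meromorphic sections of $\mathcal L$ with poles bounded by $D$. **Cohomology schemes.** $[n]=\{1,\dots,n\}$, $\bar K=[n]\smallsetminus K$, $z_K=(z_a)_{a\in K}$, $E^{(m)}=E^m/S_m$, $X_{k,n}=T^*\mathrm{Gr}(k,n)$, $X_n=\sqcup_{k=0}^nX_{k,n}$, $T=U(1)^n\times U(1)$. $\hat E_T(\mathrm{pt})=E^n\times E\times E$, with coordinates $(z_1,\dots,z_n,y,\lambda)$ on its universal cover. $\hat E_T(X_{k,n})=(E^{(k)}\times E^{(n-k)})\times_{E^{(n)}}E^n\times E\times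 E$, with projection $p_T$ to $\hat E_T(\mathrm{pt})$ and projection $\hat\chi$ to $E^{(k)}\times E^{(n-k)}\times E\times E$. It is the union of the components $Y_K=\iota_K\hat E_T(\mathrm{pt})$, $K\subset[n]$, $|K|=k$, where $\iota_K(z,y,\lambda)=(z_K,z_{\bar K},z,y,\lambda)$. The twisting bundle is $\mathcal T_{k,n}=\hat\chi^*\mathcal L(N_{k,n},0)$ with $N_{k,n}(t,s,y,\lambda)=2\sum_{i=1}^kt_i(\lambda+(n-k)y)+\sum_{i=1}^k\sum_{j=1}^{n-k}(t_i-s_j)^2$. Admissible line bundles on $\hat E_T(X_{k,n})$ are those of the form $p_T^*\mathcal L\otimes\mathcal T_{k,n}$, $\mathcal L$ a line bundle on $\hat E_T(\mathrm{pt})$. A meromorphic section of a line bundle $\mathcal M$ on $\hat E_T(X_{k,n})$ is a collection of meromorphic sections $s_K$ of $\mathcal M|_{Y_K}$ which restrict to meromorphic sections on all intersections $Y_{I_1}\cap\dots\cap Y_{I_s}$ and with $s_I=s_J$ on $Y_I\cap Y_J$; it is holomorphic if all $s_K$ are. Write $\iota_K^*s=s_K$. **Cohomology classes.** $H_T^{\mathrm{ell}}(X_{k,n})_{\mathcal L}$ is the space of holomorphic sections of $p_T^*\mathcal L\otimes\mathcal T_{k,n}$, and $H_T^{\mathrm{ell}}(X_n)_{\mathcal L}=\oplus_kH_T^{\mathrm{ell}}(X_{k,n})_{\mathcal L}$. The group $S_n$ acts on $\hat E_T(\mathrm{pt})$ by $(\sigma z)_{\sigma(a)}=z_a$, and on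 $\hat E_T(X_{k,n})$ compatibly, mapping $Y_K$ to $Y_{\sigma(K)}$; $\mathcal T_{k,n}$ is $S_n$-equivariant. The sheaf of $G$-equivariant classes is $\mathcal H_G^{\mathrm{ell}}(X_{k,n})=(\pi_*p_{T*}\mathcal T_{k,n})^{S_n}$ on $\hat E_G(\mathrm{pt})$, and for $\mathcal L\in\mathrm{Pic}(\hat E_G(\mathrm{pt}))$, $H_G^{\mathrm{ell}}(X_{k,n})_{\mathcal L}=\Gamma(\hat E_G(\mathrm{pt}),\mathcal H_G^{\mathrm{ell}}(X_{k,n})\otimes\mathcal L)$, i.e. the $S_n$-invariant elements of $H_T^{\mathrm{ell}}(X_{k,n})_{\pi^*\mathcal L}$; $H_G^{\mathrm{ell}}(X_n)_{\mathcal L}=\oplus_kH_G^{\mathrm{ell}}(X_{k,n})_{\mathcal L}$. **Admissible difference operators.** $\tau_\nu(y,\lambda)=(y,\lambda+\nu y)$, extended by the identity on other factors. For $\mu\in2\mathbb Z$, $\nu\in\mathbb Z$, an admissible difference operator of degree $(\mathcal L,\mu,\nu)$ on meromorphic sections of $\mathcal M_1=p_T^*\mathcal L_1\otimes\mathcal T_{k,n}$ is a linear map $\varphi$ to meromorphic sections of $\mathcal M_2=p_T^*(\mathcal L\otimes\tau_\nu^*\mathcal L_1)\otimes\mathcal T_{k+\mu/2,n}$ of the form $\iota_K^*\varphi(s)=\sum_{K'}\varphi_{K,K'}\tau_\nu^*\iota_{K'}^*s$ with $\varphi_{K,K'}$ meromorphic sections on $\hat E_T(\mathrm{pt})$ of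 $\iota_K^*\mathcal M_2\otimes\tau_\nu^*\iota_{K'}^*\mathcal M_1^{-1}$ (a bundle independent of $\mathcal L_1$, so the same operator acts on sections of all admissible bundles). For $\mathcal L=(\mathcal L^0,\dots,\mathcal L^n)$, an operator on $\hat E_T(X_n)$ has degree $(\mathcal L,\mu,\nu)$ if its restriction to sections over $\hat E_T(X_{k,n})$ has degree $(\mathcal L^k,\mu,\nu)$, for each $k$ with $0\le k,k+\mu/2\le n$ (sections for other values of $k$ are zero). **The operators $L_{ij}(w)$.** For $I=\{i_1<\dots<i_k\}\subset[n]$: $n(j,I)=|\{l\in I:l>j\}|$, $w(j,I)=n(j,I)-n(j,\bar I)$, $\psi_I(y,\lambda)=\prod_{j\in I}\theta(\lambda-(w(j,I)+1)y)\theta(\lambda-w(j,I)y)$, $$w_I^+(t;z,y,\lambda)=\frac1{\psi_I(y,\lambda)}\sum_{\sigma\in S_k}\sigma\cdot\frac{\prod_{r=1}^k\Big(\prod_{a<i_r}\theta(t_r-z_a+y)\;\theta(\lambda+t_r-z_{i_r}-w(i_r,I)y)\prod_{a>i_r}\theta(t_r-z_a)\Big)}{\prod_{1\le i<j\le k}\theta(t_i-t_j)\theta(t_j-t_i+y)}$$ ($\sigma$ permuting the $t_r$). $\operatorname{Stab}(v_I)$ is the meromorphic section of an admissible line bundle on $\hat E_T(X_{k,n})$ with $\iota_K^*\operatorname{Stab}(v_I)=w_I^+(z_K;z,y,\lambda)$. Let $V=\mathbb C^2$ with standard basis $v_1,v_2$ of weights $1,-1$ (eigenvalues of $h=\mathrm{diag}(1,-1)$),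 and $v_I=v_{j(1)}\otimes\dots\otimes v_{j(n)}$ with $j(a)=1$ if $a\in I$ and $j(a)=2$ otherwise. Let $\alpha(z,y,\lambda)=\frac{\theta(z)\theta(\lambda+y)}{\theta(z-y)\theta(\lambda)}$, $\beta(z,y,\lambda)=-\frac{\theta(z+\lambda)\theta(y)}{\theta(z-y)\theta(\lambda)}$, and let $R(z,y,\lambda)\in\operatorname{End}(V\otimes V)$ fix $v_1\otimes v_1$ and $v_2\otimes v_2$, with $R(v_1\otimes v_2)=\alpha(z,y,\lambda)v_1\otimes v_2+\beta(z,y,-\lambda)v_2\otimes v_1$, $R(v_2\otimes v_1)=\beta(z,y,\lambda)v_1\otimes v_2+\alpha(z,y,-\lambda)v_2\otimes v_1$. On $V\otimes V^{\otimes n}$ (factors numbered $0,\dots,n$) put $$R\Big(w-z_1,y,\lambda-y\sum_{i=2}^nh^{(i)}\Big)^{(01)}R\Big(w-z_2,y,\lambda-y\sum_{i=3}^nh^{(i)}\Big)^{(02)}\cdots R(w-z_n,y,\lambda)^{(0n)}(v_j\otimes v_I)=\sum_{i,K}L_{ij}(w,z,y,\lambda)_I^K\,v_i\otimes v_K,$$ where $h^{(i)}$ denotes the weight in the $i$-th factor. The operators $L_{ij}(w)$ of the theorem are the unique admissible difference operators (their existence, for suitable $S_n$-equivariant line bundles $\mathcal L_{ij}(w)=(\mathcal L_{ij}^0(w),\dots,\mathcal L_{ij}^n(w))$ on $\sqcup_{k=0}^n\hat E_T(\mathrm{pt})$, may be taken as given) of degree $(\mathcal L_{ij}(w),2(i-j),\epsilon(j))$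 such that $L_{ij}(w)\operatorname{Stab}(v_I)=\sum_KL_{ij}(w,z,y,\lambda)_I^K\operatorname{Stab}(v_K)$ for all $I\subset[n]$. *)

theory Defs
  imports "HOL-Analysis.Analysis" "HOL-Library.Multiset"
begin

text \<open>
  The index set $\{1,\dots,n\}$ is a finite linearly ordered type \<open>'n\<close> (so $n =$ \<open>CARD('n)\<close> $\ge 1$);
  a point \<open>(z, y, \<lambda>)\<close> of \<open>'n pt\<close> is a point of the universal cover $C^n \times C \times C$ of
  $E^n \times E \times E$.
\<close>

type_synonym 'n pt = "(complex ^ 'n) \<times> complex \<times> complex"

definition theta :: "complex \<Rightarrow> complex \<Rightarrow> complex" where
  "theta \<tau> z = (let q = exp (2 * of_real pi * \<i> * \<tau>);
       e = exp (2 * of_real pi * \<i> * z); e' = exp (- 2 * of_real pi * \<i> * z)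
     in sin (of_real pi * z) / of_real pi *
        (\<Prod>j. (1 - q ^ Suc j * e) * (1 - q ^ Suc j * e') / (1 - q ^ Suc j)\<^sup>2))"

definition lattice1 :: "complex \<Rightarrow> complex set" where
  "lattice1 \<tau> = {of_int a + \<tau> * of_int b |a b. True}"

definition lattice :: "complex \<Rightarrow> ('n::finite) pt set" where
  "lattice \<tau> = {(v, c, d). (\<forall>a. v $ a \<in> lattice1 \<tau>) \<and> c \<in> lattice1 \<tau> \<and> d \<in> lattice1 \<tau>}"

definition cscale :: "complex \<Rightarrow> ('n::finite) pt \<Rightarrow> 'n pt" where
  "cscale c = (\<lambda>(z, y, l). (c *s z, c * y, c * l))"

section \<open>Holomorphic and meromorphic functions of several variables\<close>

definition holo_on :: "(('n::finite) pt \<Rightarrow> complex) \<Rightarrow> 'n pt set \<Rightarrow> bool" where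
  "holo_on f U \<longleftrightarrow> (\<forall>x\<in>U. \<exists>f'. (f has_derivative f') (at x) \<and> (\<forall>c v. f' (cscale c v) = c * f' v))"

text \<open>
  A meromorphic function is represented by a total function, two of which are identified when they
  agree on a dense open set; values at poles and points of indeterminacy are irrelevant. All
  predicates below are invariant under this identification.
\<close>

definition gen_eq :: "(('n::finite) pt \<Rightarrow> complex) \<Rightarrow> ('n pt \<Rightarrow> complex) \<Rightarrow> bool" where
  "gen_eq f g \<longleftrightarrow> (\<exists>A. open A \<and> closure A = UNIV \<and> (\<forall>x\<in>A. f x = g x))"

text \<open>
  \<open>quot_on Z U f g h\<close>: on the open set \<open>U\<close> the meromorphic function \<open>f\<close> is the quotient \<open>g / h\<close> of
  holomorphic functions, with \<open>h\<close> not vanishing identically on any relatively open part of \<open>U\<close>, nor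
  on any relatively open part of \<open>Z \<inter> U\<close>. The latter says that no component of the analytic set \<open>Z\<close>
  lies in the polar locus, so that \<open>f\<close> restricts to the meromorphic function \<open>g / h\<close> on \<open>Z \<inter> U\<close>.
\<close>

definition quot_on ::
  "('n::finite) pt set \<Rightarrow> 'n pt set \<Rightarrow> ('n pt \<Rightarrow> complex) \<Rightarrow> ('n pt \<Rightarrow> complex) \<Rightarrow> ('n pt \<Rightarrow> complex) \<Rightarrow> bool" where
  "quot_on Z U f g h \<longleftrightarrow> open U \<and> holo_on g U \<and> holo_on h U
     \<and> U \<subseteq> closure {u \<in> U. h u \<noteq> 0} \<and> Z \<inter> U \<subseteq> closure {u \<in> Z \<inter> U. h u \<noteq> 0}
     \<and> (\<exists>A. open A \<and> U \<subseteq> closure A \<and> (\<forall>u\<in>A \<inter> U. h u * f u = g u))"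

definition mero :: "(('n::finite) pt \<Rightarrow> complex) \<Rightarrow> bool" where
  "mero f \<longleftrightarrow> (\<forall>x. \<exists>U g h. x \<in> U \<and> quot_on UNIV U f g h)"

text \<open>
  An effective reduced divisor on $E^n \times E \times E$ is given by a finite set of affine functions
  \<open>p\<close>, one for each component; the component of \<open>p\<close> has preimage \<open>{x. p x \<in> \<Lambda>}\<close> in the universal
  cover, so near a point \<open>x\<close> of it \<open>p - p x\<close> is a local equation. The empty set gives
  holomorphy.
\<close>

definition local_eqn :: "complex \<Rightarrow> (('n::finite) pt \<Rightarrow> complex) set \<Rightarrow> 'n pt \<Rightarrow> 'n pt \<Rightarrow> complex" where
  "local_eqn \<tau> D x u = (\<Prod>p \<in> {p \<in> D. p x \<in> lattice1 \<tau>}. p u - p x)"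

definition poles_bounded :: "complex \<Rightarrow> (('n::finite) pt \<Rightarrow> complex) set \<Rightarrow> ('n pt \<Rightarrow> complex) \<Rightarrow> bool" where
  "poles_bounded \<tau> D f \<longleftrightarrow> (\<forall>x. \<exists>U g. x \<in> U \<and> quot_on UNIV U f g (local_eqn \<tau> D x))"

section \<open>Line bundles\<close>

text \<open>
  Line bundles on $E^n \times E \times E$ become trivial on the universal cover, hence are given by
  factors of automorphy: sections satisfy $f(x + \gamma) = e_\gamma(x) f(x)$. Only the values
  at \<open>\<gamma> \<in> lattice \<tau>\<close> matter.
\<close>

type_synonym 'n factor = "'n pt \<Rightarrow> 'n pt \<Rightarrow> complex"

definition line_bundle :: "complex \<Rightarrow> ('n::finite) factor \<Rightarrow> bool" where
  "line_bundle \<tau> e \<longleftrightarrow>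
     (\<forall>\<gamma>\<in>lattice \<tau>. holo_on (e \<gamma>) UNIV \<and> (\<forall>x. e \<gamma> x \<noteq> 0)) \<and>
     (\<forall>\<gamma>\<in>lattice \<tau>. \<forall>\<delta>\<in>lattice \<tau>. \<forall>x. e (\<gamma> + \<delta>) x = e \<gamma> (x + \<delta>) * e \<delta> x)"

definition tensor :: "('n::finite) factor \<Rightarrow> 'n factor \<Rightarrow> 'n factor" where
  "tensor e e' = (\<lambda>\<gamma> x. e \<gamma> x * e' \<gamma> x)"

definition dual :: "('n::finite) factor \<Rightarrow> 'n factor" where
  "dual e = (\<lambda>\<gamma> x. inverse (e \<gamma> x))"

definition shift :: "int \<Rightarrow> ('n::finite) pt \<Rightarrow> 'n pt" where
  "shift \<nu> = (\<lambda>(z, y, l). (z, y, l + of_int \<nu> * y))"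

text \<open>Pullback along \<open>shift \<nu>\<close>; its linear part, acting on the lattice, is \<open>shift \<nu>\<close> itself.\<close>

definition pull :: "int \<Rightarrow> ('n::finite) factor \<Rightarrow> 'n factor" where
  "pull \<nu> e = (\<lambda>\<gamma> x. e (shift \<nu> \<gamma>) (shift \<nu> x))"

definition mero_section :: "complex \<Rightarrow> ('n::finite) factor \<Rightarrow> ('n pt \<Rightarrow> complex) \<Rightarrow> bool" where
  "mero_section \<tau> e f \<longleftrightarrow> mero f \<and> (\<forall>\<gamma>\<in>lattice \<tau>. gen_eq (\<lambda>x. f (x + \<gamma>)) (\<lambda>x. e \<gamma> x * f x))"

text \<open>
  The line bundle $\mathcal L(Q, 0)$ of an integral quadratic form \<open>Q\<close>. A vector is written
  $\gamma = a + \tau b$ with \<open>a\<close>, \<open>b\<close> real, and \<open>polar Q\<close> is the symmetric bilinear form of \<open>Q\<close>, so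
  that $Q(e_j) = N_{jj}$ and \<open>polar Q\<close> $(e_j, x) = \sum_k N_{jk} x_k$. The lemmas
  below recover the defining multipliers at the generators $e_j$, $\tau e_j$ of the lattice.
\<close>

definition polar :: "(('n::finite) pt \<Rightarrow> complex) \<Rightarrow> 'n pt \<Rightarrow> 'n pt \<Rightarrow> complex" where
  "polar Q x x' = (Q (x + x') - Q x - Q x') / 2"

definition coord1 :: "complex \<Rightarrow> complex \<Rightarrow> complex" where
  "coord1 \<tau> c = of_real (Im c / Im \<tau>)"

definition tau_part :: "complex \<Rightarrow> ('n::finite) pt \<Rightarrow> 'n pt" where
  "tau_part \<tau> = (\<lambda>(v, c, d). (\<chi> a. coord1 \<tau> (v $ a), coord1 \<tau> c, coord1 \<tau> d))"

definition form_bundle :: "complex \<Rightarrow> (('n::finite) pt \<Rightarrow> complex) \<Rightarrow> 'n factor" where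
  "form_bundle \<tau> Q = (\<lambda>\<gamma> x. let b = tau_part \<tau> \<gamma>; a = \<gamma> - cscale \<tau> b in
     exp (pi * \<i> * (Q a + Q b) - 2 * pi * \<i> * polar Q b x - pi * \<i> * \<tau> * Q b))"

definition real_pt :: "('n::finite) pt \<Rightarrow> bool" where
  "real_pt = (\<lambda>(v, c, d). (\<forall>a. v $ a \<in> \<real>) \<and> c \<in> \<real> \<and> d \<in> \<real>)"

lemma form_bundle_real_generator:
  fixes e :: "('n::finite) pt"
  assumes "real_pt e" "Q 0 = 0"
  shows "form_bundle \<tau> Q e x = exp (pi * \<i> * Q e)"
proof -
  have "tau_part \<tau> e = 0"
    using assms(1) by (cases e) (auto simp: real_pt_def tau_part_def coord1_def zero_prod_def vec_eq_iff complex_is_Real_iff)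
  moreover have "cscale \<tau> 0 = (0 :: 'n pt)"
    by (simp add: cscale_def zero_prod_def)
  ultimately show ?thesis
    using assms(2) by (simp add: form_bundle_def polar_def)
qed

lemma form_bundle_tau_generator:
  fixes e :: "('n::finite) pt"
  assumes "Im \<tau> > 0" "real_pt e" "Q 0 = 0"
  shows "form_bundle \<tau> Q (cscale \<tau> e) x =
    exp (pi * \<i> * Q e) * exp (- 2 * pi * \<i> * polar Q e x - pi * \<i> * \<tau> * Q e)"
proof -
  have *: "coord1 \<tau> (\<tau> * r) = r" if "r \<in> \<real>" for r
    using that assms(1) by (auto simp: coord1_def Reals_def)
  have "tau_part \<tau> (cscale \<tau> e) = e"
    using assms(2) by (cases e) (auto simp: real_pt_def tau_part_def cscale_def vec_eq_iff *)
  then show ?thesis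
    using assms(3) by (simp add: form_bundle_def Let_def exp_add [symmetric] algebra_simps)
qed

section \<open>The cohomology scheme\<close>

text \<open>
  The component $Y_K$ is identified with $E^n \times E \times E$ by \<open>\<iota>\<^sub>K\<close>, and
  \<open>twist_form K\<close> is the form $N_{k,n}$ at $t = z_K$, $s = z_{\bar K}$, so that \<open>twist \<tau> K\<close> is the
  \<open>\<iota>\<^sub>K\<close>-pullback of $\mathcal T_{k,n}$.
\<close>

definition twist_form :: "('n::finite) set \<Rightarrow> 'n pt \<Rightarrow> complex" where
  "twist_form K = (\<lambda>(z, y, l). 2 * (\<Sum>a\<in>K. z $ a * (l + of_nat (card (- K)) * y))
     + (\<Sum>a\<in>K. \<Sum>b\<in>- K. (z $ a - z $ b)\<^sup>2))"

definition twist :: "complex \<Rightarrow> ('n::finite) set \<Rightarrow> 'n factor" where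
  "twist \<tau> K = form_bundle \<tau> (twist_form K)"

text \<open>
  Lift of the intersection of the $Y_K$, \<open>K \<in> F\<close>. A point of this intersection has $z_K$ the same in
  $E^k/S_k$ for all \<open>K \<in> F\<close>; choosing one representative in $C$ for each point of $E$ occurring
  among the coordinates gives a lift for which the $z_K$ agree as multisets in $C$. At such a lift
  the points $\iota_K$ of the covers differ by a permutation of coordinates only, so the fibres
  over $Y_I$ and $Y_J$ of the bundles considered are identified by equality of function values.
\<close>

definition inter_lift :: "('n::finite) set set \<Rightarrow> 'n pt set" where
  "inter_lift F = {(z, y, l). \<forall>I\<in>F. \<forall>J\<in>F.
     image_mset (\<lambda>a. z $ a) (mset_set I) = image_mset (\<lambda>a. z $ a) (mset_set J)}"

text \<open>
  A section over $\hat E_T(X_n)$ is a family $s_K$; its component over $\hat E_T(X_{k,n})$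
  consists of the $s_K$ with \<open>card K = k\<close>.
\<close>

type_synonym 'n sect = "'n set \<Rightarrow> 'n pt \<Rightarrow> complex"

text \<open>Meromorphic sections of $p_T^*\mathcal L \otimes \mathcal T_{k,n}$, where \<open>e\<close> is the factor of $\mathcal L$.\<close>

definition mero_sect :: "complex \<Rightarrow> nat \<Rightarrow> ('n::finite) factor \<Rightarrow> 'n sect \<Rightarrow> bool" where
  "mero_sect \<tau> k e s \<longleftrightarrow>
     (\<forall>K. card K = k \<longrightarrow> mero_section \<tau> (tensor e (twist \<tau> K)) (s K)) \<and>
     (\<forall>F. F \<noteq> {} \<and> F \<subseteq> {K. card K = k} \<longrightarrow>
        (\<forall>K\<in>F. \<forall>x\<in>inter_lift F. \<exists>U g h. x \<in> U \<and> quot_on (inter_lift F) U (s K) g h)) \<and>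
     (\<forall>I J. card I = k \<and> card J = k \<longrightarrow>
        (\<forall>x\<in>inter_lift {I, J}. \<exists>U g h g' h'. x \<in> U \<and>
           quot_on (inter_lift {I, J}) U (s I) g h \<and> quot_on (inter_lift {I, J}) U (s J) g' h' \<and>
           (\<forall>u\<in>inter_lift {I, J} \<inter> U. g u * h' u = g' u * h u)))"

text \<open>\<open>H_T \<tau> k e D\<close> is $H_T^{ell}(X_{k,n})_{\mathcal L(D)}$.\<close>

definition H_T :: "complex \<Rightarrow> nat \<Rightarrow> ('n::finite) factor \<Rightarrow> ('n pt \<Rightarrow> complex) set \<Rightarrow> 'n sect set" where
  "H_T \<tau> k e D = {s. mero_sect \<tau> k e s \<and> (\<forall>K. card K = k \<longrightarrow> poles_bounded \<tau> D (s K))}"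

section \<open>Equivariance under the symmetric group\<close>

definition perm :: "('n \<Rightarrow> 'n) \<Rightarrow> ('n::finite) pt \<Rightarrow> 'n pt" where
  "perm \<sigma> = (\<lambda>(z, y, l). (\<chi> a. z $ inv \<sigma> a, y, l))"

text \<open>
  An $S_n$-equivariant line bundle is a factor \<open>e\<close> with a linearisation \<open>c\<close>, where \<open>\<sigma>\<close> acts
  on functions by $(\sigma f)(\sigma x) = c_\sigma(x) f(x)$. Together, \<open>e\<close> and \<open>c\<close> form a cocycle of the
  semidirect product of the lattice with $S_n$.
\<close>

definition equivariant_bundle ::
  "complex \<Rightarrow> ('n::finite) factor \<Rightarrow> (('n \<Rightarrow> 'n) \<Rightarrow> 'n pt \<Rightarrow> complex) \<Rightarrow> bool" where
  "equivariant_bundle \<tau> e c \<longleftrightarrow> line_bundle \<tau> e \<and>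
     (\<forall>\<sigma>. bij \<sigma> \<longrightarrow> holo_on (c \<sigma>) UNIV \<and> (\<forall>x. c \<sigma> x \<noteq> 0)) \<and>
     (\<forall>\<sigma> \<rho> x. bij \<sigma> \<and> bij \<rho> \<longrightarrow> c (\<sigma> \<circ> \<rho>) x = c \<sigma> (perm \<rho> x) * c \<rho> x) \<and>
     (\<forall>\<sigma> x. \<forall>\<gamma>\<in>lattice \<tau>. bij \<sigma> \<longrightarrow> e (perm \<sigma> \<gamma>) (perm \<sigma> x) * c \<sigma> x = c \<sigma> (x + \<gamma>) * e \<gamma> x)"

text \<open>
  Line bundles on $E^{(n)} \times E \times E$, presented by their pullback under \<open>\<pi>\<close>: an equivariant bundle
  descends to the quotient iff stabilisers of points of $E^n \times E \times E$ act trivially on the fibres.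
\<close>

definition G_bundle ::
  "complex \<Rightarrow> ('n::finite) factor \<Rightarrow> (('n \<Rightarrow> 'n) \<Rightarrow> 'n pt \<Rightarrow> complex) \<Rightarrow> bool" where
  "G_bundle \<tau> e c \<longleftrightarrow> equivariant_bundle \<tau> e c \<and>
     (\<forall>\<sigma> x. \<forall>\<gamma>\<in>lattice \<tau>. bij \<sigma> \<and> perm \<sigma> x = x + \<gamma> \<longrightarrow> c \<sigma> x = e \<gamma> x)"

text \<open>
  The linearisation of $\mathcal T_{k,n} = \hat\chi^* \mathcal L(N_{k,n}, 0)$ is the one of a pullback by the invariant
  map $\hat\chi$: permutation of the variables, since \<open>twist_form (\<sigma> ` K) (perm \<sigma> x) = twist_form K x\<close>.
  For an invariant divisor \<open>D\<close> without ramification components, $\pi^*(\pi(D)) = D$, so \<open>H_G\<close> with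
  the argument \<open>D\<close> is the space of $G$-equivariant classes twisted by $\pi(D)$.
\<close>

definition H_G ::
  "complex \<Rightarrow> nat \<Rightarrow> ('n::finite) factor \<Rightarrow> (('n \<Rightarrow> 'n) \<Rightarrow> 'n pt \<Rightarrow> complex) \<Rightarrow> ('n pt \<Rightarrow> complex) set \<Rightarrow> 'n sect set" where
  "H_G \<tau> k e c D = {s \<in> H_T \<tau> k e D. \<forall>\<sigma> K. bij \<sigma> \<and> card K = k \<longrightarrow>
     gen_eq (\<lambda>x. s (\<sigma> ` K) (perm \<sigma> x)) (\<lambda>x. c \<sigma> x * s K x)}"

lemma twist_form_perm:
  fixes K :: "('n::finite) set"
  assumes "bij \<sigma>"
  shows "twist_form (\<sigma> ` K) (perm \<sigma> x) = twist_form K x"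
proof -
  have inj: "inj_on \<sigma> A" for A
    using assms by (auto simp: bij_def inj_on_def)
  have compl: "- (\<sigma> ` K) = \<sigma> ` (- K)"
    using assms by (metis bij_image_Compl_eq)
  have [simp]: "inv \<sigma> (\<sigma> a) = a" for a
    using assms by (simp add: bij_is_inj)
  show ?thesis
    by (cases x) (simp add: twist_form_def perm_def compl sum.reindex [OF inj] card_image [OF inj])
qed

section \<open>Admissible difference operators\<close>

text \<open>
  A difference operator is given by its matrix \<open>M\<close>; it sends families indexed by subsets of size
  \<open>k\<close> to families indexed by subsets of size \<open>k + \<mu> / 2\<close>.
\<close>

definition diff_op :: "int \<Rightarrow> int \<Rightarrow> (('n::finite) set \<Rightarrow> 'n set \<Rightarrow> 'n pt \<Rightarrow> complex) \<Rightarrow> 'n sect \<Rightarrow> 'n sect" where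
  "diff_op \<mu> \<nu> M s K x =
     (\<Sum>K' | int (card K) = int (card K') + \<mu> div 2. M K K' x * s K' (shift \<nu> x))"

text \<open>
  Degree $(\mathcal L, \mu, \nu)$ with $\mathcal L = (\mathcal L^0, \dots, \mathcal L^n)$ given by \<open>L\<close>. The entry $\varphi_{K,K'}$ is a section
  of $\iota_K^*\mathcal M_2 \otimes \tau_\nu^*\iota_{K'}^*\mathcal M_1^{-1}$, in which the two factors $\tau_\nu^*\mathcal L_1$ and
  $\tau_\nu^*\mathcal L_1^{-1}$ have been cancelled. The image of a section is a collection of meromorphic
  sections on the components; that it glues along intersections is not part of the
  definition, as it fails for some meromorphic sections: for $n = k = 2$ there is no gluing
  condition on the source, and a section with a pole along $z_1 = z_2$ is sent by $L_{12}(w)$ to a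
  family with poles along the intersection of the two components for $k = 1$.
\<close>

definition admissible_op ::
  "complex \<Rightarrow> (nat \<Rightarrow> ('n::finite) factor) \<Rightarrow> int \<Rightarrow> int \<Rightarrow> ('n set \<Rightarrow> 'n set \<Rightarrow> 'n pt \<Rightarrow> complex) \<Rightarrow> bool" where
  "admissible_op \<tau> L \<mu> \<nu> M \<longleftrightarrow> even \<mu> \<and>
     (\<forall>K K'. int (card K) = int (card K') + \<mu> div 2 \<longrightarrow>
        mero_section \<tau> (tensor (tensor (L (card K')) (twist \<tau> K)) (dual (pull \<nu> (twist \<tau> K')))) (M K K'))"

section \<open>Stable envelopes\<close>

definition ncount :: "('n::{finite,linorder}) \<Rightarrow> 'n set \<Rightarrow> nat" where
  "ncount j I = card {l \<in> I. l > j}"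

definition wcount :: "('n::{finite,linorder}) \<Rightarrow> 'n set \<Rightarrow> int" where
  "wcount j I = int (ncount j I) - int (ncount j (- I))"

definition psi :: "complex \<Rightarrow> ('n::{finite,linorder}) set \<Rightarrow> complex \<Rightarrow> complex \<Rightarrow> complex" where
  "psi \<tau> I y l =
     (\<Prod>j\<in>I. theta \<tau> (l - of_int (wcount j I + 1) * y) * theta \<tau> (l - of_int (wcount j I) * y))"

text \<open>\<open>elt I r\<close> is $i_{r+1}$: positions \<open>r\<close> and the variables $t_r$ are numbered from 0.\<close>

definition elt :: "('n::{finite,linorder}) set \<Rightarrow> nat \<Rightarrow> 'n" where
  "elt I r = sorted_list_of_set I ! r"

definition weight_fun :: "complex \<Rightarrow> ('n::{finite,linorder}) set \<Rightarrow> (nat \<Rightarrow> complex) \<Rightarrow> 'n pt \<Rightarrow> complex" where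
  "weight_fun \<tau> I t = (\<lambda>(z, y, l). 1 / psi \<tau> I y l *
     (\<Sum>\<sigma> | \<sigma> permutes {..<card I}.
        (\<Prod>r<card I.
            (\<Prod>a | a < elt I r. theta \<tau> (t (\<sigma> r) - z $ a + y)) *
            theta \<tau> (l + t (\<sigma> r) - z $ elt I r - of_int (wcount (elt I r) I) * y) *
            (\<Prod>a | a > elt I r. theta \<tau> (t (\<sigma> r) - z $ a))) /
        (\<Prod>(i, j) \<in> {(i, j). i < j \<and> j < card I}.
            theta \<tau> (t (\<sigma> i) - t (\<sigma> j)) * theta \<tau> (t (\<sigma> j) - t (\<sigma> i) + y))))"

definition stab :: "complex \<Rightarrow> ('n::{finite,linorder}) set \<Rightarrow> 'n sect" where
  "stab \<tau> I K x = weight_fun \<tau> I (\<lambda>r. fst x $ elt K r) x"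

section \<open>The dynamical R-matrix and the L-operator\<close>

definition alpha :: "complex \<Rightarrow> complex \<Rightarrow> complex \<Rightarrow> complex \<Rightarrow> complex" where
  "alpha \<tau> z y l = theta \<tau> z * theta \<tau> (l + y) / (theta \<tau> (z - y) * theta \<tau> l)"

definition beta :: "complex \<Rightarrow> complex \<Rightarrow> complex \<Rightarrow> complex \<Rightarrow> complex" where
  "beta \<tau> z y l = - (theta \<tau> (z + l) * theta \<tau> y / (theta \<tau> (z - y) * theta \<tau> l))"

text \<open>\<open>Rmat \<tau> z y \<lambda> (i, i') (j, j')\<close> is the coefficient of $v_i \otimes v_{i'}$ in $R(z,y,\lambda)(v_j \otimes v_{j'})$.\<close>

definition Rmat :: "complex \<Rightarrow> complex \<Rightarrow> complex \<Rightarrow> complex \<Rightarrow> nat \<times> nat \<Rightarrow> nat \<times> nat \<Rightarrow> complex" where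
  "Rmat \<tau> z y l p p' =
    (if p' = (1, 1) \<or> p' = (2, 2) then (if p = p' then 1 else 0)
     else if p' = (1, 2) then
       (if p = (1, 2) then alpha \<tau> z y l else if p = (2, 1) then beta \<tau> z y (- l) else 0)
     else if p' = (2, 1) then
       (if p = (1, 2) then beta \<tau> z y l else if p = (2, 1) then alpha \<tau> z y (- l) else 0)
     else 0)"

definition tensor_idx :: "'n set \<Rightarrow> 'n \<Rightarrow> nat" where
  "tensor_idx I a = (if a \<in> I then 1 else 2)"

definition weight :: "'n set \<Rightarrow> 'n \<Rightarrow> complex" where
  "weight I a = (if a \<in> I then 1 else - 1)"

text \<open>
  Vectors of $V \otimes V^{\otimes n}$ are coefficient functions \<open>u\<close>, standing for $\sum_{j,I} u_{j,I} v_j \otimes v_I$ with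
  $j \in \{1,2\}$. \<open>R_factor\<close> is the operator $R(w - z_a, y, \lambda - y\sum_{b>a} h^{(b)})^{(0a)}$.
\<close>

definition R_factor ::
  "complex \<Rightarrow> complex \<Rightarrow> ('n::{finite,linorder}) pt \<Rightarrow> 'n \<Rightarrow> (nat \<Rightarrow> 'n set \<Rightarrow> complex) \<Rightarrow> nat \<Rightarrow> 'n set \<Rightarrow> complex" where
  "R_factor \<tau> w = (\<lambda>(z, y, l) a u i J.
     (\<Sum>j\<in>{1, 2}. \<Sum>I | I - {a} = J - {a}.
        Rmat \<tau> (w - z $ a) y (l - y * (\<Sum>b | b > a. weight I b))
          (i, tensor_idx J a) (j, tensor_idx I a) * u j I))"

definition Lcoeff ::
  "complex \<Rightarrow> nat \<Rightarrow> nat \<Rightarrow> complex \<Rightarrow> ('n::{finite,linorder}) pt \<Rightarrow> 'n set \<Rightarrow> 'n set \<Rightarrow> complex" where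
  "Lcoeff \<tau> i j w x I K =
     foldr (R_factor \<tau> w x) (sorted_list_of_set UNIV)
       (\<lambda>j' I'. if j' = j \<and> I' = I then 1 else 0) i K"

definition eps :: "nat \<Rightarrow> int" where
  "eps j = (if j = 1 then - 1 else 1)"

text \<open>
  \<open>M\<close> is the matrix of $L_{ij}(w)$, and \<open>L\<close> the bundle $\mathcal L_{ij}(w)$ of its degree. The
  equivariant structure of $\mathcal L_{ij}(w)$ is the permutation of the variables of functions.
\<close>

definition L_operator ::
  "complex \<Rightarrow> complex \<Rightarrow> nat \<Rightarrow> nat \<Rightarrow> (nat \<Rightarrow> ('n::{finite,linorder}) factor) \<Rightarrow> ('n set \<Rightarrow> 'n set \<Rightarrow> 'n pt \<Rightarrow> complex) \<Rightarrow> bool" where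
  "L_operator \<tau> w i j L M \<longleftrightarrow>
     (\<forall>k \<le> CARD('n). equivariant_bundle \<tau> (L k) (\<lambda>\<sigma> x. 1)) \<and>
     admissible_op \<tau> L (2 * (int i - int j)) (eps j) M \<and>
     (\<forall>I K'. int (card K') = int (card I) + (int i - int j) \<longrightarrow>
        gen_eq (diff_op (2 * (int i - int j)) (eps j) M (stab \<tau> I) K')
          (\<lambda>x. \<Sum>K | card K = card K'. Lcoeff \<tau> i j w x I K * stab \<tau> K K' x))"

definition pole_divisor :: "complex \<Rightarrow> (('n::finite) pt \<Rightarrow> complex) set" where
  "pole_divisor w =
     {(\<lambda>(z, y, l). z $ a + y - w) |a. True} \<union>
     {(\<lambda>(z, y, l). l + of_int j * y) |j. j \<in> {- int CARD('n)..int CARD('n)}}"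

end

theory Submission
 imports Defs "HOL-Complex_Analysis.Conformal_Mappings"
begin

text \<open>
  The matrix of stable envelopes is triangular, so the defining relation determines the matrix \<open>M\<close> of
  $L_{ij}(w)$. Exchanging two adjacent sites multiplies the stable envelopes by an $R$-matrix, and by the
  dynamical Yang-Baxter equation the coefficients of the $L$-operator are intertwined in the same way; hence
  \<open>M\<close> is invariant under $S_n$. Each entry can therefore be computed at a convenient pair of subsets, where
  triangularity leaves few terms of the relation. It follows that \<open>M\<close> has at most simple poles, on \<open>D\<close> and
  on the divisors $z_a = z_b$. On $z_a = z_b$ the residues at \<open>K'\<close> and at its image under the transposition
  $(a b)$ are opposite, while a section takes the same value on both components, so these poles cancel in
  the image of a holomorphic section; quasi-periodicity extends this to the translates of $z_a = z_b$ by the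
  lattice. The components of the image agree on $z_a = z_b$ by comparing derivatives transversal to it.
\<close>

section \<open>The theta function\<close>

text \<open>The obstacle is the dynamical variable lambda. For the first k sites the relation has
  one term on the left, and solving it divides only by differences z_a - z_b. Off the diagonal of
  L_11 the right side then also has one term, whose denominators in lambda cancel except lambda and
  lambda - y. For the diagonal entries of L_11 the right side is a genuine sum with uncontrolled
  poles in lambda. The relation for the last k sites has a one-term right side with telescoping
  lambda-factors, but solving it divides by factors z_a - z_b + y and may double the pole at lambda
  = y. The two bounds have no excess divisor in common, so each removes the excess of the other.

  The argument behind all such removals: a hypersurface drops out of the pole divisor of f as soon
  as q f is holomorphic for some holomorphic q that vanishes on no open part of that hypersurface.
  This needs division of a holomorphic function of several variables by theta of an affine form.
  Meromorphic functions are therefore handled through holomorphic multiples, never through their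
  values, which are meaningful only generically.\<close>

definition qprod :: "complex => complex => complex" where
 "qprod q c = (\<Prod>j. 1 - q ^ Suc j * c)"

lemma qprod_convergent:
 fixes q c :: complex
 assumes "norm q < 1"
 shows "convergent_prod (%j. 1 - q ^ Suc j * c)"
proof -
 have "summable (%j. norm c * norm q * norm q ^ j)"
  using assms by (intro summable_mult summable_geometric) auto
 moreover have "(%j. norm c * norm q * norm q ^ j) = (%j. norm (- (q ^ Suc j * c)))"
  by (simp add: fun_eq_iff norm_mult norm_power)
 ultimately have "summable (%j. norm (- (q ^ Suc j * c)))"
  by simp
 thus ?thesis
  by (intro abs_convergent_prod_imp_convergent_prod summable_imp_abs_convergent_prod) simp
qed

text \<open>\<open>qprod q c\<close> is the q-Pochhammer symbol (q c; q) with infinitely many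
  factors, and this is its functional equation. The head of an infinite product is split off where
  it is nonzero; a vanishing head is covered by the zero criterion.\<close>

lemma qprod_rec:
 assumes "norm q < 1"
 shows "qprod q c = (1 - q * c) * qprod q (q * c)"
proof -
 have e: "qprod q (q * c) = (\<Prod>j. 1 - q ^ Suc (Suc j) * c)"
  by (simp add: qprod_def algebra_simps)
 show ?thesis
 proof (cases "1 - q * c = 0")
  case True
  have "(%j. 1 - q ^ Suc j * c) has_prod qprod q c"
   unfolding qprod_def by (rule convergent_prod_has_prod) (rule qprod_convergent[OF assms])
  hence "qprod q c = 0"
   using True has_prod_eq_0_iff[of "%j. 1 - q ^ Suc j * c" "qprod q c"]
   by (auto intro!: image_eqI[where x=0])
  thus ?thesis using True by simp
 next
  case False
  thus ?thesis
   using prodinf_split_head[OF qprod_convergent[OF assms, of c]] e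
   by (simp add: qprod_def)
 qed
qed

lemma qprod_eq_0_iff:
 assumes "norm q < 1"
 shows "qprod q c = 0 \<longleftrightarrow> (\<exists>j. q ^ Suc j * c = 1)"
proof -
 have "(%j. 1 - q ^ Suc j * c) has_prod qprod q c"
  unfolding qprod_def by (rule convergent_prod_has_prod) (rule qprod_convergent[OF assms])
 thus ?thesis
  using has_prod_eq_0_iff[of "%j. 1 - q ^ Suc j * c" "qprod q c"] by (auto simp: image_iff)
qed

text \<open>On the unit disc around any point the factors differ from 1 by a geometric series, so
  the partial products converge locally uniformly in c.\<close>

lemma qprod_holomorphic:
 assumes "norm q < 1"
 shows "qprod q holomorphic_on UNIV"
proof (rule holomorphic_uniform_sequence)
 fix z :: complex
 have "uniformly_convergent_on (cball z 1) (%N x. \<Prod>j<N. 1 - q ^ Suc j * x)"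
 proof (rule uniformly_convergent_on_prod')
  show "uniformly_convergent_on (cball z 1) (%N x. \<Sum>n<N. norm (1 - q ^ Suc n * x - 1))"
  proof (rule Weierstrass_m_test')
   fix n x assume "x \<in> cball z (1::real)"
   hence "norm x \<le> norm z + 1"
    using norm_triangle_ineq2[of x z] by (auto simp: dist_norm norm_minus_commute)
   thus "norm (norm (1 - q ^ Suc n * x - 1)) \<le> norm q ^ Suc n * (norm z + 1)"
    by (simp add: norm_mult norm_power mult_left_mono mult.assoc)
  next
   have "summable (%n. norm q * (norm z + 1) * norm q ^ n)"
    using assms by (intro summable_mult summable_geometric) auto
   thus "summable (%n. norm q ^ Suc n * (norm z + 1))"
    by (simp add: algebra_simps)
  qed
 qed (auto intro!: continuous_intros)
 then obtain l where l: "uniform_limit (cball z 1) (%N x. \<Prod>j<N. 1 - q ^ Suc j * x) l sequentially"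
  unfolding uniformly_convergent_on_def by blast
 have "l x = qprod q x" if "x \<in> cball z 1" for x
 proof -
  have "(%N. \<Prod>j<N. 1 - q ^ Suc j * x) \<longlonglongrightarrow> l x"
   using l that by (rule tendsto_uniform_limitI)
  moreover have "(%N. \<Prod>j\<le>N. 1 - q ^ Suc j * x) \<longlonglongrightarrow> qprod q x"
   unfolding qprod_def by (rule convergent_prod_LIMSEQ) (rule qprod_convergent[OF assms])
  hence "(%N. \<Prod>j<Suc N. 1 - q ^ Suc j * x) \<longlonglongrightarrow> qprod q x"
   by (simp add: lessThan_Suc_atMost)
  hence "(%N. \<Prod>j<N. 1 - q ^ Suc j * x) \<longlonglongrightarrow> qprod q x"
   by (subst (asm) filterlim_sequentially_Suc)
  ultimately show ?thesis by (rule LIMSEQ_unique)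
 qed
 hence "uniform_limit (cball z 1) (%N x. \<Prod>j<N. 1 - q ^ Suc j * x) (qprod q) sequentially"
  using l uniform_limit_cong'[of "cball z 1" "%N x. \<Prod>j<N. 1 - q ^ Suc j * x" "%N x. \<Prod>j<N. 1 - q ^ Suc j * x" l "qprod q"] by simp
 thus "\<exists>d>0. cball z d \<subseteq> UNIV \<and> uniform_limit (cball z d) (%N x. \<Prod>j<N. 1 - q ^ Suc j * x) (qprod q) sequentially"
  by (intro exI[of _ 1]) auto
qed (auto intro!: holomorphic_intros)

locale modulus =
 fixes \<tau> :: complex
 assumes Im_pos: "Im \<tau> > 0"
begin

abbreviation th :: "complex => complex" where "th \<equiv> theta \<tau>"
abbreviation "\<Lambda> \<equiv> lattice1 \<tau>"
abbreviation "al \<equiv> alpha \<tau>"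
abbreviation "be \<equiv> beta \<tau>"
abbreviation "stb \<equiv> stab \<tau>"

definition nome :: complex where "nome = exp (2 * of_real pi * \<i> * \<tau>)"

lemma norm_nome: "norm nome < 1"
 using Im_pos by (simp add: nome_def)

text \<open>With everything written through exp (2 pi i z) and its inverse, quasi-periods and zeros
  can be read off from \<open>qprod_rec\<close> and \<open>qprod_eq_0_iff\<close>.\<close>

lemma theta_eq:
 "th z = exp (\<i> * pi * z) * (1 - exp (- 2 * pi * \<i> * z)) / (2 * pi * \<i>) *
  (qprod nome (exp (2 * pi * \<i> * z)) * qprod nome (exp (- 2 * pi * \<i> * z)) / (qprod nome 1)\<^sup>2)"
proof -
 let ?e = "exp (2 * of_real pi * \<i> * z)" and ?f = "exp (- 2 * of_real pi * \<i> * z)"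
 note c = qprod_convergent[OF norm_nome]
 have "(\<Prod>j. (1 - nome ^ Suc j * ?e) * (1 - nome ^ Suc j * ?f) / (1 - nome ^ Suc j)\<^sup>2)
   = qprod nome ?e * qprod nome ?f / (qprod nome 1)\<^sup>2"
  unfolding qprod_def
  using c[of ?e] c[of ?f] c[of 1]
  by (subst prodinf_mult, simp, simp, subst prodinf_power[symmetric], simp, subst prodinf_divide)
    (auto intro!: convergent_prod_mult convergent_prod_power)
 moreover have "sin (of_real pi * z) / of_real pi = exp (\<i> * pi * z) * (1 - ?f) / (2 * pi * \<i>)"
 proof -
  have "exp (\<i> * pi * z) * ?f = exp (- (\<i> * (pi * z)))"
   by (simp add: exp_add[symmetric] algebra_simps)
  hence "exp (\<i> * pi * z) * (1 - ?f) = exp (\<i> * (pi * z)) - exp (- (\<i> * (pi * z)))"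
   by (simp add: right_diff_distrib mult.assoc)
  moreover have "- (\<i> * X / (2 * c)) = X / (2 * c * \<i>)" for X c :: complex
   by (cases "c = 0") (simp_all add: field_simps)
  ultimately show ?thesis
   by (simp add: sin_exp_eq)
 qed
 ultimately show ?thesis
  by (simp add: theta_def Let_def nome_def)
qed

lemma theta_entire: "th holomorphic_on UNIV"
proof -
 have "qprod nome 1 \<noteq> 0"
 proof
  assume "qprod nome 1 = 0"
  then obtain j where "nome ^ Suc j = 1"
   using qprod_eq_0_iff[OF norm_nome, of 1] by auto
  hence "norm nome ^ Suc j = 1" by (metis norm_one norm_power)
  thus False using norm_nome power_less_one_iff[of "norm nome" "Suc j"] by simp
 qed
 moreover have *: "(%z. qprod nome (f z)) holomorphic_on UNIV" if "f holomorphic_on UNIV" for f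
  using holomorphic_on_compose[OF that, of "qprod nome"]
   holomorphic_on_subset[OF qprod_holomorphic[OF norm_nome] subset_UNIV, of "range f"]
  by (simp add: o_def)
 have h: "(%z. qprod nome (exp (2 * pi * \<i> * z))) holomorphic_on UNIV"
  "(%z. qprod nome (exp (- 2 * pi * \<i> * z))) holomorphic_on UNIV"
  by (rule *, (intro holomorphic_intros)[1])+
 have "(%z. exp (\<i> * pi * z) * (1 - exp (- 2 * pi * \<i> * z)) / (2 * pi * \<i>) *
  (qprod nome (exp (2 * pi * \<i> * z)) * qprod nome (exp (- 2 * pi * \<i> * z)) / (qprod nome 1)\<^sup>2)) holomorphic_on UNIV"
  using \<open>qprod nome 1 \<noteq> 0\<close> by (intro holomorphic_intros h) auto
 thus ?thesis
  by (simp only: theta_eq[symmetric] cong: holomorphic_cong)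
qed

lemma theta_minus: "th (- z) = - th z"
proof -
 have "exp (- (\<i> * pi * z)) * (1 - exp (2 * pi * \<i> * z)) = - (exp (\<i> * pi * z) * (1 - exp (- (2 * pi * \<i> * z))))"
  by (simp add: exp_add[symmetric] right_diff_distrib) (simp add: algebra_simps)
 thus ?thesis
  by (simp add: theta_eq)
qed

lemma theta_0 [simp]: "th 0 = 0"
 by (simp add: theta_eq)

lemma theta_add_1: "th (z + 1) = - th z"
proof -
 have 1: "exp (2 * pi * \<i> * (z + 1)) = exp (2 * pi * \<i> * z)"
  using exp_two_pi_i by (simp add: distrib_left exp_add)
 have 2: "exp (- 2 * pi * \<i> * (z + 1)) = exp (- 2 * pi * \<i> * z)"
 proof -
  have "exp (- 2 * pi * \<i> * (z + 1)) = inverse (exp (2 * pi * \<i> * (z + 1)))"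
   by (simp add: exp_minus[symmetric])
  also have "\<dots> = inverse (exp (2 * pi * \<i> * z))"
   by (simp only: 1)
  also have "\<dots> = exp (- 2 * pi * \<i> * z)"
   by (simp add: exp_minus[symmetric])
  finally show ?thesis .
 qed
 have 3: "exp (\<i> * pi * (z + 1)) = - exp (\<i> * pi * z)"
 proof -
  have "\<i> * pi * (z + 1) = \<i> * pi * z + pi * \<i>"
   by (simp add: algebra_simps)
  thus ?thesis by (simp only: exp_add exp_pi_i) simp
 qed
 show ?thesis
  unfolding theta_eq 1 2 3 by simp
qed

text \<open>Under z -> z + tau the product in exp (2 pi i z) loses its first factor and the one in
  exp (- 2 pi i z) gains one; the sine turns into the lost factor, and the gained one is the old
  sine, each up to an exponential.\<close>

lemma theta_add_tau: "th (z + \<tau>) = - exp (- pi * \<i> * \<tau> - 2 * pi * \<i> * z) * th z"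
proof -
 let ?e = "exp (2 * pi * \<i> * z)" and ?f = "exp (- 2 * pi * \<i> * z)"
 have e: "exp (2 * pi * \<i> * (z + \<tau>)) = nome * ?e"
  by (simp add: nome_def exp_add[symmetric] algebra_simps)
 have f: "?f = nome * exp (- 2 * pi * \<i> * (z + \<tau>))"
  by (simp add: nome_def exp_add[symmetric] algebra_simps)
 have 1: "exp (\<i> * pi * (z + \<tau>)) * (1 - exp (- 2 * pi * \<i> * (z + \<tau>)))
   = - exp (- pi * \<i> * \<tau> - 2 * pi * \<i> * z) * exp (\<i> * pi * z) * (1 - nome * ?e)"
  by (simp add: nome_def exp_add[symmetric] algebra_simps)
 have 2: "qprod nome (exp (- 2 * pi * \<i> * (z + \<tau>))) = (1 - ?f) * qprod nome ?f"
  using qprod_rec[OF norm_nome, of "exp (- 2 * pi * \<i> * (z + \<tau>))"] by (simp only: f[symmetric])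
 have 3: "qprod nome ?e = (1 - nome * ?e) * qprod nome (nome * ?e)"
  by (rule qprod_rec[OF norm_nome])
 show ?thesis
  unfolding theta_eq e 1 2 3 by simp
qed

end

section \<open>Zeros, lattice translates and divisibility; Fay's identity\<close>

lemma lattice1_0 [simp]: "0 \<in> lattice1 \<tau>"
 by (auto simp: lattice1_def intro!: exI[of _ 0])

lemma lattice1_add: "x \<in> lattice1 \<tau> ==> y \<in> lattice1 \<tau> ==> x + y \<in> lattice1 \<tau>"
 unfolding lattice1_def
 by (smt (verit, best) add.assoc add.left_commute distrib_left mem_Collect_eq of_int_add)

lemma lattice1_minus: "x \<in> lattice1 \<tau> ==> - x \<in> lattice1 \<tau>"
proof -
 assume "x \<in> lattice1 \<tau>"
 then obtain a b where "x = of_int a + \<tau> * of_int b" by (auto simp: lattice1_def)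
 hence "- x = of_int (- a) + \<tau> * of_int (- b)" by simp
 thus ?thesis unfolding lattice1_def by blast
qed

lemma lattice1_minus_iff [simp]: "- x \<in> lattice1 \<tau> \<longleftrightarrow> x \<in> lattice1 \<tau>"
 using lattice1_minus by fastforce

lemma lattice1_diff: "x \<in> lattice1 \<tau> ==> y \<in> lattice1 \<tau> ==> x - y \<in> lattice1 \<tau>"
 using lattice1_add[of x \<tau> "- y"] by simp

lemma lattice1_of_int_mult: "x \<in> lattice1 \<tau> ==> of_int k * x \<in> lattice1 \<tau>"
proof -
 assume "x \<in> lattice1 \<tau>"
 then obtain a b where "x = of_int a + \<tau> * of_int b" by (auto simp: lattice1_def)
 hence "of_int k * x = of_int (k * a) + \<tau> * of_int (k * b)" by (simp add: algebra_simps)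
 thus ?thesis unfolding lattice1_def by blast
qed

context modulus
begin

text \<open>The factor 1 - exp (- 2 pi i z) acts as the missing k = 0 factor of the product in exp
  (- 2 pi i z). Hence powers \<open>nome ^ k\<close> on one side but \<open>nome ^ Suc k\<close> on
  the other, and every multiple of tau is met exactly once.\<close>

lemma theta_eq_0_iff: "th z = 0 \<longleftrightarrow> z \<in> \<Lambda>"
proof -
 have pw: "nome ^ k * exp (2 * pi * \<i> * u) = 1 \<longleftrightarrow> (\<exists>m. u = of_int m - of_nat k * \<tau>)" for k u
 proof -
  have "nome ^ k * exp (2 * pi * \<i> * u) = exp (2 * pi * \<i> * (u + of_nat k * \<tau>))"
   by (simp add: nome_def exp_of_nat_mult[symmetric] exp_add[symmetric] algebra_simps)
  also have "\<dots> = 1 \<longleftrightarrow> (\<exists>m::int. 2 * pi * \<i> * (u + of_nat k * \<tau>) = of_int (2 * m) * pi * \<i>)"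
   using exp_eq[of "2 * pi * \<i> * (u + of_nat k * \<tau>)" 0] by simp
  also have "\<dots> \<longleftrightarrow> (\<exists>m::int. u + of_nat k * \<tau> = of_int m)"
  proof (intro ex_cong1)
   fix m :: int
   have "of_int (2 * m) * pi * \<i> = 2 * pi * \<i> * of_int m" by simp
   thus "2 * pi * \<i> * (u + of_nat k * \<tau>) = of_int (2 * m) * pi * \<i> \<longleftrightarrow> u + of_nat k * \<tau> = of_int m"
    by (simp del: of_int_mult)
  qed
  also have "\<dots> \<longleftrightarrow> (\<exists>m::int. u = of_int m - of_nat k * \<tau>)"
   by (simp add: algebra_simps)
  finally show ?thesis .
 qed
 have q1: "qprod nome 1 \<noteq> 0"
 proof
  assume "qprod nome 1 = 0"
  then obtain j where "nome ^ Suc j = 1"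
   using qprod_eq_0_iff[OF norm_nome, of 1] by auto
  hence "norm nome ^ Suc j = 1" by (metis norm_one norm_power)
  thus False using norm_nome power_less_one_iff[of "norm nome" "Suc j"] by simp
 qed
 have "th z = 0 \<longleftrightarrow> exp (2 * pi * \<i> * (- z)) = 1 \<or> qprod nome (exp (2 * pi * \<i> * z)) = 0
   \<or> qprod nome (exp (2 * pi * \<i> * (- z))) = 0"
  using q1 by (auto simp: theta_eq)
 also have "\<dots> \<longleftrightarrow> (\<exists>k. nome ^ k * exp (2 * pi * \<i> * (- z)) = 1) \<or> (\<exists>k. nome ^ Suc k * exp (2 * pi * \<i> * z) = 1)"
  (is "?A \<longleftrightarrow> ?B")
 proof
  assume ?A
  then consider "nome ^ 0 * exp (2 * pi * \<i> * (- z)) = 1" | k where "nome ^ Suc k * exp (2 * pi * \<i> * z) = 1"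
   | k where "nome ^ Suc k * exp (2 * pi * \<i> * (- z)) = 1"
   unfolding qprod_eq_0_iff[OF norm_nome] by auto
  thus ?B by cases blast+
 next
  assume ?B
  then consider k where "nome ^ k * exp (2 * pi * \<i> * (- z)) = 1" | k where "nome ^ Suc k * exp (2 * pi * \<i> * z) = 1"
   by blast
  thus ?A
  proof cases
   case (1 k)
   thus ?thesis unfolding qprod_eq_0_iff[OF norm_nome] by (cases k) auto
  next
   case 2
   thus ?thesis unfolding qprod_eq_0_iff[OF norm_nome] by blast
  qed
 qed
 also have "\<dots> \<longleftrightarrow> (\<exists>k m. - z = of_int m - of_nat k * \<tau>) \<or> (\<exists>k m. z = of_int m - of_nat (Suc k) * \<tau>)"
  unfolding pw ..
 also have "\<dots> \<longleftrightarrow> z \<in> \<Lambda>"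
 proof
  assume "(\<exists>k m. - z = of_int m - of_nat k * \<tau>) \<or> (\<exists>k m. z = of_int m - of_nat (Suc k) * \<tau>)"
  thus "z \<in> \<Lambda>"
  proof (elim disjE exE)
   fix k m assume "- z = of_int m - of_nat k * \<tau>"
   hence "z = - (of_int m - of_nat k * \<tau>)" by (metis minus_minus)
   hence "z = of_int (- m) + \<tau> * of_int (int k)"
    by (simp add: algebra_simps)
   thus ?thesis unfolding lattice1_def by blast
  next
   fix k m assume "z = of_int m - of_nat (Suc k) * \<tau>"
   hence "z = of_int m + \<tau> * of_int (- int (Suc k))"
    by (simp add: algebra_simps)
   thus ?thesis unfolding lattice1_def by blast
  qed
 next
  assume "z \<in> \<Lambda>"
  then obtain a b where z: "z = of_int a + \<tau> * of_int b" by (auto simp: lattice1_def)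
  show "(\<exists>k m. - z = of_int m - of_nat k * \<tau>) \<or> (\<exists>k m. z = of_int m - of_nat (Suc k) * \<tau>)"
  proof (cases "b \<ge> 0")
   case True
   hence "- z = of_int (- a) - of_nat (nat b) * \<tau>" by (simp add: z algebra_simps)
   thus ?thesis by blast
  next
   case False
   hence "z = of_int a - of_nat (Suc (nat (- b - 1))) * \<tau>" by (simp add: z algebra_simps)
   thus ?thesis by blast
  qed
 qed
 finally show ?thesis .
qed

text \<open>The shifts with a multiplier of this shape form a group that contains 1 and tau. Later
  arguments use the shape of the multiplier, not its constants.\<close>

lemma theta_add_lattice:
 assumes "l \<in> \<Lambda>"
 shows "\<exists>s b. s \<noteq> 0 \<and> (\<forall>z. th (z + l) = s * exp (b * z) * th z)"
proof -
 define Q where "Q l \<longleftrightarrow> (\<exists>s b. s \<noteq> 0 \<and> (\<forall>z. th (z + l) = s * exp (b * z) * th z))" for l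
 have 0: "Q 0" unfolding Q_def by (intro exI[of _ 1] exI[of _ 0]) auto
 have add: "Q (k + l)" if "Q k" "Q l" for k l
 proof -
  obtain s b where 1: "s \<noteq> 0" "\<And>z. th (z + k) = s * exp (b * z) * th z"
   using \<open>Q k\<close> unfolding Q_def by blast
  obtain s' b' where 2: "s' \<noteq> 0" "\<And>z. th (z + l) = s' * exp (b' * z) * th z"
   using \<open>Q l\<close> unfolding Q_def by blast
  note * = 1 2
  have "th (z + (k + l)) = (s * s' * exp (b' * k)) * exp ((b + b') * z) * th z" for z
   using *(4)[of "z + k"] *(2)[of z] by (simp add: exp_add algebra_simps)
  thus ?thesis unfolding Q_def using *(1,3)
   by (intro exI[of _ "s * s' * exp (b' * k)"] exI[of _ "b + b'"]) auto
 qed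
 have neg: "Q (- l)" if "Q l" for l
 proof -
  obtain s b where *: "s \<noteq> 0" "\<And>z. th (z + l) = s * exp (b * z) * th z"
   using \<open>Q l\<close> unfolding Q_def by blast
  have "th (z + - l) = (inverse s * exp (b * l)) * exp (- b * z) * th z" for z
  proof -
   have e: "exp (b * l) * exp (- b * z) = inverse (exp (b * (z - l)))"
    by (simp only: exp_minus[symmetric] exp_add[symmetric]) (simp add: algebra_simps)
   have "th z = s * exp (b * (z - l)) * th (z - l)" using *(2)[of "z - l"] by simp
   hence "inverse s * inverse (exp (b * (z - l))) * th z = th (z - l)"
    using *(1) by (simp add: field_simps)
   moreover have "(inverse s * exp (b * l)) * exp (- b * z) = inverse s * inverse (exp (b * (z - l)))"
    by (simp only: e[symmetric] mult.assoc)
   ultimately show ?thesis by (simp only: diff_conv_add_uminus[symmetric])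
  qed
  thus ?thesis unfolding Q_def using *(1)
   by (intro exI[of _ "inverse s * exp (b * l)"] exI[of _ "- b"]) auto
 qed
 have nat: "Q (of_nat n * l)" if "Q l" for n l
  by (induction n) (use 0 that add in \<open>auto simp: algebra_simps\<close>)
 have int: "Q (of_int n * l)" if "Q l" for n l
  by (cases n rule: int_cases2) (use nat[OF that] neg[OF nat[OF that]] in auto)
 have 1: "Q 1"
  unfolding Q_def by (intro exI[of _ "-1"] exI[of _ 0]) (simp add: theta_add_1)
 have "th (z + \<tau>) = (- exp (- pi * \<i> * \<tau>)) * exp ((- 2 * pi * \<i>) * z) * th z" for z
  by (simp add: theta_add_tau exp_add[symmetric])
 hence 2: "Q \<tau>"
  unfolding Q_def by (intro exI[of _ "- exp (- pi * \<i> * \<tau>)"] exI[of _ "- 2 * pi * \<i>"]) auto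
 obtain a b where "l = of_int a + \<tau> * of_int b" using assms by (auto simp: lattice1_def)
 hence "Q l" using add[OF int[OF 1, of a] int[OF 2, of b]] by (simp add: mult.commute)
 thus ?thesis unfolding Q_def .
qed

lemma theta_deriv_0: "(th has_field_derivative 1) (at 0)"
proof -
 define g where "g z = exp (\<i> * pi * z) * (qprod nome (exp (2 * pi * \<i> * z)) * qprod nome (exp (- 2 * pi * \<i> * z)) / (qprod nome 1)\<^sup>2)" for z
 define f where "f z = (1 - exp (- 2 * pi * \<i> * z)) / (2 * pi * \<i>)" for z
 have q1: "qprod nome 1 \<noteq> 0"
 proof
  assume "qprod nome 1 = 0"
  then obtain j where "nome ^ Suc j = 1"
   using qprod_eq_0_iff[OF norm_nome, of 1] by auto
  hence "norm nome ^ Suc j = 1" by (metis norm_one norm_power)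
  thus False using norm_nome power_less_one_iff[of "norm nome" "Suc j"] by simp
 qed
 have eq: "th z = f z * g z" for z
  by (simp add: theta_eq f_def g_def)
 have *: "(%z. qprod nome (f z)) holomorphic_on UNIV" if "f holomorphic_on UNIV" for f
  using holomorphic_on_compose[OF that, of "qprod nome"]
   holomorphic_on_subset[OF qprod_holomorphic[OF norm_nome] subset_UNIV, of "range f"]
  by (simp add: o_def)
 have h: "(%z. qprod nome (exp (2 * pi * \<i> * z))) holomorphic_on UNIV"
  "(%z. qprod nome (exp (- 2 * pi * \<i> * z))) holomorphic_on UNIV"
  by (rule *, (intro holomorphic_intros)[1])+
 have "g holomorphic_on UNIV"
  unfolding g_def using q1 by (intro holomorphic_intros h) auto
 hence g: "(g has_field_derivative deriv g 0) (at 0)"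
  by (simp add: holomorphic_derivI)
 have f: "(f has_field_derivative 1) (at 0)"
  unfolding f_def by (auto intro!: derivative_eq_intros simp: field_simps)
 have "((%z. f z * g z) has_field_derivative 1 * g 0 + deriv g 0 * f 0) (at 0)"
  by (rule DERIV_mult[OF f g])
 moreover have "g 0 = 1" using q1 by (simp add: g_def power2_eq_square)
 moreover have "f 0 = 0" by (simp add: f_def)
 ultimately show ?thesis by (simp add: eq[abs_def])
qed

text \<open>The zeros are simple: the derivative at 0 is 1, and a lattice shift changes it by a
  nonzero factor.\<close>

lemma theta_factor:
 assumes "l \<in> \<Lambda>"
 obtains \<eta> where "\<eta> holomorphic_on UNIV" "\<And>z. th z = (z - l) * \<eta> z" "\<eta> l \<noteq> 0"
proof -
 define \<eta> where "\<eta> = (%z. if z = l then deriv th l else (th z - th l) / (z - l))"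
 have hol: "\<eta> holomorphic_on UNIV"
  unfolding \<eta>_def by (rule pole_lemma_open[OF theta_entire]) auto
 have 0: "th l = 0" using assms by (simp add: theta_eq_0_iff)
 obtain s b where sb: "s \<noteq> 0" "\<And>z. th (z + l) = s * exp (b * z) * th z"
  using theta_add_lattice[OF assms] by blast
 have "((%z. s * exp (b * z) * th z) has_field_derivative s) (at 0)"
  by (rule derivative_eq_intros theta_deriv_0 refl | simp)+
 hence "((%z. th (z + l)) has_field_derivative s) (at 0)"
  by (simp add: sb)
 hence "(th has_field_derivative s) (at l)"
  using DERIV_shift[of th s 0 l] by simp
 hence "deriv th l = s" by (rule DERIV_imp_deriv)
 thus ?thesis
  using that[of \<eta>] hol 0 sb(1) by (auto simp: \<eta>_def)
qed

lemma isCont_theta: "isCont th z"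
 using holomorphic_on_imp_continuous_on[OF theta_entire] by (simp add: continuous_on_eq_continuous_at)

lemma isCont_theta' [continuous_intros]: "isCont f z ==> isCont (%z. th (f z)) z"
 using isCont_o2 isCont_theta by blast

lemma eventually_theta_nonzero: "eventually (%w. th w \<noteq> 0) (at z)"
proof (cases "z \<in> \<Lambda>")
 case False
 have "isCont th z"
  by (rule isCont_theta)
 thus ?thesis
  using False by (intro tendsto_imp_eventually_ne[of th "th z"]) (auto simp: isCont_def theta_eq_0_iff)
next
 case True
 obtain \<eta> where \<eta>: "\<eta> holomorphic_on UNIV" "\<And>w. th w = (w - z) * \<eta> w" "\<eta> z \<noteq> 0"
  using theta_factor[OF True] by blast
 have "isCont \<eta> z"
  using holomorphic_on_imp_continuous_on[OF \<eta>(1)] by (simp add: continuous_on_eq_continuous_at)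
 hence "eventually (%w. \<eta> w \<noteq> 0) (at z)"
  using \<eta>(3) by (intro tendsto_imp_eventually_ne[of \<eta> "\<eta> z"]) (auto simp: isCont_def)
 moreover have "eventually (%w. w \<noteq> z) (at z)"
  by (simp add: eventually_at_filter)
 ultimately show ?thesis
  by eventually_elim (simp add: \<eta>(2))
qed

lemma eventually_theta_affine_nonzero:
 assumes "k \<noteq> 0"
 shows "eventually (%w. th (k * w + c) \<noteq> 0) (at z)"
proof -
 have "filterlim (%w. k * w + c) (at (k * z + c)) (at z)"
  unfolding filterlim_at
  using assms by (auto intro!: tendsto_eq_intros simp: eventually_at_filter)
 thus ?thesis
  using eventually_theta_nonzero[of "k * z + c"] by (rule eventually_compose_filterlim[rotated])
qed

lemma isCont_eq_0:
 fixes f :: "complex => complex"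
 assumes "isCont f z" "eventually (%w. f w = 0) (at z)"
 shows "f z = 0"
proof -
 have "(f \<longlongrightarrow> f z) (at z)" using assms(1) by (simp add: isCont_def)
 moreover have "(f \<longlongrightarrow> 0) (at z)"
  using assms(2) by (rule tendsto_eventually)
 ultimately show ?thesis by (rule tendsto_unique[rotated]) simp
qed

text \<open>As the zeros of theta are simple, the quotient extends holomorphically near each point.
  Defining the global quotient by limits makes the local extensions agree without comparing them on
  overlaps.\<close>

lemma theta_divides:
 assumes f: "f holomorphic_on UNIV" and 0: "\<And>z. z + c \<in> \<Lambda> ==> f z = 0"
 obtains h where "h holomorphic_on UNIV" "\<And>z. f z = th (z + c) * h z"
proof -
 define d where "d z = th (z + c)" for z
 have d: "d holomorphic_on UNIV"
  unfolding d_def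
  by (intro holomorphic_intros holomorphic_on_compose_gen[OF _ theta_entire, unfolded o_def]) auto
 have local: "\<exists>h e. e > 0 \<and> h holomorphic_on ball p e \<and> (\<forall>z\<in>ball p e. f z = h z * d z)" for p
 proof (cases "p + c \<in> \<Lambda>")
  case True
  obtain \<eta> where \<eta>: "\<eta> holomorphic_on UNIV" "\<And>z. th z = (z - (p + c)) * \<eta> z" "\<eta> (p + c) \<noteq> 0"
   using theta_factor[OF True] by blast
  define k where "k z = \<eta> (z + c)" for z
  have dk: "d z = (z - p) * k z" for z
   using \<eta>(2)[of "z + c"] by (simp add: k_def d_def)
  have kh: "k holomorphic_on UNIV"
   unfolding k_def
   by (intro holomorphic_intros holomorphic_on_compose_gen[OF _ \<eta>(1), unfolded o_def]) auto
  have "k p \<noteq> 0" using \<eta>(3) by (simp add: k_def)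
  moreover have "isCont k p"
   using holomorphic_on_imp_continuous_on[OF kh] by (simp add: continuous_on_eq_continuous_at)
  ultimately obtain e where e: "e > 0" "\<And>z. z \<in> ball p e ==> k z \<noteq> 0"
   using continuous_at_avoid[of p k 0] by (auto simp: dist_commute)
  define g where "g = (%z. if z = p then deriv f p else (f z - f p) / (z - p))"
  have gh: "g holomorphic_on UNIV"
   unfolding g_def by (rule pole_lemma_open[OF f]) auto
  have fg: "f z = (z - p) * g z" for z using 0[OF True] by (simp add: g_def)
  have "(%z. g z / k z) holomorphic_on ball p e"
   using e(2) by (intro holomorphic_intros holomorphic_on_subset[OF gh] holomorphic_on_subset[OF kh]) auto
  moreover have "\<forall>z\<in>ball p e. f z = g z / k z * d z"
   using e(2) by (auto simp: fg dk)
  ultimately show ?thesis using e(1) by blast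
 next
  case False
  hence "d p \<noteq> 0" by (simp add: d_def theta_eq_0_iff)
  moreover have "isCont d p"
   using holomorphic_on_imp_continuous_on[OF d] by (simp add: continuous_on_eq_continuous_at)
  ultimately obtain e where e: "e > 0" "\<And>z. z \<in> ball p e ==> d z \<noteq> 0"
   using continuous_at_avoid[of p d 0] by (auto simp: dist_commute)
  have "(%z. f z / d z) holomorphic_on ball p e"
   using e(2) by (intro holomorphic_intros holomorphic_on_subset[OF f] holomorphic_on_subset[OF d]) auto
  thus ?thesis using e by (intro exI[of _ "%z. f z / d z"] exI[of _ e]) auto
 qed
 have dnz: "eventually (%w. d w \<noteq> 0) (at p)" for p
  using eventually_theta_affine_nonzero[OF one_neq_zero, of c p] by (simp add: d_def)
 define G where "G p = Lim (at p) (%z. f z / d z)" for p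
 have GL: "\<exists>e>0. G holomorphic_on ball p e \<and> f p = G p * d p" for p
 proof -
  obtain h e where he: "e > 0" "h holomorphic_on ball p e" "\<And>z. z\<in>ball p e ==> f z = h z * d z"
   using local[of p] by blast
  have "G w = h w" if w: "w \<in> ball p e" for w
  proof -
   have "isCont h w"
    using holomorphic_on_imp_continuous_on[OF he(2)] w by (simp add: continuous_on_eq_continuous_at)
   hence "(h \<longlongrightarrow> h w) (at w)" by (simp add: isCont_def)
   moreover have "eventually (%z. h z = f z / d z) (at w)"
    using eventually_at_in_open'[OF open_ball w] dnz[of w] by eventually_elim (simp add: he(3))
   ultimately have "((%z. f z / d z) \<longlongrightarrow> h w) (at w)"
    by (rule Lim_transform_eventually)
   thus ?thesis unfolding G_def by (intro tendsto_Lim) auto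
  qed
  thus ?thesis
   using he holomorphic_transform[OF he(2), of G] by (intro exI[of _ e]) auto
 qed
 have "G field_differentiable (at p)" for p
 proof -
  obtain e where "e > 0" "G holomorphic_on ball p e" using GL by blast
  thus ?thesis using holomorphic_on_imp_differentiable_at[of G "ball p e" p] by simp
 qed
 hence "G holomorphic_on UNIV" by (simp add: holomorphic_on_def)
 moreover have "f p = th (p + c) * G p" for p using GL[of p] by (auto simp: d_def mult.commute)
 ultimately show ?thesis by (rule that)
qed

text \<open>A section of a line bundle of degree two on E. The points b and - b are distinct modulo
  the lattice, so dividing by th (z - b) th (z + b) leaves a doubly periodic entire function, a
  constant by Liouville; the third zero c, congruent to neither, forces it to be 0.\<close>

lemma degree_two_theta_eq_0:
 assumes F: "F holomorphic_on UNIV" "\<And>z. F (z + 1) = F z"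
  "\<And>z. F (z + \<tau>) = exp (- 2 * pi * \<i> * (\<tau> + 2 * z)) * F z"
  and z: "F b = 0" "F (- b) = 0" "F c = 0"
  and nz: "th (2 * b) \<noteq> 0" "th (c - b) \<noteq> 0" "th (c + b) \<noteq> 0"
 shows "F x = 0"
proof -
 define d where "d z = th (z - b) * th (z + b)" for z
 have d1: "d (z + 1) = d z" for z
  using theta_add_1[of "z - b"] theta_add_1[of "z + b"] by (simp add: d_def algebra_simps)
 have dt: "d (z + \<tau>) = exp (- 2 * pi * \<i> * (\<tau> + 2 * z)) * d z" for z
 proof -
  have "d (z + \<tau>) = (exp (- pi * \<i> * \<tau> - 2 * pi * \<i> * (z - b)) * exp (- pi * \<i> * \<tau> - 2 * pi * \<i> * (z + b))) * d z"
   using theta_add_tau[of "z - b"] theta_add_tau[of "z + b"] by (simp add: d_def algebra_simps)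
  also have "exp (- pi * \<i> * \<tau> - 2 * pi * \<i> * (z - b)) * exp (- pi * \<i> * \<tau> - 2 * pi * \<i> * (z + b)) = exp (- 2 * pi * \<i> * (\<tau> + 2 * z))"
   by (simp add: exp_add[symmetric] algebra_simps)
  finally show ?thesis .
 qed
 have Fn: "F (z + of_int a) = F z" for z a
 proof (induction a rule: int_induct[of _ 0])
  case (step1 i) thus ?case using F(2)[of "z + of_int i"] by (simp add: add.assoc)
 next
  case (step2 i) thus ?case using F(2)[of "z + of_int i - 1"] by (simp add: algebra_simps)
 qed simp
 have Ft: "F z = 0 \<longleftrightarrow> F (z + \<tau> * of_int a) = 0" for z a
 proof (induction a rule: int_induct[of _ 0])
  case (step1 i) thus ?case using F(3)[of "z + \<tau> * of_int i"] by (simp add: algebra_simps)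
 next
  case (step2 i) thus ?case using F(3)[of "z + \<tau> * of_int i - \<tau>"] by (simp add: algebra_simps)
 qed simp
 have Fl: "F (z + l) = 0" if "F z = 0" "l \<in> \<Lambda>" for z l
  using that Fn[of "z + \<tau> * of_int b" a for a b] Ft[of z] by (fastforce simp: lattice1_def algebra_simps)
 have "F z = 0" if "z + - b \<in> \<Lambda>" for z
  using Fl[OF z(1) that] by simp
 from theta_divides[OF F(1) this] obtain h where h: "h holomorphic_on UNIV" "\<And>z. F z = th (z + - b) * h z"
  by blast
 have "h z = 0" if "z + b \<in> \<Lambda>" for z
 proof -
  have "th (z - b) \<noteq> 0"
  proof
   assume "th (z - b) = 0"
   hence "(z + b) - (z - b) \<in> \<Lambda>"
    using that lattice1_diff theta_eq_0_iff by blast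
   thus False using nz(1) by (simp add: theta_eq_0_iff)
  qed
  thus ?thesis using Fl[OF z(2) that] h(2)[of z] by simp
 qed
 from theta_divides[OF h(1) this] obtain G where G: "G holomorphic_on UNIV" "\<And>z. h z = th (z + b) * G z"
  by blast
 have GF: "F p = G p * d p" for p
  using h(2) G(2) by (simp add: d_def)
 have dnz: "eventually (%w. d w \<noteq> 0) (at p)" for p
  using eventually_theta_affine_nonzero[OF one_neq_zero, of "- b" p]
   eventually_theta_affine_nonzero[OF one_neq_zero, of b p]
  by (simp add: d_def eventually_conj_iff)
 have Gc: "continuous_on UNIV G" using G(1) by (rule holomorphic_on_imp_continuous_on)
 have Gi: "isCont G z" for z using Gc by (simp add: continuous_on_eq_continuous_at)
 have G1: "G (z + 1) = G z" for z
 proof -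
  have "isCont (%z. G (z + 1) - G z) z"
   by (intro continuous_intros isCont_o2[OF _ Gi] Gi)
  moreover have "eventually (%z. G (z + 1) - G z = 0) (at z)"
   using dnz[of z]
  proof eventually_elim
   case (elim z)
   thus ?case using GF[of z] GF[of "z + 1"] F(2)[of z] d1[of z] by simp
  qed
  ultimately show ?thesis using isCont_eq_0[of z "%z. G (z + 1) - G z"] by simp
 qed
 have Gt: "G (z + \<tau>) = G z" for z
 proof -
  have "isCont (%z. G (z + \<tau>) - G z) z"
   by (intro continuous_intros isCont_o2[OF _ Gi] Gi)
  moreover have "eventually (%z. G (z + \<tau>) - G z = 0) (at z)"
   using dnz[of z]
  proof eventually_elim
   case (elim z)
   thus ?case using GF[of z] GF[of "z + \<tau>"] F(3)[of z] dt[of z] by simp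
  qed
  ultimately show ?thesis using isCont_eq_0[of z "%z. G (z + \<tau>) - G z"] by simp
 qed
 have Gn: "G (z + of_int a) = G z" for z a
 proof (induction a rule: int_induct[of _ 0])
  case (step1 i) thus ?case using G1[of "z + of_int i"] by (simp add: add.assoc)
 next
  case (step2 i) thus ?case using G1[of "z + of_int i - 1"] by (simp add: algebra_simps)
 qed simp
 have Gm: "G (z + \<tau> * of_int a) = G z" for z a
 proof (induction a rule: int_induct[of _ 0])
  case (step1 i) thus ?case using Gt[of "z + \<tau> * of_int i"] by (simp add: algebra_simps)
 next
  case (step2 i) thus ?case using Gt[of "z + \<tau> * of_int i - \<tau>"] by (simp add: algebra_simps)
 qed simp
 \<comment> \<open>A closed fundamental parallelogram, on which G already takes all its
   values.\<close>
 define K where "K = (%(s, t). of_real s + \<tau> * of_real t) ` ({0..1} \<times> {0..1::real})"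
 have "compact K"
  unfolding K_def by (intro compact_continuous_image compact_Times)
   (auto intro!: continuous_intros simp: case_prod_beta)
 hence "bounded (G ` K)"
  by (intro compact_imp_bounded compact_continuous_image continuous_on_subset[OF Gc]) auto
 moreover have "range G \<subseteq> G ` K"
 proof
  fix u assume "u \<in> range G"
  then obtain p where u: "u = G p" by blast
  define t where "t = Im p / Im \<tau>"
  define s where "s = Re p - Re \<tau> * t"
  have p: "p = of_real s + \<tau> * of_real t"
   using Im_pos by (simp add: complex_eq_iff s_def t_def)
  have e: "G p = G (p + \<tau> * of_int (- \<lfloor>t\<rfloor>) + of_int (- \<lfloor>s\<rfloor>))"
   by (simp only: Gn Gm)
 have "p + \<tau> * of_int (- \<lfloor>t\<rfloor>) + of_int (- \<lfloor>s\<rfloor>) = of_real (frac s) + \<tau> * of_real (frac t)"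
   by (simp add: p frac_def algebra_simps)
  also have "\<dots> \<in> K"
   unfolding K_def by (rule image_eqI[of _ _ "(frac s, frac t)"]) (auto simp: frac_lt_1 less_imp_le)
  finally have "p + \<tau> * of_int (- \<lfloor>t\<rfloor>) + of_int (- \<lfloor>s\<rfloor>) \<in> K" .
  thus "u \<in> G ` K" using u e by blast
 qed
 ultimately have "bounded (range G)" by (rule bounded_subset)
 hence "G constant_on UNIV" using Liouville_theorem[OF G(1)] by blast
 then obtain g where g: "\<And>p. G p = g" by (auto simp: constant_on_def)
 have "d c \<noteq> 0" using nz by (simp add: d_def)
 hence "g = 0" using GF[of c] z(3) g by simp
 thus ?thesis using GF[of x] g by simp
qed

text \<open>Fay's identity (the three-term relation of Weierstrass). In x all three products are
  sections of the same degree two bundle, and the sum vanishes at b, - b and c.\<close>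

theorem theta_fay:
 "th (x + a) * th (x - a) * th (b + c) * th (b - c) + th (x + b) * th (x - b) * th (c + a) * th (c - a)
  + th (x + c) * th (x - c) * th (a + b) * th (a - b) = 0"
proof -
 define F where "F a b c x = th (x + a) * th (x - a) * th (b + c) * th (b - c) + th (x + b) * th (x - b) * th (c + a) * th (c - a)
  + th (x + c) * th (x - c) * th (a + b) * th (a - b)" for a b c x
 have neg: "th (u - v) = - th (v - u)" for u v
  using theta_minus[of "v - u"] by simp
 have gen: "F a b c x = 0" if nz: "th (2 * b) \<noteq> 0" "th (c - b) \<noteq> 0" "th (c + b) \<noteq> 0" for b c x
 proof (rule degree_two_theta_eq_0[where F = "F a b c" and b = b and c = c, OF _ _ _ _ _ _ nz])
  have 2: "th (x + 1 + u) * th (x + 1 - u) = th (x + u) * th (x - u)" for x u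
   using theta_add_1[of "x + u"] theta_add_1[of "x - u"] by (simp add: algebra_simps)
  have 3: "th (x + \<tau> + u) * th (x + \<tau> - u) = exp (- 2 * pi * \<i> * (\<tau> + 2 * x)) * (th (x + u) * th (x - u))" for x u
  proof -
   have "th (x + \<tau> + u) * th (x + \<tau> - u) =
    (exp (- pi * \<i> * \<tau> - 2 * pi * \<i> * (x + u)) * exp (- pi * \<i> * \<tau> - 2 * pi * \<i> * (x - u))) * (th (x + u) * th (x - u))"
    using theta_add_tau[of "x + u"] theta_add_tau[of "x - u"] by (simp add: algebra_simps)
   also have "exp (- pi * \<i> * \<tau> - 2 * pi * \<i> * (x + u)) * exp (- pi * \<i> * \<tau> - 2 * pi * \<i> * (x - u)) = exp (- 2 * pi * \<i> * (\<tau> + 2 * x))"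
    by (simp add: exp_add[symmetric] algebra_simps)
   finally show ?thesis .
  qed
  show "F a b c holomorphic_on UNIV"
   unfolding F_def
   by (intro holomorphic_intros holomorphic_on_compose_gen[OF _ theta_entire, unfolded o_def]) auto
  show "F a b c (x + 1) = F a b c x" for x
   unfolding F_def 2 ..
  show "F a b c (x + \<tau>) = exp (- 2 * pi * \<i> * (\<tau> + 2 * x)) * F a b c x" for x
   unfolding F_def 3 by (simp add: ring_distribs mult.assoc)
  show "F a b c b = 0"
   using neg[of b a] by (simp add: F_def add.commute)
  show "F a b c (- b) = 0"
   using neg[of "-b" a] neg[of "- b" c] theta_minus[of "a + b"] theta_minus[of "b + c"] theta_minus[of "b - a"] neg[of b c]
   by (simp add: F_def add.commute)
  show "F a b c c = 0"
   using neg[of c b] by (simp add: F_def add.commute)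
 qed
 have c: "isCont (%b. F a b c x) z" "isCont (%c. F a b c x) z" for b c z
  unfolding F_def by (intro continuous_intros)+
 \<comment> \<open>The degenerate values, first of c and then of b, are isolated and are reached by
   continuity.\<close>
 have gen2: "F a b c x = 0" if nz: "th (2 * b) \<noteq> 0" for b c
 proof (rule isCont_eq_0[OF c(2)])
  show "eventually (%w. F a b w x = 0) (at c)"
   using eventually_theta_affine_nonzero[OF one_neq_zero, of "- b" c] eventually_theta_affine_nonzero[OF one_neq_zero, of b c]
   by eventually_elim (use gen nz in auto)
 qed
 have "F a b c x = 0"
 proof (rule isCont_eq_0[OF c(1)])
  show "eventually (%w. F a w c x = 0) (at b)"
   using eventually_theta_affine_nonzero[OF zero_neq_numeral[symmetric], of _ 0 b]
   by eventually_elim (use gen2 in simp)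
 qed
 thus ?thesis by (simp add: F_def)
qed

end

section \<open>Holomorphic functions of several variables\<close>

abbreviation zv :: "('n::finite) pt \<Rightarrow> 'n \<Rightarrow> complex" (infixl "$$" 95) where
  "x$$a \<equiv> fst x $ a"

lemma cscale_add_left: "cscale (c + d) v = cscale c v + cscale d v"
 by (cases v) (simp add: cscale_def vec_eq_iff algebra_simps)

lemma cscale_add_right: "cscale c (v + w) = cscale c v + cscale c w"
 by (cases v; cases w) (simp add: cscale_def vec_eq_iff algebra_simps)

lemma cscale_cscale: "cscale c (cscale d v) = cscale (c * d) v"
 by (cases v) (simp add: cscale_def vec_eq_iff algebra_simps)

lemma cscale_0 [simp]: "cscale 0 v = 0"
 by (cases v) (simp add: cscale_def vec_eq_iff zero_prod_def)

lemma cscale_1 [simp]: "cscale 1 v = v"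
 by (cases v) (simp add: cscale_def vec_eq_iff)

lemma cscale_scaleR_left: "cscale (r *\<^sub>R c) v = r *\<^sub>R cscale c v"
 by (cases v) (simp add: cscale_def vec_eq_iff algebra_simps)

lemma cscale_scaleR_right: "cscale c (r *\<^sub>R v) = r *\<^sub>R cscale c v"
 by (cases v) (simp add: cscale_def vec_eq_iff algebra_simps)

lemma bounded_linear_cscale_left: "bounded_linear (%c. cscale c v)"
 unfolding linear_conv_bounded_linear[symmetric]
 by (rule linearI) (simp_all add: cscale_add_left cscale_scaleR_left)

lemmas continuous_cscale_left [continuous_intros] =
 bounded_linear.continuous[OF bounded_linear_cscale_left]
 bounded_linear.continuous_on[OF bounded_linear_cscale_left]

abbreviation holo :: "(('n::finite) pt => complex) => bool" where
 "holo f \<equiv> holo_on f UNIV"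

lemma holo_onE:
 assumes "holo_on f U"
 obtains D where "\<And>x. x \<in> U ==> (f has_derivative D x) (at x)" "\<And>x c v. x \<in> U ==> D x (cscale c v) = c * D x v"
 using assms unfolding holo_on_def by metis

lemma holo_on_subset: "holo_on f U ==> V \<subseteq> U ==> holo_on f V"
 unfolding holo_on_def by blast

lemma holo_isCont: "holo f ==> isCont f x"
 unfolding holo_on_def by (meson UNIV_I has_derivative_continuous)

lemma holo_continuous: "holo f ==> continuous_on A f"
 by (simp add: holo_isCont continuous_at_imp_continuous_on)

named_theorems holo_intros

lemma holo_const [holo_intros]: "holo_on (%_. c) U"
 unfolding holo_on_def by (auto intro!: exI[of _ "%_. 0"])

lemma holo_add [holo_intros]:
 assumes "holo_on f U" "holo_on g U" shows "holo_on (%x. f x + g x) U"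
proof -
 obtain D where D: "\<And>x. x \<in> U ==> (f has_derivative D x) (at x)" "\<And>x c v. x \<in> U ==> D x (cscale c v) = c * D x v"
  using assms(1) by (rule holo_onE) blast
 obtain E where E: "\<And>x. x \<in> U ==> (g has_derivative E x) (at x)" "\<And>x c v. x \<in> U ==> E x (cscale c v) = c * E x v"
  using assms(2) by (rule holo_onE) blast
 show ?thesis unfolding holo_on_def
  using has_derivative_add[OF D(1) E(1)] D(2) E(2)
  by (auto intro!: exI simp: ring_distribs)
qed

lemma holo_mult [holo_intros]:
 assumes "holo_on f U" "holo_on g U" shows "holo_on (%x. f x * g x) U"
proof -
 obtain D where D: "\<And>x. x \<in> U ==> (f has_derivative D x) (at x)" "\<And>x c v. x \<in> U ==> D x (cscale c v) = c * D x v"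
  using assms(1) by (rule holo_onE) blast
 obtain E where E: "\<And>x. x \<in> U ==> (g has_derivative E x) (at x)" "\<And>x c v. x \<in> U ==> E x (cscale c v) = c * E x v"
  using assms(2) by (rule holo_onE) blast
 show ?thesis unfolding holo_on_def
 proof
  fix x assume x: "x \<in> U"
  show "\<exists>f'. ((%x. f x * g x) has_derivative f') (at x) \<and> (\<forall>c v. f' (cscale c v) = c * f' v)"
   using has_derivative_mult[OF D(1)[OF x] E(1)[OF x]] D(2)[OF x] E(2)[OF x]
   by (intro exI conjI) (auto simp: algebra_simps)
 qed
qed

lemma holo_minus [holo_intros]: "holo_on f U ==> holo_on (%x. - f x) U"
 using holo_mult[OF holo_const[of "-1"], of f U] by simp

lemma holo_diff [holo_intros]: "holo_on f U ==> holo_on g U ==> holo_on (%x. f x - g x) U"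
 using holo_add[OF _ holo_minus, of f U g] by simp

lemma holo_sum [holo_intros]: "(\<And>i. i \<in> I ==> holo_on (f i) U) ==> holo_on (%x. \<Sum>i\<in>I. f i x) U"
 by (induction I rule: infinite_finite_induct) (auto intro!: holo_intros)

lemma holo_prod [holo_intros]: "(\<And>i. i \<in> I ==> holo_on (f i) U) ==> holo_on (%x. \<Prod>i\<in>I. f i x) U"
 by (induction I rule: infinite_finite_induct) (auto intro!: holo_intros)

lemma holo_prod_mset [holo_intros]:
 "(\<And>i. i \<in># I ==> holo_on (f i) U) ==> holo_on (%x. \<Prod>i\<in>#I. f i x) U"
 by (induction I) (auto intro!: holo_intros)

lemma holo_power [holo_intros]: "holo_on f U ==> holo_on (%x. f x ^ k) U"
 by (induction k) (auto intro!: holo_intros)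

lemma holo_compose_1:
 assumes f: "holo_on f U" and g: "g holomorphic_on V" "open V" "f ` U \<subseteq> V"
 shows "holo_on (%x. g (f x)) U"
proof -
 obtain D where D: "\<And>x. x \<in> U ==> (f has_derivative D x) (at x)" "\<And>x c v. x \<in> U ==> D x (cscale c v) = c * D x v"
  using f by (rule holo_onE) blast
 show ?thesis unfolding holo_on_def
 proof
  fix x assume x: "x \<in> U"
  have "(g has_derivative (%h. deriv g (f x) * h)) (at (f x))"
   using holomorphic_derivI[OF g(1,2), of "f x"] x g(3) by (auto simp: has_field_derivative_def)
  from has_derivative_compose[OF D(1)[OF x] this]
  show "\<exists>f'. ((%x. g (f x)) has_derivative f') (at x) \<and> (\<forall>c v. f' (cscale c v) = c * f' v)"
   using D(2)[OF x] by (intro exI conjI) auto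
 qed
qed

lemma holo_compose:
 assumes f: "holo f"
  and T: "\<And>x v. T (x + v) = T x + T' v" "linear T'" "\<And>c v. T' (cscale c v) = cscale c (T' v)"
 shows "holo (%x. f (T x))"
proof -
 obtain D where D: "\<And>x. x \<in> UNIV ==> (f has_derivative D x) (at x)" "\<And>x c v. x \<in> UNIV ==> D x (cscale c v) = c * D x v"
  using f by (rule holo_onE) blast
 have "(T has_derivative T') (at x)" for x
 proof -
  have "T = (%y. T 0 + T' y)"
   by (rule ext) (use T(1)[of 0, unfolded add_0] in blast)
  moreover have "((%y. T 0 + T' y) has_derivative (%y. 0 + T' y)) (at x)"
   using T(2) by (intro has_derivative_add has_derivative_const bounded_linear_imp_has_derivative)
    (simp add: linear_conv_bounded_linear)
  ultimately show ?thesis by simp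
 qed
 hence "((%x. f (T x)) has_derivative (%h. D (T x) (T' h))) (at x)" for x
  by (rule has_derivative_compose) (simp add: D(1))
 thus ?thesis
  unfolding holo_on_def using D(2) T(3) by (metis UNIV_I)
qed

lemma holo_linear:
 assumes "linear q" "\<And>c v. q (cscale c v) = c * q v"
 shows "holo_on q U"
 using assms unfolding holo_on_def linear_conv_bounded_linear
 by (auto intro!: exI[of _ q] bounded_linear_imp_has_derivative)

lemma holo_coords [holo_intros]:
 "holo_on (%x. x$$a) U" "holo_on (%x. fst (snd x)) U" "holo_on (%x. snd (snd x)) U"
 by (rule holo_linear; auto intro!: linearI simp: cscale_def case_prod_beta)+

lemma holo_line:
 assumes "holo f"
 shows "(%c. f (x + cscale c v)) holomorphic_on UNIV"
proof -
 obtain D where D: "\<And>x. x \<in> UNIV ==> (f has_derivative D x) (at x)" "\<And>x c v. x \<in> UNIV ==> D x (cscale c v) = c * D x v"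
  using assms by (rule holo_onE) blast
 have "((%c. f (x + cscale c v)) has_field_derivative D (x + cscale c v) v) (at c)" for c
 proof -
  have "((%c. x + cscale c v) has_derivative (%h. cscale h v)) (at c)"
   by (auto intro!: derivative_eq_intros bounded_linear.has_derivative[OF bounded_linear_cscale_left])
  hence "((%c. f (x + cscale c v)) has_derivative (%h. D (x + cscale c v) (cscale h v))) (at c)"
   by (rule has_derivative_compose) (simp add: D(1))
  thus ?thesis
   using D(2) by (simp add: has_field_derivative_def mult_commute_abs)
 qed
 thus ?thesis
  unfolding holomorphic_on_def field_differentiable_def by blast
qed

text \<open>\<open>holo_on\<close> asks only for pointwise complex differentiability. Cauchy's
  formula on the unit circle in direction v writes the derivative as an integral of values of f,
  hence it depends continuously on the base point; the Leibniz rule in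
  \<open>holo_theta_divides\<close> requires this.\<close>

lemma holo_derivative_continuous:
 fixes f :: "('n::finite) pt => complex"
 assumes D: "\<And>x. (f has_derivative D x) (at x)" "\<And>x c v. D x (cscale c v) = c * D x v"
 shows "continuous_on A (%x. D x v)"
proof -
 define e where "e t = exp (2 * of_real pi * \<i> * of_real t)" for t
 have f: "holo f" using D unfolding holo_on_def by blast
 have eq: "D x v = integral (cbox 0 1) (%t. f (x + cscale (e t) v) / e t)" for x
 proof -
  define g where "g = (%c. f (x + cscale c v))"
  have g: "g holomorphic_on UNIV" unfolding g_def using f by (rule holo_line)
  have "((%c. x + cscale c v) has_derivative (%h. cscale h v)) (at 0)"
   by (auto intro!: derivative_eq_intros bounded_linear.has_derivative[OF bounded_linear_cscale_left])
  hence "(g has_derivative (%h. D (x + cscale 0 v) (cscale h v))) (at 0)"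
   unfolding g_def by (rule has_derivative_compose) (rule D(1))
  hence "(g has_field_derivative D x v) (at 0)"
   using D(2) by (simp add: has_field_derivative_def mult_commute_abs)
  hence "deriv g 0 = D x v" by (rule DERIV_imp_deriv)
  hence "2 * pi * \<i> * D x v = contour_integral (circlepath 0 1) (%u. g u / (u - 0)\<^sup>2)"
   using Cauchy_contour_integral_circlepath_2[of 0 1 g 0]
   by (simp add: holomorphic_on_imp_continuous_on holomorphic_on_subset[OF g])
  also have "\<dots> = integral {0..1} (%t. (2 * pi * \<i>) * (g (e t) / e t))"
   unfolding contour_integral_integral vector_derivative_circlepath
   by (rule integral_cong) (simp add: circlepath e_def power2_eq_square)
  also have "\<dots> = 2 * pi * \<i> * integral {0..1} (%t. g (e t) / e t)"
   by (rule integral_mult_right)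
  finally show ?thesis by (simp add: g_def)
 qed
 have "continuous_on (UNIV \<times> cbox 0 1) (%(x, t). f (x + cscale (e t) v) / e t)"
  unfolding case_prod_beta e_def
  by (intro continuous_intros continuous_on_compose2[OF holo_continuous[OF f]]) auto
 hence "continuous_on UNIV (%x. D x v)"
  unfolding eq by (rule integral_continuous_on_param)
 thus ?thesis by (rule continuous_on_subset) auto
qed

definition affine_fn :: "(('n::finite) pt => complex) => ('n pt => complex) => bool" where
 "affine_fn p q \<longleftrightarrow> linear q \<and> (\<forall>c v. q (cscale c v) = c * q v) \<and> (\<forall>x v. p (x + v) = p x + q v)"

lemma affine_fn_holo:
 assumes "affine_fn p q"
 shows "holo_on p U"
proof -
 have "p (0 + x) = p 0 + q x" for x using assms unfolding affine_fn_def by blast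
 hence "p = (%x. p 0 + q x)" unfolding add_0 by blast
 moreover have "holo_on (%x. p 0 + q x) U"
  using assms by (intro holo_intros holo_linear) (auto simp: affine_fn_def)
 ultimately show ?thesis by simp
qed

context modulus
begin

lemma holo_theta [holo_intros]: "holo_on f U ==> holo_on (%x. th (f x)) U"
 by (rule holo_compose_1[OF _ theta_entire]) auto

text \<open>
 The quotient by \<open>th \<circ> p\<close> is holomorphic in each direction transversal to the hyperplanes, and locally
 given by a Cauchy integral in this direction, which depends holomorphically on the base point.
\<close>

lemma holo_theta_divides:
 fixes G :: "('n::finite) pt => complex"
 assumes p: "affine_fn p q" and v0: "q v0 \<noteq> 0" and G: "holo G" and 0: "\<And>x. p x \<in> \<Lambda> ==> G x = 0"
 obtains H where "holo H" "\<And>x. G x = th (p x) * H x"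
proof -
 \<comment> \<open>Scaled so that p increases by exactly c along \<open>cscale c v\<close>, which
   reduces each line to the one-variable case.\<close>
 define v where "v = cscale (1 / q v0) v0"
 have q: "linear q" "\<And>c v. q (cscale c v) = c * q v" "\<And>x v. p (x + v) = p x + q v"
  using p by (auto simp: affine_fn_def)
 have pv: "p (x + cscale c v) = c + p x" for x c
  using v0 by (simp add: q v_def)
 have "\<exists>h. h holomorphic_on UNIV \<and> (\<forall>c. G (u + cscale c v) = th (c + p u) * h c)" for u
  by (rule theta_divides[OF holo_line[OF G, of u v], of "p u"]) (use 0 pv in auto)
 then obtain h where h: "\<And>u. h u holomorphic_on UNIV" "\<And>u c. G (u + cscale c v) = th (c + p u) * h u c"
  by metis
 define H where "H u = h u 0" for u
 have GH: "G x = th (p x) * H x" for x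
  using h(2)[of x 0] by (simp add: H_def)
 obtain D where D: "\<And>x. (G has_derivative D x) (at x)" "\<And>x c v. D x (cscale c v) = c * D x v"
  using G by (rule holo_onE) blast
 have "holo H"
  unfolding holo_on_def
 proof
  fix x0 :: "'n pt"
  have "eventually (%c. th (1 * c + p x0) \<noteq> 0) (at 0)"
   by (rule eventually_theta_affine_nonzero) simp
  then obtain d where d: "d > 0" "\<And>c. c \<noteq> 0 ==> norm c < d ==> th (c + p x0) \<noteq> 0"
   unfolding eventually_at by auto
  define r where "r = d / 2"
  have r: "r > 0" "\<And>c. norm c = r ==> th (c + p x0) \<noteq> 0"
   using d by (auto simp: r_def)
  have pc: "continuous_on A p" for A
   using affine_fn_holo[OF p] by (rule holo_continuous)
  have tc: "continuous_on A th" for A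
   using theta_entire holomorphic_on_imp_continuous_on holomorphic_on_subset by blast
  \<comment> \<open>Theta has no zero on the circle of radius r through the base point x0. The
    circle is compact, so by the tube lemma one neighbourhood of x0 keeps the denominator nonzero on
    all the shifted circles.\<close>
  have "open ((%(u, c). th (c + p u)) -` (- {0}))"
   unfolding case_prod_beta
   by (intro open_vimage continuous_intros continuous_on_compose2[OF tc] continuous_on_compose2[OF pc]) auto
  from Elementary_Topology.tube_lemma[OF compact_sphere[of 0 r] this, of x0]
  obtain X where X: "x0 \<in> X" "open X" "\<And>u c. u \<in> X ==> norm c = r ==> th (c + p u) \<noteq> 0"
   using r by (fastforce simp: subset_iff)
  then obtain \<delta> where \<delta>: "\<delta> > 0" "ball x0 \<delta> \<subseteq> X"
   using open_contains_ball by blast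
  define U where "U = ball x0 \<delta>"
  have U: "x0 \<in> U" "open U" "convex U" using \<delta> by (auto simp: U_def)
  define e where "e t = of_real r * exp (2 * of_real pi * \<i> * of_real t)" for t
  have ne: "norm (e t) = r" for t using r by (simp add: e_def norm_mult)
  have nz: "th (e t + p u) \<noteq> 0" if "u \<in> U" for t u
  proof -
   have "u \<in> X" using that \<delta>(2) unfolding U_def by blast
   thus ?thesis by (rule X(3)[OF _ ne])
  qed
  have ec: "continuous_on A e" for A unfolding e_def by (intro continuous_intros)
  define F where "F u t = G (u + cscale (e t) v) / th (e t + p u)" for u t
  have HF: "H u = integral (cbox 0 1) (F u)" if u: "u \<in> U" for u
  proof -
   have "2 * pi * \<i> * H u = contour_integral (circlepath 0 r) (%c. h u c / (c - 0))"
    unfolding H_def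
    using contour_integral_unique[OF Cauchy_integral_circlepath_simple[of "h u" 0 r 0]]
     r holomorphic_on_subset[OF h(1)] by simp
   also have "\<dots> = integral {0..1} (%t. (2 * pi * \<i>) * F u t)"
    unfolding contour_integral_integral vector_derivative_circlepath
   proof (rule integral_cong)
    fix t :: real
    have "F u t = h u (e t)" using h(2)[of u "e t"] nz[OF u] by (simp add: F_def)
    thus "h u (circlepath 0 r t) / (circlepath 0 r t - 0) * (2 * pi * \<i> * r * exp (2 * of_real pi * \<i> * t)) = 2 * pi * \<i> * F u t"
     using r by (simp add: circlepath e_def)
   qed
   also have "\<dots> = 2 * pi * \<i> * integral {0..1} (F u)"
    by (rule integral_mult_right)
   finally show ?thesis by simp
  qed
  define DF where "DF u t w = (D (u + cscale (e t) v) w * th (e t + p u) - G (u + cscale (e t) v) * (deriv th (e t + p u) * q w))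
    / (th (e t + p u) * th (e t + p u))" for u t w
  have DF: "((%u. F u t) has_derivative DF u t) (at u)" if u: "u \<in> U" for u t
  proof -
   have 1: "((%u. G (u + cscale (e t) v)) has_derivative D (u + cscale (e t) v)) (at u)"
    by (rule has_derivative_compose[where f = "%u. u + cscale (e t) v" and f' = "%h. h", OF _ D(1)])
     (auto intro!: derivative_eq_intros)
   have "(p has_derivative q) (at u)"
   proof -
    have "p = (%x. p 0 + q x)"
     by (rule ext) (use q(3)[of 0, unfolded add_0] in blast)
    moreover have "((%x. p 0 + q x) has_derivative (%x. 0 + q x)) (at u)"
     using q(1) by (intro has_derivative_add has_derivative_const bounded_linear_imp_has_derivative)
      (simp add: linear_conv_bounded_linear)
    ultimately show ?thesis by simp
   qed
   hence "((%u. e t + p u) has_derivative q) (at u)"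
    by (auto intro!: derivative_eq_intros)
   moreover have "(th has_derivative (%h. deriv th (e t + p u) * h)) (at (e t + p u))"
    using holomorphic_derivI[OF theta_entire open_UNIV, of "e t + p u"] by (simp add: has_field_derivative_def)
   ultimately have 2: "((%u. th (e t + p u)) has_derivative (%w. deriv th (e t + p u) * q w)) (at u)"
    by (rule has_derivative_compose)
   show ?thesis
    using has_derivative_divide'[OF 1 2 nz[OF u]] unfolding F_def DF_def .
  qed
  define fx where "fx u t = Blinfun (DF u t)" for u t
  have fx: "blinfun_apply (fx u t) = DF u t" if "u \<in> U" for u t
   unfolding fx_def using DF[OF that] by (intro bounded_linear_Blinfun_apply) (rule has_derivative_bounded_linear)
  have dtc: "continuous_on A (deriv th)" for A
   using holomorphic_deriv[OF theta_entire open_UNIV] holomorphic_on_imp_continuous_on holomorphic_on_subset by blast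
  have Gc: "continuous_on A G" for A using G by (rule holo_continuous)
  have qc: "continuous_on A q" for A
   using q(1) linear_continuous_on linear_conv_bounded_linear by blast
  note ci = continuous_on_compose2[OF Gc] continuous_on_compose2[OF tc] continuous_on_compose2[OF dtc]
   continuous_on_compose2[OF pc] continuous_on_compose2[OF qc] continuous_on_compose2[OF ec]
   continuous_on_compose2[OF holo_derivative_continuous[OF D]]
  have cF: "continuous_on (cbox 0 1) (F u)" if "u \<in> U" for u
   unfolding F_def using nz[OF that] by (intro continuous_intros ci) auto
  have cfx: "continuous_on (U \<times> cbox 0 1) (%(u, t). fx u t)"
  proof (rule continuous_on_blinfun_componentwise)
   fix w :: "'n pt"
   have "continuous_on (U \<times> cbox 0 1) (%(u, t). DF u t w)"
    unfolding DF_def case_prod_beta by (intro continuous_intros ci) (auto simp: nz)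
   thus "continuous_on (U \<times> cbox 0 1) (%x. blinfun_apply (case x of (u, t) => fx u t) w)"
    by (rule continuous_on_eq) (auto simp: fx)
  qed
  have "((%u. integral (cbox 0 1) (F u)) has_derivative integral (cbox 0 1) (fx x0)) (at x0 within U)"
  proof (rule leibniz_rule[OF _ _ cfx U(1,3)])
   show "((%u. F u t) has_derivative blinfun_apply (fx u t)) (at u within U)" if "u \<in> U" for u t
    unfolding fx[OF that] using DF[OF that] by (rule has_derivative_at_withinI)
   show "F u integrable_on cbox 0 1" if "u \<in> U" for u
    using cF[OF that] by (rule integrable_continuous)
  qed
  hence "((%u. integral (cbox 0 1) (F u)) has_derivative integral (cbox 0 1) (fx x0)) (at x0)"
   unfolding at_within_open[OF U(1,2)] .
  hence 1: "(H has_derivative integral (cbox 0 1) (fx x0)) (at x0)"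
   by (rule has_derivative_transform_within_open[OF _ U(2,1)]) (rule HF[symmetric])
  have fi: "fx x0 integrable_on cbox 0 1"
  proof (rule integrable_continuous)
   show "continuous_on (cbox 0 1) (fx x0)"
   proof -
    have "continuous_on (cbox 0 1) (%t::real. (x0, t))"
     by (intro continuous_on_Pair continuous_on_const continuous_on_id)
    from continuous_on_compose2[OF cfx this] show ?thesis using U(1) by auto
   qed
  qed
  \<comment> \<open>The derivative of the integrand is complex linear in the direction, and
    evaluation at a direction commutes with the integral.\<close>
  have 2: "blinfun_apply (integral (cbox 0 1) (fx x0)) (cscale c w) = c * blinfun_apply (integral (cbox 0 1) (fx x0)) w" for c w
  proof -
   have "DF x0 t (cscale c w) = c * DF x0 t w" for t
    by (simp add: DF_def D(2) q(2) algebra_simps)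
   thus ?thesis
    unfolding blinfun_apply_integral[OF fi] fx[OF U(1)] by simp
  qed
  show "\<exists>f'. (H has_derivative f') (at x0) \<and> (\<forall>c v. f' (cscale c v) = c * f' v)"
   using 1 2 by blast
 qed
 thus ?thesis using GH by (rule that)
qed

end

section \<open>Generic equality and polar divisors\<close>

text \<open>The relation behind \<open>gen_eq\<close> as a filter, so that finitely many generic
  statements can be combined; two dense open sets meet in a dense open set.\<close>

definition generic :: "('n::finite) pt filter" where
 "generic = Abs_filter (%P. \<exists>A. open A \<and> closure A = UNIV \<and> (\<forall>x\<in>A. P x))"

abbreviation generically :: "(('n::finite) pt \<Rightarrow> bool) \<Rightarrow> bool" (binder "GEN " 10) where
  "generically P \<equiv> eventually P generic"

lemma dense_iff: "closure A = UNIV \<longleftrightarrow> (\<forall>U. open U \<and> U \<noteq> {} \<longrightarrow> U \<inter> A \<noteq> {})" for A :: "'a::topological_space set"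
proof
 assume "closure A = UNIV"
 thus "\<forall>U. open U \<and> U \<noteq> {} \<longrightarrow> U \<inter> A \<noteq> {}"
  using open_Int_closure_eq_empty by fastforce
next
 assume *: "\<forall>U. open U \<and> U \<noteq> {} \<longrightarrow> U \<inter> A \<noteq> {}"
 have "- closure A \<inter> A = {}" using closure_subset by blast
 hence "- closure A = {}" using * by (metis closed_closure open_Compl)
 thus "closure A = UNIV" by blast
qed

lemma eventually_generic:
 fixes P :: "('a::finite) pt => bool"
 shows "eventually P generic \<longleftrightarrow> (\<exists>A. open A \<and> closure A = UNIV \<and> (\<forall>x\<in>A. P x))"
 unfolding generic_def
proof (rule eventually_Abs_filter, rule is_filter.intro)
 show "\<exists>A. open A \<and> closure A = UNIV \<and> (\<forall>x\<in>A. True)"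
  by (rule exI[of _ UNIV]) auto
next
 fix P Q :: "'a pt => bool"
 assume "\<exists>A. open A \<and> closure A = UNIV \<and> (\<forall>x\<in>A. P x)" "\<exists>A. open A \<and> closure A = UNIV \<and> (\<forall>x\<in>A. Q x)"
 then obtain A B where A: "open A" "closure A = UNIV" "\<forall>x\<in>A. P x" and B: "open B" "closure B = UNIV" "\<forall>x\<in>B. Q x"
  by blast
 have "U \<inter> (A \<inter> B) \<noteq> {}" if "open U" "U \<noteq> {}" for U
 proof -
  have "open (U \<inter> A)" "U \<inter> A \<noteq> {}"
   using that A by (auto simp: dense_iff)
  hence "(U \<inter> A) \<inter> B \<noteq> {}" using B(2) unfolding dense_iff by blast
  thus ?thesis by (simp add: Int_assoc)
 qed
 hence "closure (A \<inter> B) = UNIV" unfolding dense_iff by blast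
 thus "\<exists>A. open A \<and> closure A = UNIV \<and> (\<forall>x\<in>A. P x \<and> Q x)"
  using A B by (intro exI[of _ "A \<inter> B"]) auto
qed auto

lemma gen_eq_iff: "gen_eq f g \<longleftrightarrow> (GEN x. f x = g x)"
 by (simp add: gen_eq_def eventually_generic)

lemma eventually_generic_compose:
 fixes S T :: "('n::finite) pt => 'n pt"
 assumes "eventually P generic"
  and T: "continuous_on UNIV T" "continuous_on UNIV S" "\<And>x. T (S x) = x" "\<And>x. S (T x) = x"
 shows "GEN x. P (T x)"
proof -
 obtain A where A: "open A" "closure A = UNIV" "\<forall>x\<in>A. P x"
  using assms(1) by (auto simp: eventually_generic)
 have "U \<inter> T -` A \<noteq> {}" if U: "open U" "U \<noteq> {}" for U
 proof -
  have "open (S -` U)" using T(2) U(1) by (simp add: open_vimage)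
  moreover have "S -` U \<noteq> {}" using U(2) T(4) by (metis ex_in_conv vimage_eq)
  ultimately obtain x where "x \<in> S -` U \<inter> A" using A(2) unfolding dense_iff by blast
  hence "S x \<in> U \<inter> T -` A" using T(3) by simp
  thus ?thesis by blast
 qed
 hence "closure (T -` A) = UNIV" unfolding dense_iff by blast
 thus ?thesis
  unfolding eventually_generic using A(1,3) T(1)
  by (intro exI[of _ "T -` A"]) (auto simp: open_vimage)
qed

lemma generic_translate:
 assumes "eventually P generic" shows "GEN x. P (x + c)"
 by (rule eventually_generic_compose[OF assms, of _ "%x. x - c"]) (auto intro!: continuous_intros)

lemma shift_shift [simp]: "shift \<nu> (shift \<mu> x) = shift (\<nu> + \<mu>) x"
 by (cases x) (simp add: shift_def algebra_simps)

lemma shift_0 [simp]: "shift 0 x = x"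
 by (cases x) (simp add: shift_def)

lemma continuous_shift [continuous_intros]: "continuous_on A (shift \<nu>)"
 unfolding shift_def case_prod_beta by (intro continuous_intros)

lemma generic_shift:
 assumes "eventually P generic" shows "GEN x. P (shift \<nu> x)"
 by (rule eventually_generic_compose[OF assms, of _ "shift (- \<nu>)"]) (auto intro!: continuous_intros)

lemma perm_perm: "bij \<sigma> ==> bij \<rho> ==> perm \<sigma> (perm \<rho> x) = perm (\<sigma> \<circ> \<rho>) x"
 by (cases x) (simp add: perm_def vec_eq_iff o_inv_distrib)

lemma perm_id [simp]: "perm id x = x" "perm (%a. a) x = x"
 by (cases x; simp add: perm_def vec_eq_iff inv_id[unfolded id_def])+

lemma continuous_perm [continuous_intros]: "continuous_on A (perm \<sigma>)"
 unfolding perm_def case_prod_beta by (intro continuous_intros)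

lemma perm_inv [simp]: "bij \<sigma> ==> perm \<sigma> (perm (inv \<sigma>) x) = x" "bij \<sigma> ==> perm (inv \<sigma>) (perm \<sigma> x) = x"
 by (simp_all add: perm_perm bij_imp_bij_inv bij_is_inj surj_iff[THEN iffD1, OF bij_is_surj] del: id_apply)

lemma generic_perm:
 assumes "eventually P generic" "bij \<sigma>" shows "GEN x. P (perm \<sigma> x)"
 by (rule eventually_generic_compose[OF assms(1), of _ "perm (inv \<sigma>)"]) (use assms(2) in \<open>auto intro!: continuous_intros\<close>)

lemma generic_eq_imp_eq:
 fixes f g :: "('n::finite) pt => complex"
 assumes "GEN x. f x = g x" "continuous_on UNIV f" "continuous_on UNIV g"
 shows "f x = g x"
proof -
 obtain A where A: "closure A = UNIV" "A \<subseteq> {x. f x = g x}"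
  using assms(1) by (auto simp: eventually_generic)
 have "closed {x. f x = g x}"
  using assms(2,3) by (intro closed_Collect_eq) auto
 hence "closure A \<subseteq> {x. f x = g x}" using A(2) by (rule closure_minimal[rotated])
 thus ?thesis using A(1) by auto
qed

text \<open>The nondegeneracy condition of \<open>quot_on\<close>: q vanishes on no relatively open
  part of Z, hence equations on Z may be divided by q.\<close>

definition gen_on :: "('n::finite) pt set => ('n pt => complex) => bool" where
 "gen_on Z q \<longleftrightarrow> Z \<subseteq> closure {x \<in> Z. q x \<noteq> 0}"

lemma gen_on_1 [simp]: "gen_on Z (%_. 1)"
 by (simp add: gen_on_def closure_subset)

lemma gen_on_iff: "gen_on Z q \<longleftrightarrow> (\<forall>x\<in>Z. \<forall>U. open U \<and> x \<in> U \<longrightarrow> (\<exists>y\<in>Z \<inter> U. q y \<noteq> 0))"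
proof
 assume *: "gen_on Z q"
 show "\<forall>x\<in>Z. \<forall>U. open U \<and> x \<in> U \<longrightarrow> (\<exists>y\<in>Z \<inter> U. q y \<noteq> 0)"
 proof (intro ballI allI impI)
  fix x U assume x: "x \<in> Z" "open U \<and> x \<in> U"
  hence "U \<inter> closure {x \<in> Z. q x \<noteq> 0} \<noteq> {}" using * by (auto simp: gen_on_def)
  hence "U \<inter> {x \<in> Z. q x \<noteq> 0} \<noteq> {}" using x by (simp add: open_Int_closure_eq_empty)
  thus "\<exists>y\<in>Z \<inter> U. q y \<noteq> 0" by blast
 qed
next
 assume *: "\<forall>x\<in>Z. \<forall>U. open U \<and> x \<in> U \<longrightarrow> (\<exists>y\<in>Z \<inter> U. q y \<noteq> 0)"
 show "gen_on Z q"
  unfolding gen_on_def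
 proof (rule subsetI, rule ccontr)
  fix x assume x: "x \<in> Z" "x \<notin> closure {x \<in> Z. q x \<noteq> 0}"
  then obtain y where "y \<in> Z \<inter> - closure {x \<in> Z. q x \<noteq> 0}" "q y \<noteq> 0"
   using * open_Compl[OF closed_closure[of "{x \<in> Z. q x \<noteq> 0}"]] by blast
  thus False using closure_subset[of "{x \<in> Z. q x \<noteq> 0}"] by blast
 qed
qed

lemma gen_on_mult:
 assumes "gen_on Z q" "gen_on Z r" "continuous_on UNIV q"
 shows "gen_on Z (%x. q x * r x)"
 unfolding gen_on_iff
proof (intro ballI allI impI)
 fix x U assume x: "x \<in> Z" "open U \<and> x \<in> U"
 then obtain y where y: "y \<in> Z \<inter> U" "q y \<noteq> 0" using assms(1) unfolding gen_on_iff by blast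
 have "open (U \<inter> q -` (- {0}))" using x assms(3) by (intro open_Int open_vimage) auto
 then obtain u where "u \<in> Z \<inter> (U \<inter> q -` (- {0}))" "r u \<noteq> 0"
  using assms(2) y unfolding gen_on_iff by blast
 thus "\<exists>y\<in>Z \<inter> U. q y * r y \<noteq> 0" by auto
qed

lemma gen_on_zero:
 assumes "gen_on Z q" "continuous_on UNIV f" "\<And>x. x \<in> Z ==> q x * f x = 0" "x \<in> Z"
 shows "f x = 0"
proof -
 have "closed {x. f x = 0}" using assms(2) by (intro closed_Collect_eq) auto
 hence "closure {x \<in> Z. q x \<noteq> 0} \<subseteq> {x. f x = 0}"
  by (intro closure_minimal) (use assms(3) in auto)
 thus ?thesis using assms(1,4) by (auto simp: gen_on_def)
qed

lemma gen_on_UNIV_generic: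
 assumes "gen_on UNIV q" "continuous_on UNIV q"
 shows "GEN x. q x \<noteq> 0"
 unfolding eventually_generic
proof (intro exI conjI)
 show "open (q -` (- {0}))" using assms(2) by (intro open_vimage) auto
 show "closure (q -` (- {0})) = UNIV"
  using assms(1) by (auto simp: gen_on_def vimage_def)
qed auto

text \<open>The identity theorem on a complex line inside Z: if f vanished on Z near x, it would
  vanish along the whole line and so at x + v.\<close>

lemma gen_on_line:
 assumes f: "holo f" and line: "\<And>x. x \<in> Z ==> \<exists>v. (\<forall>c. x + cscale c v \<in> Z) \<and> f (x + v) \<noteq> 0"
 shows "gen_on Z f"
 unfolding gen_on_iff
proof (intro ballI allI impI, rule ccontr)
 fix x U assume x: "x \<in> Z" "open U \<and> x \<in> U" and no: "\<not> (\<exists>y\<in>Z \<inter> U. f y \<noteq> 0)"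
 obtain v where v: "\<And>c. x + cscale c v \<in> Z" "f (x + v) \<noteq> 0"
  using line[OF x(1)] by blast
 define g where "g c = f (x + cscale c v)" for c
 have g: "g holomorphic_on UNIV" unfolding g_def using f by (rule holo_line)
 have "continuous_on UNIV (%c. x + cscale c v)" by (intro continuous_intros)
 hence "open ((%c. x + cscale c v) -` U)" using x(2) by (intro open_vimage) auto
 moreover have "0 \<in> (%c. x + cscale c v) -` U" using x(2) by simp
 ultimately obtain e where e: "e > 0" "ball 0 e \<subseteq> (%c. x + cscale c v) -` U"
  using open_contains_ball by blast
 have 0: "g c = 0" if "c \<in> ball 0 e" for c
  using no v(1)[of c] e(2) that unfolding g_def by blast
 have "g 1 = 0"
 proof (rule analytic_continuation[OF g open_UNIV connected_UNIV _ _ _ 0])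
  show "(0::complex) islimpt ball 0 e" using e(1) by (intro interior_limit_point) (simp add: interior_open)
 qed auto
 thus False using v(2) by (simp add: g_def)
qed

text \<open>Absence of poles, for a function that is known only up to generic equality.\<close>

definition ext :: "(('n::finite) pt => complex) => bool" where
 "ext f \<longleftrightarrow> (\<exists>g. holo g \<and> (GEN x. f x = g x))"

lemma ext_holo: "holo f ==> ext f"
 unfolding ext_def by (rule exI[of _ f]) simp

lemma ext_cong:
 assumes "ext f" "GEN x. f x = g x" shows "ext g"
proof -
 obtain h where "holo h" "GEN x. f x = h x" using assms(1) by (auto simp: ext_def)
 moreover have "GEN x. g x = h x"
  using assms(2) calculation(2) by eventually_elim simp
 ultimately show ?thesis unfolding ext_def by blast
qed

lemma ext_mult: assumes "ext f" "ext g" shows "ext (%x. f x * g x)"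
proof -
 obtain F G where *: "holo F" "GEN x. f x = F x" "holo G" "GEN x. g x = G x"
  using assms by (auto simp: ext_def)
 have "GEN x. f x * g x = F x * G x"
  using *(2,4) by eventually_elim simp
 thus ?thesis unfolding ext_def using holo_mult[OF *(1,3)] by blast
qed

lemma ext_add: assumes "ext f" "ext g" shows "ext (%x. f x + g x)"
proof -
 obtain F G where *: "holo F" "GEN x. f x = F x" "holo G" "GEN x. g x = G x"
  using assms by (auto simp: ext_def)
 have "GEN x. f x + g x = F x + G x"
  using *(2,4) by eventually_elim simp
 thus ?thesis unfolding ext_def using holo_add[OF *(1,3)] by blast
qed

lemma ext_sum: "(\<And>i. i \<in> I ==> ext (f i)) ==> ext (%x. \<Sum>i\<in>I. f i x)"
 by (induction I rule: infinite_finite_induct) (auto intro: ext_add ext_holo[OF holo_const])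

lemma ext_compose:
 assumes "ext f" and T: "\<And>x v. T (x + v) = T x + T' v" "linear T'" "\<And>c v. T' (cscale c v) = cscale c (T' v)"
  and P: "\<And>P. eventually P generic ==> (GEN x. P (T x))"
 shows "ext (%x. f (T x))"
proof -
 obtain g where g: "holo g" "GEN x. f x = g x"
  using assms(1) by (auto simp: ext_def)
 show ?thesis
  unfolding ext_def using holo_compose[OF g(1) T] P[OF g(2)] by blast
qed

lemma shift_linear: "shift \<nu> (x + v) = shift \<nu> x + shift \<nu> v" "linear (shift \<nu>)" "shift \<nu> (cscale c v) = cscale c (shift \<nu> v)"
 by (auto intro!: linearI simp: shift_def cscale_def case_prod_beta algebra_simps prod_eq_iff)

lemma perm_linear: "perm \<sigma> (x + v) = perm \<sigma> x + perm \<sigma> v" "linear (perm \<sigma>)" "perm \<sigma> (cscale c v) = cscale c (perm \<sigma> v)"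
 by (auto intro!: linearI simp: perm_def cscale_def case_prod_beta algebra_simps prod_eq_iff vec_eq_iff)

lemma ext_shift: "ext f ==> ext (%x. f (shift \<nu> x))"
 by (rule ext_compose[OF _ shift_linear]) (auto intro: generic_shift)

lemma ext_perm: "ext f ==> bij \<sigma> ==> ext (%x. f (perm \<sigma> x))"
 by (rule ext_compose[OF _ perm_linear]) (auto intro: generic_perm)

lemma holo_shift: "holo f ==> holo (%x. f (shift \<nu> x))"
 by (rule holo_compose[OF _ shift_linear])

lemma holo_perm: "holo f ==> holo (%x. f (perm \<sigma> x))"
 by (rule holo_compose[OF _ perm_linear])

text \<open>Symbols for the hypersurfaces that can occur as poles. \<open>Spec\<close> and
  \<open>Dyn\<close> give the components of D; \<open>Diff\<close> and \<open>DiffY\<close> (z_a -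
  z_b + y) come from the stable envelopes and have to disappear. With symbols in place of functions,
  divisors are multisets on which permutations and shifts act.\<close>

datatype 'n form = Diff "'n set" | DiffY 'n 'n | Spec 'n | Dyn int

text \<open>\<open>Diff {a, b}\<close> stands for \<open>z\<^sub>a - z\<^sub>b\<close> up to sign.\<close>

fun ev :: "complex => ('n::{finite,linorder}) form => 'n pt => complex" where
 "ev w (Diff S) x = x$$Min S - x$$Max S"
| "ev w (DiffY a b) x = x$$a - x$$b + fst (snd x)"
| "ev w (Spec a) x = x$$a + fst (snd x) - w"
| "ev w (Dyn j) x = snd (snd x) + of_int j * fst (snd x)"

fun valid_form :: "'n form => bool" where
 "valid_form (Diff S) \<longleftrightarrow> card S = 2"
| "valid_form (DiffY a b) \<longleftrightarrow> a \<noteq> b"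
| "valid_form _ \<longleftrightarrow> True"

lemma ev_affine: "affine_fn (ev w p) (ev 0 p)"
 unfolding affine_fn_def
 by (cases p) (auto intro!: linearI simp: cscale_def case_prod_beta algebra_simps)

lemma ev_line: "ev w p (x + cscale c v) = ev 0 p v * c + ev w p x"
 using ev_affine[of w p] unfolding affine_fn_def by (metis add.commute mult.commute)

lemma ev_holo [holo_intros]: "holo_on (ev w p) U"
 by (rule affine_fn_holo[OF ev_affine])

lemma card_2E_less:
 fixes S :: "'n::linorder set"
 assumes "card S = 2" obtains a b where "a < b" "S = {a, b}" "Min S = a" "Max S = b"
proof -
 obtain a b where "S = {a, b}" "a \<noteq> b" using assms by (auto simp: card_2_iff)
 thus ?thesis
  using that[of a b] that[of b a] by (cases "a < b") (auto simp: min_def max_def insert_commute not_less_iff_gr_or_eq)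
qed

definition unit_z :: "'n => complex ^ ('n::finite)" where
 "unit_z a = (\<chi> b. if b = a then 1 else 0)"

lemma unit_z_nth [simp]: "unit_z a$b = (if b = a then 1 else 0)"
 by (simp add: unit_z_def)

lemma ev_direction:
 assumes "valid_form p" shows "\<exists>v. ev 0 p v \<noteq> 0"
proof (cases p)
 case (Diff S)
 then obtain a b where "a < b" "Min S = a" "Max S = b" using assms by (auto elim: card_2E_less)
 thus ?thesis using Diff by (intro exI[of _ "(unit_z a, 0, 0)"]) auto
next
 case (DiffY a b) thus ?thesis by (intro exI[of _ "(0, 1, 0)"]) simp
next
 case (Spec a) thus ?thesis by (intro exI[of _ "(0, 1, 0)"]) simp
next
 case (Dyn a) thus ?thesis by (intro exI[of _ "(0, 0, 1)"]) simp
qed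

text \<open>Distinct forms have hyperplanes in different directions, so that their theta divisors,
  including all lattice translates, share no component. The case analysis only exhibits a direction
  inside one and transversal to the other.\<close>

lemma ev_not_parallel:
 assumes "valid_form p" "valid_form p'" "p \<noteq> p'"
 shows "\<exists>v. ev 0 p v = 0 \<and> ev 0 p' v \<noteq> 0"
proof (cases p')
 case p': (Diff T)
 then obtain c d where cd: "c < d" "T = {c, d}" "Min T = c" "Max T = d" using assms(2) by (auto elim: card_2E_less)
 show ?thesis
 proof (cases p)
  case (Diff S)
  then obtain a b where ab: "a < b" "S = {a, b}" "Min S = a" "Max S = b" using assms(1) by (auto elim: card_2E_less)
  hence "\<exists>e\<in>{c, d}. e \<notin> {a, b}" using cd assms(3) p' Diff by (auto simp: doubleton_eq_iff)
  then obtain e where "e \<in> {c, d}" "e \<notin> {a, b}" by blast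
  thus ?thesis using Diff p' ab cd by (intro exI[of _ "(unit_z e, 0, 0)"]) auto
 next
  case (DiffY a b)
  thus ?thesis using p' cd by (intro exI[of _ "(unit_z c, unit_z c$b - unit_z c$a, 0)"]) auto
 next
  case (Spec a)
  thus ?thesis using p' cd by (intro exI[of _ "(unit_z c, - unit_z c$a, 0)"]) auto
 next
  case (Dyn j)
  thus ?thesis using p' cd by (intro exI[of _ "(unit_z c, 0, 0)"]) auto
 qed
next
 case p': (DiffY c d)
 hence cd: "c \<noteq> d" using assms(2) by simp
 show ?thesis
 proof (cases p)
  case (Diff S)
  thus ?thesis using p' by (intro exI[of _ "(0, 1, 0)"]) auto
 next
  case (DiffY a b)
  show ?thesis
  proof (cases "a = c")
   case True
   thus ?thesis using DiffY p' cd assms by (intro exI[of _ "(unit_z d, unit_z d$b - unit_z d$a, 0)"]) auto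
  next
   case False
   thus ?thesis using DiffY p' cd assms by (intro exI[of _ "(unit_z c, unit_z c$b - unit_z c$a, 0)"]) auto
  qed
 next
  case (Spec a)
  thus ?thesis using p' cd by (intro exI[of _ "(unit_z d, - unit_z d$a, 0)"]) auto
 next
  case (Dyn j)
  thus ?thesis using p' cd by (intro exI[of _ "(unit_z c, 0, 0)"]) auto
 qed
next
 case p': (Spec c)
 show ?thesis
 proof (cases p)
  case (Diff S)
  thus ?thesis using p' by (intro exI[of _ "(0, 1, 0)"]) auto
 next
  case (DiffY a b)
  thus ?thesis using p' assms by (intro exI[of _ "(unit_z b, 1, 0)"]) auto
 next
  case (Spec a)
  thus ?thesis using p' assms by (intro exI[of _ "(unit_z c, 0, 0)"]) auto
 next
  case (Dyn j)
  thus ?thesis using p' by (intro exI[of _ "(unit_z c, 0, 0)"]) auto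
 qed
next
 case p': (Dyn k)
 show ?thesis
 proof (cases p)
  case (Dyn j)
  thus ?thesis using p' assms by (intro exI[of _ "(0, 1, - of_int j)"]) auto
 qed (use p' in \<open>intro exI[of _ "(0, 0, 1)"]; simp\<close>)+
qed

section \<open>Calculus of pole bounds\<close>

locale spectral = modulus +
 fixes w :: complex
begin

abbreviation thf :: "('n::{finite,linorder}) form => 'n pt => complex" where
 "thf p x \<equiv> th (ev w p x)"

definition fprod :: "('n::{finite,linorder}) form multiset => 'n pt => complex" where
 "fprod A x = (\<Prod>p\<in>#A. thf p x)"

lemma fprod_simps [simp]:
 "fprod {#} x = 1" "fprod (add_mset p A) x = thf p x * fprod A x" "fprod (A + B) x = fprod A x * fprod B x"
 by (simp_all add: fprod_def)

lemma fprod_holo [holo_intros]: "holo_on (fprod A) U"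
 unfolding fprod_def by (intro holo_intros)

text \<open>Multiplicity in A bounds the pole order. Theta of a form vanishes on all lattice
  translates of its hyperplane, so one symbol accounts for the whole preimage of a divisor on the
  torus.\<close>

definition poles :: "('n::{finite,linorder}) form multiset => ('n pt => complex) => bool" where
 "poles A f \<longleftrightarrow> ext (%x. fprod A x * f x)"

lemma gen_on_thf:
 assumes "\<And>x c. x \<in> Z ==> x + cscale c v \<in> Z" "ev 0 p v \<noteq> 0"
 shows "gen_on Z (thf p)"
proof (rule gen_on_line)
 show "holo (thf p)" by (intro holo_intros)
 fix x assume x: "x \<in> Z"
 obtain c where "th (ev 0 p v * c + ev w p x) \<noteq> 0"
  using eventually_happens[OF eventually_theta_affine_nonzero[OF assms(2), of "ev w p x" 0]] by auto
 hence "th (ev w p (x + cscale c v)) \<noteq> 0" by (simp add: ev_line)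
 thus "\<exists>u. (\<forall>c. x + cscale c u \<in> Z) \<and> thf p (x + u) \<noteq> 0"
  using assms(1)[OF x] by (intro exI[of _ "cscale c v"]) (auto simp: cscale_cscale)
qed

lemma thf_generic:
 assumes "valid_form p" shows "GEN x. thf p x \<noteq> 0"
proof (rule gen_on_UNIV_generic)
 obtain v where "ev 0 p v \<noteq> 0" using ev_direction[OF assms] by blast
 thus "gen_on UNIV (thf p)" by (intro gen_on_thf) auto
 show "continuous_on UNIV (thf p)" by (intro holo_continuous holo_intros)
qed

lemma fprod_generic:
 assumes "\<And>p. p \<in># A ==> valid_form p" shows "GEN x. fprod A x \<noteq> 0"
 using assms
proof (induction A)
 case (add p A)
 have "GEN x. thf p x \<noteq> 0" "GEN x. fprod A x \<noteq> 0"
  using add by (auto intro: thf_generic)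
 thus ?case by eventually_elim simp
qed simp

lemma gen_on_hyperplane_thf:
 assumes "valid_form p" "valid_form p'" "p \<noteq> p'"
 shows "gen_on {x. ev w p x \<in> \<Lambda>} (thf p')"
proof -
 obtain v where "ev 0 p v = 0" "ev 0 p' v \<noteq> 0" using ev_not_parallel[OF assms] by blast
 thus ?thesis
  by (intro gen_on_thf[of _ v]) (simp_all add: ev_line)
qed

lemma gen_on_fprod:
 assumes "\<And>p. p \<in># A ==> gen_on Z (thf p)"
 shows "gen_on Z (fprod A)"
 using assms
proof (induction A)
 case empty
 have "fprod {#} = (%_. 1)" by (simp add: fun_eq_iff)
 thus ?case by simp
next
 case (add p A)
 have "gen_on Z (%x. thf p x * fprod A x)"
  using add by (intro gen_on_mult holo_continuous holo_intros) auto
 moreover have "fprod (add_mset p A) = (%x. thf p x * fprod A x)" by (simp add: fun_eq_iff)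
 ultimately show ?case by simp
qed

text \<open>From th(p) f = G and q f = H follows q G = th(p) H. Thus G vanishes on the hyperplanes p
  in \<Lambda> wherever q does not, by density on all of them, and can be divided by th(p).\<close>

lemma ext_remove:
 assumes p: "valid_form p" and f: "ext (%x. thf p x * f x)" and q: "ext (%x. q x * f x)" "holo q"
  and gen: "gen_on {x. ev w p x \<in> \<Lambda>} q"
 shows "ext f"
proof -
 obtain G where G: "holo G" "GEN x. thf p x * f x = G x" using f by (auto simp: ext_def)
 obtain H where H: "holo H" "GEN x. q x * f x = H x" using q by (auto simp: ext_def)
 have "GEN x. q x * G x = thf p x * H x"
  using G(2) H(2) by eventually_elim (metis mult.left_commute)
 hence eq: "q x * G x = thf p x * H x" for x
  by (rule generic_eq_imp_eq) (intro holo_continuous holo_intros q(2) G(1) H(1))+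
 have "G x = 0" if "ev w p x \<in> \<Lambda>" for x
  by (rule gen_on_zero[OF gen holo_continuous[OF G(1)]]) (use that eq theta_eq_0_iff in auto)
 moreover obtain v where "ev 0 p v \<noteq> 0" using ev_direction[OF p] by blast
 ultimately obtain K where K: "holo K" "\<And>x. G x = thf p x * K x"
  using holo_theta_divides[OF ev_affine[of w p] _ G(1)] by metis
 have "GEN x. f x = K x"
  using G(2) thf_generic[OF p] by eventually_elim (simp add: K(2))
 thus ?thesis using K(1) by (auto simp: ext_def)
qed

lemma poles_remove:
 assumes v: "\<And>p. p \<in># B ==> valid_form p" and f: "poles (A + B) f"
  and q: "ext (%x. q x * (fprod A x * f x))" "holo q"
  and gen: "\<And>p. p \<in># B ==> gen_on {x. ev w p x \<in> \<Lambda>} q"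
 shows "poles A f"
 using v f gen
proof (induction B)
 case (add p B)
 have "ext (%x. fprod B x * (q x * (fprod A x * f x)))"
  by (rule ext_mult[OF ext_holo q(1)]) (intro holo_intros)
 hence 1: "ext (%x. q x * (fprod (A + B) x * f x))"
  by (rule ext_cong) (simp add: algebra_simps)
 have 2: "ext (%x. thf p x * (fprod (A + B) x * f x))"
  using add.prems(2) by (simp add: poles_def algebra_simps)
 have "poles (A + B) f"
  unfolding poles_def
  by (rule ext_remove[OF _ 2 1 q(2)]) (use add.prems(1,3)[of p] in simp_all)
 thus ?case using add.IH add.prems(1,3) by simp
qed simp

text \<open>\<open>fprod C\<close> clears the poles as well and is nonzero on a dense part of every
  hypersurface of B. In this way bounds obtained from different relations are intersected.\<close>

lemma poles_coprime:
 assumes "poles (A + B) f" "poles (A + C) f"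
  and v: "\<And>p. p \<in># B ==> valid_form p" "\<And>p. p \<in># C ==> valid_form p"
  and d: "\<And>p. p \<in># B ==> p \<notin># C"
 shows "poles A f"
proof (rule poles_remove[OF v(1) assms(1)])
 show "ext (%x. fprod C x * (fprod A x * f x))"
  using assms(2) by (simp add: poles_def algebra_simps)
 show "gen_on {x. ev w p x \<in> \<Lambda>} (fprod C)" if "p \<in># B" for p
  using that v d by (intro gen_on_fprod gen_on_hyperplane_thf) auto
qed (auto intro!: holo_intros)

lemma poles_cong: "poles A f ==> (GEN x. f x = g x) ==> poles A g"
 unfolding poles_def by (erule ext_cong) (auto elim: eventually_mono)

lemma poles_mono:
 assumes "poles A f" "A \<subseteq># B" shows "poles B f"
proof -
 have "ext (%x. fprod (B - A) x * (fprod A x * f x))"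
  by (rule ext_mult[OF ext_holo[OF fprod_holo] assms(1)[unfolded poles_def]])
 moreover have "fprod B x = fprod (B - A) x * fprod A x" for x
  using assms(2) by (metis fprod_simps(3) subset_mset.diff_add)
 ultimately show ?thesis by (simp add: poles_def mult.assoc)
qed

lemma poles_mult: assumes "poles A f" "poles B g" shows "poles (A + B) (%x. f x * g x)"
 using ext_mult[OF assms[unfolded poles_def]] by (simp add: poles_def algebra_simps)

lemma poles_add: assumes "poles A f" "poles A g" shows "poles A (%x. f x + g x)"
 using ext_add[OF assms[unfolded poles_def]] by (simp add: poles_def algebra_simps)

lemma poles_holo: "holo f ==> poles {#} f"
 by (simp add: poles_def ext_holo)

lemma poles_sum: "(\<And>i. i \<in> I ==> poles A (f i)) ==> poles A (%x. \<Sum>i\<in>I. f i x)"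
 unfolding poles_def sum_distrib_left by (rule ext_sum)

lemma poles_mult_holo: "poles A f ==> holo g ==> poles A (%x. g x * f x)"
 using poles_mult[OF poles_holo, of g A f] by simp

lemma poles_prod:
 assumes "\<And>i. i \<in> I ==> poles (A i) (f i)"
 shows "poles (\<Sum>i\<in>I. A i) (%x. \<Prod>i\<in>I. f i x)"
 using assms
 by (induction I rule: infinite_finite_induct) (auto intro: poles_mult poles_holo[OF holo_const])

lemma poles_inverse_thf: "valid_form p ==> poles {#p#} (%x. inverse (thf p x))"
 unfolding poles_def
 by (rule ext_cong[OF ext_holo[OF holo_const[of 1]]]) (use thf_generic[of p] in \<open>auto elim!: eventually_mono\<close>)

lemma poles_compose:
 assumes "poles A f"
  and T: "\<And>f. ext f ==> ext (%x. f (T x))"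
  and g: "\<And>p. p \<in># A ==> (\<forall>x. thf p (T x) = thf (g p) x) \<or> (\<forall>x. thf p (T x) = - thf (g p) x)"
 shows "poles (image_mset g A) (%x. f (T x))"
proof -
 \<comment> \<open>The sign arises because a \<open>Diff\<close> form is ordered by Min and Max,
   which a permutation need not respect.\<close>
 have "\<exists>s. s * s = 1 \<and> (\<forall>x. fprod (image_mset g A) x = s * fprod A (T x))"
  using g
 proof (induction A)
  case (add p A)
  then obtain s where s: "s * s = 1" "\<And>x. fprod (image_mset g A) x = s * fprod A (T x)" by auto
  consider "\<forall>x. thf p (T x) = thf (g p) x" | "\<forall>x. thf p (T x) = - thf (g p) x" using add.prems by auto
  thus ?case
  proof cases
   case 1 thus ?thesis using s by (intro exI[of _ s]) auto
  next
   case 2 thus ?thesis using s by (intro exI[of _ "- s"]) auto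
  qed
 qed (auto intro!: exI[of _ 1])
 then obtain s where "\<And>x. fprod (image_mset g A) x = s * fprod A (T x)" by blast
 moreover have "ext (%x. s * (fprod A (T x) * f (T x)))"
  by (rule ext_mult[OF ext_holo[OF holo_const] T[OF assms(1)[unfolded poles_def]]])
 ultimately show ?thesis by (simp add: poles_def mult.assoc)
qed

fun shift_form :: "int => 'n form => 'n form" where
 "shift_form \<nu> (Dyn j) = Dyn (j + \<nu>)"
| "shift_form \<nu> p = p"

lemma ev_shift: "ev w p (shift \<nu> x) = ev w (shift_form \<nu> p) x"
 by (cases p) (auto simp: shift_def case_prod_beta algebra_simps)

lemma poles_shift: "poles A f ==> poles (image_mset (shift_form \<nu>) A) (%x. f (shift \<nu> x))"
 by (rule poles_compose) (auto intro: ext_shift simp: ev_shift)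

fun perm_form :: "('n => 'n) => 'n form => 'n form" where
 "perm_form \<pi> (Diff S) = Diff (\<pi> ` S)"
| "perm_form \<pi> (DiffY a b) = DiffY (\<pi> a) (\<pi> b)"
| "perm_form \<pi> (Spec a) = Spec (\<pi> a)"
| "perm_form \<pi> (Dyn j) = Dyn j"

lemma fst_perm_nth: "bij \<pi> ==> fst (perm \<pi> x)$\<pi> a = x$$a"
 by (cases x) (simp add: perm_def bij_is_inj)

lemma snd_perm [simp]: "snd (perm \<pi> x) = snd x"
 by (cases x) (simp add: perm_def)

lemma thf_perm:
 assumes "bij \<pi>" "valid_form p"
 shows "(\<forall>x. thf (perm_form \<pi> p) (perm \<pi> x) = thf p x) \<or> (\<forall>x. thf (perm_form \<pi> p) (perm \<pi> x) = - thf p x)"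
proof (cases p)
 case (Diff S)
 then obtain a b where ab: "a < b" "S = {a, b}" "Min S = a" "Max S = b" using assms(2) by (auto elim: card_2E_less)
 have m: "th (u - v) = - th (v - u)" for u v using theta_minus[of "v - u"] by simp
 have "\<pi> a \<noteq> \<pi> b" using ab(1) assms(1) by (metis bij_pointE less_irrefl)
 then consider "\<pi> a < \<pi> b" | "\<pi> b < \<pi> a" by (meson linorder_neqE)
 thus ?thesis
 proof cases
  case 1
  hence "Min {\<pi> a, \<pi> b} = \<pi> a" "Max {\<pi> a, \<pi> b} = \<pi> b" by (auto simp: min_def max_def)
  thus ?thesis using Diff ab fst_perm_nth[OF assms(1)] by simp
 next
  case 2
  hence "Min {\<pi> a, \<pi> b} = \<pi> b" "Max {\<pi> a, \<pi> b} = \<pi> a" by (auto simp: min_def max_def)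
  hence "\<forall>x. thf (perm_form \<pi> p) (perm \<pi> x) = - thf p x"
   using Diff ab fst_perm_nth[OF assms(1)] by (auto intro: m)
  thus ?thesis ..
 qed
qed (use fst_perm_nth[OF assms(1)] in auto)

lemma poles_perm:
 assumes "poles A f" "bij \<pi>" "\<And>p. p \<in># A ==> valid_form p"
 shows "poles (image_mset (perm_form \<pi>) A) (%x. f (perm (inv \<pi>) x))"
proof (rule poles_compose[OF assms(1)])
 show "ext (%x. f (perm (inv \<pi>) x))" if "ext f" for f :: "'a pt => complex"
  using that assms(2) by (intro ext_perm bij_imp_bij_inv)
 fix p assume "p \<in># A"
 then consider "\<forall>x. thf (perm_form \<pi> p) (perm \<pi> x) = thf p x" | "\<forall>x. thf (perm_form \<pi> p) (perm \<pi> x) = - thf p x"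
  using thf_perm assms(2,3) by blast
 thus "(\<forall>x. thf p (perm (inv \<pi>) x) = thf (perm_form \<pi> p) x) \<or> (\<forall>x. thf p (perm (inv \<pi>) x) = - thf (perm_form \<pi> p) x)"
  by cases (metis assms(2) minus_minus perm_inv(1))+
qed

end

section \<open>Three-term identities for the R-matrix and for two sites\<close>

context modulus
begin

text \<open>The three-term identity without half periods in the arguments.\<close>

lemma theta_three:
 "th (p + k) * th p * th (m + n - k) * th (m - n) + th (p + m) * th (p + k - m) * th n * th (n - k)
  + th (p + n) * th (p + k - n) * th m * th (k - m) = 0"
 using theta_fay[of "p + k / 2" "k / 2" "m - k / 2" "n - k / 2"]
 by (simp add: algebra_simps)

text \<open>The identities that follow are instances of \<open>theta_three\<close>, with p and p + k
  the arguments of two factors of the first product. They are the numerators of the entries of the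
  Yang-Baxter equation once denominators are cleared.\<close>

lemma ybe_1:
 "th (b-a+L) * th (a) * th (b-y) * th (L-y) + th (b-a) * th (b+L-y) * th (a-L) * th (y) - th (b) * th (b-a+L-y) * th (a-y) * th (L) = 0"
 using theta_three[of "L-a+b" "-L+2 * a-b" "a-y" "-L+a"] theta_minus[of "L-a+b-y"]
 by (simp add: algebra_simps)

lemma ybe_2:
 "th (b-a+L) * th (y) * th (a+L) * th (b-y) - th (b-a) * th (L+y) * th (b+L-y) * th (a) + th (b+L) * th (b-a-y) * th (a-y) * th (L) = 0"
 using theta_three[of "L-a+b" "2 * a-b" "a" "a-y"] theta_minus[of "-a+b"]
 by (simp add: algebra_simps)

lemma ybe_3:
 "th (b-a-L) * th (b) * th (a-y) * th (L-y) - th (a) * th (L) * th (b-a-L+y) * th (b-y) + th (a+L-y) * th (y) * th (b-L) * th (b-a) = 0"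
 using theta_three[of "-L-a+b" "L+a" "L+a-y" "a"] theta_minus[of "L"]
 by (simp add: algebra_simps)

lemma ybe_4:
 "th (b-a) * th (a+L) * th (L-y) * th (b-y) + th (b-a-L) * th (y) * th (b+L-y) * th (a) - th (a+L-y) * th (b) * th (b-a-y) * th (L) = 0"
 using theta_three[of "-a+b" "L+2 * a-b" "L+a-y" "a"] theta_minus[of "-a+b-y"]
 by (simp add: algebra_simps)

lemma ybe_5:
 "th (b) * th (a-L) * th (b-a-y) * th (L-y) + th (a) * th (b-L) * th (b-a+L-y) * th (y) - th (a-L+y) * th (b-a) * th (b-y) * th (L) = 0"
 using theta_three[of "-L+a" "L-a+b" "L-a+b-y" "-a+b"] theta_minus[of "L"]
 by (simp add: algebra_simps)

lemma ybe_6: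
 "th (b-L+y) * th (a-y) * th (b-a-y) * th (L-y) - th (a) * th (L-2 * y) * th (b-L) * th (b-a) - th (a-L+y) * th (b-a-L+y) * th (y) * th (b-y) = 0"
 using theta_three[of "a-y" "-L-a+b+2 * y" "-L-a+b+y" "-a+b"] theta_minus[of "L-y"]
 by (simp add: algebra_simps)

text \<open>An identity without spectral parameter. \<open>ybe_coeff_4\<close> is the only entry
  with four terms; it takes this one together with \<open>ybe_8\<close>.\<close>

lemma ybe_7:
 "th (L-y) * th (L-y) * th (L-y) * th (L+y) - th (L) * th (L) * th (L) * th (L-2 * y) - th (y) * th (y) * th (y) * th (2 * L-y) = 0"
 using theta_three[of "L-y" "2 * y" "y" "L"] theta_minus[of "L-y"]
 by (simp add: algebra_simps)

lemma ybe_8: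
 "th (b-a-L) * th (b+L-y) * th (a-L) * th (L-y) + th (a+L-y) * th (b-L) * th (b-a+L-y) * th (L) - th (b-y) * th (a) * th (b-a) * th (2 * L-y) = 0"
 using theta_three[of "-L-a+b" "2 * L+a-y" "L+a-y" "a"] theta_minus[of "2 * L-y"]
 by (simp add: algebra_simps)

text \<open>The first two exchange identities are the two-site case with one occupied site, the
  third the case with both occupied; u, v (or b, d) are differences between a variable of the weight
  function and a coordinate.\<close>

lemma exchange_1:
 "th (L+v+y) * th (u) * th (L) * th (v-u-y) + th (L+v-u) * th (y) * th (L+u+y) * th (v) - th (v-u) * th (u+y) * th (L+v) * th (L+y) = 0"
 using theta_three[of "u" "L-u+v+y" "L-u+v" "-u+v"] theta_minus[of "L+y"]
 by (simp add: algebra_simps)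

lemma exchange_2:
 "th (v+y) * th (L+u) * th (L) * th (v-u-y) - th (v-u) * th (L-y) * th (L+u+y) * th (v) - th (v-u-L) * th (y) * th (u+y) * th (L+v) = 0"
 using theta_three[of "L+u" "-L-u+v+y" "-L-u+v" "-u+v"] theta_minus[of "L"]
 by (simp add: algebra_simps)

lemma exchange_3:
 "th (L+b-e-y) * th (b) * th (d-e+y) * th (L+d) - th (L+b-y) * th (b-e) * th (d+y) * th (L+d-e) + th (b-d-y) * th (e) * th (L+b+d-e) * th (L-y) = 0"
 using theta_three[of "L+b-e-y" "-L+e+y" "d+y" "e"] theta_minus[of "L+d-e"]
 by (simp add: algebra_simps)

lemma alpha_minus: "al z y (- l) = th z * th (l - y) / (th (z - y) * th l)"
 using theta_minus[of "l - y"] theta_minus[of l] by (simp add: alpha_def)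

lemma beta_minus: "be z y (- l) = th (z - l) * th y / (th (z - y) * th l)"
 using theta_minus[of l] by (simp add: beta_def)

lemma alpha_shift: "al z y (l - y) = th z * th l / (th (z - y) * th (l - y))"
 by (simp add: alpha_def)

lemma alpha_minus_shift: "al z y (y - l) = th z * th (l - 2 * y) / (th (z - y) * th (l - y))"
 using alpha_minus[of z y "l - y"] by (simp add: algebra_simps)

lemma beta_shift: "be z y (l - y) = - (th (z + l - y) * th y / (th (z - y) * th (l - y)))"
 by (simp add: beta_def algebra_simps)

lemma beta_minus_shift: "be z y (y - l) = th (z - l + y) * th y / (th (z - y) * th (l - y))"
 using beta_minus[of z y "l - y"] by (simp add: algebra_simps)

context
 fixes a b y L :: complex
 assumes nz: "th (a - y) \<noteq> 0" "th (b - y) \<noteq> 0" "th (b - a - y) \<noteq> 0" "th L \<noteq> 0" "th (L - y) \<noteq> 0"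
begin

text \<open>With a = w - z_p, b = w - z_q and L the dynamical parameter at q, the nine identities
  are the 3 x 3 entries of the dynamical Yang-Baxter equation on the vectors with two factors v_1
  and one factor v_2. The other three-dimensional weight space follows by L -> - L.\<close>

lemma ybe_coeff_1:
 "be (b - a) y L * al a y L + al (b - a) y L * be b y (L - y) * be a y (- L)
  = al b y L * be (b - a) y (L - y)"
 unfolding alpha_shift beta_shift alpha_minus beta_minus alpha_minus_shift beta_minus_shift
 unfolding alpha_def beta_def
 using nz ybe_1[of b a L y] by (simp add: divide_simps) algebra

lemma ybe_coeff_2:
 "al (b - a) y L * al b y (L - y) = al b y L * al (b - a) y (L - y)"
 unfolding alpha_shift unfolding alpha_def
 using nz by (simp add: divide_simps) 

lemma ybe_coeff_3:
 "be (b - a) y L * be a y L + al (b - a) y L * be b y (L - y) * al a y (- L)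
  = be b y L"
 unfolding alpha_shift beta_shift alpha_minus beta_minus alpha_minus_shift beta_minus_shift
 unfolding alpha_def beta_def
 using nz ybe_2[of b a L y] by (simp add: divide_simps) algebra

lemma ybe_coeff_4:
 "al (b - a) y (- L) * al a y L + be (b - a) y (- L) * be b y (L - y) * be a y (- L)
  = al a y (L - y) * al (b - a) y (y - L)
   + be a y (L - y) * be b y (- L) * be (b - a) y (L - y)"
 unfolding alpha_shift beta_shift alpha_minus beta_minus alpha_minus_shift beta_minus_shift
 unfolding alpha_def beta_def
 using nz ybe_7[of L y] ybe_8[of b a L y] by (simp add: divide_simps) algebra

lemma ybe_coeff_5:
 "be (b - a) y (- L) * al b y (L - y) = al a y (L - y) * be (b - a) y (y - L)
   + be a y (L - y) * be b y (- L) * al (b - a) y (L - y)"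
 unfolding alpha_shift beta_shift alpha_minus beta_minus alpha_minus_shift beta_minus_shift
 unfolding alpha_def beta_def
 using nz ybe_3[of b a L y] by (simp add: divide_simps) algebra

lemma ybe_coeff_6:
 "al (b - a) y (- L) * be a y L + be (b - a) y (- L) * be b y (L - y) * al a y (- L)
  = be a y (L - y) * al b y (- L)"
 unfolding alpha_shift beta_shift alpha_minus beta_minus alpha_minus_shift beta_minus_shift
 unfolding alpha_def beta_def
 using nz ybe_4[of b a L y] by (simp add: divide_simps) algebra

lemma ybe_coeff_7:
 "al b y (y - L) * be a y (- L) = al a y (y - L) * be b y (- L) * be (b - a) y (L - y)
   + be a y (y - L) * al (b - a) y (y - L)"
 unfolding alpha_shift beta_shift alpha_minus beta_minus alpha_minus_shift beta_minus_shift
 unfolding alpha_def beta_def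
 using nz ybe_5[of b a L y] by (simp add: divide_simps) algebra

lemma ybe_coeff_8:
 "be b y (y - L) = al a y (y - L) * be b y (- L) * al (b - a) y (L - y)
   + be a y (y - L) * be (b - a) y (y - L)"
 unfolding alpha_shift beta_shift alpha_minus beta_minus alpha_minus_shift beta_minus_shift
 unfolding alpha_def beta_def
 using nz ybe_6[of b L y a] by (simp add: divide_simps) algebra

lemma ybe_coeff_9:
 "al b y (y - L) * al a y (- L) = al a y (y - L) * al b y (- L)"
 unfolding alpha_minus alpha_minus_shift
 using nz by (simp add: divide_simps)

end

end

section \<open>Stable envelopes as sums over bijections\<close>

lemma elt_bij: "bij_betw (elt I) {..<card I} (I :: 'n::{finite,linorder} set)"
 unfolding elt_def by (rule bij_betw_nth) auto

lemma elt_mono: "i < j ==> j < card I ==> elt I i < elt (I :: 'n::{finite,linorder} set) j"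
 unfolding elt_def using sorted_wrt_nth_less[OF strict_sorted_list_of_set[of I]] by simp

lemma elt_less_iff: "i < card I ==> j < card I ==> elt I i < elt (I :: 'n::{finite,linorder} set) j \<longleftrightarrow> i < j"
 by (metis elt_mono less_asym' linorder_neqE_nat order_less_irrefl)

text \<open>Extensionality makes each bijection of I onto K occur exactly once in a sum.\<close>

definition Bij :: "'a set => 'a set => ('a => 'a) set" where
 "Bij I K = {f. bij_betw f I K \<and> f \<in> extensional I}"

abbreviation pairs :: "'a::linorder set => ('a \<times> 'a) set" where
 "pairs I \<equiv> {(i, j). i \<in> I \<and> j \<in> I \<and> i < j}"

definition wterm :: "complex => ('n::{finite,linorder}) set => ('n => complex) => 'n pt => complex" where
 "wterm \<tau> I t = (%(z, y, l).
   (\<Prod>i\<in>I. (\<Prod>a | a < i. theta \<tau> (t i - z$a + y)) * theta \<tau> (l + t i - z$i - of_int (wcount i I) * y)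
    * (\<Prod>a | a > i. theta \<tau> (t i - z$a)))
   / (\<Prod>(i, j)\<in>pairs I. theta \<tau> (t i - t j) * theta \<tau> (t j - t i + y)))"

text \<open>A permutation of the variables corresponds to the bijection that sends the r-th element
  of I to the element of K whose variable is put there. Sums over bijections involve no numbering of
  positions, so permuting sites becomes a mere reindexing.\<close>

lemma stab_eq:
 fixes I K :: "('n::{finite,linorder}) set"
 assumes "card I = card K"
 shows "stab \<tau> I K (z, y, l) = 1 / psi \<tau> I y l * (\<Sum>f\<in>Bij I K. wterm \<tau> I (%i. z$f i) (z, y, l))"
proof -
 define k where "k = card I"
 define N where "N t i = (\<Prod>a | a < i. theta \<tau> (t - z$a + y)) * theta \<tau> (l + t - z$i - of_int (wcount i I) * y)
    * (\<Prod>a | a > i. theta \<tau> (t - z$a))" for t i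
 define d where "d s t = theta \<tau> (s - t) * theta \<tau> (t - s + y)" for s t
 \<comment> \<open>\<open>F\<close> and \<open>G\<close> are mutually inverse only with matching
   defaults: \<open>undefined\<close> off I for extensional maps, the identity off {..<k} for
   permutations.\<close>
 define F where "F \<sigma> = (%i. if i \<in> I then elt K (\<sigma> (inv_into {..<k} (elt I) i)) else undefined)" for \<sigma>
 define G where "G f = (%r. if r < k then inv_into {..<k} (elt K) (f (elt I r)) else r)" for f
 have eI: "bij_betw (elt I) {..<k} I" and eK: "bij_betw (elt K) {..<k} K"
  using elt_bij[of I] elt_bij[of K] assms by (simp_all add: k_def)
 have invI: "inv_into {..<k} (elt I) (elt I r) = r" if "r < k" for r
  using eI that by (simp add: bij_betw_inv_into_left)
 have invK: "inv_into {..<k} (elt K) (elt K r) = r" if "r < k" for r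
  using eK that by (simp add: bij_betw_inv_into_left)
 have Ieq: "I = elt I ` {..<k}" using eI by (simp add: bij_betw_def)
 have injI: "inj_on (elt I) {..<k}" using eI by (simp add: bij_betw_def)
 have tm: "(\<Prod>r<k. N (z$elt K (\<sigma> r)) (elt I r)) / (\<Prod>(i, j)\<in>{(i, j). i < j \<and> j < k}. d (z$elt K (\<sigma> i)) (z$elt K (\<sigma> j)))
  = wterm \<tau> I (%i. z$F \<sigma> i) (z, y, l)" for \<sigma>
 proof -
  have FI: "F \<sigma> (elt I r) = elt K (\<sigma> r)" if "r < k" for r
   using that Ieq invI by (auto simp: F_def)
  have "(\<Prod>i\<in>I. N (z$F \<sigma> i) i) = (\<Prod>r<k. N (z$F \<sigma> (elt I r)) (elt I r))"
   by (rule prod.reindex_bij_betw[OF eI, symmetric])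
  hence 1: "(\<Prod>i\<in>I. N (z$F \<sigma> i) i) = (\<Prod>r<k. N (z$elt K (\<sigma> r)) (elt I r))"
   using FI by simp
  have "bij_betw (%(i, j). (elt I i, elt I j)) {(i, j). i < j \<and> j < k} (pairs I)"
  proof (rule bij_betw_imageI)
   show "inj_on (%(i, j). (elt I i, elt I j)) {(i, j). i < j \<and> j < k}"
    using injI by (auto simp: inj_on_def)
   show "(%(i, j). (elt I i, elt I j)) ` {(i, j). i < j \<and> j < k} = pairs I"
   proof (intro equalityI subsetI)
    fix p assume "p \<in> (%(i, j). (elt I i, elt I j)) ` {(i, j). i < j \<and> j < k}"
    then obtain i j where "p = (elt I i, elt I j)" "i < j" "j < k" by auto
    moreover have "elt I i \<in> I" "elt I j \<in> I"
     using \<open>i < j\<close> \<open>j < k\<close> Ieq by auto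
    ultimately show "p \<in> pairs I"
     using elt_mono[of i j I] by (simp add: k_def)
   next
    fix p assume "p \<in> pairs I"
    then obtain a b where p: "p = (a, b)" "a \<in> I" "b \<in> I" "a < b" by auto
    obtain i where i: "a = elt I i" "i < k" using p(2) Ieq by auto
    obtain j where j: "b = elt I j" "j < k" using p(3) Ieq by auto
    have "i < j" using p(4) i j elt_less_iff[of i I j] by (simp add: k_def)
    thus "p \<in> (%(i, j). (elt I i, elt I j)) ` {(i, j). i < j \<and> j < k}"
     using p(1) i j by (intro image_eqI[of _ _ "(i, j)"]) auto
   qed
  qed
  from prod.reindex_bij_betw[OF this, of "%(i, j). d (z$F \<sigma> i) (z$F \<sigma> j)"]
  have 2: "(\<Prod>(i, j)\<in>pairs I. d (z$F \<sigma> i) (z$F \<sigma> j))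
   = (\<Prod>(i, j)\<in>{(i, j). i < j \<and> j < k}. d (z$elt K (\<sigma> i)) (z$elt K (\<sigma> j)))"
   using FI by (auto simp: case_prod_beta intro!: prod.cong)
  show ?thesis
   unfolding wterm_def case_prod_conv N_def[symmetric] d_def[symmetric] 1 2 ..
 qed
 have "(\<Sum>\<sigma> | \<sigma> permutes {..<k}. (\<Prod>r<k. N (z$elt K (\<sigma> r)) (elt I r)) / (\<Prod>(i, j)\<in>{(i, j). i < j \<and> j < k}. d (z$elt K (\<sigma> i)) (z$elt K (\<sigma> j))))
  = (\<Sum>f\<in>Bij I K. wterm \<tau> I (%i. z$f i) (z, y, l))"
 proof (rule sum.reindex_bij_witness[of _ G F])
  fix \<sigma> assume \<sigma>: "\<sigma> \<in> {\<sigma>. \<sigma> permutes {..<k}}"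
  hence \<sigma>k: "\<sigma> r < k \<longleftrightarrow> r < k" for r using permutes_in_image[of \<sigma> "{..<k}" r] by simp
  have FI: "F \<sigma> (elt I r) = elt K (\<sigma> r)" if "r < k" for r
   using that Ieq invI by (auto simp: F_def)
  show "G (F \<sigma>) = \<sigma>"
  proof
   fix r show "G (F \<sigma>) r = \<sigma> r"
   proof (cases "r < k")
    case True thus ?thesis using FI invK \<sigma>k by (simp add: G_def)
   next
    case False thus ?thesis using \<sigma> permutes_not_in[of \<sigma> "{..<k}" r] by (simp add: G_def)
   qed
  qed
  have "bij_betw (%i. elt K (\<sigma> (inv_into {..<k} (elt I) i))) I K"
   using bij_betw_trans[OF bij_betw_trans[OF bij_betw_inv_into[OF eI] permutes_imp_bij] eK] \<sigma>
   by (simp add: o_def)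
  hence "bij_betw (F \<sigma>) I K"
   by (rule bij_betw_cong[THEN iffD1, rotated]) (simp add: F_def)
  thus "F \<sigma> \<in> Bij I K" by (simp add: Bij_def F_def extensional_def)
  show "wterm \<tau> I (%i. z$F \<sigma> i) (z, y, l) = (\<Prod>r<k. N (z$elt K (\<sigma> r)) (elt I r)) / (\<Prod>(i, j)\<in>{(i, j). i < j \<and> j < k}. d (z$elt K (\<sigma> i)) (z$elt K (\<sigma> j)))"
   by (rule tm[symmetric])
 next
  fix f assume f: "f \<in> Bij I K"
  hence fb: "bij_betw f I K" and fe: "f \<in> extensional I" by (auto simp: Bij_def)
  have "bij_betw (%r. inv_into {..<k} (elt K) (f (elt I r))) {..<k} {..<k}"
   using bij_betw_trans[OF bij_betw_trans[OF eI fb] bij_betw_inv_into[OF eK]] by (simp add: o_def)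
  hence "bij_betw (G f) {..<k} {..<k}"
   by (rule bij_betw_cong[THEN iffD1, rotated]) (simp add: G_def)
  thus "G f \<in> {\<sigma>. \<sigma> permutes {..<k}}"
   by (intro CollectI bij_imp_permutes) (auto simp: G_def)
  show "F (G f) = f"
  proof
   fix i show "F (G f) i = f i"
   proof (cases "i \<in> I")
    case True
    then obtain r where r: "r < k" "i = elt I r" using Ieq by auto
    have "f i \<in> K" using fb True by (auto simp: bij_betw_def)
    hence "elt K (inv_into {..<k} (elt K) (f i)) = f i"
     using eK by (simp add: bij_betw_inv_into_right)
    thus ?thesis using True r invI by (simp add: F_def G_def)
   next
    case False thus ?thesis using fe by (simp add: F_def extensional_def)
   qed
  qed
 qed
 thus ?thesis
  unfolding stab_def weight_fun_def case_prod_conv fst_conv N_def d_def k_def by simp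
qed

section \<open>The dominance order and triangularity\<close>

definition rk :: "'n::{finite,linorder} => nat" where
 "rk a = card {b. b < a}"

lemma rk_less_iff [simp]:
 fixes a b :: "'n::{finite,linorder}"
 shows "rk a < rk b \<longleftrightarrow> a < b"
proof -
 have mono: "rk a < rk b" if "a < b" for a b :: 'n
  unfolding rk_def using that by (intro psubset_card_mono) auto
 show ?thesis using mono[of a b] mono[of b a] by (cases a b rule: linorder_cases) auto
qed

lemma rk_le_iff [simp]: "rk a \<le> rk b \<longleftrightarrow> a \<le> b"
 by (metis linorder_not_less rk_less_iff)

lemma rk_inj: "inj rk"
 by (rule injI) (metis linorder_neqE rk_less_iff order_less_irrefl)

lemma rk_lt_card: "rk (a :: 'n::{finite,linorder}) < CARD('n)"
 unfolding rk_def by (intro psubset_card_mono) auto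

lemma rk_bij: "bij_betw rk (UNIV :: 'n::{finite,linorder} set) {..<CARD('n)}"
proof -
 have "rk ` (UNIV :: 'n set) = {..<CARD('n)}"
  by (rule card_subset_eq) (auto simp: rk_lt_card card_image[OF rk_inj])
 thus ?thesis using rk_inj by (simp add: bij_betw_def)
qed

text \<open>The Bruhat order on subsets of a fixed size: equivalently, the r-th element of K is at
  most the r-th element of I. The matrix of stable envelopes is triangular for it.\<close>

definition dominated :: "'n::{finite,linorder} set => 'n set => bool" where
 "dominated K I \<longleftrightarrow> (\<exists>f. bij_betw f I K \<and> (\<forall>i\<in>I. f i \<le> i))"

lemma decreasing_bij_id:
 fixes f :: "'n::{finite,linorder} => 'n"
 assumes "bij_betw f I I" "\<forall>i\<in>I. f i \<le> i" "i \<in> I"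
 shows "f i = i"
proof (rule ccontr)
 assume "f i \<noteq> i"
 hence "rk (f i) < rk i" using assms(2,3) by (simp add: order_neq_le_trans)
 hence "(\<Sum>i\<in>I. rk (f i)) < (\<Sum>i\<in>I. rk i)"
  using assms(2,3) by (intro sum_strict_mono_ex1) auto
 moreover have "(\<Sum>i\<in>I. rk (f i)) = (\<Sum>i\<in>I. rk i)"
  by (rule sum.reindex_bij_betw[OF assms(1)])
 ultimately show False by simp
qed

text \<open>The sum of ranks is a strictly monotone measure for the order; the induction in
  \<open>stab_unique\<close> runs on it.\<close>

lemma dominated_rank:
 assumes "dominated K I" "K \<noteq> I"
 shows "(\<Sum>i\<in>K. rk i) < (\<Sum>i\<in>I. rk i)"
proof -
 obtain f where f: "bij_betw f I K" "\<forall>i\<in>I. f i \<le> i" using assms(1) by (auto simp: dominated_def)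
 have "\<exists>i\<in>I. f i \<noteq> i"
 proof (rule ccontr)
  assume "\<not> ?thesis"
  hence "f ` I = I" by simp
  thus False using f(1) assms(2) by (simp add: bij_betw_def)
 qed
 hence "\<exists>i\<in>I. rk (f i) < rk i" using f(2) order_neq_le_trans by (simp only: rk_less_iff) blast
 hence "(\<Sum>i\<in>I. rk (f i)) < (\<Sum>i\<in>I. rk i)"
  using f(2) by (intro sum_strict_mono_ex1) auto
 thus ?thesis using sum.reindex_bij_betw[OF f(1), of rk] by simp
qed

lemma dominated_card: "dominated K I ==> card K = card I"
 unfolding dominated_def using bij_betw_same_card by metis

text \<open>A decreasing bijection maps the elements of I up to a injectively to elements of K up to
  a.\<close>

lemma dominated_count:
 assumes "dominated K I"
 shows "card {i\<in>I. i \<le> a} \<le> card {i\<in>K. i \<le> a}"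
proof -
 obtain f where f: "bij_betw f I K" "\<forall>i\<in>I. f i \<le> i" using assms(1) by (auto simp: dominated_def)
 have "f ` {i\<in>I. i \<le> a} \<subseteq> {i\<in>K. i \<le> a}"
  using f by (auto simp: bij_betw_def)
 moreover have "inj_on f {i\<in>I. i \<le> a}"
  using f(1) by (auto simp: bij_betw_def intro: inj_on_subset)
 ultimately show ?thesis
  using card_mono[of "{i\<in>K. i \<le> a}" "f ` {i\<in>I. i \<le> a}"] by (simp add: card_image)
qed

context modulus
begin

text \<open>The product over a > i contains the factor a = f i, which is th 0.\<close>

lemma wterm_eq_0:
 assumes "i \<in> I" "i < f i"
 shows "wterm \<tau> I (%i. z$f i) (z, y, l) = 0"
proof -
 have "(\<Prod>a | a > i. th (z$f i - z$a)) = 0"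
  using assms(2) by (intro prod_zero) auto
 thus ?thesis
  unfolding wterm_def case_prod_conv using assms(1) by (auto intro!: prod_zero)
qed

lemma stab_eq_decreasing:
 fixes I K :: "('n::{finite,linorder}) set"
 assumes "card I = card K"
 shows "stb I K (z, y, l) = 1 / psi \<tau> I y l * (\<Sum>f\<in>{f\<in>Bij I K. \<forall>i\<in>I. f i \<le> i}. wterm \<tau> I (%i. z$f i) (z, y, l))"
proof -
 have "(\<Sum>f\<in>Bij I K. wterm \<tau> I (%i. z$f i) (z, y, l)) = (\<Sum>f\<in>{f\<in>Bij I K. \<forall>i\<in>I. f i \<le> i}. wterm \<tau> I (%i. z$f i) (z, y, l))"
  by (rule sum.mono_neutral_right) (auto simp: not_le intro: wterm_eq_0)
 thus ?thesis by (simp add: stab_eq[OF assms])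
qed

lemma stab_eq_0:
 assumes "card I = card K" "\<not> dominated K I"
 shows "stb I K x = 0"
proof -
 obtain z y l where x: "x = (z, y, l)" by (cases x)
 have "{f\<in>Bij I K. \<forall>i\<in>I. f i \<le> i} = {}" using assms(2) by (auto simp: dominated_def Bij_def)
 thus ?thesis unfolding x stab_eq_decreasing[OF assms(1)] by (simp only: sum.empty mult_zero_right)
qed

text \<open>The matrix of stable envelopes is triangular, so a row vector is determined by its products with the columns.\<close>

lemma stab_unique:
 fixes A :: "('n::{finite,linorder}) set => complex"
 assumes nz: "\<And>I. card I = k ==> stb I I x \<noteq> 0"
  and eq: "\<And>I. card I = k ==> (\<Sum>K | card K = k. A K * stb I K x) = 0"
  and K: "card K = k"
 shows "A K = 0"
 using K
proof (induction "\<Sum>i\<in>K. rk i" arbitrary: K rule: less_induct)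
 case less
 have "(\<Sum>K' | card K' = k. A K' * stb K K' x) = A K * stb K K x"
 proof (rule sum.remove[THEN trans])
  show "A K * stb K K x + (\<Sum>K'\<in>{K'. card K' = k} - {K}. A K' * stb K K' x) = A K * stb K K x"
  proof -
   have "A K' * stb K K' x = 0" if "K' \<in> {K'. card K' = k} - {K}" for K'
   proof (cases "dominated K' K")
    case True
    thus ?thesis using less.hyps[OF dominated_rank[OF True]] that by auto
   next
    case False
    thus ?thesis using stab_eq_0[of K K' x] that less.prems by simp
   qed
   hence "(\<Sum>K'\<in>{K'. card K' = k} - {K}. A K' * stb K K' x) = 0"
    by (intro sum.neutral) blast
   thus ?thesis by simp
  qed
 qed (use less.prems in auto)
 thus ?case using eq[OF less.prems] nz[OF less.prems] by simp
qed

lemma psi_generic_form: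
 "psi \<tau> I y l = (\<Prod>i\<in>I. th (l - of_int (wcount i I + 1) * y)) * (\<Prod>i\<in>I. th (l - of_int (wcount i I) * y))"
 by (simp add: psi_def prod.distrib)

text \<open>The identity is the only decreasing bijection of I to itself. The denominator over pairs
  of I then cancels all numerator factors with a in I, and half of psi cancels the factors in
  lambda.\<close>

lemma stab_diag:
 fixes I :: "('n::{finite,linorder}) set"
 assumes nz: "\<And>i j. i \<in> I ==> j \<in> I ==> i < j ==> th (z$i - z$j) \<noteq> 0 \<and> th (z$j - z$i + y) \<noteq> 0"
 shows "stb I I (z, y, l) =
  1 / psi \<tau> I y l * (\<Prod>i\<in>I. th (l - of_int (wcount i I) * y)) *
  (\<Prod>i\<in>I. (\<Prod>a | a < i \<and> a \<notin> I. th (z$i - z$a + y)) * (\<Prod>a | a > i \<and> a \<notin> I. th (z$i - z$a)))"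
proof -
 have "{f\<in>Bij I I. \<forall>i\<in>I. f i \<le> i} = {restrict id I}"
 proof (intro equalityI subsetI)
  fix f assume f: "f \<in> {f\<in>Bij I I. \<forall>i\<in>I. f i \<le> i}"
  hence "f i = i" if "i \<in> I" for i
   using decreasing_bij_id[OF _ _ that] by (auto simp: Bij_def)
  hence "f = restrict id I"
   using f by (intro extensionalityI[of _ I]) (auto simp: Bij_def)
  thus "f \<in> {restrict id I}" by simp
 next
  fix f assume "f \<in> {restrict id I}"
  thus "f \<in> {f\<in>Bij I I. \<forall>i\<in>I. f i \<le> i}"
   by (auto simp: Bij_def bij_betw_def inj_on_def)
 qed
 hence "stb I I (z, y, l) = 1 / psi \<tau> I y l * wterm \<tau> I (%i. z$restrict id I i) (z, y, l)"
  using stab_eq_decreasing[of I I z y l] by simp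
 also have "wterm \<tau> I (%i. z$restrict id I i) (z, y, l) =
  (\<Prod>i\<in>I. (\<Prod>a | a < i. th (z$i - z$a + y)) * th (l - of_int (wcount i I) * y) * (\<Prod>a | a > i. th (z$i - z$a)))
   / (\<Prod>(i, j)\<in>pairs I. th (z$i - z$j) * th (z$j - z$i + y))"
  unfolding wterm_def case_prod_conv by (intro arg_cong2[where f = "(/)"] prod.cong) auto
 also have "(\<Prod>(i, j)\<in>pairs I. th (z$i - z$j) * th (z$j - z$i + y))
  = (\<Prod>i\<in>I. (\<Prod>a | a < i \<and> a \<in> I. th (z$i - z$a + y)) * (\<Prod>a | a > i \<and> a \<in> I. th (z$i - z$a)))"
 proof -
  have 1: "(\<Prod>(i, j)\<in>pairs I. th (z$i - z$j)) = (\<Prod>i\<in>I. \<Prod>a | a > i \<and> a \<in> I. th (z$i - z$a))"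
   by (subst prod.Sigma) (auto intro!: prod.cong)
  have "(\<Prod>(i, j)\<in>pairs I. th (z$j - z$i + y)) = (\<Prod>(j, i)\<in>{(j, i). i \<in> I \<and> j \<in> I \<and> i < j}. th (z$j - z$i + y))"
   by (rule prod.reindex_bij_witness[of _ "%(i, j). (j, i)" "%(i, j). (j, i)"]) auto
  also have "\<dots> = (\<Prod>i\<in>I. \<Prod>a | a < i \<and> a \<in> I. th (z$i - z$a + y))"
   by (subst prod.Sigma) (auto intro!: prod.cong)
  finally show ?thesis using 1 by (simp add: case_prod_beta prod.distrib mult.commute)
 qed
 also have "(\<Prod>i\<in>I. (\<Prod>a | a < i. th (z$i - z$a + y)) * th (l - of_int (wcount i I) * y) * (\<Prod>a | a > i. th (z$i - z$a)))
   / (\<Prod>i\<in>I. (\<Prod>a | a < i \<and> a \<in> I. th (z$i - z$a + y)) * (\<Prod>a | a > i \<and> a \<in> I. th (z$i - z$a)))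
  = (\<Prod>i\<in>I. th (l - of_int (wcount i I) * y) *
   ((\<Prod>a | a < i \<and> a \<notin> I. th (z$i - z$a + y)) * (\<Prod>a | a > i \<and> a \<notin> I. th (z$i - z$a))))"
  unfolding prod_dividef[symmetric]
 proof (rule prod.cong[OF refl])
  have cancel: "A * B * L * (C * D) / (A * C) = L * (B * D)" if "A \<noteq> 0" "C \<noteq> 0" for A B C D L :: complex
  proof -
   have "A * C \<noteq> 0" using that by simp
   from nonzero_divide_eq_eq[OF this] show ?thesis by (simp only: mult_ac)
  qed
  fix i assume i: "i \<in> I"
  have 1: "(\<Prod>a | a < i. th (z$i - z$a + y)) = (\<Prod>a | a < i \<and> a \<in> I. th (z$i - z$a + y)) * (\<Prod>a | a < i \<and> a \<notin> I. th (z$i - z$a + y))"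
   by (subst prod.union_disjoint[symmetric]) (auto intro!: prod.cong)
  have 2: "(\<Prod>a | a > i. th (z$i - z$a)) = (\<Prod>a | a > i \<and> a \<in> I. th (z$i - z$a)) * (\<Prod>a | a > i \<and> a \<notin> I. th (z$i - z$a))"
   by (subst prod.union_disjoint[symmetric]) (auto intro!: prod.cong)
  have "(\<Prod>a | a < i \<and> a \<in> I. th (z$i - z$a + y)) \<noteq> 0" "(\<Prod>a | a > i \<and> a \<in> I. th (z$i - z$a)) \<noteq> 0"
   using nz i by auto
  thus "(\<Prod>a | a < i. th (z$i - z$a + y)) * th (l - of_int (wcount i I) * y) * (\<Prod>a | a > i. th (z$i - z$a))
    / ((\<Prod>a | a < i \<and> a \<in> I. th (z$i - z$a + y)) * (\<Prod>a | a > i \<and> a \<in> I. th (z$i - z$a)))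
   = th (l - of_int (wcount i I) * y) *
    ((\<Prod>a | a < i \<and> a \<notin> I. th (z$i - z$a + y)) * (\<Prod>a | a > i \<and> a \<notin> I. th (z$i - z$a)))"
   unfolding 1 2 by (rule cancel)
 qed
 finally show ?thesis by (simp add: prod.distrib mult_ac)
qed

end

section \<open>Exchange of adjacent sites\<close>

definition wfac :: "complex => ('n::{finite,linorder}) set => 'n => complex => 'n pt => complex" where
 "wfac \<tau> I i s = (%(z, y, l). (\<Prod>a | a < i. theta \<tau> (s - z$a + y)) * theta \<tau> (l + s - z$i - of_int (wcount i I) * y)
    * (\<Prod>a | a > i. theta \<tau> (s - z$a)))"

definition wpair :: "complex => complex => complex => complex => complex" where
 "wpair \<tau> y s t = theta \<tau> (s - t) * theta \<tau> (t - s + y)"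

definition wpairs :: "complex => complex => ('n::{finite,linorder}) set => ('n => complex) => complex" where
 "wpairs \<tau> y I t = (\<Prod>(i, j)\<in>pairs I. wpair \<tau> y (t i) (t j))"

lemma wterm_eq: "wterm \<tau> I t (z, y, l) = (\<Prod>i\<in>I. wfac \<tau> I i (t i) (z, y, l)) / wpairs \<tau> y I t"
 by (simp add: wterm_def wfac_def wpairs_def wpair_def)

text \<open>The pair factors joining the index i, whose variable has the value s, to J. Keeping s as
  an argument allows i to be replaced by an adjacent index.\<close>

definition wcross :: "complex => complex => ('n::{finite,linorder}) set => ('n => complex) => 'n => complex => complex" where
 "wcross \<tau> y J t i s = (\<Prod>j\<in>J. if j < i then wpair \<tau> y (t j) s else wpair \<tau> y s (t j))"

lemma wpairs_insert:
 fixes J :: "('n::{finite,linorder}) set"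
 assumes "i \<notin> J"
 shows "wpairs \<tau> y (insert i J) t = wpairs \<tau> y J t * wcross \<tau> y J t i (t i)"
proof -
 let ?P = "%I. {(a, b). a \<in> I \<and> b \<in> I \<and> a < b}"
 have "?P (insert i J) = ?P J \<union> (%j. if j < i then (j, i) else (i, j)) ` J"
  using assms by (auto simp: image_iff) (metis linorder_neqE)+
 moreover have "?P J \<inter> (%j. if j < i then (j, i) else (i, j)) ` J = {}"
  using assms by (auto split: if_splits)
 ultimately have "wpairs \<tau> y (insert i J) t = wpairs \<tau> y J t * (\<Prod>(a, b)\<in>(%j. if j < i then (j, i) else (i, j)) ` J. wpair \<tau> y (t a) (t b))"
  unfolding wpairs_def by (simp add: prod.union_disjoint)
 also have "(\<Prod>(a, b)\<in>(%j. if j < i then (j, i) else (i, j)) ` J. wpair \<tau> y (t a) (t b)) = wcross \<tau> y J t i (t i)"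
  unfolding wcross_def
  by (subst prod.reindex) (auto simp: inj_on_def split: if_splits intro!: prod.cong)
 finally show ?thesis .
qed

lemma wpairs_cong: "(\<And>j. j \<in> J ==> t j = t' j) ==> wpairs \<tau> y J t = wpairs \<tau> y J t'"
 unfolding wpairs_def by (intro prod.cong) auto

lemma wcount_eq: "wcount j I = (\<Sum>b | b > j. if b \<in> I then 1 else - 1)"
proof -
 have "(\<Sum>b | b > j. if b \<in> I then 1 else - 1 :: int) = (\<Sum>b\<in>{b. b > j} \<inter> I. 1) + (\<Sum>b\<in>{b. b > j} \<inter> - I. - 1)"
  by (rule sum.If_cases[of "{b. b > j}" "%b. b \<in> I" "%_. 1" "%_. - 1", simplified Collect_mem_eq]) simp
 moreover have "{b. b > j} \<inter> I = {l \<in> I. l > j}" "{b. b > j} \<inter> - I = {l \<in> - I. l > j}" by auto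
 ultimately show ?thesis by (simp add: wcount_def ncount_def)
qed

text \<open>The count w(j, I) of the stable envelope is the dynamical shift of the R-matrix at site
  j; this agreement makes the exchange relations possible.\<close>

lemma weight_sum: "(\<Sum>b | b > j. weight I b) = of_int (wcount j I)"
 unfolding wcount_eq weight_def of_int_sum by (intro sum.cong) auto

abbreviation swap :: "'n => 'n => 'n => 'n" where "swap \<equiv> Transposition.transpose"

definition adjacent :: "'n::linorder => 'n => bool" where
 "adjacent p q \<longleftrightarrow> p < q \<and> (\<forall>a. \<not> (p < a \<and> a < q))"

lemma perm_swap: "perm (swap p q) (z, y, l) = ((\<chi> a. z$swap p q a), y, l)"
 by (simp add: perm_def)

context
 fixes p q :: "'n::{finite,linorder}"
 assumes pq: "adjacent p q"
begin

lemma adjacent_less: "p < q" "p \<noteq> q" "\<And>a. a < q \<longleftrightarrow> a < p \<or> a = p" "\<And>a. p < a \<longleftrightarrow> a = q \<or> q < a"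
 using pq unfolding adjacent_def by (auto dest: order.strict_trans)

lemma wcount_adjacent: "wcount p I = wcount q I + (if q \<in> I then 1 else - 1)"
proof -
 have "{b. b > p} = insert q {b. b > q}" using adjacent_less by auto
 thus ?thesis by (simp add: wcount_eq)
qed

lemma wcount_above: "j \<ge> q ==> (\<And>a. a \<noteq> p ==> a \<noteq> q ==> a \<in> I \<longleftrightarrow> a \<in> I') ==> wcount j I = wcount j I'"
 unfolding wcount_eq
proof (intro sum.cong refl)
 fix b assume *: "j \<ge> q" "\<And>a. a \<noteq> p ==> a \<noteq> q ==> a \<in> I \<longleftrightarrow> a \<in> I'" "b \<in> {b. b > j}"
 hence "b > q" "b > p" using adjacent_less(1) by (auto dest: order.strict_trans1 order.strict_trans)
 hence "b \<in> I \<longleftrightarrow> b \<in> I'" by (intro *(2)) auto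
 thus "(if b \<in> I then 1 else - 1) = (if b \<in> I' then 1 else - 1 :: int)" by simp
qed

lemma wcount_off:
 assumes "j \<noteq> p" "j \<noteq> q" "J \<inter> {p, q} = {}"
 shows "wcount j (insert p J) = wcount j (insert q J)"
proof (cases "j < p")
 case True
 hence e: "{b. b > j} = insert p (insert q {b. b > j \<and> b \<noteq> p \<and> b \<noteq> q})" using adjacent_less by auto
 have "(\<Sum>b | b > j \<and> b \<noteq> p \<and> b \<noteq> q. if b \<in> insert p J then 1 else - 1 :: int)
   = (\<Sum>b | b > j \<and> b \<noteq> p \<and> b \<noteq> q. if b \<in> insert q J then 1 else - 1)"
  by (intro sum.cong) auto
 thus ?thesis unfolding wcount_eq e using assms(3) adjacent_less by simp
next
 case False
 hence "j > q" using assms adjacent_less by (metis linorder_neqE)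
 thus ?thesis by (intro wcount_above) auto
qed

lemma wcross_adjacent:
 assumes "J \<inter> {p, q} = {}" "\<And>j. j \<in> J ==> t j = t' j"
 shows "wcross \<tau> y J t p s = wcross \<tau> y J t' q s"
 unfolding wcross_def using assms adjacent_less by (intro prod.cong) auto

lemma wfac_off:
 assumes "j \<noteq> p" "j \<noteq> q" "wcount j I = wcount j I'"
 shows "wfac \<tau> I j s (perm (swap p q) (z, y, l)) = wfac \<tau> I' j s (z, y, l)"
proof -
 have b: "bij_betw (swap p q) {a. a < j} {a. a < j}" "bij_betw (swap p q) {a. a > j} {a. a > j}"
  using assms(1,2) adjacent_less
  by (auto intro!: bij_betw_byWitness[of _ "swap p q"] simp: transpose_def split: if_splits)
 have "(\<Prod>a | a < j. theta \<tau> (s - z$swap p q a + y)) = (\<Prod>a | a < j. theta \<tau> (s - z$a + y))"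
  by (rule prod.reindex_bij_betw[OF b(1)])
 moreover have "(\<Prod>a | a > j. theta \<tau> (s - z$swap p q a)) = (\<Prod>a | a > j. theta \<tau> (s - z$a))"
  by (rule prod.reindex_bij_betw[OF b(2)])
 ultimately show ?thesis
  unfolding wfac_def perm_swap case_prod_conv using assms by (simp add: transpose_def)
qed

text \<open>What the sites other than p and q contribute to the factor of the variable s; it does
  not change when p and q are exchanged.\<close>

definition wout :: "complex => complex => 'n pt => complex" where
 "wout \<tau> s = (%(z, y, l). (\<Prod>a | a < p. theta \<tau> (s - z$a + y)) * (\<Prod>a | a > q. theta \<tau> (s - z$a)))"

lemma wout_swap: "wout \<tau> s (perm (swap p q) (z, y, l)) = wout \<tau> s (z, y, l)"
proof -
 have "swap p q a = a" if "a < p \<or> q < a" for a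
  using that adjacent_less(1) by (auto simp: transpose_def)
 hence "(\<Prod>a | a < p. theta \<tau> (s - z$swap p q a + y)) = (\<Prod>a | a < p. theta \<tau> (s - z$a + y))"
  "(\<Prod>a | a > q. theta \<tau> (s - z$swap p q a)) = (\<Prod>a | a > q. theta \<tau> (s - z$a))"
  by (auto intro!: prod.cong)
 thus ?thesis
  unfolding wout_def perm_swap case_prod_conv by simp
qed

lemma wfac_p: "wfac \<tau> I p s (z, y, l) = wout \<tau> s (z, y, l) * (theta \<tau> (l + s - z$p - of_int (wcount p I) * y) * theta \<tau> (s - z$q))"
proof -
 have "{a. a > p} = insert q {a. a > q}" using adjacent_less by auto
 thus ?thesis by (simp add: wfac_def wout_def)
qed

lemma wfac_q: "wfac \<tau> I q s (z, y, l) = wout \<tau> s (z, y, l) * (theta \<tau> (s - z$p + y) * theta \<tau> (l + s - z$q - of_int (wcount q I) * y))"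
proof -
 have "{a. a < q} = insert p {a. a < p}" using adjacent_less by auto
 thus ?thesis using adjacent_less by (simp add: wfac_def wout_def)
qed

lemma wfac_swapped:
 assumes "x = (z, y, l) \<and> u = z$p \<and> v = z$q \<or> x = perm (swap p q) (z, y, l) \<and> u = z$q \<and> v = z$p"
 shows "wfac \<tau> I p s x = wout \<tau> s (z, y, l) * (theta \<tau> (l + s - u - of_int (wcount p I) * y) * theta \<tau> (s - v))"
  "wfac \<tau> I q s x = wout \<tau> s (z, y, l) * (theta \<tau> (s - u + y) * theta \<tau> (l + s - v - of_int (wcount q I) * y))"
 using assms wout_swap[of \<tau> s z y l] by (auto simp: perm_swap wfac_p wfac_q)

end

context modulus
begin

definition wval :: "('n::{finite,linorder}) set => ('n => complex) => 'n pt => complex" where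
 "wval I t x = 1 / psi \<tau> I (fst (snd x)) (snd (snd x)) * wterm \<tau> I t x"

lemma stab_wval:
 assumes "card I = card K"
 shows "stb I K x = (\<Sum>f\<in>Bij I K. wval I (%i. x$$f i) x)"
 using stab_eq[OF assms, of \<tau> "fst x" "fst (snd x)" "snd (snd x)"] by (simp add: wval_def sum_distrib_left)

context
 fixes p q :: "'n::{finite,linorder}" and J :: "('n::{finite,linorder}) set"
  and z :: "complex ^ ('n::{finite,linorder})" and y l L \<zeta> :: complex
 assumes pq: "adjacent p q" and J: "J \<inter> {p, q} = {}"
 defines "L \<equiv> l - of_int (wcount q J) * y" and "\<zeta> \<equiv> z$p - z$q"
 assumes nz: "th L \<noteq> 0" "th (L - y) \<noteq> 0" "th (L + y) \<noteq> 0" "th (\<zeta> - y) \<noteq> 0"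
begin

lemma wval_none: "wval J t (perm (swap p q) (z, y, l)) = wval J t (z, y, l)"
proof -
 have "(\<Prod>i\<in>J. wfac \<tau> J i (t i) (perm (swap p q) (z, y, l))) = (\<Prod>i\<in>J. wfac \<tau> J i (t i) (z, y, l))"
  using J by (intro prod.cong wfac_off[OF pq]) auto
 thus ?thesis by (simp add: wval_def wterm_eq perm_swap)
qed

text \<open>The common factor of the terms for J \<union> {p} and J \<union> {q}, s being the value
  of the variable at the moving index. Splitting it off leaves a two-site problem.\<close>

definition rest :: "('n => complex) => complex => complex" where
 "rest t s = 1 / (\<Prod>j\<in>J. th (l - of_int (wcount j (insert p J) + 1) * y) * th (l - of_int (wcount j (insert p J)) * y))
   * (\<Prod>i\<in>J. wfac \<tau> (insert p J) i (t i) (z, y, l)) * wout p q \<tau> s (z, y, l)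
   / (wpairs \<tau> y J t * wcross \<tau> y J t p s)"

lemma rest_cong:
 assumes "\<And>j. j \<in> J ==> t j = t' j" shows "rest t s = rest t' s"
proof -
 have "wcross \<tau> y J t p s = wcross \<tau> y J t' p s"
  unfolding wcross_def using assms by (intro prod.cong) auto
 moreover have "(\<Prod>i\<in>J. wfac \<tau> (insert p J) i (t i) (z, y, l)) = (\<Prod>i\<in>J. wfac \<tau> (insert p J) i (t' i) (z, y, l))"
  using assms by (intro prod.cong) auto
 moreover have "wpairs \<tau> y J t = wpairs \<tau> y J t'" using assms by (rule wpairs_cong)
 ultimately show ?thesis unfolding rest_def by simp
qed

lemma wc: "wcount p (insert p J) = wcount q J - 1" "wcount q (insert q J) = wcount q J"
 using J wcount_adjacent[OF pq, of "insert p J"] adjacent_less(2)[OF pq]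
  wcount_above[OF pq, of q "insert p J" J] wcount_above[OF pq, of q "insert q J" J] by auto

lemma wc_off: assumes "j \<in> J" shows "wcount j (insert q J) = wcount j (insert p J)"
 using J assms by (intro wcount_off[OF pq, symmetric]) auto

lemma wval_p:
 assumes "x = (z, y, l) \<and> u = z$p \<and> v = z$q \<or> x = perm (swap p q) (z, y, l) \<and> u = z$q \<and> v = z$p"
 shows "wval (insert p J) t x = rest t (t p) * (th (L + (t p - u) + y) * th (t p - v)) / (th L * th (L + y))"
proof -
 have pJ: "p \<notin> J" using J by auto
 have fac: "wfac \<tau> (insert p J) i s x = wfac \<tau> (insert p J) i s (z, y, l)" if "i \<in> J" for i s
  using assms that J wfac_off[OF pq, of i "insert p J" "insert p J" \<tau> s z y l] by auto
 have "wfac \<tau> (insert p J) p (t p) x = wout p q \<tau> (t p) (z, y, l) * (th (L + (t p - u) + y) * th (t p - v))"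
  using wfac_swapped(1)[OF pq assms, of \<tau> "insert p J" "t p"] by (simp add: wc L_def algebra_simps)
 moreover have "snd x = (y, l)" using assms by (auto simp: perm_swap)
 moreover have "wterm \<tau> (insert p J) t x = (\<Prod>i\<in>insert p J. wfac \<tau> (insert p J) i (t i) x) / wpairs \<tau> y (insert p J) t"
  using assms by (auto simp: wterm_eq perm_swap)
 moreover have "psi \<tau> (insert p J) y l = (\<Prod>j\<in>J. th (l - of_int (wcount j (insert p J) + 1) * y) * th (l - of_int (wcount j (insert p J)) * y)) * (th L * th (L + y))"
  using pJ by (simp add: psi_def wc L_def algebra_simps)
 ultimately show ?thesis
  using pJ by (simp add: wval_def rest_def wpairs_insert fac) (simp only: mult_ac)
qed

lemma wval_q:
 assumes "x = (z, y, l) \<and> u = z$p \<and> v = z$q \<or> x = perm (swap p q) (z, y, l) \<and> u = z$q \<and> v = z$p"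
 shows "wval (insert q J) t x = rest t (t q) * (th (t q - u + y) * th (L + (t q - v))) / (th (L - y) * th L)"
proof -
 have qJ: "q \<notin> J" using J by auto
 have fac: "wfac \<tau> (insert q J) i s x = wfac \<tau> (insert p J) i s (z, y, l)" if "i \<in> J" for i s
 proof -
  have w: "wcount i (insert q J) = wcount i (insert p J)" by (rule wc_off[OF that])
  hence "wfac \<tau> (insert q J) i s (z, y, l) = wfac \<tau> (insert p J) i s (z, y, l)"
   by (simp add: wfac_def)
  thus ?thesis
   using assms that J wfac_off[OF pq _ _ w, of \<tau> s z y l] by auto
 qed
 have "wfac \<tau> (insert q J) q (t q) x = wout p q \<tau> (t q) (z, y, l) * (th (t q - u + y) * th (L + (t q - v)))"
  using wfac_swapped(2)[OF pq assms, of \<tau> "insert q J" "t q"] by (simp add: wc L_def algebra_simps)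
 moreover have "snd x = (y, l)" using assms by (auto simp: perm_swap)
 moreover have "wterm \<tau> (insert q J) t x = (\<Prod>i\<in>insert q J. wfac \<tau> (insert q J) i (t i) x) / wpairs \<tau> y (insert q J) t"
  using assms by (auto simp: wterm_eq perm_swap)
 moreover have "psi \<tau> (insert q J) y l = (\<Prod>j\<in>J. th (l - of_int (wcount j (insert p J) + 1) * y) * th (l - of_int (wcount j (insert p J)) * y)) * (th (L - y) * th L)"
 proof -
  have "(\<Prod>j\<in>J. th (l - of_int (wcount j (insert q J) + 1) * y) * th (l - of_int (wcount j (insert q J)) * y))
   = (\<Prod>j\<in>J. th (l - of_int (wcount j (insert p J) + 1) * y) * th (l - of_int (wcount j (insert p J)) * y))"
   by (intro prod.cong) (simp_all add: wc_off)
  moreover have "l - of_int (wcount q J + 1) * y = L - y" "l - of_int (wcount q J) * y = L"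
   by (simp_all add: L_def algebra_simps)
  ultimately show ?thesis
   unfolding psi_def using qJ by (simp only: prod.insert[OF finite qJ] wc mult.commute)
 qed
 moreover have "wcross \<tau> y J t q s = wcross \<tau> y J t p s" for s
  by (rule wcross_adjacent[OF pq J, symmetric]) simp
 ultimately show ?thesis
  using qJ by (simp add: wval_def rest_def wpairs_insert fac) (simp only: mult_ac)
qed

text \<open>After cancelling \<open>rest\<close> this is \<open>exchange_1\<close>. It holds summand
  by summand, with t' the assignment in which q carries the variable formerly carried by p.\<close>

lemma wval_exchange_p:
 assumes "t' q = t p" "\<And>j. j \<in> J ==> t' j = t j"
 shows "wval (insert p J) t (perm (swap p q) (z, y, l)) =
  be \<zeta> y L * wval (insert p J) t (z, y, l) + al \<zeta> y (- L) * wval (insert q J) t' (z, y, l)"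
proof -
 define u v r where "u = t p - z$p" "v = t p - z$q" "r = rest t (t p)"
 have r: "rest t' (t p) = r" unfolding u_v_r_def by (rule rest_cong) (rule assms(2))
 have 1: "wval (insert p J) t (perm (swap p q) (z, y, l)) = r * (th (L + v + y) * th u) / (th L * th (L + y))"
  using wval_p[of "perm (swap p q) (z, y, l)" "z$q" "z$p" t] by (simp add: u_v_r_def)
 have 2: "wval (insert p J) t (z, y, l) = r * (th (L + u + y) * th v) / (th L * th (L + y))"
  using wval_p[of "(z, y, l)" "z$p" "z$q" t] by (simp add: u_v_r_def)
 have 3: "wval (insert q J) t' (z, y, l) = r * (th (u + y) * th (L + v)) / (th (L - y) * th L)"
  using wval_q[of "(z, y, l)" "z$p" "z$q" t'] assms(1) r by (simp add: u_v_r_def)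
 have 4: "\<zeta> = v - u" "\<zeta> + L = L + v - u" "\<zeta> - y = v - u - y"
  by (simp_all add: u_v_r_def \<zeta>_def)
 have "th (L + v + y) * th u * th L * th (\<zeta> - y) + th (\<zeta> + L) * th y * th (L + u + y) * th v
   - th \<zeta> * th (u + y) * th (L + v) * th (L + y) = 0"
  unfolding 4(2,3) unfolding 4(1) by (rule exchange_1)
 thus ?thesis
  unfolding 1 2 3 alpha_minus beta_def using nz by (simp add: divide_simps) algebra
qed

lemma wval_exchange_q:
 assumes "t' p = t q" "\<And>j. j \<in> J ==> t' j = t j"
 shows "wval (insert q J) t (perm (swap p q) (z, y, l)) =
  al \<zeta> y L * wval (insert p J) t' (z, y, l) + be \<zeta> y (- L) * wval (insert q J) t (z, y, l)"
proof -
 define u v r where "u = t q - z$p" "v = t q - z$q" "r = rest t (t q)"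
 have r: "rest t' (t q) = r" unfolding u_v_r_def by (rule rest_cong) (rule assms(2))
 have 1: "wval (insert q J) t (perm (swap p q) (z, y, l)) = r * (th (v + y) * th (L + u)) / (th (L - y) * th L)"
  using wval_q[of "perm (swap p q) (z, y, l)" "z$q" "z$p" t] by (simp add: u_v_r_def)
 have 2: "wval (insert q J) t (z, y, l) = r * (th (u + y) * th (L + v)) / (th (L - y) * th L)"
  using wval_q[of "(z, y, l)" "z$p" "z$q" t] by (simp add: u_v_r_def)
 have 3: "wval (insert p J) t' (z, y, l) = r * (th (L + u + y) * th v) / (th L * th (L + y))"
  using wval_p[of "(z, y, l)" "z$p" "z$q" t'] assms(1) r by (simp add: u_v_r_def)
 have 4: "\<zeta> = v - u" "\<zeta> - L = v - u - L" "\<zeta> - y = v - u - y"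
  by (simp_all add: u_v_r_def \<zeta>_def)
 have "th (v + y) * th (L + u) * th L * th (\<zeta> - y) - th \<zeta> * th (L - y) * th (L + u + y) * th v
   - th (\<zeta> - L) * th y * th (u + y) * th (L + v) = 0"
  unfolding 4(2,3) unfolding 4(1) by (rule exchange_2)
 thus ?thesis
  unfolding 1 2 3 alpha_def beta_minus using nz by (simp add: divide_simps) algebra
qed

end

text \<open>Both sites occupied: only the sum over the two assignments of the variables is symmetric.\<close>

lemma wval_exchange_both:
 fixes p q :: "'n::{finite,linorder}" and J :: "('n::{finite,linorder}) set" and z :: "complex ^ ('n::{finite,linorder})"
 assumes pq: "adjacent p q" and J: "J \<inter> {p, q} = {}"
  and t': "t' p = t q" "t' q = t p" "\<And>j. j \<in> J ==> t' j = t j"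
  and nz: "th (t p - t q) \<noteq> 0" "th (t p - t q + y) \<noteq> 0" "th (t q - t p + y) \<noteq> 0"
 shows "wval (insert p (insert q J)) t (perm (swap p q) (z, y, l)) + wval (insert p (insert q J)) t' (perm (swap p q) (z, y, l))
  = wval (insert p (insert q J)) t (z, y, l) + wval (insert p (insert q J)) t' (z, y, l)"
proof -
 let ?I = "insert p (insert q J)"
 have pJ: "p \<notin> insert q J" "q \<notin> J" using J adjacent_less(2)[OF pq] by auto
 define L where "L = l - of_int (wcount q J) * y"
 have w: "wcount q ?I = wcount q J" "wcount p ?I = wcount q J + 1"
  using wcount_adjacent[OF pq, of ?I] wcount_above[OF pq, of q ?I J] by auto
 define P where "P = (\<Prod>j\<in>J. wfac \<tau> ?I j (t j) (z, y, l))"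
 define c where "c = 1 / psi \<tau> ?I y l * P * (wout p q \<tau> (t p) (z, y, l) * wout p q \<tau> (t q) (z, y, l))
  / (wpairs \<tau> y J t * wcross \<tau> y J t p (t p) * wcross \<tau> y J t p (t q))"
 define N where "N s r u v = th (L + s - u - y) * th (s - v) * (th (r - u + y) * th (L + r - v)) / (th (s - r) * th (r - s + y))" for s r u v
 have main: "wval ?I f x = c * N (f p) (f q) u v"
  if x: "x = (z, y, l) \<and> u = z$p \<and> v = z$q \<or> x = perm (swap p q) (z, y, l) \<and> u = z$q \<and> v = z$p"
   and f: "f = t \<or> f = t'" for x u v f
 proof -
  have fJ: "\<And>j. j \<in> J ==> f j = t j" using f t'(3) by auto
  have 1: "(\<Prod>j\<in>J. wfac \<tau> ?I j (f j) x) = P"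
   unfolding P_def
  proof (rule prod.cong[OF refl])
   fix j assume j: "j \<in> J"
   hence "j \<noteq> p" "j \<noteq> q" using J by auto
   thus "wfac \<tau> ?I j (f j) x = wfac \<tau> ?I j (t j) (z, y, l)"
    using x wfac_off[OF pq, of j ?I ?I \<tau> "t j" z y l] by (auto simp: fJ[OF j])
  qed
  have 2: "wfac \<tau> ?I p (f p) x = wout p q \<tau> (f p) (z, y, l) * (th (L + f p - u - y) * th (f p - v))"
   using wfac_swapped(1)[OF pq x, of \<tau> ?I "f p"] by (simp add: w L_def algebra_simps)
  have 3: "wfac \<tau> ?I q (f q) x = wout p q \<tau> (f q) (z, y, l) * (th (f q - u + y) * th (L + f q - v))"
   using wfac_swapped(2)[OF pq x, of \<tau> ?I "f q"] by (simp add: w L_def algebra_simps)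
  have 4: "wcross \<tau> y (insert q J) f p (f p) = wpair \<tau> y (f p) (f q) * wcross \<tau> y J t p (f p)"
  proof -
   have "wcross \<tau> y J f p (f p) = wcross \<tau> y J t p (f p)"
    unfolding wcross_def using fJ by (intro prod.cong) auto
   moreover have "\<not> q < p" using adjacent_less(1)[OF pq] by simp
   ultimately show ?thesis using pJ(2) by (simp add: wcross_def)
  qed
  have 5: "wcross \<tau> y J f q (f q) = wcross \<tau> y J t p (f q)"
   by (rule wcross_adjacent[OF pq J, symmetric]) (simp add: fJ)
  have 6: "wpairs \<tau> y J f = wpairs \<tau> y J t" using fJ by (rule wpairs_cong)
  have 7: "{f p, f q} = {t p, t q}" using f t' by auto
  have 8: "g (f p) * g (f q) = g (t p) * g (t q)" for g :: "complex => complex"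
   using f t' by auto
  have "snd x = (y, l)" using x by (auto simp: perm_swap)
  moreover have "wterm \<tau> ?I f x = (\<Prod>i\<in>?I. wfac \<tau> ?I i (f i) x) / wpairs \<tau> y ?I f"
   using x by (auto simp: wterm_eq perm_swap)
  ultimately have "wval ?I f x = 1 / psi \<tau> ?I y l * (wfac \<tau> ?I p (f p) x * (wfac \<tau> ?I q (f q) x * P))
    / (wpairs \<tau> y J t * wcross \<tau> y J t p (f q) * (wpair \<tau> y (f p) (f q) * wcross \<tau> y J t p (f p)))"
   using pJ 1 4 5 6 by (simp add: wval_def wpairs_insert)
  also have "\<dots> = 1 / psi \<tau> ?I y l * P * (wout p q \<tau> (f p) (z, y, l) * wout p q \<tau> (f q) (z, y, l))
    / (wpairs \<tau> y J t * (wcross \<tau> y J t p (f p) * wcross \<tau> y J t p (f q))) * N (f p) (f q) u v"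
   unfolding 2 3 N_def wpair_def times_divide_eq_left times_divide_eq_right divide_divide_eq_left by (simp only: mult_ac)
  also have "\<dots> = c * N (f p) (f q) u v"
   unfolding 8[of "%s. wout p q \<tau> s (z, y, l)"] 8[of "%s. wcross \<tau> y J t p s"] c_def by (simp only: mult.assoc)
  finally show ?thesis .
 qed
 have "N (t p) (t q) (z$q) (z$p) + N (t q) (t p) (z$q) (z$p) = N (t p) (t q) (z$p) (z$q) + N (t q) (t p) (z$p) (z$q)"
 proof -
  define b d e where "b = t p - z$q" "d = t q - z$q" "e = z$p - z$q"
  note bde = b_d_e_def
  have s: "th (t q - t p) = - th (t p - t q)" using theta_minus[of "t p - t q"] by simp
  have 1: "th (L + b - e - y) * th b * th (d - e + y) * th (L + d) - th (L + b - y) * th (b - e) * th (d + y) * th (L + d - e)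
   + th (b - d - y) * th e * th (L + b + d - e) * th (L - y) = 0"
   by (rule exchange_3)
  \<comment> \<open>The same identity with b and d interchanged. After division by the respective
    pair factors the third products of the two are opposite, so they cancel in the sum over both
    assignments.\<close>
  have 2: "th (L + d - e - y) * th d * th (b - e + y) * th (L + b) - th (L + d - y) * th (d - e) * th (b + y) * th (L + b - e)
   + th (d - b - y) * th e * th (L + d + b - e) * th (L - y) = 0"
   by (rule exchange_3)
  have 3: "th (d - b - y) = - th (b - d + y)" "th (b - d - y) = - th (d - b + y)"
   using theta_minus[of "b - d + y"] theta_minus[of "d - b + y"] by (simp_all add: algebra_simps)
  have 4: "L + d + b - e = L + b + d - e" by simp
  have args: "L + t p - z$q - y = L + b - y" "t p - z$p = b - e" "t q - z$q + y = d + y" "L + t q - z$p = L + d - e"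
   "L + t q - z$q - y = L + d - y" "t q - z$p = d - e" "t p - z$q + y = b + y" "L + t p - z$p = L + b - e"
   "L + t p - z$p - y = L + b - e - y" "t p - z$q = b" "t q - z$p + y = d - e + y" "L + t q - z$q = L + d"
   "L + t q - z$p - y = L + d - e - y" "t q - z$q = d" "t p - z$p + y = b - e + y" "L + t p - z$q = L + b"
   "t p - t q = b - d" "t q - t p = d - b"
   by (simp_all add: bde)
  have s': "th (d - b) = - th (b - d)" using s unfolding args .
  show ?thesis
   using nz 1 2[unfolded 4 3] 1[unfolded 3]
   unfolding N_def args s' by (simp add: divide_simps) algebra
 qed
 thus ?thesis
  using main[of "perm (swap p q) (z, y, l)" "z$q" "z$p" t] main[of "perm (swap p q) (z, y, l)" "z$q" "z$p" t']
   main[of "(z, y, l)" "z$p" "z$q" t] main[of "(z, y, l)" "z$p" "z$q" t'] t'(1,2)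
  by (simp add: distrib_left[symmetric])
qed

end

section \<open>The Yang-Baxter equation for two adjacent sites\<close>

lemma R_factor_eq:
 fixes a :: "'n::{finite,linorder}"
 shows "R_factor \<tau> w (z, y, l) a u i J =
  (let L = l - of_int (wcount a J) * y in
   if i = 1 then (if a \<in> J then u 1 J else alpha \<tau> (w - z$a) y L * u 1 J + beta \<tau> (w - z$a) y L * u 2 (insert a J))
   else if i = 2 then (if a \<in> J then alpha \<tau> (w - z$a) y (- L) * u 2 J + beta \<tau> (w - z$a) y (- L) * u 1 (J - {a}) else u 2 J)
   else 0)"
proof -
 have sets: "{I. I - {a} = J - {a}} = {insert a J, J - {a}}" by auto
 have ne: "insert a J \<noteq> J - {a}" by blast
 have w: "(\<Sum>b | b > a. weight (insert a J) b) = of_int (wcount a J)"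
  "(\<Sum>b | b > a. weight (J - {a}) b) = of_int (wcount a J)"
  by (auto simp: weight_sum[symmetric] weight_def intro!: sum.cong)
 have w0: "sum (weight J) {b. a < b} = of_int (wcount a J)"
  by (auto simp: weight_sum[symmetric] weight_def intro!: sum.cong)
 have ij: "insert a J = J" if "a \<in> J" using that by auto
 have jd: "J - {a} = J" if "a \<notin> J" using that by auto
 show ?thesis
  unfolding R_factor_def case_prod_conv sets
  by (simp add: ne w w0 Rmat_def tensor_idx_def Let_def ij jd mult.commute[of y])
qed

text \<open>\<open>rdiag\<close> and \<open>roff\<close> are the diagonal and off-diagonal
  coefficients of the R-matrix composed with the flip, b and c telling whether the two sites are
  occupied.\<close>

definition rdiag :: "complex => complex => complex => complex => bool => bool => complex" where
 "rdiag \<tau> \<zeta> y L b c = (if b = c then 1 else if b then beta \<tau> \<zeta> y L else beta \<tau> \<zeta> y (- L))"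

definition roff :: "complex => complex => complex => complex => bool => bool => complex" where
 "roff \<tau> \<zeta> y L b c = (if b = c then 0 else if b then alpha \<tau> \<zeta> y (- L) else alpha \<tau> \<zeta> y L)"

text \<open>The operator \<open>P R\<close> on the tensor factors \<open>p\<close>, \<open>q\<close>; \<open>h\<close> is the contribution of factor 0 to the dynamical shift.\<close>

definition rop :: "complex => ('n::{finite,linorder}) => 'n => (nat => int) => 'n pt => (nat => 'n set => complex) => nat => 'n set => complex" where
 "rop \<tau> p q h = (%(z, y, l) u i J. let \<zeta> = z$p - z$q; L = l - of_int (wcount q J + h i) * y in
   rdiag \<tau> \<zeta> y L (p \<in> J) (q \<in> J) * u i J + roff \<tau> \<zeta> y L (q \<in> J) (p \<in> J) * u i (swap p q ` J))"

lemma swap_image_mem: "a \<in> swap p q ` J \<longleftrightarrow> swap p q a \<in> J"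
 by (metis (no_types, lifting) imageE image_eqI transpose_involutory)

lemma swap_image_simps:
 assumes "p \<notin> B" "q \<notin> B"
 shows "swap p q ` B = B" "swap p q ` insert p B = insert q B" "swap p q ` insert q B = insert p B"
  "swap p q ` insert p (insert q B) = insert p (insert q B)"
proof -
 have "swap p q a = a" if "a \<in> B" for a using assms that by (auto simp: Transposition.transpose_def)
 hence B: "swap p q ` B = B" by force
 thus "swap p q ` B = B" "swap p q ` insert p B = insert q B" "swap p q ` insert q B = insert p B"
  "swap p q ` insert p (insert q B) = insert p (insert q B)"
  by (auto simp: Transposition.transpose_def)
qed

lemma swap_image_insert_other:
 assumes "a \<noteq> p" "a \<noteq> q"
 shows "swap p q ` insert a J = insert a (swap p q ` J)" "swap p q ` (J - {a}) = swap p q ` J - {a}"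
  "a \<in> swap p q ` J \<longleftrightarrow> a \<in> J"
proof -
 have a: "swap p q a = a" using assms by (simp add: Transposition.transpose_def)
 thus "swap p q ` insert a J = insert a (swap p q ` J)" "a \<in> swap p q ` J \<longleftrightarrow> a \<in> J"
  by (auto simp: swap_image_mem)
 have "swap p q ` (J - {a}) = swap p q ` J - swap p q ` {a}" by (intro image_set_diff inj_transpose)
 thus "swap p q ` (J - {a}) = swap p q ` J - {a}" using a by simp
qed

context
 fixes p q :: "'n::{finite,linorder}"
 assumes pq: "adjacent p q"
begin

lemma wcount_swap_image:
 assumes "a \<noteq> p" "a \<noteq> q"
 shows "wcount a (swap p q ` J) = wcount a J"
proof -
 have b: "bij_betw (swap p q) {b. b > a} {b. b > a}"
  using assms adjacent_less[OF pq]
  by (auto intro!: bij_betw_byWitness[of _ "swap p q"] simp: Transposition.transpose_def split: if_splits)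
 have "(\<Sum>b | b > a. if b \<in> J then 1 else - 1 :: int) = (\<Sum>b | b > a. if swap p q b \<in> J then 1 else - 1)"
  using sum.reindex_bij_betw[OF b, of "%b. if b \<in> J then 1 else - 1 :: int"] by simp
 thus ?thesis unfolding wcount_eq swap_image_mem by simp
qed

lemma wcount_q_insert:
 assumes "a \<noteq> p" "a \<noteq> q" "a \<notin> J"
 shows "wcount q (insert a J) = wcount q J + (if a > q then 2 else 0)"
proof (cases "a > q")
 case True
 hence e: "{b. b > q} = insert a {b. b > q \<and> b \<noteq> a}" by auto
 have "(\<Sum>b | b > q \<and> b \<noteq> a. if b \<in> insert a J then 1 else - 1 :: int) = (\<Sum>b | b > q \<and> b \<noteq> a. if b \<in> J then 1 else - 1)"
  by (intro sum.cong) auto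
 thus ?thesis unfolding wcount_eq e using assms True by simp
next
 case False
 thus ?thesis unfolding wcount_eq by (simp, intro sum.cong) auto
qed

text \<open>The conserved quantity: moving a unit of weight between factor 0 and factor \<open>a > q\<close> does not change the shift.\<close>

lemma rop_commute:
 assumes a: "a \<noteq> p" "a \<noteq> q"
  and h: "if a > q then h 2 = h 1 - 2 else h 2 = h 1"
 shows "R_factor \<tau> w (z, y, l) a (rop \<tau> p q h (z, y, l) u) = rop \<tau> p q h (z, y, l) (R_factor \<tau> w (perm (swap p q) (z, y, l)) a u)"
proof (intro ext)
 fix i J
 note s = swap_image_insert_other[OF a]
 have pa: "p \<noteq> a" "q \<noteq> a" using a by auto
 have wi: "wcount q (insert a J) + h 2 = wcount q J + h 1" if "a \<notin> J"
  using wcount_q_insert[OF a that] h by (auto split: if_splits)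
 have wd: "wcount q (J - {a}) + h 1 = wcount q J + h 2" if "a \<in> J"
  using wcount_q_insert[OF a, of "J - {a}"] h that by (auto simp: insert_absorb split: if_splits)
 have sa: "swap p q a = a" using a by (simp add: Transposition.transpose_def)
 have za: "(\<chi> b. z$swap p q b)$a = z$a" using a by (simp add: Transposition.transpose_def)
 show "R_factor \<tau> w (z, y, l) a (rop \<tau> p q h (z, y, l) u) i J = rop \<tau> p q h (z, y, l) (R_factor \<tau> w (perm (swap p q) (z, y, l)) a u) i J"
 proof (cases "i = 1 \<or> i = 2")
  case True
  thus ?thesis
   unfolding perm_swap
   by (cases "a \<in> J"; elim disjE)
    (simp_all add: R_factor_eq rop_def Let_def s za pa sa wi wd wcount_swap_image[OF a] distrib_left mult_ac del: of_int_add One_nat_def)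
 next
  case False
  thus ?thesis unfolding perm_swap by (simp add: R_factor_eq rop_def Let_def)
 qed
qed

end

context modulus
begin

text \<open>The dynamical Yang-Baxter equation on factors 0, p, q. The set B of the other occupied
  sites is frozen, which leaves eight rows: two are trivial, three are \<open>ybe_coeff_1\<close> to
  \<open>ybe_coeff_9\<close>. The values of h are the weights of v_1 and v_2 in factor 0.\<close>

lemma rop_yang_baxter:
 fixes p q :: "'n::{finite,linorder}"
 assumes pq: "adjacent p q" and h: "h 1 = 1" "h 2 = - 1"
  and nz: "th (w - z$p - y) \<noteq> 0" "th (w - z$q - y) \<noteq> 0" "th (z$p - z$q - y) \<noteq> 0"
   "\<And>J. th (l - of_int (wcount q J) * y) \<noteq> 0" "\<And>J. th (l - of_int (wcount q J) * y - y) \<noteq> 0" "\<And>J. th (l - of_int (wcount q J) * y + y) \<noteq> 0"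
 shows "R_factor \<tau> w (z, y, l) p (R_factor \<tau> w (z, y, l) q (rop \<tau> p q h (z, y, l) u))
  = rop \<tau> p q (%_. 0) (z, y, l) (R_factor \<tau> w (perm (swap p q) (z, y, l)) p (R_factor \<tau> w (perm (swap p q) (z, y, l)) q u))"
proof (intro ext)
 fix i and J :: "'n set"
 define B where "B = J - {p, q}"
 have B: "p \<notin> B" "q \<notin> B" "p \<noteq> q" "q \<noteq> p" using adjacent_less(2)[OF pq] by (auto simp: B_def)
 define c where "c = wcount q B"
 have wq: "wcount q (insert p B) = c" "wcount q (insert q B) = c" "wcount q (insert p (insert q B)) = c" "wcount q B = c"
  unfolding c_def by (auto intro!: wcount_above[OF pq])
 have wp: "wcount p (insert p B) = c - 1" "wcount p (insert q B) = c + 1" "wcount p (insert p (insert q B)) = c + 1" "wcount p B = c - 1"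
  using wcount_adjacent[OF pq] B wq by auto
 note sw = swap_image_simps[OF B(1,2)]
 define L where "L = l - of_int c * y"
 define a where "a = w - z$p" 
 define b where "b = w - z$q"
 have zs: "(\<chi> a. z$swap p q a)$p = z$q" "(\<chi> a. z$swap p q a)$q = z$p"
  by simp_all
 have nza: "th (a - y) \<noteq> 0" "th (b - y) \<noteq> 0" "th (b - a - y) \<noteq> 0"
  using nz(1-3) by (simp_all add: a_def b_def)
 have nzL: "th L \<noteq> 0" "th (L - y) \<noteq> 0" "th (L + y) \<noteq> 0"
  using nz(4)[of B] nz(5)[of B] nz(6)[of B] by (simp_all add: L_def c_def)
 have nzm: "th (- L) \<noteq> 0" "th (- L - y) \<noteq> 0"
  using nzL theta_minus[of L] theta_minus[of "L + y"] by (simp_all add: algebra_simps)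
 have ba: "z$p - z$q = b - a" by (simp add: a_def b_def)
 have Leq: "l - of_int (c + h 1) * y = L - y" "l - of_int (c + h 2) * y = L + y" "l - of_int (c + 1) * y = L - y"
  "l - of_int (c - 1) * y = L + y" "l - of_int c * y = L" "l - of_int (c + 0) * y = L"
  by (simp_all add: L_def h h[simplified] algebra_simps)
 have ic: "insert q (insert p B) = insert p (insert q B)" by auto
 have df: "insert p B - {p} = B" "insert q B - {q} = B" "insert p (insert q B) - {p} = insert q B"
  "insert p (insert q B) - {q} = insert p B"
  using B by auto
 note Y = ybe_coeff_1[OF nza nzL(1,2)] ybe_coeff_2[OF nza nzL(1,2)] ybe_coeff_3[OF nza nzL(1,2)]
  ybe_coeff_4[OF nza nzL(1,2)] ybe_coeff_5[OF nza nzL(1,2)] ybe_coeff_6[OF nza nzL(1,2)]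
  ybe_coeff_7[OF nza nzL(1,2)] ybe_coeff_8[OF nza nzL(1,2)] ybe_coeff_9[OF nza nzL(1,2)]
 have mL: "- L - y = - (L + y)" "y - - L = L + y" "- (- L) = L" by simp_all
 \<comment> \<open>Exchanging v_1 and v_2 reverses the sign of L, so the three remaining rows are
   the same identities at - L.\<close>
 note Ym = ybe_coeff_1[OF nza nzm] ybe_coeff_2[OF nza nzm] ybe_coeff_3[OF nza nzm]
  ybe_coeff_4[OF nza nzm] ybe_coeff_5[OF nza nzm] ybe_coeff_6[OF nza nzm]
  ybe_coeff_7[OF nza nzm] ybe_coeff_8[OF nza nzm] ybe_coeff_9[OF nza nzm]
 note Ym' = Ym[unfolded mL]
 have mL2: "- (L - y) = y - L" "- L + - y = - (L + y)" by simp_all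
 note unf = R_factor_eq rop_def Let_def perm_swap case_prod_conv zs wq wp Leq sw ba a_def[symmetric] b_def[symmetric]
  ic df rdiag_def roff_def
 let ?goal = "%i J. R_factor \<tau> w (z, y, l) p (R_factor \<tau> w (z, y, l) q (rop \<tau> p q h (z, y, l) u)) i J
  = rop \<tau> p q (%_. 0) (z, y, l) (R_factor \<tau> w (perm (swap p q) (z, y, l)) p (R_factor \<tau> w (perm (swap p q) (z, y, l)) q u)) i J"
 have goal_B: "?goal i B" "?goal i (insert p B)" "?goal i (insert q B)" "?goal i (insert p (insert q B))" if i: "i = 1 \<or> i = 2"
 proof -

  have W: "p \<noteq> q" "q \<noteq> p" "(1::nat) \<noteq> 2" "(2::nat) \<noteq> 1" using B by auto
  note S = unf insert_iff W B simp_thms if_True if_False refl mL2(1)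

  have A1: "?goal 1 (insert p B)" using Y(1-3) by (simp only: S) algebra
  have A2: "?goal 1 (insert q B)" using Y(4-6) by (simp only: S) algebra
  have A3: "?goal 2 (insert p (insert q B))" using Y(7-9) by (simp only: S) algebra
  have A4: "?goal 1 (insert p (insert q B))" by (simp only: S)
  have A5: "?goal 2 B" by (simp only: S)
  have A6: "?goal 1 B" using Ym'(7-9) apply (simp only: S) apply algebra done
  have A7: "?goal 2 (insert p B)" using Ym'(4-6) apply (simp only: S) apply algebra done
  have A8: "?goal 2 (insert q B)" using Ym'(1-3) apply (simp only: S) apply algebra done
  show "?goal i B" "?goal i (insert p B)" "?goal i (insert q B)" "?goal i (insert p (insert q B))"
   using i A1 A2 A3 A4 A5 A6 A7 A8 by blast+
 qed
 show "?goal i J"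
 proof (cases "i = 1 \<or> i = 2")
  case True
  have "J = B \<or> J = insert p B \<or> J = insert q B \<or> J = insert p (insert q B)"
   unfolding B_def by auto
  thus ?thesis using goal_B[OF True] by blast
 next
  case False
  thus ?thesis unfolding perm_swap by (simp add: R_factor_eq rop_def Let_def)
 qed
qed

end

lemma Bij_precompose:
 assumes "bij \<sigma>"
 shows "(\<Sum>g\<in>Bij I K. F (%i. if i \<in> \<sigma> ` I then g (inv \<sigma> i) else undefined)) = (\<Sum>g\<in>Bij (\<sigma> ` I) (K :: 'a set). F g)"
proof (rule sum.reindex_bij_witness[of _ "%g i. if i \<in> I then g (\<sigma> i) else undefined" "%g i. if i \<in> \<sigma> ` I then g (inv \<sigma> i) else undefined"])
 have [simp]: "inv \<sigma> (\<sigma> a) = a" for a using assms by (simp add: bij_is_inj)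
 have bs: "bij_betw \<sigma> I (\<sigma> ` I)" "bij_betw (inv \<sigma>) (\<sigma> ` I) I"
  using bij_betw_subset[OF assms subset_UNIV refl, of I] bij_betw_inv_into_subset[OF assms subset_UNIV, of I] by auto
 fix g assume g: "g \<in> Bij I K"
 thus "(%i. if i \<in> I then (if \<sigma> i \<in> \<sigma> ` I then g (inv \<sigma> (\<sigma> i)) else undefined) else undefined) = g"
  by (intro ext) (auto simp: Bij_def extensional_def)
 have "bij_betw (g \<circ> inv \<sigma>) (\<sigma> ` I) K" using g bs(2) by (auto simp: Bij_def intro: bij_betw_trans)
 hence "bij_betw (%i. if i \<in> \<sigma> ` I then g (inv \<sigma> i) else undefined) (\<sigma> ` I) K"
  by (rule iffD1[OF bij_betw_cong, rotated]) auto
 thus "(%i. if i \<in> \<sigma> ` I then g (inv \<sigma> i) else undefined) \<in> Bij (\<sigma> ` I) K"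
  by (auto simp: Bij_def extensional_def)
next
 have [simp]: "\<sigma> (inv \<sigma> a) = a" "inv \<sigma> (\<sigma> a) = a" for a using assms by (simp_all add: bij_is_inj bij_is_surj surj_f_inv_f)
 have bs: "bij_betw \<sigma> I (\<sigma> ` I)"
  using bij_betw_subset[OF assms subset_UNIV refl, of I] by auto
 fix g assume g: "g \<in> Bij (\<sigma> ` I) K"
 thus "(%i. if i \<in> \<sigma> ` I then (if inv \<sigma> i \<in> I then g (\<sigma> (inv \<sigma> i)) else undefined) else undefined) = g"
  by (intro ext) (auto simp: Bij_def extensional_def)
 have "bij_betw (g \<circ> \<sigma>) I K" using g bs by (auto simp: Bij_def intro: bij_betw_trans)
 hence "bij_betw (%i. if i \<in> I then g (\<sigma> i) else undefined) I K"
  by (rule iffD1[OF bij_betw_cong, rotated]) auto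
 thus "(%i. if i \<in> I then g (\<sigma> i) else undefined) \<in> Bij I K"
  by (auto simp: Bij_def extensional_def)
qed simp

lemma Bij_postcompose:
 assumes "bij \<sigma>"
 shows "(\<Sum>g\<in>Bij I K. F (%i. if i \<in> I then \<sigma> (g i) else undefined)) = (\<Sum>g\<in>Bij I (\<sigma> ` K :: 'a set). F g)"
proof (rule sum.reindex_bij_witness[of _ "%g i. if i \<in> I then inv \<sigma> (g i) else undefined" "%g i. if i \<in> I then \<sigma> (g i) else undefined"])
 have [simp]: "inv \<sigma> (\<sigma> a) = a" for a using assms by (simp add: bij_is_inj)
 have bs: "bij_betw \<sigma> K (\<sigma> ` K)" 
  using bij_betw_subset[OF assms subset_UNIV refl, of K] by auto
 fix g assume g: "g \<in> Bij I K"
 thus "(%i. if i \<in> I then inv \<sigma> (if i \<in> I then \<sigma> (g i) else undefined) else undefined) = g"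
  by (intro ext) (auto simp: Bij_def extensional_def)
 have "bij_betw (\<sigma> \<circ> g) I (\<sigma> ` K)" using g bs by (auto simp: Bij_def intro: bij_betw_trans)
 hence "bij_betw (%i. if i \<in> I then \<sigma> (g i) else undefined) I (\<sigma> ` K)"
  by (rule iffD1[OF bij_betw_cong, rotated]) auto
 thus "(%i. if i \<in> I then \<sigma> (g i) else undefined) \<in> Bij I (\<sigma> ` K)"
  by (auto simp: Bij_def extensional_def)
next
 have [simp]: "\<sigma> (inv \<sigma> a) = a" for a using assms by (simp add: bij_is_surj surj_f_inv_f)
 have bs: "bij_betw (inv \<sigma>) (\<sigma> ` K) K" 
  using bij_betw_inv_into_subset[OF assms subset_UNIV, of K] by auto
 fix g assume g: "g \<in> Bij I (\<sigma> ` K)"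
 thus "(%i. if i \<in> I then \<sigma> (if i \<in> I then inv \<sigma> (g i) else undefined) else undefined) = g"
  by (intro ext) (auto simp: Bij_def extensional_def)
 have "bij_betw (inv \<sigma> \<circ> g) I K" using g bs by (auto simp: Bij_def intro: bij_betw_trans)
 hence "bij_betw (%i. if i \<in> I then inv \<sigma> (g i) else undefined) I K"
  by (rule iffD1[OF bij_betw_cong, rotated]) auto
 thus "(%i. if i \<in> I then inv \<sigma> (g i) else undefined) \<in> Bij I K"
  by (auto simp: Bij_def extensional_def)
qed simp

lemma foldr_intertwine:
 assumes "\<And>a u. a \<in> set xs ==> f a (g u) = g (f' a u)"
 shows "foldr f xs (g u) = g (foldr f' xs u)"
 using assms by (induction xs) auto

lemma sorted_list_adjacent:
 fixes p q :: "'n::{finite,linorder}"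
 assumes "adjacent p q"
 shows "sorted_list_of_set UNIV = sorted_list_of_set {..<p} @ p # q # sorted_list_of_set {q<..}"
proof (rule sorted_distinct_set_unique)
 note a = adjacent_less[OF assms]
 show "sorted (sorted_list_of_set {..<p} @ p # q # sorted_list_of_set {q<..})"
  using a(1) by (auto simp: sorted_append)
 show "distinct (sorted_list_of_set {..<p} @ p # q # sorted_list_of_set {q<..})"
  using a(1) by auto
 have "b < p \<or> b = p \<or> b = q \<or> q < b" for b using a(4)[of b] by (metis linorder_neqE)
 thus "set (sorted_list_of_set UNIV) = set (sorted_list_of_set {..<p} @ p # q # sorted_list_of_set {q<..})"
  by (simp, intro equalityI subsetI) auto
qed auto

lemma wcount_bound: "\<bar>wcount (a :: 'n::{finite,linorder}) J\<bar> \<le> int CARD('n)"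
proof -
 have "ncount a J \<le> CARD('n)" "ncount a (- J) \<le> CARD('n)" unfolding ncount_def by (auto intro: card_mono)
 thus ?thesis unfolding wcount_def by linarith
qed

definition Lmap :: "complex => complex => ('n::{finite,linorder}) pt => (nat => 'n set => complex) => nat => 'n set => complex" where
 "Lmap \<tau> w x = foldr (R_factor \<tau> w x) (sorted_list_of_set UNIV)"

definition basis_vec :: "nat => 'n set => nat => 'n set => complex" where
 "basis_vec j I = (%j' I'. if j' = j \<and> I' = I then 1 else 0)"

lemma Lcoeff_Lmap: "Lcoeff \<tau> i j w x I K = Lmap \<tau> w x (basis_vec j I) i K"
 by (simp add: Lcoeff_def Lmap_def basis_vec_def)

lemma Lmap_lincomb:
 "Lmap \<tau> w x (%j I. c * u j I + d * v j I) = (%i K. c * Lmap \<tau> w x u i K + d * Lmap \<tau> w x v i K)"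
proof -
 have R: "R_factor \<tau> w x a (%j I. c * u j I + d * v j I) = (%i K. c * R_factor \<tau> w x a u i K + d * R_factor \<tau> w x a v i K)" for a u v
  by (cases x) (simp add: R_factor_def sum.distrib sum_distrib_left algebra_simps fun_eq_iff)
 have "foldr (R_factor \<tau> w x) xs (%j I. c * u j I + d * v j I)
  = (%i K. c * foldr (R_factor \<tau> w x) xs u i K + d * foldr (R_factor \<tau> w x) xs v i K)" for xs
  by (induction xs) (simp_all add: R)
 thus ?thesis unfolding Lmap_def .
qed

section \<open>Exchange relations at regular points\<close>

context spectral
begin

lemma wval_cong:
 assumes "\<And>i. i \<in> I ==> t i = t' i"
 shows "wval I t x = wval I t' x"
proof -
 obtain z y l where x: "x = (z, y, l)" by (metis prod_cases3)
 have "(\<Prod>i\<in>I. wfac \<tau> I i (t i) x) = (\<Prod>i\<in>I. wfac \<tau> I i (t' i) x)"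
  using assms by (intro prod.cong) auto
 moreover have "wpairs \<tau> y I t = wpairs \<tau> y I t'" using assms by (rule wpairs_cong)
 ultimately show ?thesis unfolding wval_def x wterm_eq by simp
qed

text \<open>The conditions under which no denominator met below vanishes. Since |w(a, J)| \<le> n,
  the margin 2 leaves room for the neighbouring multiples of y.\<close>

definition regular :: "('n::{finite,linorder}) pt => bool" where
 "regular x \<longleftrightarrow> (\<forall>a b. a \<noteq> b \<longrightarrow> th (x$$a - x$$b) \<noteq> 0 \<and> th (x$$a - x$$b + fst (snd x)) \<noteq> 0)
  \<and> (\<forall>a. th (x$$a + fst (snd x) - w) \<noteq> 0)
  \<and> (\<forall>j. \<bar>j\<bar> \<le> int CARD('n) + 2 \<longrightarrow> th (snd (snd x) + of_int j * fst (snd x)) \<noteq> 0)"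

lemma regular_generic: "eventually (regular :: ('n::{finite,linorder}) pt => bool) generic"
proof -
 have 1: "eventually (%x :: 'n pt. a \<noteq> b \<longrightarrow> th (x$$a - x$$b) \<noteq> 0) generic" for a b
 proof (cases "a = b")
  case False
  have "th (x$$a - x$$b) = 0 \<longleftrightarrow> thf (Diff {a, b}) x = 0" for x
   using theta_minus[of "x$$a - x$$b"] by (auto simp: min_def max_def)
  thus ?thesis using thf_generic[of "Diff {a, b}"] False by simp
 qed auto
 have 2: "eventually (%x :: 'n pt. a \<noteq> b \<longrightarrow> th (x$$a - x$$b + fst (snd x)) \<noteq> 0) generic" for a b
  using thf_generic[of "DiffY a b"] by (cases "a = b") auto
 have 3: "eventually (%x :: 'n pt. th (x$$a + fst (snd x) - w) \<noteq> 0) generic" for a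
  using thf_generic[of "Spec a"] by simp
 have 4: "eventually (%x :: 'n pt. th (snd (snd x) + of_int j * fst (snd x)) \<noteq> 0) generic" for j
  using thf_generic[of "Dyn j"] by simp
 have 5: "{j. \<bar>j\<bar> \<le> int CARD('n) + 2} = {- (int CARD('n) + 2)..int CARD('n) + 2}" by auto
 have "eventually (%x :: 'n pt. \<forall>j\<in>{j. \<bar>j\<bar> \<le> int CARD('n) + 2}. th (snd (snd x) + of_int j * fst (snd x)) \<noteq> 0) generic"
  using 4 unfolding 5 by (intro eventually_ball_finite) auto
 hence "eventually (%x :: 'n pt. \<forall>j. \<bar>j\<bar> \<le> int CARD('n) + 2 \<longrightarrow> th (snd (snd x) + of_int j * fst (snd x)) \<noteq> 0) generic"
  by simp
 thus ?thesis
  unfolding regular_def using 1 2 3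
  by (intro eventually_conj eventually_all_finite) (auto simp: imp_conjR eventually_conj_iff)
qed

lemma regularD:
 assumes "regular x"
 shows "a \<noteq> b ==> th (x$$a - x$$b) \<noteq> 0" "a \<noteq> b ==> th (x$$a - x$$b + fst (snd x)) \<noteq> 0"
  "a \<noteq> b ==> th (x$$a - x$$b - fst (snd x)) \<noteq> 0"
  "th (x$$a + fst (snd x) - w) \<noteq> 0" "th (w - x$$a - fst (snd x)) \<noteq> 0"
proof -
 show *: "a \<noteq> b ==> th (x$$a - x$$b) \<noteq> 0" "th (x$$a + fst (snd x) - w) \<noteq> 0" for a b
  using assms by (auto simp: regular_def)
 show **: "a \<noteq> b ==> th (x$$a - x$$b + fst (snd x)) \<noteq> 0" for a b
  using assms by (auto simp: regular_def)
 show "th (x$$a - x$$b - fst (snd x)) \<noteq> 0" if "a \<noteq> b"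
  using **[of b a] that theta_minus[of "x$$b - x$$a + fst (snd x)"] by (simp add: algebra_simps)
 show "th (w - x$$a - fst (snd x)) \<noteq> 0"
  using *(2)[of a] theta_minus[of "x$$a + fst (snd x) - w"] by (simp add: algebra_simps)
qed

lemma regular_dyn:
 fixes x :: "('n::{finite,linorder}) pt"
 assumes "regular x" "\<bar>j\<bar> \<le> int CARD('n) + 2"
 shows "th (snd (snd x) + of_int j * fst (snd x)) \<noteq> 0" "th (snd (snd x) - of_int j * fst (snd x)) \<noteq> 0"
 using assms(1)[unfolded regular_def, THEN conjunct2, THEN conjunct2, rule_format, OF assms(2)]
  assms(1)[unfolded regular_def, THEN conjunct2, THEN conjunct2, rule_format, of "- j"] assms(2) by auto

lemma regular_wcount:
 fixes z :: "complex ^ 'n::{finite,linorder}" and a :: 'n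
 assumes "regular (z, y, l)"
 shows "th (l - of_int (wcount a J) * y) \<noteq> 0" "th (l - of_int (wcount a J) * y - y) \<noteq> 0" "th (l - of_int (wcount a J) * y + y) \<noteq> 0"
 using regular_dyn(2)[OF assms, of "wcount a J"] regular_dyn(2)[OF assms, of "wcount a J + 1"]
  regular_dyn(2)[OF assms, of "wcount a J - 1"] wcount_bound[of a J]
 by (auto simp: algebra_simps)

text \<open>\<open>rop\<close> commutes past the sites above q, then the Yang-Baxter equation
  carries it past q and p, then it commutes past the sites below p. The dynamical parameter contains
  the weight \<open>- eps i\<close> of factor 0 until factor 0 has crossed q and p; afterwards h is
  0.\<close>

lemma Lmap_exchange:
 fixes p q :: "'n::{finite,linorder}" and x :: "'n pt"
 assumes pq: "adjacent p q" and x: "regular x"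
 shows "Lmap \<tau> w x (rop \<tau> p q (%i. - eps i) x u) = rop \<tau> p q (%_. 0) x (Lmap \<tau> w (perm (swap p q) x) u)"
proof -
 obtain z y l where xe: "x = (z, y, l)" by (metis prod_cases3)
 note a = adjacent_less[OF pq]
 note r = x[unfolded xe]
 let ?x' = "perm (swap p q) x"
 have 1: "foldr (R_factor \<tau> w x) (sorted_list_of_set {q<..}) (rop \<tau> p q (%i. - eps i) x v)
   = rop \<tau> p q (%i. - eps i) x (foldr (R_factor \<tau> w ?x') (sorted_list_of_set {q<..}) v)" for v
 proof (rule foldr_intertwine[where g = "rop \<tau> p q (%i. - eps i) x"])
  fix b u assume "b \<in> set (sorted_list_of_set {q<..})"
  hence b: "q < b" "b \<noteq> p" "b \<noteq> q" using a(1) by auto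
  show "R_factor \<tau> w x b (rop \<tau> p q (%i. - eps i) x u) = rop \<tau> p q (%i. - eps i) x (R_factor \<tau> w ?x' b u)"
   unfolding xe by (rule rop_commute[OF pq b(2,3)]) (use b in \<open>simp add: eps_def\<close>)
 qed
 have 2: "foldr (R_factor \<tau> w x) (sorted_list_of_set {..<p}) (rop \<tau> p q (%_. 0) x v)
   = rop \<tau> p q (%_. 0) x (foldr (R_factor \<tau> w ?x') (sorted_list_of_set {..<p}) v)" for v
 proof (rule foldr_intertwine[where g = "rop \<tau> p q (%_. 0) x"])
  fix b u assume "b \<in> set (sorted_list_of_set {..<p})"
  hence b: "\<not> q < b" "b \<noteq> p" "b \<noteq> q" using a(1) by auto
  show "R_factor \<tau> w x b (rop \<tau> p q (%_. 0) x u) = rop \<tau> p q (%_. 0) x (R_factor \<tau> w ?x' b u)"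
   unfolding xe by (rule rop_commute[OF pq b(2,3)]) (use b in simp)
 qed
 have 3: "R_factor \<tau> w x p (R_factor \<tau> w x q (rop \<tau> p q (%i. - eps i) x v))
   = rop \<tau> p q (%_. 0) x (R_factor \<tau> w ?x' p (R_factor \<tau> w ?x' q v))" for v
  unfolding xe using regularD(5)[OF r] regularD(3)[OF r a(2)] regular_wcount[OF r]
  by (intro rop_yang_baxter[OF pq]) (auto simp: eps_def)
 show ?thesis
  unfolding Lmap_def sorted_list_adjacent[OF pq] by (simp add: 1 2 3)
qed

text \<open>The relation holds for each bijection separately unless both sites belong to I; then a
  bijection has to be paired with its composite with the swap.\<close>

lemma stab_exchange:
 fixes p q :: "'n::{finite,linorder}" and x :: "'n pt" and I K :: "'n set"
 assumes pq: "adjacent p q" and reg: "regular x" and card: "card I = card K"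
 defines "L \<equiv> snd (snd x) - of_int (wcount q I) * fst (snd x)" and "\<zeta> \<equiv> x$$p - x$$q"
 shows "stb I (swap p q ` K) (perm (swap p q) x) =
  rdiag \<tau> \<zeta> (fst (snd x)) L (p \<in> I) (q \<in> I) * stb I K x
  + roff \<tau> \<zeta> (fst (snd x)) L (p \<in> I) (q \<in> I) * stb (swap p q ` I) K x"
proof -
 obtain z y l where xe: "x = (z, y, l)" by (metis prod_cases3)
 note r = reg[unfolded xe]
 define \<sigma> where "\<sigma> = swap p q"
 have inv: "inv \<sigma> = \<sigma>" and bij: "bij \<sigma>" by (simp_all add: \<sigma>_def)
 have ss: "\<sigma> (\<sigma> a) = a" for a by (simp add: \<sigma>_def)
 note a = adjacent_less[OF pq]
 define J where "J = I - {p, q}"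
 have J: "J \<inter> {p, q} = {}" by (auto simp: J_def)
 have sJ: "\<sigma> j = j" if "j \<in> J" for j using that by (auto simp: J_def \<sigma>_def Transposition.transpose_def)
 have sw: "\<sigma> ` insert p J = insert q J" "\<sigma> ` insert q J = insert p J" "\<sigma> ` insert p (insert q J) = insert p (insert q J)"
  unfolding \<sigma>_def using swap_image_simps[of p J q] J by auto
 have sp: "\<sigma> p = q" "\<sigma> q = p" by (simp_all add: \<sigma>_def)
 have wJ: "wcount q J = wcount q I" by (rule wcount_above[OF pq]) (auto simp: J_def)
 have Le: "L = l - of_int (wcount q J) * y" and ze: "\<zeta> = z$p - z$q"
  unfolding L_def \<zeta>_def wJ xe by simp_all
 have nz: "th (l - of_int (wcount q J) * y) \<noteq> 0" "th (l - of_int (wcount q J) * y - y) \<noteq> 0" "th (l - of_int (wcount q J) * y + y) \<noteq> 0"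
  "th (z$p - z$q - y) \<noteq> 0"
  using regular_wcount[OF r] regularD(3)[OF r a(2)] by auto
 have cK: "card I = card (\<sigma> ` K)" "card (\<sigma> ` I) = card K" using card card_image[OF inj_on_subset[OF bij_is_inj[OF bij]]] by auto
 have cong: "wval I' t v = wval I' t' v" if "\<And>i. i \<in> I' ==> t i = t' i" for I' :: "'n set" and t t' v
  using that by (rule wval_cong)
 have S1: "stb I (\<sigma> ` K) (perm \<sigma> x) = (\<Sum>g\<in>Bij I K. wval I (%i. z$g i) (perm \<sigma> x))"
  unfolding stab_wval[OF cK(1)] Bij_postcompose[OF bij, symmetric]
  by (intro sum.cong refl cong) (simp add: xe fst_perm_nth[OF bij])
 have S2: "stb (\<sigma> ` I) K x = (\<Sum>g\<in>Bij I K. wval (\<sigma> ` I) (%i. z$g (\<sigma> i)) x)"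
  unfolding stab_wval[OF cK(2)] Bij_precompose[OF bij, symmetric]
  by (intro sum.cong refl cong) (simp add: xe inv)
 have S3: "stb I K x = (\<Sum>g\<in>Bij I K. wval I (%i. z$g i) x)"
  unfolding stab_wval[OF card] by (simp add: xe)
 have np: "p \<noteq> q" "q \<noteq> p" using a by auto
 consider "p \<notin> I" "q \<notin> I" | "p \<in> I" "q \<notin> I" | "p \<notin> I" "q \<in> I" | "p \<in> I" "q \<in> I" by blast
 thus ?thesis
 proof cases
  case 1
  hence "J = I" by (auto simp: J_def)
  thus ?thesis using 1 wval_none[OF pq J nz]
   unfolding \<sigma>_def[symmetric] S1 S3 by (simp add: rdiag_def roff_def xe \<sigma>_def)
 next
  case 2
  hence I: "I = insert p J" by (auto simp: J_def)
  hence I2: "\<sigma> ` I = insert q J" using sw by simp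
  have "wval I (%i. z$g i) (perm \<sigma> x) = be \<zeta> y L * wval I (%i. z$g i) x
    + al \<zeta> y (- L) * wval (\<sigma> ` I) (%i. z$g (\<sigma> i)) x" for g
   unfolding I2 unfolding I xe Le ze
   using wval_exchange_p[OF pq J nz, of "%i. z$g (\<sigma> i)" "%i. z$g i"] sJ sp by (simp add: \<sigma>_def)
  thus ?thesis
   using 2 unfolding \<sigma>_def[symmetric] S1 S2 S3 by (simp add: rdiag_def roff_def sum.distrib sum_distrib_left xe)
 next
  case 3
  hence I: "I = insert q J" by (auto simp: J_def)
  hence I2: "\<sigma> ` I = insert p J" using sw by simp
  have "wval I (%i. z$g i) (perm \<sigma> x) = al \<zeta> y L * wval (\<sigma> ` I) (%i. z$g (\<sigma> i)) x
    + be \<zeta> y (- L) * wval I (%i. z$g i) x" for g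
   unfolding I2 unfolding I xe Le ze
   using wval_exchange_q[OF pq J nz, of "%i. z$g (\<sigma> i)" "%i. z$g i"] sJ sp by (simp add: \<sigma>_def)
  thus ?thesis
   using 3 unfolding \<sigma>_def[symmetric] S1 S2 S3 by (simp add: rdiag_def roff_def sum.distrib sum_distrib_left xe)
 next
  case 4
  hence I: "I = insert p (insert q J)" by (auto simp: J_def)
  hence I2: "\<sigma> ` I = I" using sw by simp
  \<comment> \<open>Composition with the swap permutes the bijections, so the paired terms count
    every bijection twice; this is the factor 2 below.\<close>
  have pair: "(\<Sum>g\<in>Bij I K. wval I (%i. z$g (\<sigma> i)) v) = (\<Sum>g\<in>Bij I K. wval I (%i. z$g i) v)" for v
  proof -
   have "(\<Sum>g\<in>Bij I K. wval I (%i. z$g i) v) = (\<Sum>g\<in>Bij (\<sigma> ` I) K. wval I (%i. z$g i) v)" by (simp add: I2)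
   also have "\<dots> = (\<Sum>g\<in>Bij I K. wval I (%i. z$g (\<sigma> i)) v)"
    unfolding Bij_precompose[OF bij, symmetric] by (intro sum.cong refl cong) (simp add: inv I2)
   finally show ?thesis by simp
  qed
  have e: "wval I (%i. z$g i) (perm \<sigma> x) + wval I (%i. z$g (\<sigma> i)) (perm \<sigma> x)
    = wval I (%i. z$g i) x + wval I (%i. z$g (\<sigma> i)) x" if g: "g \<in> Bij I K" for g
  proof -
   have "inj_on g I" using g by (auto simp: Bij_def bij_betw_def)
   hence "g p \<noteq> g q" using 4 np by (auto dest: inj_onD)
   thus ?thesis
    unfolding I xe \<sigma>_def using regularD(1,2)[OF r]
    by (intro wval_exchange_both[OF pq J]) (use sJ in \<open>auto simp: \<sigma>_def\<close>)
  qed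
  have "2 * (\<Sum>g\<in>Bij I K. wval I (%i. z$g i) (perm \<sigma> x)) = 2 * (\<Sum>g\<in>Bij I K. wval I (%i. z$g i) x)"
   using sum.cong[OF refl e, of "Bij I K" "%g. g"] unfolding sum.distrib pair by simp
  thus ?thesis unfolding \<sigma>_def[symmetric] S1 S3 using 4 by (simp add: rdiag_def roff_def)
 qed
qed

end

lemma shift_perm: "shift \<nu> (perm \<sigma> x) = perm \<sigma> (shift \<nu> x)"
 by (cases x) (simp add: shift_def perm_def)

lemma sum_image_sets:
 fixes \<sigma> :: "'n::finite => 'n"
 assumes "bij \<sigma>"
 shows "(\<Sum>K | card K = k. F (\<sigma> ` K)) = (\<Sum>K | card K = k. F K)"
proof (rule sum.reindex_bij_witness[of _ "%K. inv \<sigma> ` K" "%K. \<sigma> ` K"])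
 have i: "inj \<sigma>" "surj \<sigma>" "inj (inv \<sigma>)" using assms by (auto simp: bij_is_inj bij_is_surj bij_imp_bij_inv)
 fix K :: "'n set"
 show "inv \<sigma> ` \<sigma> ` K = K" "\<sigma> ` inv \<sigma> ` K = K" using i by (auto simp: image_inv_f_f image_f_inv_f)
 show "\<sigma> ` K \<in> {K. card K = k}" if "K \<in> {K. card K = k}"
  using that i by (simp add: card_image inj_on_subset)
 show "inv \<sigma> ` K \<in> {K. card K = k}" if "K \<in> {K. card K = k}"
  using that i by (simp add: card_image inj_on_subset)
qed simp

lemma (in spectral) regular_perm: "bij \<sigma> ==> regular (perm \<sigma> x) \<longleftrightarrow> regular (x :: 'n::{finite,linorder} pt)"
proof -
 have *: "regular (perm \<sigma> x)" if "regular x" "bij \<sigma>" for \<sigma> :: "'n => 'n" and x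
 proof -
  have "bij (inv \<sigma>)" using that(2) by (rule bij_imp_bij_inv)
  hence "a \<noteq> b ==> inv \<sigma> a \<noteq> inv \<sigma> b" for a b by (metis bij_is_inj injD)
  thus ?thesis using that unfolding regular_def perm_def by (cases x) auto
 qed
 show "bij \<sigma> ==> regular (perm \<sigma> x) \<longleftrightarrow> regular x"
  using *[of x \<sigma>] *[of "perm \<sigma> x" "inv \<sigma>"] by (auto simp: bij_imp_bij_inv)
qed

lemma (in spectral) stab_diag_nonzero:
 fixes x :: "'n::{finite,linorder} pt"
 assumes "regular x"
 shows "stab \<tau> I I x \<noteq> 0"
proof -
 obtain z y l where x: "x = (z, y, l)" by (metis prod_cases3)
 note r = assms[unfolded x]
 have p: "psi \<tau> I y l \<noteq> 0"
  unfolding psi_generic_form using regular_wcount[OF r] by (auto simp: algebra_simps)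
 have d: "i \<in> I ==> j \<in> I ==> i < j ==> th (z$i - z$j) \<noteq> 0 \<and> th (z$j - z$i + y) \<noteq> 0" for i j
  using regularD(1,2)[OF r] by auto
 have nz: "a < b ==> th (z$a - z$b) \<noteq> 0" "a < b ==> th (z$b - z$a + y) \<noteq> 0" for a b
  using regularD(1,2)[OF r] by auto
 have "stab \<tau> I I (z, y, l) \<noteq> 0"
  using p regular_wcount(1)[OF r] nz by (subst stab_diag) (use d in auto)
 thus ?thesis by (simp add: x)
qed

section \<open>Symmetry of the operator\<close>

text \<open>M is computed from the defining relation alone. The line bundles of the entries enter
  only through \<open>image_automorphy\<close>.\<close>

locale quantum_entry = spectral +
 fixes i j :: nat and M :: "('n::{finite,linorder}) set => 'n set => 'n pt => complex"
 assumes ij: "i \<in> {1, 2}" "j \<in> {1, 2}"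
  and relation: "\<And>I K. int (card K) = int (card I) + (int i - int j) ==>
   (GEN x. (\<Sum>K' | card K' = card I. M K K' x * stab \<tau> I K' (shift (eps j) x))
    = (\<Sum>K'' | card K'' = card K. Lcoeff \<tau> i j w x I K'' * stab \<tau> K'' K x))"
begin

abbreviation "Lc \<equiv> Lcoeff \<tau> i j w"

abbreviation op_stab :: "'n set => 'n set => 'n pt => complex" where
 "op_stab I K x \<equiv> (\<Sum>K' | card K' = card I. M K K' x * stb I K' (shift (eps j) x))"

abbreviation L_stab :: "'n set => 'n set => 'n pt => complex" where
 "L_stab I K x \<equiv> (\<Sum>K'' | card K'' = card K. Lcoeff \<tau> i j w x I K'' * stb K'' K x)"

definition good :: "'n pt => bool" where
 "good x \<longleftrightarrow> regular x \<and> regular (shift (eps j) x) \<and>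
  (\<forall>I K. int (card K) = int (card I) + (int i - int j) \<longrightarrow>
   op_stab I K x
    = L_stab I K x)"

lemma good_generic: "eventually good generic"
proof -
 have "GEN x. int (card K) = int (card I) + (int i - int j) \<longrightarrow>
   op_stab I K x
    = L_stab I K x" for I K
  using relation[of K I] by (cases "int (card K) = int (card I) + (int i - int j)") auto
 thus ?thesis
  unfolding good_def by (intro eventually_conj eventually_all_finite regular_generic generic_shift[OF regular_generic])
qed

lemma goodD:
 assumes "good x"
 shows "regular x" "regular (shift (eps j) x)"
  "int (card K) = int (card I) + (int i - int j) ==>
   op_stab I K x
    = L_stab I K x"
 using assms unfolding good_def by blast+

text \<open>Swapping the sites transforms the left side of the relation by
  \<open>stab_exchange\<close> at the shifted point and the right side by
  \<open>Lmap_exchange\<close>, with the same coefficients. So the swapped row minus the original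
  one is orthogonal to every column of the stable envelope matrix, and \<open>stab_unique\<close>
  applies.\<close>

lemma M_swap_adjacent:
 assumes pq: "adjacent p q" and card: "int (card K) = int (card K') + (int i - int j)"
  and x: "good x" "good (perm (swap p q) x)"
 shows "M (swap p q ` K) (swap p q ` K') (perm (swap p q) x) = M K K' x"
proof -
 define \<sigma> where "\<sigma> = swap p q"
 have bij: "bij \<sigma>" and ss: "\<sigma> ` \<sigma> ` A = A" for A :: "'n set" by (simp_all add: \<sigma>_def image_comp)
 have cs: "card (\<sigma> ` A) = card A" for A by (intro card_image inj_on_subset[OF bij_is_inj[OF bij]]) simp
 define sx where "sx = shift (eps j) x"
 define A where "A K' = M (\<sigma> ` K) (\<sigma> ` K') (perm \<sigma> x) - M K K' x" for K'
 define \<zeta> where "\<zeta> = x$$p - x$$q"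
 define y where "y = fst (snd x)"
 have sx: "fst sx = fst x" "fst (snd sx) = y" "snd (snd sx) = snd (snd x) + of_int (eps j) * y"
  unfolding sx_def y_def by (cases x; simp add: shift_def)+
 have wq: "wcount q (\<sigma> ` J) = wcount q J" for J
 proof (rule wcount_above[OF pq])
  show "a \<noteq> p ==> a \<noteq> q ==> (a \<in> \<sigma> ` J) = (a \<in> J)" for a
   unfolding \<sigma>_def using swap_image_insert_other(3)[of a p q J] by auto
 qed simp
 have mem: "p \<in> \<sigma> ` J \<longleftrightarrow> q \<in> J" "q \<in> \<sigma> ` J \<longleftrightarrow> p \<in> J" for J
  unfolding \<sigma>_def by (simp_all add: swap_image_mem)
 define c d where "c h J = rdiag \<tau> \<zeta> y (snd (snd x) - of_int (wcount q J + h) * y) (p \<in> J) (q \<in> J)"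
  and "d h J = roff \<tau> \<zeta> y (snd (snd x) - of_int (wcount q J + h) * y) (p \<in> J) (q \<in> J)" for h J
 have ex: "stb J (\<sigma> ` K) (perm \<sigma> x) = c 0 J * stb J K x + d 0 J * stb (\<sigma> ` J) K x"
  if "card J = card K" for J K
  using stab_exchange[OF pq goodD(1)[OF x(1)] that] by (simp add: \<sigma>_def c_def d_def \<zeta>_def y_def)
 \<comment> \<open>Shifting lambda by \<open>eps j\<close> times y amounts to replacing w(q, J) by
   w(q, J) - \<open>eps j\<close>. This is exactly the parameter h at which \<open>rop\<close> acts
   on the input vector.\<close>
 have exs: "stb J (\<sigma> ` K) (perm \<sigma> sx) = c (- eps j) J * stb J K sx + d (- eps j) J * stb (\<sigma> ` J) K sx"
  if "card J = card K" for J K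
  using stab_exchange[OF pq goodD(2)[OF x(1)] that] sx
  unfolding sx_def[symmetric] by (simp add: \<sigma>_def c_def d_def \<zeta>_def algebra_simps)
 have rop: "rop \<tau> p q h x u a J = c (h a) J * u a J + d (h a) (\<sigma> ` J) * u a (\<sigma> ` J)" for h u a J
  by (cases x) (simp add: rop_def c_def d_def \<zeta>_def y_def Let_def wq mem \<sigma>_def[symmetric])
 have ropb: "rop \<tau> p q (%i. - eps i) x (basis_vec j I) = (%a J. c (- eps j) I * basis_vec j I a J + d (- eps j) I * basis_vec j (\<sigma> ` I) a J)" for I
 proof -
  have "\<sigma> ` J = I \<longleftrightarrow> J = \<sigma> ` I" for J using ss by metis
  thus ?thesis unfolding rop basis_vec_def by (simp add: fun_eq_iff ss)
 qed
 have A0: "(\<Sum>K' | card K' = card I. A K' * stb I (\<sigma> ` K') (perm \<sigma> sx)) = 0" if cI: "card I = card K'" for I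
 proof -
  have cKI: "int (card K) = int (card I) + (int i - int j)" "int (card (\<sigma> ` K)) = int (card I) + (int i - int j)"
   "int (card K) = int (card (\<sigma> ` I)) + (int i - int j)"
   using cI card cs by auto
  define v where "v = Lmap \<tau> w (perm \<sigma> x) (basis_vec j I) i"
  have "(\<Sum>K' | card K' = card I. M (\<sigma> ` K) (\<sigma> ` K') (perm \<sigma> x) * stb I (\<sigma> ` K') (perm \<sigma> sx))
   = (\<Sum>K' | card K' = card I. M (\<sigma> ` K) K' (perm \<sigma> x) * stb I K' (shift (eps j) (perm \<sigma> x)))"
   unfolding sum_image_sets[OF bij, of "%K'. M (\<sigma> ` K) K' (perm \<sigma> x) * stb I K' (perm \<sigma> sx)"]
   by (simp add: shift_perm sx_def)
  also have "\<dots> = (\<Sum>J | card J = card K. v J * stb J (\<sigma> ` K) (perm \<sigma> x))"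
   using goodD(3)[OF x(2)[folded \<sigma>_def] cKI(2)] by (simp add: cs Lcoeff_Lmap v_def)
  also have "\<dots> = (\<Sum>J | card J = card K. v J * (c 0 J * stb J K x + d 0 J * stb (\<sigma> ` J) K x))"
   by (intro sum.cong refl) (simp add: ex)
  also have "\<dots> = (\<Sum>J | card J = card K. v J * c 0 J * stb J K x) + (\<Sum>J | card J = card K. v J * d 0 J * stb (\<sigma> ` J) K x)"
   by (simp add: sum.distrib[symmetric] algebra_simps)
  also have "(\<Sum>J | card J = card K. v J * d 0 J * stb (\<sigma> ` J) K x) = (\<Sum>J | card J = card K. v (\<sigma> ` J) * d 0 (\<sigma> ` J) * stb J K x)"
   using sum_image_sets[OF bij, of "%J. v J * d 0 J * stb (\<sigma> ` J) K x" "card K"] by (simp add: ss)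
  also have "(\<Sum>J | card J = card K. v J * c 0 J * stb J K x) + \<dots>
   = (\<Sum>J | card J = card K. rop \<tau> p q (%_. 0) x (Lmap \<tau> w (perm \<sigma> x) (basis_vec j I)) i J * stb J K x)"
   unfolding rop v_def[symmetric] sum.distrib[symmetric] by (intro sum.cong) (auto simp: algebra_simps)
  also have "\<dots> = (\<Sum>J | card J = card K. Lmap \<tau> w x (rop \<tau> p q (%i. - eps i) x (basis_vec j I)) i J * stb J K x)"
   unfolding \<sigma>_def Lmap_exchange[OF pq goodD(1)[OF x(1)]] ..
  also have "\<dots> = c (- eps j) I * (\<Sum>J | card J = card K. Lc x I J * stb J K x)
    + d (- eps j) I * (\<Sum>J | card J = card K. Lc x (\<sigma> ` I) J * stb J K x)"
   unfolding ropb Lmap_lincomb Lcoeff_Lmap sum_distrib_left sum.distrib[symmetric] by (intro sum.cong) (auto simp: algebra_simps)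
  also have "\<dots> = c (- eps j) I * (\<Sum>K' | card K' = card I. M K K' x * stb I K' sx)
    + d (- eps j) I * (\<Sum>K' | card K' = card I. M K K' x * stb (\<sigma> ` I) K' sx)"
   using goodD(3)[OF x(1) cKI(1)] goodD(3)[OF x(1) cKI(3)] by (simp add: cs sx_def)
  also have "\<dots> = (\<Sum>K' | card K' = card I. M K K' x * stb I (\<sigma> ` K') (perm \<sigma> sx))"
   unfolding sum_distrib_left sum.distrib[symmetric] by (intro sum.cong refl) (simp add: exs algebra_simps)
  finally show ?thesis unfolding A_def by (simp add: left_diff_distrib sum_subtractf)
 qed
 have "A (\<sigma> ` (\<sigma> ` K')) = 0"
 proof (rule stab_unique[of "card K'" "perm \<sigma> sx" "%J. A (\<sigma> ` J)"])
  show "stb I I (perm \<sigma> sx) \<noteq> 0" for I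
   using goodD(2)[OF x(1)] by (intro stab_diag_nonzero) (simp add: regular_perm[OF bij] sx_def)
  show "(\<Sum>K | card K = card K'. A (\<sigma> ` K) * stb I K (perm \<sigma> sx)) = 0" if "card I = card K'" for I
   using A0[OF that] sum_image_sets[OF bij, of "%K. A (\<sigma> ` K) * stb I K (perm \<sigma> sx)" "card K'"] that by (simp add: ss)
 qed (simp add: cs)
 thus ?thesis unfolding ss A_def by (simp add: \<sigma>_def)
qed

definition symmetric_under :: "('n => 'n) => bool" where
 "symmetric_under \<sigma> \<longleftrightarrow> bij \<sigma> \<and> (\<forall>K K'. int (card K) = int (card K') + (int i - int j) \<longrightarrow>
   (GEN x. M (\<sigma> ` K) (\<sigma> ` K') (perm \<sigma> x) = M K K' x))"

lemma symmetric_under_comp: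
 assumes "symmetric_under \<sigma>" "symmetric_under \<rho>"
 shows "symmetric_under (\<sigma> \<circ> \<rho>)"
 unfolding symmetric_under_def
proof (intro conjI allI impI)
 have b: "bij \<sigma>" "bij \<rho>" using assms by (auto simp: symmetric_under_def)
 thus "bij (\<sigma> \<circ> \<rho>)" by (rule bij_comp[rotated])
 fix K K' :: "'n set" assume c: "int (card K) = int (card K') + (int i - int j)"
 have cs: "card (\<rho> ` A) = card A" for A by (intro card_image inj_on_subset[OF bij_is_inj[OF b(2)]]) simp
 have 1: "GEN x. M (\<rho> ` K) (\<rho> ` K') (perm \<rho> x) = M K K' x"
  using assms(2) c by (auto simp: symmetric_under_def)
 have "GEN x. M (\<sigma> ` \<rho> ` K) (\<sigma> ` \<rho> ` K') (perm \<sigma> x) = M (\<rho> ` K) (\<rho> ` K') x"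
  using assms(1) c cs unfolding symmetric_under_def by auto
 from generic_perm[OF this b(2)] 1
 show "GEN x. M ((\<sigma> \<circ> \<rho>) ` K) ((\<sigma> \<circ> \<rho>) ` K') (perm (\<sigma> \<circ> \<rho>) x) = M K K' x"
  by eventually_elim (simp add: perm_perm[OF b] image_comp)
qed

lemma symmetric_under_adjacent:
 assumes "adjacent p q" shows "symmetric_under (swap p q)"
 unfolding symmetric_under_def
proof (intro conjI allI impI)
 fix K K' :: "'n set" assume c: "int (card K) = int (card K') + (int i - int j)"
 have "bij (swap p q)" by simp
 from good_generic generic_perm[OF good_generic this]
 show "GEN x. M (swap p q ` K) (swap p q ` K') (perm (swap p q) x) = M K K' x"
  by eventually_elim (rule M_swap_adjacent[OF assms c])
qed simp

text \<open>A transposition of distant sites is a shorter one conjugated by an adjacent one.\<close>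

lemma symmetric_under_swap:
 assumes "p < q" shows "symmetric_under (swap p q)"
 using assms
proof (induction "rk q" arbitrary: q rule: less_induct)
 case less
 show ?case
 proof (cases "adjacent p q")
  case False
  define c where "c = Max {a. a < q}"
  have fin: "finite {a. a < q}" "{a. a < q} \<noteq> {}" using less.prems by auto
  have c: "c < q" "\<And>a. a < q ==> a \<le> c" using Max_in[OF fin] Max_ge[OF fin(1)] by (auto simp: c_def)
  hence cq: "adjacent c q" unfolding adjacent_def by (meson leD)
  hence "p \<noteq> c" using False by auto
  hence pc: "p < c" using c(2)[OF less.prems] by simp
  have e: "swap p q = swap c q \<circ> (swap p c \<circ> swap c q)"
   using pc c(1) by (auto simp: fun_eq_iff Transposition.transpose_def)
  show ?thesis unfolding e
   using less.hyps[of c] pc c(1) symmetric_under_adjacent[OF cq] by (intro symmetric_under_comp) auto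
 qed (rule symmetric_under_adjacent)
qed

lemma symmetric_under_bij:
 assumes "bij \<sigma>" shows "symmetric_under \<sigma>"
proof -
 have "\<sigma> permutes UNIV" using assms by (intro bij_imp_permutes) auto
 from this finite_class.finite_UNIV show ?thesis
 proof (induction rule: permutes_induct)
  case id
  show ?case using bij_id by (simp add: symmetric_under_def id_def)
 next
  case (swap a b p)
  have "symmetric_under (swap a b)"
  proof (cases a b rule: linorder_cases)
   case equal
   thus ?thesis by (simp add: symmetric_under_def)
  next
   case greater
   thus ?thesis using symmetric_under_swap[of b a] by (simp add: transpose_commute)
  qed (rule symmetric_under_swap)
  thus ?case using swap by (intro symmetric_under_comp)
 qed
qed

lemma M_perm:
 assumes "bij \<sigma>" "int (card K) = int (card K') + (int i - int j)"
 shows "GEN x. M (\<sigma> ` K) (\<sigma> ` K') (perm \<sigma> x) = M K K' x"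
 using symmetric_under_bij[OF assms(1)] assms(2) unfolding symmetric_under_def by blast

end

text \<open>
 Reading the sites from left to right, the vector \<open>v\<^sub>i \<otimes> v\<^sub>K\<close> determines at each site whether the state of
 factor 0 changes, so every matrix entry of the product of \<open>R\<close>-matrices is a single product.
\<close>

primrec path :: "complex => complex => ('n::{finite,linorder}) pt => nat => 'n set => 'n set => nat => 'n list => complex" where
 "path \<tau> w x j I K i [] = (if i = j then 1 else 0)"
| "path \<tau> w x j I K i (a # as) =
  (let v = w - x$$a; y = fst (snd x); L = snd (snd x) - of_int (wcount a K) * y in
   if i = 1 then
    (if a \<in> K then (if a \<in> I then path \<tau> w x j I K 1 as else 0)
    else if a \<in> I then beta \<tau> v y L * path \<tau> w x j I K 2 as
    else alpha \<tau> v y L * path \<tau> w x j I K 1 as)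
   else if i = 2 then
    (if a \<in> K then (if a \<in> I then alpha \<tau> v y (- L) * path \<tau> w x j I K 2 as
            else beta \<tau> v y (- L) * path \<tau> w x j I K 1 as)
    else if a \<in> I then 0 else path \<tau> w x j I K 2 as)
   else 0)"

text \<open>Outside \<open>as\<close> no site has been touched, so J has to agree with I there. The
  list contains every site above each of its members, where J already agrees with K, and so the
  dynamical parameter may be written with \<open>wcount a K\<close>.\<close>

lemma foldr_path:
 fixes as :: "('n::{finite,linorder}) list"
 assumes "sorted_wrt (<) as" "\<And>a b. a \<in> set as ==> a < b ==> b \<in> set as"
  "\<And>a. a \<in> set as ==> a \<in> J \<longleftrightarrow> a \<in> K" "i \<in> {1, 2}"
 shows "foldr (R_factor \<tau> w x) as (basis_vec j I) i J = (if \<forall>a. a \<notin> set as \<longrightarrow> (a \<in> J \<longleftrightarrow> a \<in> I) then path \<tau> w x j I K i as else 0)"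
 using assms
proof (induction as arbitrary: i J)
 case Nil
 thus ?case by (auto simp: basis_vec_def)
next
 case (Cons a as)
 obtain z y l where x: "x = (z, y, l)" by (metis prod_cases3)
 have "wcount a J = wcount a K"
 proof -
  have "{b. b > a} \<subseteq> set as" using Cons.prems(1) Cons.prems(2)[of a] by auto
  hence "b > a ==> b \<in> J \<longleftrightarrow> b \<in> K" for b using Cons.prems(3)[of b] by auto
  thus ?thesis unfolding wcount_eq by (intro sum.cong) auto
 qed
 have na: "a \<notin> set as" using Cons.prems(1) by auto
 have up: "\<And>c b. c \<in> set as ==> c < b ==> b \<in> set as"
  using Cons.prems(1,2) by (metis dual_order.strict_trans list.set_intros(2) order_less_irrefl set_ConsD sorted_wrt.simps(2))
 have IH: "foldr (R_factor \<tau> w x) as (basis_vec j I) i' J'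
   = (if \<forall>a. a \<notin> set as \<longrightarrow> (a \<in> J' \<longleftrightarrow> a \<in> I) then path \<tau> w x j I K i' as else 0)"
  if "i' \<in> {1, 2}" "J' - {a} = J - {a}" for i' J'
 proof (rule Cons.IH)
  show "sorted_wrt (<) as" using Cons.prems(1) by simp
  show "b \<in> J' \<longleftrightarrow> b \<in> K" if b: "b \<in> set as" for b
   using Cons.prems(3)[of b] b na \<open>J' - {a} = J - {a}\<close> by (metis Diff_iff list.set_intros(2) singletonD)
 qed (use up that in auto)
 have aK: "a \<in> J \<longleftrightarrow> a \<in> K" using Cons.prems(3) by simp
 have P: "(\<forall>b. b \<notin> set as \<longrightarrow> (b \<in> J' \<longleftrightarrow> b \<in> I)) \<longleftrightarrow>
   (a \<in> J' \<longleftrightarrow> a \<in> I) \<and> (\<forall>b. b \<notin> set (a # as) \<longrightarrow> (b \<in> J \<longleftrightarrow> b \<in> I))" if "J' - {a} = J - {a}" for J'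
 proof -
  have "b \<noteq> a ==> b \<in> J' \<longleftrightarrow> b \<in> J" for b using that by blast
  thus ?thesis using na by (metis list.set_intros(1) list.set_intros(2) set_ConsD)
 qed
 have IH': "foldr (R_factor \<tau> w x) as (basis_vec j I) i' J'
   = (if (a \<in> J' \<longleftrightarrow> a \<in> I) \<and> (\<forall>b. b \<notin> set (a # as) \<longrightarrow> (b \<in> J \<longleftrightarrow> b \<in> I)) then path \<tau> w x j I K i' as else 0)"
  if "i' \<in> {1, 2}" "J' - {a} = J - {a}" for i' J'
  unfolding IH[OF that] P[OF that(2)] ..
 have e: "foldr (R_factor \<tau> w x) (a # as) (basis_vec j I) i J = R_factor \<tau> w x a (foldr (R_factor \<tau> w x) as (basis_vec j I)) i J"
  by simp
 define u where "u = foldr (R_factor \<tau> w x) as (basis_vec j I)"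
 define Q where "Q \<longleftrightarrow> (\<forall>b. b \<notin> set (a # as) \<longrightarrow> (b \<in> J \<longleftrightarrow> b \<in> I))"
 have u: "u 1 J = (if (a \<in> J \<longleftrightarrow> a \<in> I) \<and> Q then path \<tau> w x j I K 1 as else 0)"
  "u 2 J = (if (a \<in> J \<longleftrightarrow> a \<in> I) \<and> Q then path \<tau> w x j I K 2 as else 0)"
  "u 2 (insert a J) = (if a \<in> I \<and> Q then path \<tau> w x j I K 2 as else 0)"
  "u 1 (J - {a}) = (if a \<notin> I \<and> Q then path \<tau> w x j I K 1 as else 0)"
  unfolding u_def Q_def by (subst IH', simp, blast, simp)+
 show ?case
  unfolding e Q_def[symmetric] u_def[symmetric] unfolding x R_factor_eq unfolding x[symmetric] Let_def \<open>wcount a J = wcount a K\<close> aK path.simps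
  using Cons.prems(4) u aK by (auto simp: x simp del: One_nat_def)
qed

lemma Lcoeff_path:
 fixes x :: "('n::{finite,linorder}) pt"
 assumes "i \<in> {1, 2}"
 shows "Lcoeff \<tau> i j w x I K = path \<tau> w x j I K i (sorted_list_of_set UNIV)"
proof -
 have "foldr (R_factor \<tau> w x) (sorted_list_of_set UNIV) (basis_vec j I) i K = path \<tau> w x j I K i (sorted_list_of_set UNIV)"
  by (subst foldr_path[of _ K K]) (use assms in auto)
 thus ?thesis by (simp add: Lcoeff_Lmap Lmap_def)
qed

text \<open>In the convenient pairs I, K = I - B \<union> C at most the first site leaves and at
  most the last site enters. Extremal sites cannot be moved further by dominance, which isolates one
  term of the relation.\<close>

abbreviation bottom_set :: "'n::order set => bool" where
 "bottom_set B \<equiv> B = {} \<or> (\<exists>b. B = {b} \<and> (\<forall>a. b \<le> a))"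

abbreviation top_set :: "'n::order set => bool" where
 "top_set C \<equiv> C = {} \<or> (\<exists>c. C = {c} \<and> (\<forall>a. a \<le> c))"

section \<open>Poles of the matrix entries\<close>

abbreviation yv :: "('n::finite) pt => complex" where "yv x \<equiv> fst (snd x)"
abbreviation lv :: "('n::finite) pt => complex" where "lv x \<equiv> snd (snd x)"

definition decreasing_bij :: "('n::linorder) set => 'n set => ('n => 'n) set" where
 "decreasing_bij I K = {f \<in> Bij I K. \<forall>i\<in>I. f i \<le> i}"

text \<open>The stable envelope without psi, hence without its poles in lambda.\<close>

definition stabnum :: "complex => ('n::{finite,linorder}) set => 'n set => 'n pt => complex" where
 "stabnum \<tau> I K x = (\<Sum>f\<in>decreasing_bij I K. wterm \<tau> I (%i. x$$f i) x)"

definition diff_forms :: "'n set => ('n::finite) form multiset" where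
 "diff_forms K = image_mset Diff (mset_set {S. S \<subseteq> K \<and> card S = 2})"

lemma wcount_rk:
 fixes I :: "'n::{finite,linorder} set"
 shows "wcount a I = 2 * int (card {b\<in>I. b > a}) - (int CARD('n) - 1 - int (rk a))"
proof -
 have "{b. b > a} = {b\<in>I. b > a} \<union> {b\<in>- I. b > a}" by auto
 hence c: "card {b. b > a} = card {b\<in>I. b > a} + card {b\<in>- I. b > a}"
  by (metis (no_types, lifting) ComplD Int_emptyI card_Un_disjoint finite mem_Collect_eq)
 have "(UNIV :: 'n set) = {b. b < a} \<union> insert a {b. b > a}" by auto
 hence "CARD('n) = card ({b. b < a} \<union> insert a {b. b > a})" by simp
 also have "\<dots> = card {b. b < a} + card (insert a {b. b > a})" by (rule card_Un_disjoint) auto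
 also have "\<dots> = rk a + Suc (card {b. b > a})" by (simp add: rk_def)
 finally show ?thesis using c by (simp add: wcount_def ncount_def)
qed

context modulus
begin

lemma stab_stabnum:
 assumes "card I = card K"
 shows "stb I K x = stabnum \<tau> I K x / psi \<tau> I (yv x) (lv x)"
 using stab_eq_decreasing[OF assms, of "fst x" "yv x" "lv x"] by (simp add: stabnum_def decreasing_bij_def)

end

context spectral
begin

lemma valid_diff_forms: "p \<in># diff_forms K ==> valid_form p"
 by (auto simp: diff_forms_def)

lemma thf_Diff: "thf (Diff {a, b}) x = th (x$$a - x$$b) \<or> thf (Diff {a, b}) x = - th (x$$a - x$$b)"
 using theta_minus[of "x$$a - x$$b"] by (auto simp: min_def max_def)

lemma thf_Diff_cases:
 "(\<forall>x. thf (Diff {a, b}) x = th (x$$a - x$$b)) \<or> (\<forall>x. thf (Diff {a, b}) x = - th (x$$a - x$$b))"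
 using theta_minus[of "_$$a - _$$b"] by (cases "a \<le> b") (auto simp: min_def max_def)

lemma poles_uminus: "poles A f ==> poles A (%x. - f x)"
 using poles_mult_holo[of A f "%_. - 1"] by (simp add: holo_const)

lemma poles_inverse_Diff:
 assumes "a \<noteq> b" shows "poles {#Diff {a, b}#} (%x. inverse (th (x$$a - x$$b)))"
proof -
 have "poles {#Diff {a, b}#} (%x. inverse (thf (Diff {a, b}) x))" using assms by (intro poles_inverse_thf) simp
 moreover from this have "poles {#Diff {a, b}#} (%x. - inverse (thf (Diff {a, b}) x))" by (rule poles_uminus)
 ultimately show ?thesis using thf_Diff_cases[of a b] by auto
qed

lemma poles_inverse_Spec: "poles {#Spec a#} (%x. inverse (th (w - x$$a - yv x)))"
proof -
 have "poles {#Spec a#} (%x. - inverse (thf (Spec a) x))" by (intro poles_uminus poles_inverse_thf) simp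
 moreover have "- inverse (thf (Spec a) x) = inverse (th (w - x$$a - yv x))" for x
  using theta_minus[of "x$$a + yv x - w"] by (simp add: algebra_simps)
 ultimately show ?thesis by simp
qed

lemma poles_inverse_Dyn: "poles {#Dyn j#} (%x. inverse (th (lv x + of_int j * yv x)))"
 using poles_inverse_thf[of "Dyn j"] by simp

lemma poles_inverse_Dyn': "poles {#Dyn (- j)#} (%x. inverse (th (lv x - of_int j * yv x)))"
 using poles_inverse_Dyn[of "- j"] by simp

lemma poles_inverse_prod_Diff:
 assumes "finite P" "\<And>a b. (a, b) \<in> P ==> a \<noteq> b"
 shows "poles (image_mset (%(a, b). Diff {a, b}) (mset_set P)) (%x. inverse (\<Prod>(a, b)\<in>P. th (x$$a - x$$b)))"
proof -
 have 1: "poles (\<Sum>ab\<in>P. {#Diff {fst ab, snd ab}#}) (%x. \<Prod>ab\<in>P. inverse (th (x$$fst ab - x$$snd ab)))"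
  using assms(2) by (intro poles_prod poles_inverse_Diff) auto
 have 2: "(\<Sum>ab\<in>P. {#Diff {fst ab, snd ab}#}) = image_mset (%(a, b). Diff {a, b}) (mset_set P)"
  using assms(1) by (induction P) (auto simp: case_prod_beta)
 show ?thesis using 1 unfolding 2 by (simp add: prod_inversef[symmetric] case_prod_beta comp_def)
qed

definition reduced :: "('n => 'n) => ('n::{finite,linorder}) set => 'n pt => complex" where
 "reduced f I x = (\<Prod>i\<in>I. (\<Prod>a | a < i \<and> a \<notin> f ` {j\<in>I. j < i}. th (x$$f i - x$$a + yv x))
   * th (lv x + x$$f i - x$$i - of_int (wcount i I) * yv x) * (\<Prod>a | a > i. th (x$$f i - x$$a)))"

lemma reduced_holo [holo_intros]: "holo_on (reduced f I) U"
 unfolding reduced_def by (intro holo_intros)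

text \<open>For i < j a decreasing f has f i \<le> i < j, so th (z_{f j} - z_{f i} + y) from the
  denominator also occurs in the numerator. Only the differences z_{f i} - z_{f j} remain as
  denominators.\<close>

lemma wterm_reduced:
 assumes f: "f \<in> decreasing_bij I K" and x: "regular x"
 shows "wterm \<tau> I (%i. x$$f i) x = reduced f I x / (\<Prod>(i, j)\<in>pairs I. th (x$$f i - x$$f j))"
proof -
 obtain z y l where xe: "x = (z, y, l)" by (metis prod_cases3)
 let ?P = "(pairs I)"
 have inj: "inj_on f I" and dec: "\<And>i. i \<in> I ==> f i \<le> i" using f by (auto simp: decreasing_bij_def Bij_def bij_betw_def)
 have nz: "th (z$f j - z$f i + y) \<noteq> 0" if "i \<in> I" "j \<in> I" "i < j" for i j
 proof -
  have "f j \<noteq> f i" using inj that by (metis inj_onD less_irrefl)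
  thus ?thesis using regularD(2)[OF x, of "f j" "f i"] by (simp add: xe)
 qed
 have split: "(\<Prod>a | a < i. th (z$f i - z$a + y)) = (\<Prod>a | a < i \<and> a \<notin> f ` {j\<in>I. j < i}. th (z$f i - z$a + y)) * (\<Prod>j | j \<in> I \<and> j < i. th (z$f i - z$f j + y))"
  if i: "i \<in> I" for i
 proof -
  have sub: "f ` {j\<in>I. j < i} \<subseteq> {a. a < i}" using dec by (auto intro: le_less_trans)
  have "(\<Prod>a | a < i. th (z$f i - z$a + y)) = (\<Prod>a\<in>{a. a < i} - f ` {j\<in>I. j < i}. th (z$f i - z$a + y)) * (\<Prod>a\<in>f ` {j\<in>I. j < i}. th (z$f i - z$a + y))"
   by (rule prod.subset_diff[OF sub]) simp
  moreover have "{a. a < i} - f ` {j\<in>I. j < i} = {a. a < i \<and> a \<notin> f ` {j\<in>I. j < i}}" by auto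
  moreover have "(\<Prod>a\<in>f ` {j\<in>I. j < i}. th (z$f i - z$a + y)) = (\<Prod>j | j \<in> I \<and> j < i. th (z$f i - z$f j + y))"
   using inj by (subst prod.reindex) (auto intro: inj_on_subset)
  ultimately show ?thesis by simp
 qed
 have D: "(\<Prod>i\<in>I. \<Prod>j | j \<in> I \<and> j < i. th (z$f i - z$f j + y)) = (\<Prod>(i, j)\<in>?P. th (z$f j - z$f i + y))"
 proof -
  have "(\<Prod>i\<in>I. \<Prod>j | j \<in> I \<and> j < i. th (z$f i - z$f j + y)) = (\<Prod>(i, j)\<in>Sigma I (%i. {j. j \<in> I \<and> j < i}). th (z$f i - z$f j + y))"
   by (rule prod.Sigma) auto
  also have "\<dots> = (\<Prod>(i, j)\<in>?P. th (z$f j - z$f i + y))"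
   by (rule prod.reindex_bij_witness[of _ "%(i, j). (j, i)" "%(i, j). (j, i)"]) auto
  finally show ?thesis .
 qed
 have Dn: "(\<Prod>(i, j)\<in>?P. th (z$f j - z$f i + y)) \<noteq> 0" using nz by (auto simp: case_prod_beta)
 have "(\<Prod>i\<in>I. (\<Prod>a | a < i. th (z$f i - z$a + y)) * th (l + z$f i - z$i - of_int (wcount i I) * y) * (\<Prod>a | a > i. th (z$f i - z$a)))
  = reduced f I x * (\<Prod>(i, j)\<in>?P. th (z$f j - z$f i + y))"
  unfolding D[symmetric] reduced_def prod.distrib[symmetric] xe fst_conv snd_conv
  by (intro prod.cong refl) (simp add: split mult_ac)
 moreover have "(\<Prod>(i, j)\<in>?P. th (z$f i - z$f j) * th (z$f j - z$f i + y))
   = (\<Prod>(i, j)\<in>?P. th (z$f i - z$f j)) * (\<Prod>(i, j)\<in>?P. th (z$f j - z$f i + y))"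
  by (simp add: prod.distrib[symmetric] case_prod_beta)
 ultimately show ?thesis using Dn unfolding wterm_def xe by simp
qed

lemma poles_wterm:
 assumes f: "f \<in> decreasing_bij I K"
 shows "poles (diff_forms K) (%x. wterm \<tau> I (%i. x$$f i) x)"
proof -
 let ?P = "(pairs I)"
 have inj: "inj_on f I" and im: "f ` I = K" using f by (auto simp: decreasing_bij_def Bij_def bij_betw_def)
 have ne: "f i \<noteq> f j" if "(i, j) \<in> ?P" for i j using that inj by (auto dest: inj_onD)
 define Q where "Q = (%(i, j). (f i, f j)) ` ?P"
 have injQ: "inj_on (%(i, j). (f i, f j)) ?P" using inj by (auto simp: inj_on_def)
 \<comment> \<open>By injectivity of f no pair occurs in both orders, so each diagonal is at most a
   simple pole.\<close>
 have asym: "(b, a) \<notin> Q" if ab: "(a, b) \<in> Q" for a b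
 proof
  assume "(b, a) \<in> Q"
  then obtain i' j' where 1: "b = f i'" "a = f j'" "i' \<in> I" "j' \<in> I" "i' < j'" by (auto simp: Q_def)
  obtain i j where 2: "a = f i" "b = f j" "i \<in> I" "j \<in> I" "i < j" using ab by (auto simp: Q_def)
  have "i = j'" "j = i'" using inj_onD[OF inj, of i j'] inj_onD[OF inj, of j i'] 1 2 by auto
  thus False using 1(5) 2(5) by simp
 qed
 have injD: "inj_on (%(a, b). {a, b}) Q"
  using asym by (auto simp: inj_on_def doubleton_eq_iff)
 have imQ: "(%(a, b). {a, b}) ` Q = {S. S \<subseteq> K \<and> card S = 2}"
 proof (intro equalityI subsetI)
  fix S assume "S \<in> (%(a, b). {a, b}) ` Q"
  thus "S \<in> {S. S \<subseteq> K \<and> card S = 2}" using im ne by (auto simp: Q_def card_2_iff)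
 next
  fix S assume "S \<in> {S. S \<subseteq> K \<and> card S = 2}"
  then obtain a b where "S = {a, b}" "a \<noteq> b" "a \<in> K" "b \<in> K" by (auto simp: card_2_iff)
  then obtain i j where ij: "i \<in> I" "j \<in> I" "i \<noteq> j" "S = {f i, f j}" using im by blast
  show "S \<in> (%(a, b). {a, b}) ` Q"
  proof (cases "i < j")
   case True
   thus ?thesis using ij unfolding Q_def by force
  next
   case False
   hence "(j, i) \<in> ?P" using ij by auto
   thus ?thesis using ij(4) unfolding Q_def by (force simp: insert_commute)
  qed
 qed
 have e: "diff_forms K = image_mset (%(a, b). Diff {a, b}) (mset_set Q)"
  unfolding diff_forms_def imQ[symmetric] image_mset_mset_set[OF injD, symmetric] multiset.map_comp by (intro image_mset_cong) auto
 have "poles (diff_forms K) (%x. reduced f I x * inverse (\<Prod>(a, b)\<in>Q. th (x$$a - x$$b)))"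
  unfolding e using ne by (intro poles_mult_holo poles_inverse_prod_Diff holo_intros) (auto simp: Q_def)
 moreover have "(\<Prod>(a, b)\<in>Q. th (x$$a - x$$b)) = (\<Prod>(i, j)\<in>?P. th (x$$f i - x$$f j))" for x :: "'a pt"
  unfolding Q_def by (subst prod.reindex[OF injQ]) (simp add: case_prod_beta)
 ultimately have "poles (diff_forms K) (%x. reduced f I x / (\<Prod>(i, j)\<in>?P. th (x$$f i - x$$f j)))"
  by (simp add: divide_inverse)
 moreover have "GEN x. reduced f I x / (\<Prod>(i, j)\<in>?P. th (x$$f i - x$$f j)) = wterm \<tau> I (%i. x$$f i) x"
  using regular_generic by eventually_elim (use wterm_reduced[OF f] in simp)
 ultimately show ?thesis by (rule poles_cong)
qed

lemma poles_stabnum: "poles (diff_forms K) (stabnum \<tau> I K)"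
proof -
 have "poles (diff_forms K) (%x. \<Sum>f\<in>decreasing_bij I K. wterm \<tau> I (%i. x$$f i) x)"
  by (intro poles_sum poles_wterm)
 thus ?thesis unfolding stabnum_def .
qed

definition diag_factor :: "('n::{finite,linorder}) set => 'n pt => complex" where
 "diag_factor I x = (\<Prod>i\<in>I. (\<Prod>a | a < i \<and> a \<notin> I. th (x$$i - x$$a + yv x)) * (\<Prod>a | a > i \<and> a \<notin> I. th (x$$i - x$$a)))"

lemma diag_factor_nonzero:
 assumes "regular x" shows "diag_factor I x \<noteq> 0"
proof -
 have "a < b ==> th (x$$a - x$$b) \<noteq> 0" "a < b ==> th (x$$b - x$$a + yv x) \<noteq> 0" for a b
  using regularD(1,2)[OF assms] by auto
 thus ?thesis unfolding diag_factor_def by auto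
qed

lemma diag_factor_shift [simp]: "diag_factor I (shift \<nu> x) = diag_factor I x"
 by (cases x) (simp add: diag_factor_def shift_def)

lemma stab_diag_regular:
 assumes "regular x"
 shows "stb I I x = diag_factor I x / (\<Prod>i\<in>I. th (lv x - of_int (wcount i I + 1) * yv x))"
proof -
 obtain z y l where x: "x = (z, y, l)" by (metis prod_cases3)
 note r = assms[unfolded x]
 have "stb I I (z, y, l) = 1 / psi \<tau> I y l * (\<Prod>i\<in>I. th (l - of_int (wcount i I) * y)) * diag_factor I x"
  unfolding diag_factor_def x fst_conv snd_conv using regularD(1,2)[OF r] by (intro stab_diag) auto
 moreover have "(\<Prod>i\<in>I. th (l - of_int (wcount i I) * y)) \<noteq> 0" using regular_wcount(1)[OF r] by simp
 ultimately show ?thesis unfolding psi_generic_form x by (simp add: field_simps)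
qed

lemma poles_alpha:
 "poles {#Spec a, Dyn (- m)#} (%x. al (w - x$$a) (yv x) (lv x - of_int m * yv x))"
 "poles {#Spec a, Dyn (- m)#} (%x. al (w - x$$a) (yv x) (- (lv x - of_int m * yv x)))"
proof -
 have p: "poles {#Spec a, Dyn (- m)#} (%x. inverse (th (w - x$$a - yv x)) * inverse (th (lv x - of_int m * yv x)))"
  using poles_mult[OF poles_inverse_Spec poles_inverse_Dyn'] by (simp add: add_mset_commute)
 have "poles {#Spec a, Dyn (- m)#} (%x. (th (w - x$$a) * th (lv x - of_int m * yv x + yv x)) * (inverse (th (w - x$$a - yv x)) * inverse (th (lv x - of_int m * yv x))))"
  by (intro poles_mult_holo p holo_intros)
 thus "poles {#Spec a, Dyn (- m)#} (%x. al (w - x$$a) (yv x) (lv x - of_int m * yv x))"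
  unfolding alpha_def by (simp add: field_simps)
 have "poles {#Spec a, Dyn (- m)#} (%x. (th (w - x$$a) * th (lv x - of_int m * yv x - yv x)) * (inverse (th (w - x$$a - yv x)) * inverse (th (lv x - of_int m * yv x))))"
  by (intro poles_mult_holo p holo_intros)
 thus "poles {#Spec a, Dyn (- m)#} (%x. al (w - x$$a) (yv x) (- (lv x - of_int m * yv x)))"
  unfolding alpha_minus by (simp add: field_simps)
qed

lemma poles_beta:
 "poles {#Spec a, Dyn (- m)#} (%x. be (w - x$$a) (yv x) (lv x - of_int m * yv x))"
 "poles {#Spec a, Dyn (- m)#} (%x. be (w - x$$a) (yv x) (- (lv x - of_int m * yv x)))"
proof -
 have p: "poles {#Spec a, Dyn (- m)#} (%x. inverse (th (w - x$$a - yv x)) * inverse (th (lv x - of_int m * yv x)))"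
  using poles_mult[OF poles_inverse_Spec poles_inverse_Dyn'] by (simp add: add_mset_commute)
 have "poles {#Spec a, Dyn (- m)#} (%x. (- (th (w - x$$a + (lv x - of_int m * yv x)) * th (yv x))) * (inverse (th (w - x$$a - yv x)) * inverse (th (lv x - of_int m * yv x))))"
  by (intro poles_mult_holo p holo_intros)
 thus "poles {#Spec a, Dyn (- m)#} (%x. be (w - x$$a) (yv x) (lv x - of_int m * yv x))"
  unfolding beta_def by (simp add: field_simps)
 have "poles {#Spec a, Dyn (- m)#} (%x. (th (w - x$$a - (lv x - of_int m * yv x)) * th (yv x)) * (inverse (th (w - x$$a - yv x)) * inverse (th (lv x - of_int m * yv x))))"
  by (intro poles_mult_holo p holo_intros)
 thus "poles {#Spec a, Dyn (- m)#} (%x. be (w - x$$a) (yv x) (- (lv x - of_int m * yv x)))"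
  unfolding beta_minus by (simp add: field_simps)
qed

lemma poles_path:
 "poles (mset (map Spec as) + mset (map (%a. Dyn (- wcount a K)) as)) (%x. path \<tau> w x j I K i as)"
proof (induction as arbitrary: i)
 case Nil
 show ?case by (simp add: poles_holo holo_const)
next
 case (Cons a as)
 have e: "mset (map Spec (a # as)) + mset (map (%a. Dyn (- wcount a K)) (a # as))
  = {#Spec a, Dyn (- wcount a K)#} + (mset (map Spec as) + mset (map (%a. Dyn (- wcount a K)) as))" by simp
 have 0: "poles (mset (map Spec (a # as)) + mset (map (%a. Dyn (- wcount a K)) (a # as))) (%x. path \<tau> w x j I K i' as)" for i'
  unfolding e by (rule poles_mono[OF Cons]) simp
 have z: "poles A (%x. 0 :: complex)" for A :: "'a form multiset" by (rule poles_mono[OF poles_holo[OF holo_const]]) simp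
 note a = poles_mult[OF poles_alpha(1)[of a "wcount a K"] Cons, folded e] poles_mult[OF poles_alpha(2)[of a "wcount a K"] Cons, folded e]
  poles_mult[OF poles_beta(1)[of a "wcount a K"] Cons, folded e] poles_mult[OF poles_beta(2)[of a "wcount a K"] Cons, folded e]
 show ?case unfolding path.simps Let_def using 0 z a
  by (cases "i = 1"; cases "i = 2"; cases "a \<in> K"; cases "a \<in> I") (simp_all del: minus_diff_eq One_nat_def)
qed

definition specs :: "('n::finite) form multiset" where "specs = image_mset Spec (mset_set UNIV)"

lemma valid_specs: "p \<in># specs ==> valid_form p" by (auto simp: specs_def)

text \<open>Position and multiplicity of the dynamical poles are left open, because a second bound
  of the same entry eliminates them.\<close>

lemma poles_Lcoeff:
 fixes I K :: "('n::{finite,linorder}) set"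
 assumes "i \<in> {1, 2}"
 shows "\<exists>A. (\<forall>p\<in>#A. \<exists>m. p = Dyn m) \<and> poles (specs + A) (%x. Lcoeff \<tau> i j w x I K)"
proof -
 have "mset (map Spec (sorted_list_of_set (UNIV :: 'n set))) = specs"
  unfolding specs_def mset_map by (metis finite mset_sorted_list_of_multiset sorted_list_of_mset_set)
 thus ?thesis
  using poles_path[of "sorted_list_of_set UNIV" K j I i] unfolding Lcoeff_path[OF assms]
  by (intro exI[of _ "mset (map (%a. Dyn (- wcount a K)) (sorted_list_of_set UNIV))"]) auto
qed

end

section \<open>Relations for the first k sites\<close>

definition initial :: "('n::linorder) set => bool" where
 "initial I \<longleftrightarrow> (\<forall>a\<in>I. \<forall>b\<in>- I. a < b)"

lemma sorted_list_of_set_Un: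
 fixes A B :: "('n::{finite,linorder}) set"
 assumes "\<And>a b. a \<in> A ==> b \<in> B ==> a < b"
 shows "sorted_list_of_set (A \<union> B) = sorted_list_of_set A @ sorted_list_of_set B"
proof (rule sorted_distinct_set_unique)
 show "sorted (sorted_list_of_set A @ sorted_list_of_set B)"
  using assms by (auto simp: sorted_append less_imp_le)
 show "distinct (sorted_list_of_set A @ sorted_list_of_set B)"
  using assms by force
qed auto

lemma sorted_list_initial:
 assumes "initial (I :: ('n::{finite,linorder}) set)"
 shows "sorted_list_of_set UNIV = sorted_list_of_set I @ sorted_list_of_set (- I)"
 using sorted_list_of_set_Un[of I "- I"] assms by (auto simp: initial_def)

lemma dominated_extremes:
 fixes K K'' :: "('n::{finite,linorder}) set"
 assumes "dominated K K''"
 shows "\<forall>a. b \<le> a ==> b \<in> K'' ==> b \<in> K" "\<forall>a. a \<le> c ==> c \<in> K ==> c \<in> K''"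
proof -
 obtain f where f: "bij_betw f K'' K" "\<forall>i\<in>K''. f i \<le> i" using assms by (auto simp: dominated_def)
 show "b \<in> K" if "\<forall>a. b \<le> a" "b \<in> K''"
  using f that by (metis antisym bij_betwE)
 show "c \<in> K''" if "\<forall>a. a \<le> c" "c \<in> K"
  using f that by (metis antisym bij_betw_imp_surj_on imageE)
qed

text \<open>By \<open>dominated_count\<close> at the last element of I, the dominated set K has at
  least as many elements in I as K''.\<close>

lemma dominated_initial:
 fixes I K K'' :: "('n::{finite,linorder}) set"
 assumes "dominated K K''" "initial I"
 shows "card (I - K) \<le> card (I - K'')" "card (K - I) \<le> card (K'' - I)"
proof -
 have le: "card (K'' \<inter> I) \<le> card (K \<inter> I)"
 proof (cases "I = {}")
  case False
  hence "Max I \<in> I" by simp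
  hence "i \<in> I \<longleftrightarrow> i \<le> Max I" for i
   using assms(2) unfolding initial_def by (metis ComplI Max_ge finite leD)
  hence "K \<inter> I = {i\<in>K. i \<le> Max I}" "K'' \<inter> I = {i\<in>K''. i \<le> Max I}" by auto
  thus ?thesis using dominated_count[OF assms(1), of "Max I"] by simp
 qed simp
 have 1: "card I = card (K \<inter> I) + card (I - K)" "card I = card (K'' \<inter> I) + card (I - K'')"
  by (metis Int_commute card_Int_Diff finite)+
 have 2: "card K = card (K \<inter> I) + card (K - I)" "card K'' = card (K'' \<inter> I) + card (K'' - I)"
  by (metis card_Int_Diff finite)+
 show "card (I - K) \<le> card (I - K'')" "card (K - I) \<le> card (K'' - I)"
  using le 1 2 dominated_card[OF assms(1)] by linarith+
qed

lemma dominated_by_initial: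
 fixes I K :: "('n::{finite,linorder}) set"
 assumes "dominated K I" "initial I" shows "K = I"
 using dominated_initial[OF assms] by auto

context
 fixes \<tau> w :: complex and x :: "('n::{finite,linorder}) pt" and j :: nat and I K :: "'n set"
begin

abbreviation lam :: "'n => complex" where "lam a \<equiv> lv x - of_int (wcount a K) * yv x"

lemma path_2_in: "set as \<subseteq> I ==> path \<tau> w x j I K 2 (as @ bs) \<noteq> 0 ==> set as \<subseteq> K \<and> path \<tau> w x j I K 2 bs \<noteq> 0"
 by (induction as) (auto split: if_splits simp: Let_def)

lemma path_1_in:
 "set as \<subseteq> I ==> distinct as ==> path \<tau> w x j I K 1 (as @ bs) \<noteq> 0 ==>
  set as \<subseteq> K \<and> path \<tau> w x j I K 1 bs \<noteq> 0 \<or> (\<exists>b. set as - K = {b} \<and> path \<tau> w x j I K 2 bs \<noteq> 0)"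
proof (induction as)
 case (Cons a as)
 show ?case
 proof (cases "a \<in> K")
  case True
  thus ?thesis using Cons by (auto simp: Let_def insert_Diff_if)
 next
  case False
  hence "path \<tau> w x j I K 2 (as @ bs) \<noteq> 0" using Cons.prems by (auto simp: Let_def)
  hence "set as \<subseteq> K" "path \<tau> w x j I K 2 bs \<noteq> 0" using path_2_in[of as bs] Cons.prems(1) by auto
  thus ?thesis using False by (intro disjI2 exI[of _ a]) auto
 qed
qed auto

lemma path_1_out: "set bs \<inter> I = {} ==> path \<tau> w x j I K 1 bs \<noteq> 0 ==> set bs \<inter> K = {} \<and> j = 1"
 by (induction bs) (auto split: if_splits simp: Let_def)

lemma path_2_out:
 "set bs \<inter> I = {} ==> distinct bs ==> path \<tau> w x j I K 2 bs \<noteq> 0 ==>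
  set bs \<inter> K = {} \<and> j = 2 \<or> (\<exists>c. set bs \<inter> K = {c}) \<and> j = 1"
proof (induction bs)
 case (Cons a bs)
 show ?case
 proof (cases "a \<in> K")
  case True
  hence "path \<tau> w x j I K 1 bs \<noteq> 0" using Cons.prems by (auto simp: Let_def)
  hence "set bs \<inter> K = {}" "j = 1" using path_1_out[of bs] Cons.prems by auto
  thus ?thesis using True by auto
 qed (use Cons in \<open>auto simp: Let_def\<close>)
qed (auto split: if_splits)

text \<open>On the sites of I factor 0 can only change from 1 to 2, which removes a site; on the
  remaining sites only from 2 to 1, which adds one. So at most one site leaves and at most one
  enters, and i, j decide which of this happens.\<close>

lemma Lcoeff_initial_support:
 assumes "initial I" "i \<in> {1, 2}" "Lcoeff \<tau> i j w x I K \<noteq> 0"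
 shows "i = 2 \<and> j = 2 ==> K = I" "card (I - K) \<le> 1" "card (K - I) \<le> 1" "i = 2 ==> I \<subseteq> K" "j = 2 ==> K \<subseteq> I"
proof -
 let ?as = "sorted_list_of_set I" and ?bs = "sorted_list_of_set (- I)"
 have nz: "path \<tau> w x j I K i (?as @ ?bs) \<noteq> 0"
  using assms(3) unfolding Lcoeff_path[OF assms(2)] sorted_list_initial[OF assms(1)] .
 have s: "set ?as = I" "set ?bs = - I" "set ?bs \<inter> I = {}" "distinct ?as" "distinct ?bs" by auto
 have e: "- I \<inter> K = K - I" by auto
 have P: "(i = 2 \<and> I \<subseteq> K \<or> i = 1 \<and> (\<exists>b. I - K = {b})) \<and> (K - I = {} \<and> j = 2 \<or> (\<exists>c. K - I = {c}) \<and> j = 1)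
   \<or> i = 1 \<and> j = 1 \<and> K = I"
 proof (cases "i = 1")
  case True
  thus ?thesis using path_1_in[of ?as ?bs] path_1_out[of ?bs] path_2_out[of ?bs] nz s e by auto
 next
  case False
  hence "i = 2" using assms(2) by auto
  thus ?thesis using path_2_in[of ?as ?bs] path_2_out[of ?bs] nz s e by auto
 qed
 have c: "I \<subseteq> K ==> card (I - K) = 0" "I - K = {b} ==> card (I - K) = 1" "K - I = {b} ==> card (K - I) = 1"
  "K - I = {} ==> card (K - I) = 0" "K - I = {} ==> K \<subseteq> I" for b
  by (simp_all add: Diff_eq_empty_iff)
 show "i = 2 \<and> j = 2 ==> K = I"
  using P c(5) by auto
 show "card (I - K) \<le> 1" using P c(1,2) by (metis le_numeral_extra(4) order_refl subset_refl zero_le)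
 show "card (K - I) \<le> 1" using P c(3,4) by (metis Diff_cancel le_numeral_extra(4) order_refl zero_le)
 show "i = 2 ==> I \<subseteq> K" using P by auto
 show "j = 2 ==> K \<subseteq> I" using P c(5) by auto
qed

lemma path_2_both: "set as \<subseteq> I \<inter> K ==> distinct as ==>
  path \<tau> w x j I K 2 (as @ bs) = (\<Prod>a\<in>set as. alpha \<tau> (w - x$$a) (yv x) (- lam a)) * path \<tau> w x j I K 2 bs"
 by (induction as) (auto simp: Let_def)

lemma path_2_neither: "set as \<inter> (I \<union> K) = {} ==> path \<tau> w x j I K 2 (as @ bs) = path \<tau> w x j I K 2 bs"
 by (induction as) (auto simp: Let_def)

lemma path_1_both: "set as \<subseteq> I \<inter> K ==> path \<tau> w x j I K 1 (as @ bs) = path \<tau> w x j I K 1 bs"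
 by (induction as) (auto simp: Let_def)

lemma path_1_neither: "set as \<inter> (I \<union> K) = {} ==> distinct as ==>
  path \<tau> w x j I K 1 (as @ bs) = (\<Prod>a\<in>set as. alpha \<tau> (w - x$$a) (yv x) (lam a)) * path \<tau> w x j I K 1 bs"
 by (induction as) (auto simp: Let_def)

text \<open>There is one path: beta where the first site is given up, alpha along the other sites of
  I, factor 1 on the sites that stay empty, beta where the last site is filled.\<close>

lemma Lcoeff_move:
 assumes I: "initial I" and B: "bottom_set B" "B \<subseteq> I"
  and C: "top_set C" "C \<inter> I = {}"
  and K: "K = I - B \<union> C" and ij: "i = (if B = {} then 2 else 1)" "j = (if C = {} then 2 else 1)"
 shows "Lcoeff \<tau> i j w x I K = (\<Prod>b\<in>B. beta \<tau> (w - x$$b) (yv x) (lam b))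
  * (\<Prod>a\<in>I - B. alpha \<tau> (w - x$$a) (yv x) (- lam a)) * (\<Prod>c\<in>C. beta \<tau> (w - x$$c) (yv x) (- lam c))"
proof -
 have "sorted_list_of_set (B \<union> (I - B)) = sorted_list_of_set B @ sorted_list_of_set (I - B)"
  using B by (intro sorted_list_of_set_Un) (auto simp: order.strict_iff_order)
 hence 1: "sorted_list_of_set I = sorted_list_of_set B @ sorted_list_of_set (I - B)"
  using B(2) by (simp add: Un_absorb1)
 have "sorted_list_of_set (- I - C \<union> C) = sorted_list_of_set (- I - C) @ sorted_list_of_set C"
  using C by (intro sorted_list_of_set_Un) (auto simp: order.strict_iff_order)
 moreover have "- I - C \<union> C = - I" using C(2) by auto
 ultimately have 2: "sorted_list_of_set (- I) = sorted_list_of_set (- I - C) @ sorted_list_of_set C" by simp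
 have b: "path \<tau> w x j I K i (sorted_list_of_set B @ as) = (\<Prod>b\<in>B. beta \<tau> (w - x$$b) (yv x) (lam b)) * path \<tau> w x j I K 2 as" for as
  using B(1)
 proof
  assume "\<exists>b. B = {b} \<and> (\<forall>a. b \<le> a)"
  then obtain b where b: "B = {b}" by auto
  hence "b \<in> I" "b \<notin> K" using B(2) C(2) K by auto
  thus ?thesis using ij(1) b by (simp add: Let_def)
 qed (use ij(1) in simp)
 have c: "path \<tau> w x j I K 2 (sorted_list_of_set C) = (\<Prod>c\<in>C. beta \<tau> (w - x$$c) (yv x) (- lam c))"
  using C(1)
 proof
  assume "\<exists>c. C = {c} \<and> (\<forall>a. a \<le> c)"
  then obtain c where c: "C = {c}" by auto
  hence "c \<notin> I" "c \<in> K" using C(2) K by auto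
  thus ?thesis using ij(2) c by (simp add: Let_def)
 qed (use ij(2) in simp)
 have m: "path \<tau> w x j I K 2 (sorted_list_of_set (I - B) @ as) = (\<Prod>a\<in>I - B. alpha \<tau> (w - x$$a) (yv x) (- lam a)) * path \<tau> w x j I K 2 as" for as
  using path_2_both[of "sorted_list_of_set (I - B)" as] by (simp add: K)
 have n: "path \<tau> w x j I K 2 (sorted_list_of_set (- I - C) @ as) = path \<tau> w x j I K 2 as" for as
  by (rule path_2_neither) (auto simp: K)
 have i: "i \<in> {1, 2}" using ij(1) by auto
 show ?thesis
  unfolding Lcoeff_path[OF i] sorted_list_initial[OF I] 1 2 by (simp add: b m n c mult.assoc)
qed

end

context quantum_entry
begin

text \<open>An initial subset dominates only itself, so the left side of the relation is a single
  term.\<close>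

lemma M_initial:
 assumes x: "good x" and I: "initial I" and card: "int (card K) = int (card I) + (int i - int j)"
 shows "M K I x * stb I I (shift (eps j) x) = L_stab I K x"
proof -
 have "op_stab I K x = (\<Sum>K'\<in>{I}. M K K' x * stb I K' (shift (eps j) x))"
 proof (rule sum.mono_neutral_right)
  show "\<forall>K'\<in>{K'. card K' = card I} - {I}. M K K' x * stb I K' (shift (eps j) x) = 0"
  proof
   fix K' assume K': "K' \<in> {K'. card K' = card I} - {I}"
   hence "\<not> dominated K' I" using dominated_by_initial[OF _ I] by blast
   thus "M K K' x * stb I K' (shift (eps j) x) = 0" using K' stab_eq_0[of I K'] by simp
  qed
 qed auto
 thus ?thesis using goodD(3)[OF x card] by simp
qed

lemma M_initial_zero:
 assumes x: "good x" and I: "initial I" and card: "int (card K) = int (card I) + (int i - int j)" and nz: "M K I x \<noteq> 0"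
 shows "i = 2 \<and> j = 2 ==> K = I" "card (I - K) \<le> 1" "card (K - I) \<le> 1"
proof -
 have "L_stab I K x \<noteq> 0"
  using M_initial[OF x I card] nz stab_diag_nonzero[OF goodD(2)[OF x]] by auto
 then obtain K'' where K'': "card K'' = card K" "Lc x I K'' \<noteq> 0" "stb K'' K x \<noteq> 0"
  by (auto elim: sum.not_neutral_contains_not_neutral)
 hence d: "dominated K K''" using stab_eq_0 by blast
 note s = Lcoeff_initial_support[OF I ij(1) K''(2)]
 show "card (I - K) \<le> 1" "card (K - I) \<le> 1" using dominated_initial[OF d I] s by linarith+
 show "K = I" if "i = 2 \<and> j = 2" using s(1)[OF that] dominated_by_initial[OF d] I by simp
qed

text \<open>A contributing K'' dominates K and differs from I by at most one removed and one added
  site. Dominance keeps the first site out of K'' if K lacks it, and keeps the last site in K'' if K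
  has it, which forces K'' = K.\<close>

lemma M_initial_move:
 assumes x: "good x" and I: "initial I" and B: "bottom_set B" "B \<subseteq> I"
  and C: "top_set C" "C \<inter> I = {}"
  and K: "K = I - B \<union> C" and ij': "i = (if B = {} then 2 else 1)" "j = (if C = {} then 2 else 1)"
 shows "M K I x * stb I I (shift (eps j) x) = Lc x I K * stb K K x"
proof -
 have cB: "card B \<le> 1" "card C \<le> 1" "card B = (if B = {} then 0 else 1)" "card C = (if C = {} then 0 else 1)" using B(1) C(1) by auto
 have "card K = card (I - B) + card C" unfolding K using C(2) by (intro card_Un_disjoint) auto
 moreover have "card (I - B) = card I - card B" "card B \<le> card I" using B(2) by (auto intro: card_Diff_subset card_mono finite_subset)
 ultimately have card: "int (card K) = int (card I) + (int i - int j)" using cB ij' by auto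
 have "L_stab I K x = (\<Sum>K''\<in>{K}. Lc x I K'' * stb K'' K x)"
 proof (rule sum.mono_neutral_right)
  show "\<forall>K''\<in>{K''. card K'' = card K} - {K}. Lc x I K'' * stb K'' K x = 0"
  proof (rule ballI, rule ccontr)
   fix K'' assume K'': "K'' \<in> {K''. card K'' = card K} - {K}" "Lc x I K'' * stb K'' K x \<noteq> 0"
   hence d: "dominated K K''" using stab_eq_0[of K'' K x] by auto
   have nz: "Lc x I K'' \<noteq> 0" using K'' by auto
   note s = Lcoeff_initial_support[OF I ij(1) nz]
   have 1: "B \<inter> K'' = {}"
    using B(1)
   proof
    assume "\<exists>b. B = {b} \<and> (\<forall>a. b \<le> a)"
    then obtain b where b: "B = {b}" "\<forall>a. b \<le> a" by auto
    hence "b \<notin> K" using B(2) C(2) K by auto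
    thus ?thesis using dominated_extremes(1)[OF d b(2)] b by auto
   qed auto
   have 2: "C \<subseteq> K''"
    using C(1)
   proof
    assume "\<exists>c. C = {c} \<and> (\<forall>a. a \<le> c)"
    then obtain c where c: "C = {c}" "\<forall>a. a \<le> c" by auto
    hence "c \<in> K" using K by auto
    thus ?thesis using dominated_extremes(2)[OF d c(2)] c by auto
   qed auto
   have "I - K'' = B"
   proof (cases "B = {}")
    case True
    thus ?thesis using s(4) ij' by auto
   next
    case False
    have "B \<subseteq> I - K''" using B(2) 1 by auto
    moreover have "card (I - K'') \<le> card B" using s(2) cB False by simp
    ultimately show ?thesis by (metis card_seteq finite)
   qed
   moreover have "K'' - I = C"
   proof (cases "C = {}")
    case True
    thus ?thesis using s(5) ij' by auto
   next
    case False
    have "C \<subseteq> K'' - I" using C(2) 2 by auto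
    moreover have "card (K'' - I) \<le> card C" using s(3) cB False by simp
    ultimately show ?thesis by (metis card_seteq finite)
   qed
   ultimately have "K'' = K" using K by auto
   thus False using K''(1) by simp
  qed
 qed auto
 thus ?thesis using M_initial[OF x I card] by simp
qed

end

section \<open>All entries except the diagonal of L_11\<close>

lemma initial_exists:
 assumes "k \<le> CARD('n::{finite,linorder})"
 obtains I :: "'n::{finite,linorder} set" where "initial I" "card I = k"
proof
 let ?I = "{a :: 'n. rk a < k}"
 show "initial ?I" by (auto simp: initial_def) (metis leD leI less_le_trans rk_le_iff)
 have "rk ` ?I = {..<k}"
 proof
  show "{..<k} \<subseteq> rk ` ?I"
  proof
   fix r assume r: "r \<in> {..<k}"
   hence "r \<in> rk ` (UNIV :: 'n set)" using assms rk_bij[where 'n='n] by (auto simp: bij_betw_def)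
   thus "r \<in> rk ` ?I" using r by auto
  qed
 qed auto
 thus "card ?I = k" using card_image[OF inj_on_subset[OF rk_inj subset_UNIV], of ?I] by simp
qed

lemma bij_between_partitions:
 fixes B J C B' J' C' :: "'n::finite set"
 assumes "card B = card B'" "card J = card J'" "card C = card C'"
  and disj: "B \<inter> J = {}" "(B \<union> J) \<inter> C = {}" "B' \<inter> J' = {}" "(B' \<union> J') \<inter> C' = {}"
 obtains \<pi> where "bij \<pi>" "\<pi> ` B = B'" "\<pi> ` J = J'" "\<pi> ` C = C'"
proof -
 let ?N = "- (B \<union> J \<union> C)" and ?N' = "- (B' \<union> J' \<union> C')"
 have "card (B \<union> J \<union> C) = card (B' \<union> J' \<union> C')"
  using assms by (simp add: card_Un_disjoint)
 hence cN: "card ?N = card ?N'" by (simp add: Compl_eq_Diff_UNIV card_Diff_subset)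
 obtain f1 f2 f3 f4 where f: "bij_betw f1 B B'" "bij_betw f2 J J'" "bij_betw f3 C C'" "bij_betw f4 ?N ?N'"
  using assms(1-3) cN by (metis finite finite_same_card_bij)
 define g where "g x = (if x \<in> B then f1 x else f2 x)" for x
 define h where "h x = (if x \<in> B \<union> J then g x else f3 x)" for x
 define \<pi> where "\<pi> x = (if x \<in> B \<union> J \<union> C then h x else f4 x)" for x
 have "bij_betw g (B \<union> J) (B' \<union> J')" unfolding g_def using f disj by (intro bij_betw_disjoint_Un) auto
 hence "bij_betw h (B \<union> J \<union> C) (B' \<union> J' \<union> C')" unfolding h_def using f disj by (intro bij_betw_disjoint_Un) auto
 hence "bij_betw \<pi> (B \<union> J \<union> C \<union> ?N) (B' \<union> J' \<union> C' \<union> ?N')" unfolding \<pi>_def using f by (intro bij_betw_disjoint_Un) auto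
 moreover have "B \<union> J \<union> C \<union> ?N = UNIV" "B' \<union> J' \<union> C' \<union> ?N' = UNIV" by auto
 ultimately have "bij \<pi>" by simp
 moreover have "\<pi> ` B = f1 ` B" "\<pi> ` J = f2 ` J" "\<pi> ` C = f3 ` C"
  using disj by (auto simp: \<pi>_def h_def g_def image_iff Bex_def)
 ultimately show ?thesis using that f by (simp add: bij_betw_def)
qed

text \<open>The orbit of (K, K') under permutations depends only on the sizes of K - K', K' - K and
  their intersection. So K' may be made initial, the leaving site the first and the entering site
  the last.\<close>

lemma initial_representative:
 fixes K K' :: "'n::{finite,linorder} set"
 assumes "card (K - K') \<le> 1" "card (K' - K) \<le> 1"
 obtains \<pi> :: "'n => 'n" and I B C where "bij \<pi>" "initial I" "\<pi> ` I = K'" "\<pi> ` (I - B \<union> C) = K"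
  "bottom_set B" "B \<subseteq> I" "B = {} \<longleftrightarrow> K' \<subseteq> K"
  "top_set C" "C \<inter> I = {}" "C = {} \<longleftrightarrow> K \<subseteq> K'"
proof -
 have "card K' \<le> CARD('n)" by (rule card_mono) auto
 then obtain I :: "'n set" where I: "initial I" "card I = card K'" by (rule initial_exists)
 define B :: "'n set" where "B = (if K' \<subseteq> K then {} else {Min UNIV})"
 define C :: "'n set" where "C = (if K \<subseteq> K' then {} else {Max UNIV})"
 have BI: "B \<subseteq> I"
 proof (cases "K' \<subseteq> K")
  case False
  hence "I \<noteq> {}" using I(2) by auto
  then obtain i where "i \<in> I" by auto
  hence "Min UNIV \<in> I" using I(1) unfolding initial_def by (metis ComplI Min_le UNIV_I finite leD)
  thus ?thesis by (simp add: B_def)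
 qed (simp add: B_def)
 have CI: "C \<inter> I = {}"
 proof (cases "K \<subseteq> K'")
  case False
  hence "I \<noteq> UNIV" using I(2) by (metis UNIV_I card_subset_eq finite subsetI subset_UNIV)
  then obtain i where "i \<notin> I" by auto
  hence "Max UNIV \<notin> I" using I(1) unfolding initial_def by (metis ComplI Max_ge UNIV_I finite leD)
  thus ?thesis by (simp add: C_def)
 qed (simp add: C_def)
 have cB: "card B = card (K' - K)"
 proof (cases "K' \<subseteq> K")
  case False
  hence "card (K' - K) \<noteq> 0" by auto
  hence "card (K' - K) = 1" using assms(2) by linarith
  thus ?thesis using False by (simp add: B_def)
 qed (simp add: B_def Diff_eq_empty_iff[THEN iffD2])
 have cC: "card C = card (K - K')"
 proof (cases "K \<subseteq> K'")
  case False
  hence "card (K - K') \<noteq> 0" by auto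
  hence "card (K - K') = 1" using assms(1) by linarith
  thus ?thesis using False by (simp add: C_def)
 qed (simp add: C_def Diff_eq_empty_iff[THEN iffD2])
 have "card (I - B) = card I - card B" using BI by (intro card_Diff_subset) auto
 moreover have "card (K' \<inter> K) = card K' - card (K' - K)" using card_Int_Diff[of K' K] by simp
 ultimately have cJ: "card (I - B) = card (K' \<inter> K)" using I(2) cB by simp
 obtain \<pi> where \<pi>: "bij \<pi>" "\<pi> ` B = K' - K" "\<pi> ` (I - B) = K' \<inter> K" "\<pi> ` C = K - K'"
  by (rule bij_between_partitions[OF cB cJ cC]) (use CI BI in auto)
 show ?thesis
 proof (rule that[OF \<pi>(1) I(1)])
  have "I = B \<union> (I - B)" using BI by auto
  hence "\<pi> ` I = \<pi> ` B \<union> \<pi> ` (I - B)" by (metis image_Un)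
  thus "\<pi> ` I = K'" using \<pi> by auto
  show "\<pi> ` (I - B \<union> C) = K" using \<pi> by (auto simp: image_Un)
  show "bottom_set B" "top_set C"
   by (auto simp: B_def C_def)
  show "B = {} \<longleftrightarrow> K' \<subseteq> K" "C = {} \<longleftrightarrow> K \<subseteq> K'" by (auto simp: B_def C_def)
 qed (use BI CI in auto)
qed

text \<open>The denominator in \<open>M_initial_formula\<close> involves pairs from (I - B) x C,
  from B x N and from B x C: both sites in K, both outside K, or the exchanged pair. This
  description is independent of the order of the sites and hence invariant.\<close>

definition move_pairs :: "'n set => 'n set => 'n set set" where
 "move_pairs K K' = {S. card S = 2 \<and> (S \<subseteq> K \<or> S \<inter> K = {} \<or> S = (K - K') \<union> (K' - K))}"

text \<open>\<open>Dyn 0\<close> and \<open>Dyn (- 1)\<close>, that is lambda and lambda - y, come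
  from the entering site c, for which w(c, K) = 0.\<close>

definition move_forms :: "'n::finite set => 'n set => 'n form multiset" where
 "move_forms K K' = spectral.specs + {#Dyn 0, Dyn (- 1)#} + image_mset Diff (mset_set (move_pairs K K'))"

context spectral
begin

lemma valid_move_forms: "p \<in># move_forms K K' ==> valid_form p"
 by (auto simp: move_forms_def move_pairs_def dest: valid_specs)

lemma perm_move_forms:
 fixes \<pi> :: "'n::finite => 'n"
 assumes "bij \<pi>"
 shows "image_mset (perm_form \<pi>) (move_forms K K') = move_forms (\<pi> ` K) (\<pi> ` K')"
proof -
 have inj: "inj \<pi>" using assms by (rule bij_is_inj)
 have "image_mset (perm_form \<pi>) specs = image_mset Spec (image_mset \<pi> (mset_set UNIV))"
  by (simp add: specs_def multiset.map_comp comp_def)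
 also have "image_mset \<pi> (mset_set UNIV) = mset_set UNIV"
  using inj assms by (simp add: image_mset_mset_set bij_is_surj)
 finally have 1: "image_mset (perm_form \<pi>) specs = specs" by (simp add: specs_def)
 have im: "(%S. \<pi> ` S) ` move_pairs K K' = move_pairs (\<pi> ` K) (\<pi> ` K')"
 proof (intro equalityI subsetI)
  fix S assume "S \<in> (%S. \<pi> ` S) ` move_pairs K K'"
  then obtain T where T: "S = \<pi> ` T" "T \<in> move_pairs K K'" by blast
  have "card S = card T" unfolding T(1) by (rule card_image[OF inj_on_subset[OF inj]]) simp
  moreover have "S \<subseteq> \<pi> ` K \<longleftrightarrow> T \<subseteq> K" unfolding T(1) using inj by (simp add: inj_image_subset_iff)
  moreover have "S \<inter> \<pi> ` K = {} \<longleftrightarrow> T \<inter> K = {}" unfolding T(1) image_Int[OF inj, symmetric] by simp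
  moreover have "S = (\<pi> ` K - \<pi> ` K') \<union> (\<pi> ` K' - \<pi> ` K) \<longleftrightarrow> T = (K - K') \<union> (K' - K)"
   unfolding T(1) image_set_diff[OF inj, symmetric] image_Un[symmetric] inj_image_eq_iff[OF inj] ..
  ultimately show "S \<in> move_pairs (\<pi> ` K) (\<pi> ` K')" using T(2) unfolding move_pairs_def by auto
 next
  fix S assume S: "S \<in> move_pairs (\<pi> ` K) (\<pi> ` K')"
  define T where "T = inv \<pi> ` S"
  have T: "S = \<pi> ` T" unfolding T_def using assms by (simp add: bij_is_surj image_f_inv_f)
  have "card S = card T" unfolding T(1) by (rule card_image[OF inj_on_subset[OF inj]]) simp
  moreover have "S \<subseteq> \<pi> ` K \<longleftrightarrow> T \<subseteq> K" unfolding T(1) using inj by (simp add: inj_image_subset_iff)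
  moreover have "S \<inter> \<pi> ` K = {} \<longleftrightarrow> T \<inter> K = {}" unfolding T(1) image_Int[OF inj, symmetric] by simp
  moreover have "S = (\<pi> ` K - \<pi> ` K') \<union> (\<pi> ` K' - \<pi> ` K) \<longleftrightarrow> T = (K - K') \<union> (K' - K)"
   unfolding T(1) image_set_diff[OF inj, symmetric] image_Un[symmetric] inj_image_eq_iff[OF inj] ..
  ultimately have "T \<in> move_pairs K K'" using S unfolding move_pairs_def by auto
  thus "S \<in> (%S. \<pi> ` S) ` move_pairs K K'" using T by blast
 qed
 have "image_mset (perm_form \<pi>) (image_mset Diff (mset_set (move_pairs K K'))) = image_mset Diff (image_mset (%S. \<pi> ` S) (mset_set (move_pairs K K')))"
  by (simp add: multiset.map_comp comp_def)
 also have "image_mset (%S. \<pi> ` S) (mset_set (move_pairs K K')) = mset_set (move_pairs (\<pi> ` K) (\<pi> ` K'))"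
  unfolding im[symmetric] by (rule image_mset_mset_set) (use inj in \<open>auto simp: inj_on_def inj_image_eq_iff\<close>)
 finally show ?thesis by (simp add: move_forms_def 1)
qed

end

context quantum_entry
begin

text \<open>The support of the column of an initial subset, carried to arbitrary pairs by the
  symmetry of M.\<close>

lemma M_zero:
 assumes card: "int (card K) = int (card K') + (int i - int j)"
  and "i = 2 \<and> j = 2 \<and> K \<noteq> K' \<or> card (K - K') > 1 \<or> card (K' - K) > 1"
 shows "GEN x. M K K' x = 0"
proof -
 have "card K' \<le> CARD('n)" by (rule card_mono) auto
 then obtain I :: "'n set" where I: "initial I" "card I = card K'" by (rule initial_exists)
 obtain \<pi> where \<pi>: "bij \<pi>" "\<pi> ` I = K'" using bij_between_partitions[of I K' "{}" "{}" "{}" "{}"] I(2) by auto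
 define K0 where "K0 = inv \<pi> ` K"
 have K0: "\<pi> ` K0 = K" unfolding K0_def using \<pi>(1) by (simp add: bij_is_surj image_f_inv_f)
 have inj: "inj \<pi>" using \<pi>(1) by (rule bij_is_inj)
 have ci: "card (\<pi> ` A) = card A" for A by (rule card_image[OF inj_on_subset[OF inj]]) simp
 have c: "int (card K0) = int (card I) + (int i - int j)" using card ci[of K0] K0 I(2) by simp
 have d: "K - K' = \<pi> ` (K0 - I)" "K' - K = \<pi> ` (I - K0)" using K0 \<pi>(2) image_set_diff[OF inj] by auto
 have ne: "K \<noteq> K' ==> K0 \<noteq> I" using K0 \<pi>(2) by auto
 have "GEN x. M K0 I x = 0"
  using good_generic
 proof eventually_elim
  case (elim x)
  show ?case
  proof (rule ccontr)
   assume "M K0 I x \<noteq> 0"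
   from M_initial_zero[OF elim I(1) c this] show False using assms(2) ne unfolding d ci by auto
  qed
 qed
 hence "GEN x. M K0 I (perm (inv \<pi>) x) = 0"
  using \<pi>(1) by (intro generic_perm bij_imp_bij_inv)
 moreover have "GEN x. M (\<pi> ` K0) (\<pi> ` I) (perm \<pi> (perm (inv \<pi>) x)) = M K0 I (perm (inv \<pi>) x)"
  using \<pi>(1) by (intro generic_perm[OF M_perm[OF \<pi>(1) c]] bij_imp_bij_inv)
 ultimately show ?thesis
  by eventually_elim (simp add: K0 \<pi>)
qed

text \<open>The one-term relation divided by the diagonal stable envelope. The lambda-denominators
  of the R-matrix entries cancel against those of the two stable envelopes, except at the entering
  site; the quotient of the factors in z is E / D.\<close>

lemma M_initial_formula:
 assumes x: "good x" and I: "initial I" and B: "bottom_set B" "B \<subseteq> I"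
  and C: "top_set C" "C \<inter> I = {}"
  and ij': "i = (if B = {} then 2 else 1)" "j = (if C = {} then 2 else 1)"
 defines "K \<equiv> I - B \<union> C" and "N \<equiv> - I - C"
 defines "D \<equiv> %u. \<Prod>(a, b)\<in>(I - B) \<times> C \<union> B \<times> (N \<union> C). th (u$$a - u$$b)"
  and "E \<equiv> %u. (\<Prod>a\<in>I - B. \<Prod>b\<in>B. th (u$$a - u$$b + yv u)) * (\<Prod>a\<in>C. \<Prod>b\<in>N \<union> B. th (u$$a - u$$b + yv u))"
  and "F \<equiv> %u. (\<Prod>b\<in>B. - (th (w - u$$b + (lv u - of_int (wcount b K) * yv u)) * th (yv u))) * (\<Prod>a\<in>I - B. th (w - u$$a))
     * (\<Prod>c\<in>C. th (w - u$$c - lv u) * th (yv u))"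
 shows "M K I x = E x * F x * inverse (D x) * (\<Prod>a\<in>I \<union> C. inverse (th (w - x$$a - yv x)))
  * (\<Prod>c\<in>C. inverse (th (lv x + of_int 0 * yv x)) * inverse (th (lv x + of_int (- 1) * yv x)))"
proof -
 note reg = goodD(1)[OF x]
 obtain z y l where xe: "x = (z, y, l)" by (metis prod_cases3)
 define \<Lambda> where "\<Lambda> a = lv x - of_int (wcount a K) * yv x" for a
 have fin: "finite B" "finite C" by auto
 have above: "{b\<in>K. b > a} = {b\<in>I. b > a} \<union> C" if "a \<in> I" for a
 proof -
  have "\<not> a < b" if "b \<in> B" for b using B that by (auto simp: not_less)
  moreover have "a < c" if "c \<in> C" for c using C that \<open>a \<in> I\<close> by (auto simp: order.strict_iff_order)
  ultimately show ?thesis unfolding K_def by auto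
 qed
 have wK: "wcount a K = wcount a I + 2 * int (card C)" if "a \<in> I" for a
 proof -
  have "card {b\<in>K. b > a} = card {b\<in>I. b > a} + card C"
   unfolding above[OF that] using C(2) by (intro card_Un_disjoint) auto
  thus ?thesis unfolding wcount_rk by simp
 qed
 have wC: "wcount c K = 0" if "c \<in> C" for c
 proof -
  have "{b. b > c} = {}" using C(1) that by (auto simp: not_less)
  thus ?thesis unfolding wcount_eq by (simp only: sum.empty)
 qed
 have nzL: "th (\<Lambda> a) \<noteq> 0" "th (\<Lambda> a - yv x) \<noteq> 0" for a
  using regular_wcount[OF reg[unfolded xe], of a K] by (simp_all add: \<Lambda>_def xe)
 have nzS: "th (w - x$$a - yv x) \<noteq> 0" for a using regularD(5)[OF reg] .
 have shI: "stb I I (shift (eps j) x) = diag_factor I x / (\<Prod>a\<in>I. th (\<Lambda> a))"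
 proof -
  \<comment> \<open>The entering site raises every w(a, I) by 2, and the sign of the shift depends
    on whether there is one. With C nonempty, lambda - y - (w(a, I) + 1) y, and otherwise lambda + y
    - (w(a, I) + 1) y, are both lambda - w(a, K) y.\<close>
  have "lv (shift (eps j) x) - of_int (wcount a I + 1) * yv (shift (eps j) x) = \<Lambda> a" if "a \<in> I" for a
   using wK[OF that] C(1) ij'(2) by (auto simp: xe shift_def \<Lambda>_def eps_def algebra_simps)
  thus ?thesis unfolding stab_diag_regular[OF goodD(2)[OF x]] by simp
 qed
 have shK: "stb K K x = diag_factor K x / (\<Prod>a\<in>K. th (\<Lambda> a - yv x))"
  unfolding stab_diag_regular[OF reg] by (simp add: \<Lambda>_def algebra_simps)
 have L: "Lc x I K = (\<Prod>b\<in>B. be (w - x$$b) (yv x) (\<Lambda> b))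
  * (\<Prod>a\<in>I - B. al (w - x$$a) (yv x) (- \<Lambda> a)) * (\<Prod>c\<in>C. be (w - x$$c) (yv x) (- \<Lambda> c))"
  unfolding \<Lambda>_def by (rule Lcoeff_move[OF I B C]) (use K_def ij' in auto)
 have nzI: "diag_factor I x \<noteq> 0" "(\<Prod>a\<in>I. th (\<Lambda> a)) \<noteq> 0" "(\<Prod>a\<in>K. th (\<Lambda> a - yv x)) \<noteq> 0" using diag_factor_nonzero[OF reg] nzL by auto
 have "M K I x * stb I I (shift (eps j) x) = Lc x I K * stb K K x"
  by (rule M_initial_move[OF x I B C]) (use K_def ij' in auto)
 hence M: "M K I x = Lc x I K * (\<Prod>a\<in>I. th (\<Lambda> a)) / (\<Prod>a\<in>K. th (\<Lambda> a - yv x)) * (diag_factor K x / diag_factor I x)"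
  unfolding shI shK using nzI by (simp add: field_simps)
 have prI: "(\<Prod>a\<in>I. g a) = (\<Prod>b\<in>B. g b) * (\<Prod>a\<in>I - B. g a)" for g :: "'n => complex"
  using prod.subset_diff[OF B(2), of g] by (simp add: mult.commute)
 have prK: "(\<Prod>a\<in>K. g a) = (\<Prod>a\<in>I - B. g a) * (\<Prod>c\<in>C. g c)" for g :: "'n => complex"
  unfolding K_def using C(2) by (intro prod.union_disjoint) auto
 have prIC: "(\<Prod>a\<in>I \<union> C. g a) = (\<Prod>b\<in>B. g b) * (\<Prod>a\<in>I - B. g a) * (\<Prod>c\<in>C. g c)" for g :: "'n => complex"
  unfolding prI[symmetric] using C(2) by (intro prod.union_disjoint) auto
 have P: "Lc x I K * (\<Prod>a\<in>I. th (\<Lambda> a)) / (\<Prod>a\<in>K. th (\<Lambda> a - yv x))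
  = F x * (\<Prod>a\<in>I \<union> C. inverse (th (w - x$$a - yv x))) * (\<Prod>c\<in>C. inverse (th (lv x + of_int 0 * yv x)) * inverse (th (lv x + of_int (- 1) * yv x)))"
 proof -
  have 1: "(\<Prod>b\<in>B. be (w - x$$b) (yv x) (\<Lambda> b)) * (\<Prod>b\<in>B. th (\<Lambda> b))
   = (\<Prod>b\<in>B. - (th (w - x$$b + \<Lambda> b) * th (yv x))) * (\<Prod>b\<in>B. inverse (th (w - x$$b - yv x)))"
   unfolding prod.distrib[symmetric] by (intro prod.cong refl) (use nzL in \<open>simp add: beta_def field_simps\<close>)
  have 2: "(\<Prod>a\<in>I - B. al (w - x$$a) (yv x) (- \<Lambda> a)) * (\<Prod>a\<in>I - B. th (\<Lambda> a)) / (\<Prod>a\<in>I - B. th (\<Lambda> a - yv x))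
   = (\<Prod>a\<in>I - B. th (w - x$$a)) * (\<Prod>a\<in>I - B. inverse (th (w - x$$a - yv x)))"
   unfolding prod.distrib[symmetric] prod_dividef[symmetric] by (intro prod.cong refl) (use nzL in \<open>simp add: alpha_minus field_simps\<close>)
  have 3: "(\<Prod>c\<in>C. be (w - x$$c) (yv x) (- \<Lambda> c)) / (\<Prod>c\<in>C. th (\<Lambda> c - yv x))
   = (\<Prod>c\<in>C. th (w - x$$c - lv x) * th (yv x)) * (\<Prod>c\<in>C. inverse (th (w - x$$c - yv x)))
    * (\<Prod>c\<in>C. inverse (th (lv x + of_int 0 * yv x)) * inverse (th (lv x + of_int (- 1) * yv x)))"
   unfolding prod.distrib[symmetric] prod_dividef[symmetric]
   by (intro prod.cong refl) (simp add: beta_minus \<Lambda>_def wC divide_inverse mult_ac)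
  have "Lc x I K * (\<Prod>a\<in>I. th (\<Lambda> a)) / (\<Prod>a\<in>K. th (\<Lambda> a - yv x))
   = ((\<Prod>b\<in>B. be (w - x$$b) (yv x) (\<Lambda> b)) * (\<Prod>b\<in>B. th (\<Lambda> b)))
    * ((\<Prod>a\<in>I - B. al (w - x$$a) (yv x) (- \<Lambda> a)) * (\<Prod>a\<in>I - B. th (\<Lambda> a)) / (\<Prod>a\<in>I - B. th (\<Lambda> a - yv x)))
    * ((\<Prod>c\<in>C. be (w - x$$c) (yv x) (- \<Lambda> c)) / (\<Prod>c\<in>C. th (\<Lambda> c - yv x)))"
   unfolding L prI[of "%a. th (\<Lambda> a)"] prK by (simp add: field_simps)
  thus ?thesis unfolding 1 2 3 prIC F_def \<Lambda>_def[symmetric] by (simp only: mult_ac)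
 qed
 have Q: "diag_factor K x / diag_factor I x = E x * inverse (D x)"
 proof -
  define g where "g a b = th (x$$a - x$$b)" for a b
  define h where "h a b = th (x$$a - x$$b + yv x)" for a b
  have s1: "{a. a < b \<and> a \<notin> I} = {}" "{a. a > b \<and> a \<notin> I} = N \<union> C" if "b \<in> I" for b
   using that I C(2) unfolding initial_def N_def by (auto dest: less_asym)
  have dI: "diag_factor I x = (\<Prod>a\<in>I. \<Prod>b\<in>N \<union> C. g a b)"
   unfolding diag_factor_def g_def by (intro prod.cong refl) (simp only: s1 prod.empty mult_1_left)
  have s2: "{a. a < b \<and> a \<notin> K} = B" "{a. a > b \<and> a \<notin> K} = N" if "b \<in> I - B" for b
  proof -
   have b: "b \<in> I" "b \<notin> B" "b \<notin> C" using that C(2) by auto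
   have "a \<in> B ==> a < b" for a using B b by (auto simp: order.strict_iff_order)
   moreover have "a \<in> N ==> b < a" for a using I b unfolding initial_def N_def by auto
   moreover have "a \<notin> K \<longleftrightarrow> a \<in> B \<or> a \<in> N" for a using B C unfolding K_def N_def by blast
   ultimately show "{a. a < b \<and> a \<notin> K} = B" "{a. a > b \<and> a \<notin> K} = N" by (auto dest: less_asym)
  qed
  have s3: "{a. a < c \<and> a \<notin> K} = N \<union> B" "{a. a > c \<and> a \<notin> K} = {}" if "c \<in> C" for c
  proof -
   have c: "\<And>a. a \<le> c" "c \<in> K" using C(1) that by (auto simp: K_def)
   moreover have "a \<notin> K \<longleftrightarrow> a \<in> B \<or> a \<in> N" for a using B C unfolding K_def N_def by blast
   ultimately show "{a. a < c \<and> a \<notin> K} = N \<union> B" "{a. a > c \<and> a \<notin> K} = {}"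
    by (auto simp: order.strict_iff_order not_less intro: antisym)
  qed
  have dK: "diag_factor K x = (\<Prod>a\<in>I - B. (\<Prod>b\<in>B. h a b) * (\<Prod>b\<in>N. g a b)) * (\<Prod>a\<in>C. \<Prod>b\<in>N \<union> B. h a b)"
  proof -
   have "diag_factor K x = (\<Prod>i\<in>I - B. (\<Prod>a | a < i \<and> a \<notin> K. h i a) * (\<Prod>a | a > i \<and> a \<notin> K. g i a))
     * (\<Prod>i\<in>C. (\<Prod>a | a < i \<and> a \<notin> K. h i a) * (\<Prod>a | a > i \<and> a \<notin> K. g i a))"
    unfolding diag_factor_def g_def h_def by (rule prK)
   also have "(\<Prod>i\<in>I - B. (\<Prod>a | a < i \<and> a \<notin> K. h i a) * (\<Prod>a | a > i \<and> a \<notin> K. g i a)) = (\<Prod>a\<in>I - B. (\<Prod>b\<in>B. h a b) * (\<Prod>b\<in>N. g a b))"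
    by (intro prod.cong refl) (simp only: s2)
   also have "(\<Prod>i\<in>C. (\<Prod>a | a < i \<and> a \<notin> K. h i a) * (\<Prod>a | a > i \<and> a \<notin> K. g i a)) = (\<Prod>a\<in>C. \<Prod>b\<in>N \<union> B. h a b)"
    by (intro prod.cong refl) (simp only: s3 prod.empty mult_1_right)
   finally show ?thesis .
  qed
  have NC: "N \<inter> C = {}" by (auto simp: N_def)
  have D: "D x = (\<Prod>a\<in>I - B. \<Prod>b\<in>C. g a b) * (\<Prod>a\<in>B. \<Prod>b\<in>N \<union> C. g a b)"
   unfolding D_def g_def prod.cartesian_product using B(2) by (intro prod.union_disjoint) auto
  have gn: "g a b \<noteq> 0" if "a \<in> I" "b \<in> N \<union> C" for a b
   unfolding g_def using that C(2) by (intro regularD(1)[OF reg]) (auto simp: N_def)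
  have "(\<Prod>b\<in>N \<union> C. g a b) = (\<Prod>b\<in>N. g a b) * (\<Prod>b\<in>C. g a b)" for a using NC by (intro prod.union_disjoint) auto
  hence "diag_factor I x = (\<Prod>a\<in>B. \<Prod>b\<in>N \<union> C. g a b) * (\<Prod>a\<in>I - B. \<Prod>b\<in>N. g a b) * (\<Prod>a\<in>I - B. \<Prod>b\<in>C. g a b)"
   unfolding dI prI[of "%a. \<Prod>b\<in>N \<union> C. g a b"] by (simp add: prod.distrib mult.assoc)
  hence "diag_factor K x * D x = diag_factor I x * E x"
   unfolding dK D E_def g_def[symmetric] h_def[symmetric] prod.distrib by (simp only: mult_ac)
  moreover have "D x \<noteq> 0" unfolding D using gn B(2) by auto
  ultimately show ?thesis using nzI by (simp add: field_simps)
 qed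
 show ?thesis unfolding M P Q by (simp only: mult_ac)
qed

end

lemma sum_singleton_mset: "finite A ==> (\<Sum>a\<in>A. {#f a#}) = image_mset f (mset_set A)"
 by (induction A rule: finite_induct) auto

context spectral
begin

lemma poles_inverse_specs:
 "poles specs (%x. \<Prod>a\<in>A. inverse (th (w - x$$a - yv x)))" for A :: "'n::{finite,linorder} set"
proof -
 have "poles (\<Sum>a\<in>A. {#Spec a#}) (%x. \<Prod>a\<in>A. inverse (th (w - x$$a - yv x)))"
  by (intro poles_prod poles_inverse_Spec)
 thus ?thesis
  by (rule poles_mono) (auto simp: sum_singleton_mset specs_def intro!: image_mset_subseteq_mono subset_imp_msubset_mset_set)
qed

lemma poles_inverse_pairs:
 fixes P :: "('n::{finite,linorder} \<times> 'n) set"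
 assumes "\<And>a b. (a, b) \<in> P ==> a \<noteq> b \<and> (b, a) \<notin> P" "\<And>a b. (a, b) \<in> P ==> {a, b} \<in> S"
 shows "poles (image_mset Diff (mset_set S)) (%x. inverse (\<Prod>(a, b)\<in>P. th (x$$a - x$$b)))"
proof -
 have "inj_on (%(a, b). {a, b}) P" using assms(1) by (auto simp: inj_on_def doubleton_eq_iff)
 hence "image_mset (%(a, b). {a, b}) (mset_set P) = mset_set ((%(a, b). {a, b}) ` P)" by (rule image_mset_mset_set)
 moreover have "mset_set ((%(a, b). {a, b}) ` P) \<subseteq># mset_set S" using assms(2) by (intro subset_imp_msubset_mset_set) auto
 ultimately have "image_mset Diff (image_mset (%(a, b). {a, b}) (mset_set P)) \<subseteq># image_mset Diff (mset_set S)"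
  by (intro image_mset_subseteq_mono) simp
 hence sub: "image_mset Diff (image_mset (%(a, b). {a, b}) (mset_set P)) \<subseteq># image_mset Diff (mset_set S)" .
 have eq: "image_mset Diff (image_mset (%(a, b). {a, b}) (mset_set P)) = image_mset (%(a, b). Diff {a, b}) (mset_set P)"
  unfolding multiset.map_comp by (intro image_mset_cong) auto
 have "poles (image_mset (%(a, b). Diff {a, b}) (mset_set P)) (%x. inverse (\<Prod>(a, b)\<in>P. th (x$$a - x$$b)))"
  using assms(1) by (intro poles_inverse_prod_Diff) auto
 thus ?thesis by (rule poles_mono) (use sub eq in simp)
qed

lemma poles_zero: "(GEN x. f x = 0) ==> poles A f"
proof (rule poles_cong)
 show "poles A (%x. 0)" by (rule poles_mono[OF poles_holo[OF holo_const]]) simp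
qed (auto elim: eventually_mono)

end

context quantum_entry
begin

lemma poles_M_initial:
 assumes I: "initial I" and B: "bottom_set B" "B \<subseteq> I"
  and C: "top_set C" "C \<inter> I = {}"
  and ij': "i = (if B = {} then 2 else 1)" "j = (if C = {} then 2 else 1)" and K: "K = I - B \<union> C"
 shows "poles (move_forms K I) (M K I)"
proof -
 define N where "N = - I - C"
 define P where "P = (I - B) \<times> C \<union> B \<times> (N \<union> C)"
 define E where "E = (%u. (\<Prod>a\<in>I - B. \<Prod>b\<in>B. th (u$$a - u$$b + yv u)) * (\<Prod>a\<in>C. \<Prod>b\<in>N \<union> B. th (u$$a - u$$b + yv u)))"
 define F where "F = (%u. (\<Prod>b\<in>B. - (th (w - u$$b + (lv u - of_int (wcount b K) * yv u)) * th (yv u))) * (\<Prod>a\<in>I - B. th (w - u$$a))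
     * (\<Prod>c\<in>C. th (w - u$$c - lv u) * th (yv u)))"
 have 1: "poles specs (%x. \<Prod>a\<in>I \<union> C. inverse (th (w - x$$a - yv x)))" by (rule poles_inverse_specs)
 have 2: "poles {#Dyn 0, Dyn (- 1)#} (%x. \<Prod>c\<in>C. inverse (th (lv x + of_int 0 * yv x)) * inverse (th (lv x + of_int (- 1) * yv x)))"
  using C(1)
 proof
  assume "\<exists>c. C = {c} \<and> (\<forall>a. a \<le> c)"
  thus ?thesis using poles_mult[OF poles_inverse_Dyn[of 0] poles_inverse_Dyn[of "- 1"]] by (auto simp: add_mset_commute)
 next
  assume "C = {}"
  thus ?thesis using poles_mono[OF poles_holo[OF holo_const, of 1], of "{#Dyn 0, Dyn (- 1)#}"] by simp
 qed
 have 3: "poles (image_mset Diff (mset_set (move_pairs K I))) (%x. inverse (\<Prod>(a, b)\<in>P. th (x$$a - x$$b)))"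
 proof (rule poles_inverse_pairs)
  show "a \<noteq> b \<and> (b, a) \<notin> P" if "(a, b) \<in> P" for a b using that C(2) B(2) by (auto simp: P_def N_def)
  show "{a, b} \<in> move_pairs K I" if ab: "(a, b) \<in> P" for a b
  proof -
   have "card {a, b} = 2" using \<open>(a, b) \<in> P ==> a \<noteq> b \<and> (b, a) \<notin> P\<close> ab by simp
   moreover have "{a, b} \<subseteq> K \<or> {a, b} \<inter> K = {} \<or> {a, b} = (K - I) \<union> (I - K)"
   proof -
    consider "a \<in> I - B" "b \<in> C" | "a \<in> B" "b \<in> N" | "a \<in> B" "b \<in> C" using ab by (auto simp: P_def)
    thus ?thesis
    proof cases
     case 3
     hence "K - I = {b}" "I - K = {a}" using B C K by auto
     thus ?thesis by auto
    qed (use B(2) C(2) K N_def in auto)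
   qed
   ultimately show ?thesis by (simp add: move_pairs_def)
  qed
 qed
 have "poles (specs + {#Dyn 0, Dyn (- 1)#} + image_mset Diff (mset_set (move_pairs K I)))
  (%x. E x * F x * ((\<Prod>a\<in>I \<union> C. inverse (th (w - x$$a - yv x)))
  * (\<Prod>c\<in>C. inverse (th (lv x + of_int 0 * yv x)) * inverse (th (lv x + of_int (- 1) * yv x))) * inverse (\<Prod>(a, b)\<in>P. th (x$$a - x$$b))))"
  by (intro poles_mult_holo poles_mult[OF poles_mult[OF 1 2] 3]) (unfold E_def F_def, intro holo_intros)
 thus ?thesis unfolding move_forms_def
 proof (rule poles_cong)
  show "GEN x. E x * F x * ((\<Prod>a\<in>I \<union> C. inverse (th (w - x$$a - yv x)))
  * (\<Prod>c\<in>C. inverse (th (lv x + of_int 0 * yv x)) * inverse (th (lv x + of_int (- 1) * yv x))) * inverse (\<Prod>(a, b)\<in>P. th (x$$a - x$$b))) = M K I x"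
   using good_generic
  proof eventually_elim
   case (elim x)
   show ?case
    unfolding K M_initial_formula[OF elim I B C ij']
    unfolding E_def F_def P_def N_def K by (simp only: mult_ac)
  qed
 qed
qed

lemma poles_M_transfer:
 assumes p: "poles A (M K K')" and \<pi>: "bij \<pi>" and v: "\<And>p. p \<in># A ==> valid_form p"
  and c: "int (card K) = int (card K') + (int i - int j)"
 shows "poles (image_mset (perm_form \<pi>) A) (M (\<pi> ` K) (\<pi> ` K'))"
proof (rule poles_cong[OF poles_perm[OF p \<pi> v]])
 have "GEN x. M (\<pi> ` K) (\<pi> ` K') (perm \<pi> (perm (inv \<pi>) x)) = M K K' (perm (inv \<pi>) x)"
  using \<pi> by (intro generic_perm[OF M_perm[OF \<pi> c]] bij_imp_bij_inv)
 thus "GEN x. M K K' (perm (inv \<pi>) x) = M (\<pi> ` K) (\<pi> ` K') x"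
  by eventually_elim (simp add: \<pi>)
qed

text \<open>Once the zero entries are discarded, i and j determine which of K' \<subseteq> K and K
  \<subseteq> K' hold, hence which of B and C are empty, and the bound is carried over from the
  representative. Only the diagonal entries of L_11 are left out.\<close>

lemma poles_M_move:
 assumes c: "int (card K) = int (card K') + (int i - int j)" and ne: "K \<noteq> K' \<or> i = 2 \<and> j = 2"
 shows "poles (move_forms K K') (M K K')"
proof (cases "i = 2 \<and> j = 2 \<and> K \<noteq> K' \<or> card (K - K') > 1 \<or> card (K' - K) > 1")
 case True
 thus ?thesis using M_zero[OF c] by (intro poles_zero) auto
next
 case False
 hence le: "card (K - K') \<le> 1" "card (K' - K) \<le> 1" by auto
 have "card K = card (K \<inter> K') + card (K - K')" "card K' = card (K \<inter> K') + card (K' - K)"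
  by (metis card_Int_Diff finite, metis Int_commute card_Int_Diff finite)
 hence c': "int (card (K - K')) = int (card (K' - K)) + (int i - int j)" using c by simp
 have z: "card (K - K') = 0 \<longleftrightarrow> K \<subseteq> K'" "card (K' - K) = 0 \<longleftrightarrow> K' \<subseteq> K" by auto
 have ij': "i = (if K' \<subseteq> K then 2 else 1)" "j = (if K \<subseteq> K' then 2 else 1)"
 proof -
  consider "i = 1" "j = 1" | "i = 2" "j = 2" | "i = 1" "j = 2" | "i = 2" "j = 1" using ij by auto
  hence "i = (if K' \<subseteq> K then 2 else 1) \<and> j = (if K \<subseteq> K' then 2 else 1)"
  proof cases
   case 1
   hence "card (K - K') = card (K' - K)" using c' by simp
   hence "K \<subseteq> K' \<longleftrightarrow> K' \<subseteq> K" using z by metis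
   thus ?thesis using 1 ne by auto
  next
   case 2
   thus ?thesis using False by auto
  next
   case 3
   hence "card (K - K') = 0" "card (K' - K) \<noteq> 0" using c' le by linarith+
   thus ?thesis using 3 z by simp
  next
   case 4
   hence "card (K' - K) = 0" "card (K - K') \<noteq> 0" using c' le by linarith+
   thus ?thesis using 4 z by simp
  qed
  thus "i = (if K' \<subseteq> K then 2 else 1)" "j = (if K \<subseteq> K' then 2 else 1)" by auto
 qed
 obtain \<pi> :: "'n => 'n" and I B C where \<pi>: "bij \<pi>" "initial I" "\<pi> ` I = K'" "\<pi> ` (I - B \<union> C) = K"
  "bottom_set B" "B \<subseteq> I" "B = {} \<longleftrightarrow> K' \<subseteq> K"
  "top_set C" "C \<inter> I = {}" "C = {} \<longleftrightarrow> K \<subseteq> K'"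
  by (rule initial_representative[OF le])
 have p: "poles (move_forms (I - B \<union> C) I) (M (I - B \<union> C) I)"
  by (rule poles_M_initial[OF \<pi>(2,5,6,8,9)]) (use ij' \<pi>(7,10) in auto)
 have ci: "card (\<pi> ` A) = card A" for A by (rule card_image[OF inj_on_subset[OF bij_is_inj[OF \<pi>(1)]]]) simp
 have "poles (image_mset (perm_form \<pi>) (move_forms (I - B \<union> C) I)) (M (\<pi> ` (I - B \<union> C)) (\<pi> ` I))"
  by (rule poles_M_transfer[OF p \<pi>(1) valid_move_forms]) (use c ci[of I] ci[of "I - B \<union> C"] \<pi>(3,4) in auto)
 thus ?thesis unfolding perm_move_forms[OF \<pi>(1)] \<pi>(3,4) .
qed

text \<open>Several subsets now contribute on the right, each with its own 1 / psi, so the dynamical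
  forms A are uncontrolled. The gain is that no z_a - z_b + y appears and that all diagonals are at
  most simple poles.\<close>

lemma poles_M_diag_initial:
 assumes I: "initial I" and ij': "i = 1" "j = 1"
 shows "\<exists>A. (\<forall>p\<in>#A. \<exists>m. p = Dyn m) \<and> poles (specs + diff_forms UNIV + A) (M I I)"
proof -
 have s1: "{a. a < b \<and> a \<notin> I} = {}" "{a. a > b \<and> a \<notin> I} = - I" if "b \<in> I" for b
  using that I unfolding initial_def by (auto dest: less_asym)
 define P where "P = I \<times> (- I)"
 have dI: "diag_factor I x = (\<Prod>(a, b)\<in>P. th (x$$a - x$$b))" for x
  unfolding diag_factor_def P_def prod.cartesian_product[symmetric] by (intro prod.cong refl) (simp only: s1 prod.empty mult_1_left)
 \<comment> \<open>Pairs inside I come from the numerators, pairs not inside I from the division by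
   \<open>diag_factor I\<close>. No pair is in both families, so no diagonal is counted
   twice.\<close>
 define S1 where "S1 = {S. S \<subseteq> I \<and> card S = 2}"
 define S2 where "S2 = {S :: 'n set. card S = 2 \<and> \<not> S \<subseteq> I}"
 have 1: "poles (image_mset Diff (mset_set S2)) (%x. inverse (diag_factor I x))"
  unfolding dI by (rule poles_inverse_pairs) (auto simp: P_def S2_def card_2_iff)
 have S12: "diff_forms UNIV = image_mset Diff (mset_set S1) + image_mset Diff (mset_set S2)"
 proof -
  have "{S :: 'n set. S \<subseteq> UNIV \<and> card S = 2} = S1 \<union> S2" by (auto simp: S1_def S2_def)
  moreover have "mset_set (S1 \<union> S2) = mset_set S1 + mset_set S2"
   by (rule mset_set_Union) (auto simp: S1_def S2_def)
  ultimately show ?thesis by (simp add: diff_forms_def)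
 qed
 define psiA :: "'n set => 'n form multiset" where "psiA K = (\<Sum>a\<in>K. {#Dyn (- (wcount a K + 1)), Dyn (- wcount a K)#})" for K
 have 2: "poles (psiA K) (%x. inverse (psi \<tau> K (yv x) (lv x)))" for K
 proof -
  have "poles (psiA K) (%x. \<Prod>a\<in>K. inverse (th (lv x - of_int (wcount a K + 1) * yv x)) * inverse (th (lv x - of_int (wcount a K) * yv x)))"
   unfolding psiA_def
  proof (rule poles_prod)
   fix a
   show "poles {#Dyn (- (wcount a K + 1)), Dyn (- wcount a K)#} (%x. inverse (th (lv x - of_int (wcount a K + 1) * yv x)) * inverse (th (lv x - of_int (wcount a K) * yv x)))"
    by (rule poles_mono[OF poles_mult[OF poles_inverse_Dyn'[of "wcount a K + 1"] poles_inverse_Dyn'[of "wcount a K"]]]) simp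
  qed
  thus ?thesis by (simp add: psi_def prod_inversef[symmetric] comp_def)
 qed
 have "\<forall>K. \<exists>A. (\<forall>p\<in>#A. \<exists>m. p = Dyn m) \<and> poles (specs + A) (%x. Lc x I K)"
  using poles_Lcoeff[OF ij(1), of j I] by blast
 then obtain LA where LA: "\<And>K. (\<forall>p\<in>#LA K. \<exists>m. p = Dyn m) \<and> poles (specs + LA K) (%x. Lc x I K)" by metis
 define G :: "'n pt => complex" where "G x = (\<Prod>a\<in>I. th (lv (shift (eps j) x) - of_int (wcount a I + 1) * yv (shift (eps j) x)))" for x
 have G: "holo G" unfolding G_def by (intro holo_shift[of "%x. \<Prod>a\<in>I. th (lv x - of_int (wcount a I + 1) * yv x)"] holo_intros)
 define A where "A = (\<Sum>K | card K = card I. LA K + psiA K)"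
 have "\<forall>p\<in>#psiA K. \<exists>m. p = Dyn m" for K
  unfolding psiA_def by (auto simp: set_mset_sum)
 hence Adyn: "\<forall>p\<in>#A. \<exists>m. p = Dyn m"
  unfolding A_def using LA by (intro ballI) (auto simp: set_mset_sum)
 have summand: "poles (specs + diff_forms UNIV + A) (%x. Lc x I K * stb K I x * (G x * inverse (diag_factor I x)))"
  if cK: "card K = card I" for K
 proof -
  have e: "Lc x I K * stb K I x * (G x * inverse (diag_factor I x))
   = G x * ((Lc x I K * inverse (psi \<tau> K (yv x) (lv x))) * (stabnum \<tau> K I x * inverse (diag_factor I x)))" for x
   using stab_stabnum[OF cK, of x] by (simp add: divide_inverse mult_ac)
  have "poles ((specs + LA K + psiA K) + (diff_forms I + image_mset Diff (mset_set S2))) (%x. Lc x I K * stb K I x * (G x * inverse (diag_factor I x)))"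
   unfolding e using LA[of K] by (intro poles_mult_holo G poles_mult 2 poles_stabnum 1) auto
  thus ?thesis
  proof (rule poles_mono)
   have "A = (LA K + psiA K) + (\<Sum>K\<in>{K. card K = card I} - {K}. LA K + psiA K)"
    unfolding A_def by (rule sum.remove) (use cK in auto)
   hence sub: "LA K + psiA K \<subseteq># A" by simp
   have D: "diff_forms I + image_mset Diff (mset_set S2) = diff_forms UNIV" unfolding S12 by (simp add: diff_forms_def S1_def)
   have "specs + LA K + psiA K + (diff_forms I + image_mset Diff (mset_set S2)) = specs + diff_forms UNIV + (LA K + psiA K)"
    unfolding D by (simp add: ac_simps)
   thus "specs + LA K + psiA K + (diff_forms I + image_mset Diff (mset_set S2)) \<subseteq># specs + diff_forms UNIV + A"
    using sub by simp
  qed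
 qed
 have "poles (specs + diff_forms UNIV + A) (%x. \<Sum>K | card K = card I. Lc x I K * stb K I x * (G x * inverse (diag_factor I x)))"
  by (intro poles_sum summand) simp
 hence "poles (specs + diff_forms UNIV + A) (M I I)"
 proof (rule poles_cong)
  show "GEN x. (\<Sum>K | card K = card I. Lc x I K * stb K I x * (G x * inverse (diag_factor I x))) = M I I x"
   using good_generic
  proof eventually_elim
   case (elim x)
   have nz: "diag_factor I x \<noteq> 0" using diag_factor_nonzero goodD(1)[OF elim] by blast
   have s: "stb I I (shift (eps j) x) = diag_factor I x / G x"
    unfolding stab_diag_regular[OF goodD(2)[OF elim]] G_def by simp
   have "stb I I (shift (eps j) x) \<noteq> 0" using stab_diag_nonzero goodD(2)[OF elim] by blast
   hence "G x \<noteq> 0" using s by auto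
   thus ?case
    using M_initial[OF elim I, of I] nz ij' unfolding sum_distrib_right[symmetric] s by (simp add: field_simps)
  qed
 qed
 thus ?thesis using Adyn by blast
qed

end

section \<open>The diagonal of L_11 and the last k sites\<close>

lemma initial_rk_image:
 fixes A :: "'n::{finite,linorder} set"
 assumes "initial A" shows "bij_betw rk A {..<card A}"
proof -
 have inj: "inj_on rk A" using inj_on_subset[OF rk_inj subset_UNIV] .
 have "rk ` A \<subseteq> {..<card A}"
 proof (clarsimp)
  fix a assume a: "a \<in> A"
  hence "{b. b < a} \<subset> A" using assms unfolding initial_def by (auto dest: less_asym)
  thus "rk a < card A" unfolding rk_def by (intro psubset_card_mono) auto
 qed
 hence "rk ` A = {..<card A}" using inj by (intro card_seteq) (auto simp: card_image)
 thus ?thesis using inj by (simp add: bij_betw_def)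
qed

text \<open>For the last k sites w(a, I) just counts the sites above a and takes each value 0, ...,
  k - 1 once; products over I thereby become telescoping products over s < k.\<close>

lemma final_above_image:
 fixes I :: "'n::{finite,linorder} set"
 assumes "initial (- I)" shows "bij_betw (%a. CARD('n) - 1 - rk a) I {..<card I}" "a \<in> I ==> wcount a I = int (CARD('n) - 1 - rk a)"
proof -
 have above: "{b\<in>I. b > a} = {b. b > a}" if "a \<in> I" for a using assms that unfolding initial_def by (auto dest: less_asym)
 have card_above: "card {b. b > a} = CARD('n) - 1 - rk a" for a :: 'n
 proof -
  have "(UNIV :: 'n set) = {b. b < a} \<union> insert a {b. b > a}" by auto
  hence "CARD('n) = card ({b. b < a} \<union> insert a {b. b > a})" by simp
  also have "\<dots> = card {b. b < a} + card (insert a {b. b > a})" by (rule card_Un_disjoint) auto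
  also have "\<dots> = rk a + Suc (card {b. b > a})" by (simp add: rk_def)
  finally show ?thesis by simp
 qed
 have r: "rk a < CARD('n)" for a :: 'n by (rule rk_lt_card)
 show "wcount a I = int (CARD('n) - 1 - rk a)" if "a \<in> I"
  unfolding wcount_rk above[OF that] card_above using r[of a] by simp
 have inj: "inj_on (%a. CARD('n) - 1 - rk a) I"
 proof (rule inj_onI)
  fix a b :: 'n assume "CARD('n) - 1 - rk a = CARD('n) - 1 - rk b"
  hence "rk a = rk b" using r[of a] r[of b] by simp
  thus "a = b" by (metis rk_inj injD)
 qed
 have "(%a. CARD('n) - 1 - rk a) ` I \<subseteq> {..<card I}"
 proof (clarsimp)
  fix a assume a: "a \<in> I"
  hence "{b. b > a} \<subset> I" using above[OF a] by auto
  hence "card {b. b > a} < card I" by (intro psubset_card_mono) auto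
  thus "CARD('n) - Suc (rk a) < card I" using card_above[of a] by simp
 qed
 thus "bij_betw (%a. CARD('n) - 1 - rk a) I {..<card I}"
  using inj card_seteq[of "{..<card I}"] by (auto simp: bij_betw_def card_image)
qed

lemma path_1_out_in: "set as \<inter> I = {} ==> path \<tau> w x j I K 1 (as @ bs) \<noteq> 0 ==> set as \<inter> K = {}"
 by (induction as) (auto simp: Let_def split: if_splits)

text \<open>The sites outside I are read first, and factor 0 starts in state 1, which it cannot
  leave there without K staying empty on them. So K lies in I, and equal size gives K = I.\<close>

lemma Lcoeff_final:
 fixes I :: "'n::{finite,linorder} set"
 assumes I: "initial (- I)"
 shows "card K = card I ==> Lcoeff \<tau> 1 1 w x I K \<noteq> 0 ==> K = I"
  "Lcoeff \<tau> 1 1 w x I I = (\<Prod>a\<in>- I. alpha \<tau> (w - x$$a) (yv x) (lv x - of_int (wcount a I) * yv x))"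
proof -
 have l: "sorted_list_of_set UNIV = sorted_list_of_set (- I) @ sorted_list_of_set I" using sorted_list_initial[OF I] by simp
 have p: "Lcoeff \<tau> 1 1 w x I K = path \<tau> w x 1 I K 1 (sorted_list_of_set (- I) @ sorted_list_of_set I)" for K
  unfolding l[symmetric] by (rule Lcoeff_path) simp
 show "K = I" if "card K = card I" "Lcoeff \<tau> 1 1 w x I K \<noteq> 0"
 proof -
  have "(- I) \<inter> K = {}" using path_1_out_in[of "sorted_list_of_set (- I)" I] that(2) unfolding p by simp
  hence "K \<subseteq> I" by auto
  thus ?thesis using that(1) by (simp add: card_subset_eq)
 qed
 have "path \<tau> w x 1 I I 1 (sorted_list_of_set I @ []) = path \<tau> w x 1 I I 1 []"
  by (rule path_1_both) simp
 thus "Lcoeff \<tau> 1 1 w x I I = (\<Prod>a\<in>- I. alpha \<tau> (w - x$$a) (yv x) (lv x - of_int (wcount a I) * yv x))"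
  unfolding p by (subst path_1_neither) auto
qed

lemma prod_quotient_shift:
 fixes F :: "nat => complex"
 assumes "\<And>s. s \<le> m ==> F s \<noteq> 0"
 shows "(\<Prod>s<m. F s / F (Suc s)) = F 0 / F m"
 using assms by (induction m) (auto simp: field_simps)

context spectral
begin

context
 fixes I :: "'n::{finite,linorder} set"
 assumes I: "initial (- I)"
begin

lemma prod_final: "(\<Prod>a\<in>I. g (wcount a I)) = (\<Prod>s<card I. g (int s))"
 using prod.reindex_bij_betw[OF final_above_image(1)[OF I], of "%s. g (int s)"] final_above_image(2)[OF I] by simp

lemma psi_final: "psi \<tau> I y l = (\<Prod>s<card I. th (l - of_nat (Suc s) * y)) * (\<Prod>s<card I. th (l - of_nat s * y))"
 unfolding psi_generic_form using prod_final[of "%m. th (l - of_int (m + 1) * y)"] prod_final[of "%m. th (l - of_int m * y)"]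
 by (simp add: add.commute)

lemma stab_diag_final:
 assumes "regular x"
 shows "stb I I x = diag_factor I x / (\<Prod>s<card I. th (lv x - of_nat (Suc s) * yv x))"
 using stab_diag_regular[OF assms, of I] prod_final[of "%m. th (lv x - of_int (m + 1) * yv x)"] by (simp add: add.commute)

lemma regular_dyn_nat:
 fixes x :: "'n pt"
 assumes "regular x" "s \<le> CARD('n) + 2" shows "th (lv x - of_nat s * yv x) \<noteq> 0"
 using regular_dyn(2)[OF assms(1), of "int s"] assms(2) by simp

text \<open>Outside I the count w(a, I) grows by one from each site to the next, so the
  lambda-factors of the alphas telescope to F 0 / F m.\<close>

lemma Lcoeff_final_value:
 assumes x: "regular x"
 shows "Lcoeff \<tau> 1 1 w x I I = (\<Prod>a\<in>- I. th (w - x$$a) * inverse (th (w - x$$a - yv x)))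
  * (th (lv x - of_int (2 * int (card I) - int CARD('n)) * yv x) / th (lv x - of_nat (card I) * yv x))"
proof -
 define m where "m = CARD('n) - card I"
 have cle: "card I \<le> CARD('n)" by (rule card_mono) auto
 have cm: "card (- I) = m" unfolding m_def by (simp add: Compl_eq_Diff_UNIV card_Diff_subset)
 define F where "F r = th (lv x - of_int (2 * int (card I) - int CARD('n) + int r) * yv x)" for r
 have wc: "wcount a I = 2 * int (card I) - int CARD('n) + int (Suc (rk a))" if "a \<in> - I" for a
 proof -
  have "{b\<in>I. b > a} = I" using I that unfolding initial_def by auto
  thus ?thesis unfolding wcount_rk by simp
 qed
 have F: "F r \<noteq> 0" if "r \<le> m" for r
  unfolding F_def by (rule regular_dyn(2)[OF x]) (use that cle m_def in auto)
 have "Lcoeff \<tau> 1 1 w x I I = (\<Prod>a\<in>- I. (th (w - x$$a) * inverse (th (w - x$$a - yv x))) * (F (rk a) / F (Suc (rk a))))"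
  unfolding Lcoeff_final(2)[OF I]
 proof (intro prod.cong refl)
  fix a assume a: "a \<in> - I"
  show "al (w - x$$a) (yv x) (lv x - of_int (wcount a I) * yv x)
   = (th (w - x$$a) * inverse (th (w - x$$a - yv x))) * (F (rk a) / F (Suc (rk a)))"
   unfolding alpha_def F_def wc[OF a] by (simp add: field_simps)
 qed
 also have "\<dots> = (\<Prod>a\<in>- I. th (w - x$$a) * inverse (th (w - x$$a - yv x))) * (\<Prod>a\<in>- I. F (rk a) / F (Suc (rk a)))"
  by (simp only: prod.distrib)
 also have "(\<Prod>a\<in>- I. F (rk a) / F (Suc (rk a))) = (\<Prod>r<m. F r / F (Suc r))"
  using prod.reindex_bij_betw[OF initial_rk_image[OF I], of "%r. F r / F (Suc r)"] by (simp add: cm)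
 also have "\<dots> = F 0 / F m" by (rule prod_quotient_shift[OF F])
 also have "F m = th (lv x - of_nat (card I) * yv x)"
  unfolding F_def m_def using cle by (simp add: of_nat_diff)
 finally show ?thesis by (simp add: F_def)
qed

lemma stabnum_final:
 assumes x: "regular x"
 shows "stabnum \<tau> I I x = diag_factor I x * (\<Prod>s<card I. th (lv x - of_nat s * yv x))"
proof -
 have c: "card I \<le> CARD('n)" by (rule card_mono) auto
 have n: "(\<Prod>s<card I. th (lv x - of_nat (Suc s) * yv x)) \<noteq> 0" "(\<Prod>s<card I. th (lv x - of_nat s * yv x)) \<noteq> 0"
  using regular_dyn_nat[OF x] c by (auto simp del: of_nat_Suc)
 show ?thesis
  using stab_stabnum[of I I x] stab_diag_final[OF x] n unfolding psi_final by (simp add: field_simps del: of_nat_Suc)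
qed

end

end

context quantum_entry
begin

definition row_factor :: "nat => 'n set => 'n pt => complex" where
 "row_factor k I x = (\<Prod>a\<in>- I. th (w - x$$a)) * th (lv x - of_int (2 * int k - int CARD('n)) * yv x) * th (lv x - of_nat (Suc k) * yv x)
  * ((\<Prod>a\<in>- I. inverse (th (w - x$$a - yv x))) * (inverse (th (lv x + of_int 0 * yv x)) * inverse (th (lv x + of_int (- 1) * yv x))))"

lemma poles_row_factor: "poles (specs + {#Dyn 0, Dyn (- 1)#}) (row_factor k I)"
proof -
 have "poles {#Dyn 0, Dyn (- 1)#} (%x :: 'n pt. inverse (th (lv x + of_int 0 * yv x)) * inverse (th (lv x + of_int (- 1) * yv x)))"
  by (rule poles_mono[OF poles_mult[OF poles_inverse_Dyn[of 0] poles_inverse_Dyn[of "- 1"]]]) simp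
 from poles_mult[OF poles_inverse_specs[of "- I"] this]
 show ?thesis unfolding row_factor_def
  by (rule poles_mult_holo) (intro holo_intros)
qed

text \<open>The relation for the last sites, multiplied by psi at the shifted point. The quotient of
  the two psi telescopes to P (k + 1) P k / (P 1 P 0), and P k cancels the denominator of
  \<open>Lcoeff_final_value\<close>; only lambda and lambda - y are left in the dynamical
  denominator.\<close>

lemma M_final_row:
 assumes ij': "i = 1" "j = 1" and I: "initial (- I)" and card: "card K = card I" and x: "good x"
 shows "(\<Sum>K' | card K' = card I. M K K' x * stabnum \<tau> I K' (shift (- 1) x)) = row_factor (card I) I x * stabnum \<tau> I K x"
proof -
 define k where "k = card I"
 have k: "k \<le> CARD('n)" unfolding k_def by (rule card_mono) auto
 have ej: "eps j = - 1" by (simp add: eps_def ij')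
 note reg = goodD(1)[OF x]
 define P where "P s = th (lv x - of_nat s * yv x)" for s
 have P: "P s \<noteq> 0" if "s \<le> Suc k" for s unfolding P_def by (rule regular_dyn_nat[OF I reg]) (use that k in simp)
 have sh: "yv (shift (- 1) x) = yv x" "lv (shift (- 1) x) = lv x - yv x" by (cases x; simp add: shift_def)+
 have psi: "psi \<tau> I (yv x) (lv x) = (\<Prod>s<k. P (Suc s)) * (\<Prod>s<k. P s)"
  unfolding psi_final[OF I] P_def k_def ..
 have psis: "psi \<tau> I (yv (shift (- 1) x)) (lv (shift (- 1) x)) = (\<Prod>s<k. P (Suc (Suc s))) * (\<Prod>s<k. P (Suc s))"
  unfolding psi_final[OF I] sh P_def k_def by (simp add: algebra_simps)
 have pn: "(\<Prod>s<k. P (Suc s)) \<noteq> 0" "(\<Prod>s<k. P s) \<noteq> 0" "(\<Prod>s<k. P (Suc (Suc s))) \<noteq> 0" using P by auto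
 have t1: "(\<Prod>s<k. P s) * P k = P 0 * (\<Prod>s<k. P (Suc s))" "(\<Prod>s<k. P (Suc s)) * P (Suc k) = P (Suc 0) * (\<Prod>s<k. P (Suc (Suc s)))"
  using prod.lessThan_Suc_shift[of P k] prod.lessThan_Suc[of P k] prod.lessThan_Suc_shift[of "%s. P (Suc s)" k] prod.lessThan_Suc[of "%s. P (Suc s)" k] by simp_all
 have row: "(\<Sum>K' | card K' = card I. M K K' x * stb I K' (shift (- 1) x)) = Lcoeff \<tau> 1 1 w x I I * stb I K x"
 proof -
  have "L_stab I K x = (\<Sum>K''\<in>{I}. Lc x I K'' * stb K'' K x)"
  proof (rule sum.mono_neutral_right)
   show "\<forall>K''\<in>{K''. card K'' = card K} - {I}. Lc x I K'' * stb K'' K x = 0"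
    using Lcoeff_final(1)[OF I, of _ \<tau> w x] unfolding ij' using card by fastforce
  qed (use card in auto)
  thus ?thesis using goodD(3)[OF x, of K I] card unfolding ej unfolding ij' by simp
 qed
 have "(\<Sum>K' | card K' = card I. M K K' x * stabnum \<tau> I K' (shift (- 1) x))
  = (\<Sum>K' | card K' = card I. M K K' x * stb I K' (shift (- 1) x)) * psi \<tau> I (yv (shift (- 1) x)) (lv (shift (- 1) x))"
  unfolding sum_distrib_right
 proof (intro sum.cong refl)
  fix K' :: "'n set" assume "K' \<in> {K'. card K' = card I}"
  hence "stb I K' (shift (- 1) x) = stabnum \<tau> I K' (shift (- 1) x) / psi \<tau> I (yv (shift (- 1) x)) (lv (shift (- 1) x))"
   by (intro stab_stabnum) simp
  thus "M K K' x * stabnum \<tau> I K' (shift (- 1) x) = M K K' x * stb I K' (shift (- 1) x) * psi \<tau> I (yv (shift (- 1) x)) (lv (shift (- 1) x))"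
   using pn unfolding psis by simp
 qed
 also have "\<dots> = Lcoeff \<tau> 1 1 w x I I * (psi \<tau> I (yv (shift (- 1) x)) (lv (shift (- 1) x)) / psi \<tau> I (yv x) (lv x)) * stabnum \<tau> I K x"
  unfolding row using stab_stabnum[of I K x] card by simp
 also have "psi \<tau> I (yv (shift (- 1) x)) (lv (shift (- 1) x)) / psi \<tau> I (yv x) (lv x) = (P (Suc k) * P k) / (P (Suc 0) * P 0)"
 proof -
  have "(\<Prod>s<k. P (Suc (Suc s))) * (P (Suc 0) * P 0) = P (Suc k) * P k * (\<Prod>s<k. P s)"
   using t1 by algebra
  thus ?thesis unfolding psi psis using pn P[of 0] P[of "Suc 0"] by (simp add: field_simps)
 qed
 finally have "(\<Sum>K' | card K' = card I. M K K' x * stabnum \<tau> I K' (shift (- 1) x))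
  = Lcoeff \<tau> 1 1 w x I I * ((P (Suc k) * P k) / (P (Suc 0) * P 0)) * stabnum \<tau> I K x" .
 also have "Lcoeff \<tau> 1 1 w x I I * ((P (Suc k) * P k) / (P (Suc 0) * P 0)) = row_factor (card I) I x"
  unfolding Lcoeff_final_value[OF I reg] k_def[symmetric] P_def[symmetric] row_factor_def prod.distrib
  using P[of k] by (simp add: P_def field_simps)
 finally show ?thesis .
qed

end

definition dyns :: "nat => nat => 'n form multiset" where
 "dyns m k = image_mset (%s. Dyn (- int s)) (mset_set {m..k})"

lemma dyns_subset: "m' \<le> m ==> k \<le> k' ==> dyns m k \<subseteq># dyns m' k'"
 unfolding dyns_def by (intro image_mset_subseteq_mono subset_imp_msubset_mset_set) auto

lemma dyns_0: "k \<ge> 1 ==> dyns 0 k = {#Dyn 0, Dyn (- 1)#} + dyns 2 k"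
proof -
 assume "k \<ge> 1"
 hence "{0..k} = insert 0 (insert 1 {2..k})" by auto
 thus ?thesis by (simp add: dyns_def)
qed

lemma dyns_dyn: "p \<in># dyns m k ==> \<exists>j. p = Dyn j"
 by (auto simp: dyns_def)

text \<open>The forms free of lambda and w. Permutations preserve this class and shifts fix its
  members, so bounds modulo junk can be transported.\<close>

fun junk_form :: "'n form => bool" where
 "junk_form (Diff S) \<longleftrightarrow> card S = 2"
| "junk_form (DiffY a b) \<longleftrightarrow> a \<noteq> b"
| "junk_form _ \<longleftrightarrow> False"

lemma junk_valid: "junk_form p ==> valid_form p"
 by (cases p) auto

lemma junk_diff_forms: "p \<in># diff_forms K ==> junk_form p"
 by (auto simp: diff_forms_def)

context spectral
begin

lemma junk_perm: "bij \<pi> ==> junk_form p ==> junk_form (perm_form \<pi> p)"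
 by (cases p) (auto simp: card_image[OF inj_on_subset[OF bij_is_inj]] bij_is_inj inj_eq)

lemma junk_shift: "junk_form p ==> shift_form \<nu> p = p"
 by (cases p) auto

text \<open>Poles along the divisors \<open>z\<^sub>a = z\<^sub>b\<close> and \<open>z\<^sub>a - z\<^sub>b + y = 0\<close> are disregarded.\<close>

definition poles_upto :: "('n::{finite,linorder}) form multiset => ('n pt => complex) => bool" where
 "poles_upto A f \<longleftrightarrow> (\<exists>J. (\<forall>p\<in>#J. junk_form p) \<and> poles (A + J) f)"

lemma poles_uptoI: "poles (A + J) f ==> (\<And>p. p \<in># J ==> junk_form p) ==> poles_upto A f"
 unfolding poles_upto_def by blast

lemma poles_upto_mono: "poles_upto A f ==> A \<subseteq># B ==> poles_upto B f"
 unfolding poles_upto_def using poles_mono by (metis subset_mset.add_right_mono)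

lemma poles_upto_cong: "poles_upto A f ==> (GEN x. f x = g x) ==> poles_upto A g"
 unfolding poles_upto_def using poles_cong by metis

lemma poles_upto_mult: "poles_upto A f ==> poles_upto B g ==> poles_upto (A + B) (%x. f x * g x)"
proof -
 assume "poles_upto A f" "poles_upto B g"
 then obtain J L where *: "\<forall>p\<in>#J. junk_form p" "poles (A + J) f" "\<forall>p\<in>#L. junk_form p" "poles (B + L) g"
  unfolding poles_upto_def by blast
 have e: "(A + J) + (B + L) = (A + B) + (J + L)" by (simp add: ac_simps)
 show ?thesis
  using poles_mult[OF *(2,4)] *(1,3) unfolding e by (intro poles_uptoI[of _ "J + L"]) auto
qed

lemma poles_upto_add: "poles_upto A f ==> poles_upto A g ==> poles_upto A (%x. f x + g x)"
proof -
 assume "poles_upto A f" "poles_upto A g"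
 then obtain J L where *: "\<forall>p\<in>#J. junk_form p" "poles (A + J) f" "\<forall>p\<in>#L. junk_form p" "poles (A + L) g"
  unfolding poles_upto_def by blast
 have "poles (A + (J + L)) f" "poles (A + (J + L)) g" using *(2,4) by (auto elim!: poles_mono)
 thus ?thesis using *(1,3) by (intro poles_uptoI[of _ "J + L"] poles_add) auto
qed

lemma poles_upto_holo: "holo f ==> poles_upto {#} f"
 using poles_uptoI[of "{#}" "{#}" f] poles_holo by auto

lemma poles_upto_sum: "(\<And>i. i \<in> I ==> poles_upto A (f i)) ==> poles_upto A (%x. \<Sum>i\<in>I. f i x)"
proof (induction I rule: infinite_finite_induct)
 case empty
 show ?case using poles_upto_mono[OF poles_upto_holo[OF holo_const, of 0]] by simp
next
 case (infinite I)
 show ?case using poles_upto_mono[OF poles_upto_holo[OF holo_const, of 0]] infinite by simp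
next
 case (insert i I)
 thus ?case using poles_upto_add[of A "f i" "%x. \<Sum>i\<in>I. f i x"] by simp
qed

lemma poles_upto_poles: "poles A f ==> poles_upto A f"
 using poles_uptoI[of A "{#}" f] by simp

lemma poles_upto_uminus: "poles_upto A f ==> poles_upto A (%x. - f x)"
 unfolding poles_upto_def using poles_uminus by blast

lemma poles_upto_stabnum: "poles_upto {#} (stabnum \<tau> I K)"
 using poles_stabnum[of K I] junk_diff_forms by (intro poles_uptoI[of _ "diff_forms K"]) auto

lemma poles_upto_shift: "poles_upto {#} f ==> poles_upto {#} (%x. f (shift \<nu> x))"
proof -
 assume "poles_upto {#} f"
 then obtain J where J: "\<forall>p\<in>#J. junk_form p" "poles J f" unfolding poles_upto_def by auto
 have "image_mset (shift_form \<nu>) J = image_mset (%p. p) J" by (intro image_mset_cong) (use J junk_shift in auto)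
 thus ?thesis using poles_shift[OF J(2), of \<nu>] J(1) by (intro poles_uptoI[of _ J]) auto
qed

lemma poles_upto_diag_factor: "poles_upto {#} (%x. inverse (diag_factor I x))"
proof -
 have "poles_upto {#} (%x. inverse (th (x$$i - x$$a + yv x)))" if "a \<noteq> i" for a i :: 'a
  using poles_inverse_thf[of "DiffY i a"] that by (intro poles_uptoI[of _ "{#DiffY i a#}"]) auto
 moreover have "poles_upto {#} (%x. inverse (th (x$$i - x$$a)))" if "a \<noteq> i" for a i :: 'a
  using poles_inverse_Diff[of i a] that by (intro poles_uptoI[of _ "{#Diff {i, a}#}"]) auto
 moreover have pr: "poles_upto {#} (%x. \<Prod>i\<in>S. f i x)" if "\<And>i. i \<in> S ==> poles_upto {#} (f i)" for S :: "'a set" and f :: "'a => 'a pt => complex"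
  using finite[of S] that
 proof (induction S rule: finite_induct)
  case (insert i S)
  thus ?case using poles_upto_mult[of "{#}" "f i" "{#}"] by simp
 qed (simp add: poles_upto_holo holo_const)
 ultimately have "poles_upto {#} (%x. \<Prod>i\<in>I. (\<Prod>a | a < i \<and> a \<notin> I. inverse (th (x$$i - x$$a + yv x))) * (\<Prod>a | a > i \<and> a \<notin> I. inverse (th (x$$i - x$$a))))"
  by (intro pr poles_upto_mult[of "{#}" _ "{#}", simplified]) auto
 thus ?thesis unfolding diag_factor_def by (simp add: prod_inversef[symmetric] comp_def)
qed

lemma poles_inverse_dyns: "poles (dyns m k) (%x. \<Prod>s=m..k. inverse (th (lv x - of_nat s * yv x)))"
proof -
 have "poles (\<Sum>s=m..k. {#Dyn (- int s)#}) (%x. \<Prod>s=m..k. inverse (th (lv x - of_nat s * yv x)))"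
  using poles_inverse_Dyn'[of "int _"] by (intro poles_prod) simp
 thus ?thesis by (simp add: sum_singleton_mset dyns_def)
qed

lemma th_y_generic: "eventually (%x :: ('n::finite) pt. th (yv x) \<noteq> 0) generic"
proof (rule gen_on_UNIV_generic)
 show "gen_on UNIV (%x :: 'n pt. th (yv x))"
 proof (rule gen_on_line)
  fix x :: "'n pt"
  obtain c where "th (c + yv x) \<noteq> 0"
   using eventually_happens[OF eventually_theta_affine_nonzero[of 1 "yv x" 0]] by auto
  thus "\<exists>v. (\<forall>c. x + cscale c v \<in> UNIV) \<and> th (yv (x + v)) \<noteq> 0"
   by (intro exI[of _ "(0, c, 0)"]) (simp add: add.commute)
 qed (intro holo_intros)
 show "continuous_on UNIV (%x :: 'n pt. th (yv x))" by (intro holo_continuous holo_intros)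
qed

text \<open>Each summand contains lambda in one theta for every i in I. The sum of their arguments
  does not depend on f, because f maps onto K, so all summands acquire the same multiplier.\<close>

lemma stabnum_translate:
 fixes I K :: "'n::{finite,linorder} set"
 assumes "c \<in> \<Lambda>"
 obtains U where "holo U" "\<And>x. U x \<noteq> 0" "\<And>x. stabnum \<tau> I K (x + (0, 0, c)) = U x * stabnum \<tau> I K x"
proof -
 obtain s b where sb: "s \<noteq> 0" "\<And>z. th (z + c) = s * exp (b * z) * th z" using theta_add_lattice[OF assms] by blast
 define e where "e x = (\<Sum>i\<in>I. lv x - x$$i - of_int (wcount i I) * yv x) + (\<Sum>a\<in>K. x$$a)" for x :: "'n pt"
 define U where "U x = s ^ card I * exp (b * e x)" for x
 have w: "wterm \<tau> I (%i. fst (x + (0, 0, c))$f i) (x + (0, 0, c)) = U x * wterm \<tau> I (%i. x$$f i) x"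
  if f: "f \<in> decreasing_bij I K" for f x
 proof -
  obtain z y l where x: "x = (z, y, l)" by (metis prod_cases3)
  have bij: "bij_betw f I K" using f by (simp add: decreasing_bij_def Bij_def)
  have "e x = (\<Sum>i\<in>I. l + z$f i - z$i - of_int (wcount i I) * y)"
   unfolding e_def sum.reindex_bij_betw[OF bij, of "%a. x$$a", symmetric] sum.distrib[symmetric]
   by (intro sum.cong) (auto simp: x)
  hence "U x = (\<Prod>i\<in>I. s * exp (b * (l + z$f i - z$i - of_int (wcount i I) * y)))"
   unfolding U_def by (simp add: prod.distrib exp_sum sum_distrib_left)
  moreover have "th (l + c + z$f i - z$i - of_int (wcount i I) * y)
    = s * exp (b * (l + z$f i - z$i - of_int (wcount i I) * y)) * th (l + z$f i - z$i - of_int (wcount i I) * y)" for i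
   using sb(2)[of "l + z$f i - z$i - of_int (wcount i I) * y"] by (simp add: algebra_simps)
  ultimately show ?thesis
   unfolding wterm_def x by (simp add: prod.distrib mult_ac)
 qed
 have "holo U" unfolding U_def e_def
  by (rule holo_compose_1[where g = "%t. s ^ card I * exp (b * t)" and V = UNIV]) (auto intro!: holo_intros holomorphic_intros)
 moreover have "U x \<noteq> 0" for x using sb(1) by (simp add: U_def)
 moreover have "stabnum \<tau> I K (x + (0, 0, c)) = U x * stabnum \<tau> I K x" for x
  unfolding stabnum_def sum_distrib_left by (intro sum.cong refl w)
 ultimately show ?thesis using that by blast
qed

text \<open>If the cleared numerator H vanishes on lambda in \<Lambda>, it is divisible by th
  lambda. Otherwise a point where H is nonzero can be translated to every component of this
  hypersurface, and a line inside the component connects it to any other point.\<close>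

lemma stabnum_dichotomy:
 fixes I K :: "'n::{finite,linorder} set"
 obtains H where "holo H" "GEN x. fprod (diff_forms K) x * stabnum \<tau> I K x = H x"
  "gen_on {x. lv x \<in> \<Lambda>} H \<or> (\<forall>x. lv x \<in> \<Lambda> \<longrightarrow> H x = 0) \<and> poles (diff_forms K) (%x. inverse (th (lv x)) * stabnum \<tau> I K x)"
proof -
 obtain H where H: "holo H" "GEN x. fprod (diff_forms K) x * stabnum \<tau> I K x = H x"
  using poles_stabnum[of K I] unfolding poles_def ext_def by blast
 show ?thesis
 proof (cases "\<forall>x. lv x \<in> \<Lambda> \<longrightarrow> H x = 0")
  case True
  have "linear (lv :: 'n pt => complex)" by (intro linearI) auto
  hence aff: "affine_fn (lv :: 'n pt => complex) lv" by (auto simp: affine_fn_def cscale_def case_prod_beta)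
  obtain G where G: "holo G" "\<And>x. H x = th (lv x) * G x"
   by (rule holo_theta_divides[OF aff, of "(0, 0, 1)" H]) (use H(1) True in auto)
  have "ext (%x. fprod (diff_forms K) x * (inverse (th (lv x)) * stabnum \<tau> I K x))"
  proof (rule ext_cong[OF ext_holo[OF G(1)]])
   show "GEN x. G x = fprod (diff_forms K) x * (inverse (th (lv x)) * stabnum \<tau> I K x)"
    using H(2) regular_generic
   proof eventually_elim
    case (elim x)
    have "th (lv x) \<noteq> 0" using regular_dyn(1)[OF elim(2), of 0] by simp
    thus ?case using elim(1) G(2)[of x] by (simp add: field_simps)
   qed
  qed
  thus ?thesis using that[OF H] True by (simp add: poles_def)
 next
  case False
  then obtain x0 where x0: "lv x0 \<in> \<Lambda>" "H x0 \<noteq> 0" by blast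
  have "gen_on {x. lv x \<in> \<Lambda>} H"
  proof (rule gen_on_line[OF H(1)])
   fix x :: "'n pt" assume x: "x \<in> {x. lv x \<in> \<Lambda>}"
   \<comment> \<open>The translation in lambda that takes x0 to the component containing x.\<close>
   define c where "c = lv x - lv x0"
   have c: "c \<in> \<Lambda>" unfolding c_def using x x0(1) lattice1_diff by auto
   obtain U where U: "holo U" "\<And>x. U x \<noteq> 0" "\<And>x. stabnum \<tau> I K (x + (0, 0, c)) = U x * stabnum \<tau> I K x"
    using stabnum_translate[OF c, where I=I and K=K] by blast
   have fp: "fprod (diff_forms K) (x + (0, 0, c)) = fprod (diff_forms K) x" for x
    unfolding fprod_def by (intro arg_cong[of _ _ prod_mset] image_mset_cong) (auto simp: diff_forms_def)
   have "GEN x. H (x + (0, 0, c)) = U x * H x"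
    using H(2) generic_translate[OF H(2), of "(0, 0, c)"]
   proof eventually_elim
    case (elim x)
    thus ?case using U(3)[of x] by (simp add: fp mult_ac flip: elim)
   qed
   hence "H (x0 + (0, 0, c)) = U x0 * H x0"
   proof (rule generic_eq_imp_eq)
    show "continuous_on UNIV (%x. H (x + (0, 0, c)))"
     by (rule continuous_on_compose2[OF holo_continuous[OF H(1)]]) (auto intro!: continuous_on_add continuous_on_id continuous_on_const)
    show "continuous_on UNIV (%x. U x * H x)" using U(1) H(1) by (intro holo_continuous holo_intros)
   qed
   hence "H (x0 + (0, 0, c)) \<noteq> 0" using U(2) x0(2) by simp
   thus "\<exists>v. (\<forall>c. x + cscale c v \<in> {x. lv x \<in> \<Lambda>}) \<and> H (x + v) \<noteq> 0"
    using x by (intro exI[of _ "x0 + (0, 0, c) - x"]) (auto simp: c_def cscale_def case_prod_beta)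
  qed
  thus ?thesis using that[OF H] by blast
 qed
qed

lemma gen_on_shift:
 fixes H :: "'n::{finite,linorder} pt => complex"
 assumes "gen_on {x. lv x \<in> \<Lambda>} H"
 shows "gen_on {x. ev w (Dyn (- 1)) x \<in> \<Lambda>} (%x. H (shift (- 1) x))"
 unfolding gen_on_iff
proof (intro ballI allI impI)
 fix x :: "'n pt" and U assume x: "x \<in> {x. ev w (Dyn (- 1)) x \<in> \<Lambda>}" and U: "open U \<and> x \<in> U"
 have "open (shift 1 -` U)" using U by (intro open_vimage) (auto intro: continuous_intros)
 moreover have "shift (- 1) x \<in> shift 1 -` U" using U by simp
 moreover have "shift (- 1) x \<in> {x. lv x \<in> \<Lambda>}" using x by (simp add: shift_def case_prod_beta)
 ultimately obtain y where y: "y \<in> {x. lv x \<in> \<Lambda>} \<inter> (shift 1 -` U)" "H y \<noteq> 0"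
  using assms unfolding gen_on_iff by blast
 have "ev w (Dyn (- 1)) (shift 1 y) = lv y" by (simp add: shift_def case_prod_beta)
 thus "\<exists>y\<in>{x. ev w (Dyn (- 1)) x \<in> \<Lambda>} \<inter> U. H (shift (- 1) y) \<noteq> 0"
  using y by (intro bexI[of _ "shift 1 y"]) auto
qed

end

lemma eventually_generic_ex: "eventually P generic ==> \<exists>x. P x" for P :: "('n::finite) pt => bool"
proof -
 assume "eventually P generic"
 then obtain A where A: "closure A = UNIV" "\<forall>x\<in>A. P x" unfolding eventually_generic by blast
 hence "A \<noteq> {}" by auto
 thus ?thesis using A(2) by blast
qed

lemma prod_inverse: "(\<Prod>s\<in>A. inverse (f s)) = inverse (\<Prod>s\<in>A. f s)" for f :: "'a => complex"
 using prod_inversef[of f A] by (simp add: comp_def)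

context spectral
begin

lemma perm_specs:
 assumes "bij \<pi>" shows "image_mset (perm_form \<pi>) specs = specs"
proof -
 have "image_mset (perm_form \<pi>) specs = image_mset Spec (image_mset \<pi> (mset_set UNIV))"
  by (simp add: specs_def multiset.map_comp comp_def)
 also have "image_mset \<pi> (mset_set UNIV) = mset_set UNIV"
  using assms by (simp add: image_mset_mset_set bij_is_surj bij_is_inj)
 finally show ?thesis by (simp add: specs_def)
qed

lemma perm_dyns: "image_mset (perm_form \<pi>) (dyns m k) = dyns m k"
 by (simp add: dyns_def multiset.map_comp comp_def)

text \<open>For one occupied site, the last one, the numerator is an explicit product that is not
  identically zero on lambda = 0. This settles k = 1 < n, where the vanishing hypothesis
  fails.\<close>

lemma stabnum_single:
 fixes e c :: "'n::{finite,linorder}"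
 assumes e: "\<And>a. a \<le> e" and "c \<noteq> e"
 shows "\<exists>x. lv x \<in> \<Lambda> \<and> stabnum \<tau> {e} {c} x \<noteq> 0" "holo (stabnum \<tau> {e} {c})"
proof -
 define f where "f = (%i. if i = e then c else undefined)"
 have "decreasing_bij {e} {c} = {f}"
  using e by (auto simp: decreasing_bij_def Bij_def f_def bij_betw_def extensional_def fun_eq_iff)
 moreover have ab: "{a. a > e} = {}" using e by (auto simp: not_less)
 moreover have "wcount e {e} = 0" unfolding wcount_eq ab by simp
 moreover have pr: "(\<Prod>(i, j)\<in>{(i, j). i \<in> {e} \<and> j \<in> {e} \<and> i < j}. F i j) = 1" for F :: "'n => 'n => complex"
  by (rule prod.neutral) auto
 moreover have pr2: "(\<Prod>a | a > e. G a) = 1" for G :: "'n => complex" unfolding ab by simp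
 ultimately have s: "stabnum \<tau> {e} {c} x = (\<Prod>a | a < e. th (x$$c - x$$a + yv x)) * th (lv x + x$$c - x$$e)" for x
  unfolding stabnum_def wterm_def by (cases x) (simp only: prod.case pr, simp add: f_def pr2)
 show "holo (stabnum \<tau> {e} {c})" unfolding s[abs_def] by (intro holo_intros)
 obtain x :: "'n pt" where x: "regular x" "th (yv x) \<noteq> 0"
  using eventually_generic_ex[OF eventually_conj[OF regular_generic th_y_generic]] by blast
 define x' where "x' = (fst x, yv x, 0 :: complex)"
 have "th (x$$c - x$$a + yv x) \<noteq> 0" for a using regularD(2)[OF x(1), of c a] x(2) by (cases "a = c") auto
 moreover have "th (x$$c - x$$e) \<noteq> 0" using regularD(1)[OF x(1)] assms(2) by auto
 ultimately have "stabnum \<tau> {e} {c} x' \<noteq> 0" unfolding s x'_def by simp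
 thus "\<exists>x. lv x \<in> \<Lambda> \<and> stabnum \<tau> {e} {c} x \<noteq> 0" by (intro exI[of _ x']) (simp add: x'_def lattice1_0)
qed

end

context quantum_entry
begin

context
 fixes I :: "'n set"
 assumes ij': "i = 1" "j = 1" and I: "initial (- I)"
begin

text \<open>Shifting lambda by - y turns \<open>P s\<close> into \<open>P (Suc s)\<close>. Hence the
  diagonal of the shifted numerator \<open>W\<close> has the factors s = 1, ..., k in place of s =
  0, ..., k - 1.\<close>

definition P :: "nat => 'n pt => complex" where "P s x = th (lv x - of_nat s * yv x)"

definition W :: "'n set => 'n pt => complex" where "W K x = stabnum \<tau> I K (shift (- 1) x)"

lemma P_holo [holo_intros]: "holo_on (P s) U"
 unfolding P_def by (intro holo_intros)

lemma card_le: "card I \<le> CARD('n)"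
 by (rule card_mono) auto

lemma P_nonzero: "regular x ==> s \<le> CARD('n) + 2 ==> P s (x :: 'n pt) \<noteq> 0"
 unfolding P_def by (rule regular_dyn_nat[OF I])

lemma poles_inverse_P: "poles {#Dyn (- int s)#} (%x. inverse (P s x))"
 unfolding P_def using poles_inverse_Dyn'[of "int s"] by simp

lemma poles_inverse_Ps: "poles (dyns m k) (%x. \<Prod>s=m..k. inverse (P s x))"
 unfolding P_def by (rule poles_inverse_dyns)

lemma W_diag: "good x ==> W I x = diag_factor I x * (\<Prod>s=1..card I. P s x)"
proof -
 assume x: "good x"
 have "eps j = - 1" by (simp add: eps_def ij')
 hence "regular (shift (- 1) x)" using goodD(2)[OF x] by simp
 from stabnum_final[OF I this] show ?thesis
  unfolding W_def One_nat_def prod.atLeast1_atMost_eq diag_factor_shift by (simp add: P_def shift_def case_prod_beta algebra_simps)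
qed

lemma row_split:
 assumes x: "good x" and K: "card K = card I"
 shows "M K K x * W K x = row_factor (card I) I x * stabnum \<tau> I K x - (\<Sum>K'\<in>{K'. card K' = card I} - {K}. M K K' x * W K' x)"
proof -
 have "(\<Sum>K' | card K' = card I. M K K' x * W K' x) = M K K x * W K x + (\<Sum>K'\<in>{K'. card K' = card I} - {K}. M K K' x * W K' x)"
  using K by (intro sum.remove) auto
 thus ?thesis using M_final_row[OF ij' I K x] unfolding W_def by simp
qed

lemma poles_upto_W: "poles_upto {#} (W K)"
 unfolding W_def by (rule poles_upto_shift[OF poles_upto_stabnum])

lemma poles_upto_M_move: "card K = card K' ==> K \<noteq> K' ==> poles_upto (specs + {#Dyn 0, Dyn (- 1)#}) (M K K')"
proof -
 assume "card K = card K'" "K \<noteq> K'"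
 hence "poles (move_forms K K') (M K K')" by (intro poles_M_move) (auto simp: ij')
 thus ?thesis unfolding move_forms_def
  by (rule poles_uptoI) (auto simp: move_pairs_def)
qed

lemma poles_upto_row:
 assumes K: "card K = card I"
 shows "poles_upto (specs + {#Dyn 0, Dyn (- 1)#}) (%x. M K K x * W K x)"
proof (rule poles_upto_cong)
 have "poles_upto (specs + {#Dyn 0, Dyn (- 1)#}) (%x. row_factor (card I) I x * stabnum \<tau> I K x)"
  using poles_upto_mult[OF poles_upto_poles[OF poles_row_factor] poles_upto_stabnum, of "card I" I I K] by simp
 moreover have "poles_upto (specs + {#Dyn 0, Dyn (- 1)#}) (%x. - (\<Sum>K'\<in>{K'. card K' = card I} - {K}. M K K' x * W K' x))"
 proof (intro poles_upto_uminus poles_upto_sum)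
  fix K' assume "K' \<in> {K'. card K' = card I} - {K}"
  hence "card K = card K'" "K \<noteq> K'" using K by auto
  thus "poles_upto (specs + {#Dyn 0, Dyn (- 1)#}) (%x. M K K' x * W K' x)"
   using poles_upto_mult[OF poles_upto_M_move[of K K'] poles_upto_W[of K']] by simp
 qed
 ultimately show "poles_upto (specs + {#Dyn 0, Dyn (- 1)#}) (%x. row_factor (card I) I x * stabnum \<tau> I K x + - (\<Sum>K'\<in>{K'. card K' = card I} - {K}. M K K' x * W K' x))"
  by (rule poles_upto_add)
 show "GEN x. row_factor (card I) I x * stabnum \<tau> I K x + - (\<Sum>K'\<in>{K'. card K' = card I} - {K}. M K K' x * W K' x) = M K K x * W K x"
  using good_generic by eventually_elim (simp add: row_split[OF _ K])
qed

text \<open>Dividing the row at I by W I adds P 1, ..., P k to the denominators lambda and lambda -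
  y already present. For k \<ge> 1 this makes \<open>Dyn (- 1)\<close> a double pole, the only
  excess up to junk.\<close>

lemma poles_upto_M_final: "poles_upto (specs + {#Dyn 0, Dyn (- 1)#} + dyns 1 (card I)) (M I I)"
proof (rule poles_upto_cong)
 have "poles_upto (specs + {#Dyn 0, Dyn (- 1)#} + ({#} + dyns 1 (card I))) (%x. (M I I x * W I x) * (inverse (diag_factor I x) * (\<Prod>s=1..card I. inverse (P s x))))"
  by (intro poles_upto_mult poles_upto_row poles_upto_diag_factor poles_upto_poles poles_inverse_Ps refl)
 thus "poles_upto (specs + {#Dyn 0, Dyn (- 1)#} + dyns 1 (card I)) (%x. (M I I x * W I x) * (inverse (diag_factor I x) * (\<Prod>s=1..card I. inverse (P s x))))" by simp
 show "GEN x. (M I I x * W I x) * (inverse (diag_factor I x) * (\<Prod>s=1..card I. inverse (P s x))) = M I I x"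
  using good_generic
 proof eventually_elim
  case (elim x)
  have "P s x \<noteq> 0" if "s \<le> card I" for s using P_nonzero[OF goodD(1)[OF elim]] that card_le by simp
  hence "(\<Prod>s=1..card I. P s x) \<noteq> 0" by simp
  thus ?case using diag_factor_nonzero[OF goodD(1)[OF elim], of I] unfolding W_diag[OF elim] prod_inverse
   by (simp add: field_simps)
 qed
qed

text \<open>
 The relation for the last subset alone may leave a double pole along \<open>Dyn (- 1)\<close>. Either all other
 numerators \<open>W K'\<close> vanish there and the relation can be divided by this form, or some \<open>W K\<close> does not vanish
 identically there, and the relation at \<open>K\<close> bounds the pole.
\<close>

lemma poles_upto_M_final_vanishing:
 assumes van: "\<And>K'. card K' = card I ==> K' \<noteq> I ==> poles_upto {#} (%x. inverse (P 1 x) * W K' x)"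
  and k: "card I \<ge> 2 \<or> card I = 1 \<and> CARD('n) = 1"
 shows "poles_upto (specs + dyns 0 (card I)) (M I I)"
proof (rule poles_upto_cong)
 define k where "k = card I"
 have k1: "k \<ge> 1" using k by (auto simp: k_def)
 define S where "S x = (\<Prod>a\<in>- I. inverse (th (w - x$$a - yv x)))" for x :: "'n pt"
 define N where "N x = (\<Prod>a\<in>- I. th (w - x$$a)) * P (Suc k) x" for x :: "'n pt"
 define N' where "N' x = th (lv x - of_int (2 * int k - int CARD('n)) * yv x)" for x :: "'n pt"
 define T where "T x = N' x * (inverse (P 1 x) * inverse (P k x))" for x
 \<comment> \<open>For k \<ge> 2 the two denominators are different forms. For k = n = 1 they
   coincide, but then N' is P 1 and cancels one of them.\<close>
 have T: "poles (dyns 0 k) T"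
 proof (cases "k \<ge> 2")
  case True
  have "poles ({#Dyn (- int 1)#} + {#Dyn (- int k)#}) T"
   unfolding T_def N'_def by (intro poles_mult_holo poles_mult poles_inverse_P holo_intros)
  thus ?thesis
  proof (rule poles_mono)
   have "{#Dyn (- int 1)#} + {#Dyn (- int k)#} = image_mset (%s. Dyn (- int s)) (mset_set {1, k})"
    using True by simp
   also have "\<dots> \<subseteq># dyns 0 k"
    unfolding dyns_def by (intro image_mset_subseteq_mono subset_imp_msubset_mset_set) (use k1 in auto)
   finally show "{#Dyn (- int 1)#} + {#Dyn (- int k)#} \<subseteq># (dyns 0 k :: 'n form multiset)" .
  qed
 next
  case False
  hence k': "k = 1" "CARD('n) = 1" using k by (auto simp: k_def)
  have "poles {#Dyn (- int 1)#} T"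
  proof (rule poles_cong[OF poles_inverse_P])
   show "GEN x. inverse (P 1 x) = T x"
    using regular_generic
   proof eventually_elim
    case (elim x)
    have "P 1 x \<noteq> 0" by (rule P_nonzero[OF elim]) simp
    thus ?case unfolding T_def N'_def k' by (simp add: P_def)
   qed
  qed
  thus ?thesis by (rule poles_mono) (use k' in \<open>auto simp: dyns_def\<close>)
 qed
 have "poles (specs + dyns 0 k) (%x. N x * (S x * T x))"
  unfolding N_def S_def by (intro poles_mult_holo poles_mult poles_inverse_specs T holo_intros)
 hence 1: "poles_upto (specs + dyns 0 k) (%x. N x * (S x * T x))" by (rule poles_upto_poles)
 \<comment> \<open>The factor 1 / P 1 is absorbed by W K', which vanishes there by hypothesis; only
   P s with s \<ge> 2 are added to the poles of M I K'.\<close>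
 define Q where "Q K' x = M I K' x * ((inverse (P 1 x) * W K' x) * (inverse (diag_factor I x) * (\<Prod>s=2..k. inverse (P s x))))" for K' x
 have 2: "poles_upto (specs + dyns 0 k) (%x. - (\<Sum>K'\<in>{K'. card K' = card I} - {I}. Q K' x))"
 proof (intro poles_upto_uminus poles_upto_sum)
  fix K' assume K': "K' \<in> {K'. card K' = card I} - {I}"
  have "poles_upto (specs + {#Dyn 0, Dyn (- 1)#} + ({#} + ({#} + dyns 2 k))) (%x. Q K' x)"
   unfolding Q_def
  proof (intro poles_upto_mult poles_upto_diag_factor poles_upto_poles[OF poles_inverse_Ps])
   have "card I = card K'" "I \<noteq> K'" using K' by auto
   thus "poles_upto (specs + {#Dyn 0, Dyn (- 1)#}) (M I K')" by (rule poles_upto_M_move)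
   show "poles_upto {#} (%x. inverse (P 1 x) * W K' x)" using K' by (intro van) auto
  qed
  thus "poles_upto (specs + dyns 0 k) (%x. Q K' x)" unfolding dyns_0[OF k1] by (simp add: ac_simps)
 qed
 show "poles_upto (specs + dyns 0 (card I)) (%x. N x * (S x * T x) + - (\<Sum>K'\<in>{K'. card K' = card I} - {I}. Q K' x))"
  using poles_upto_add[OF 1 2] by (simp add: k_def)
 show "GEN x. N x * (S x * T x) + - (\<Sum>K'\<in>{K'. card K' = card I} - {I}. Q K' x) = M I I x"
  using good_generic
 proof eventually_elim
  case (elim x)
  note reg = goodD(1)[OF elim]
  have P: "P s x \<noteq> 0" if "s \<le> k" for s using P_nonzero[OF reg] that card_le by (simp add: k_def)
  have d: "diag_factor I x \<noteq> 0" using diag_factor_nonzero[OF reg] .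
  have s1: "(\<Prod>s=1..k. P s x) = P 1 x * (\<Prod>s=2..k. P s x)" using prod.atLeast_Suc_atMost[OF k1, of "%s. P s x"] by (simp add: numeral_2_eq_2)
  have n: "(\<Prod>s=1..k. P s x) \<noteq> 0" "(\<Prod>s=2..k. P s x) \<noteq> 0" "(\<Prod>s<k. P s x) \<noteq> 0" using P by auto
  have tel: "(\<Prod>s<k. P s x) * P k x = P 0 x * (\<Prod>s=1..k. P s x)"
   unfolding One_nat_def prod.atLeast1_atMost_eq using prod.lessThan_Suc_shift[of "%s. P s x" k] prod.lessThan_Suc[of "%s. P s x" k] by simp
  have rf: "row_factor (card I) I x = N x * N' x * (S x * (inverse (P 0 x) * inverse (P 1 x)))"
   unfolding row_factor_def N_def N'_def S_def P_def k_def by (simp add: mult_ac)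
  define V where "V = (\<Sum>K'\<in>{K'. card K' = card I} - {I}. M I K' x * W K' x)"
  have W: "W I x = diag_factor I x * (P 1 x * (\<Prod>s=2..k. P s x))" using s1 unfolding W_diag[OF elim] k_def by simp
  have Qs: "(\<Sum>K'\<in>{K'. card K' = card I} - {I}. Q K' x) = V * inverse (W I x)"
   unfolding V_def W sum_distrib_right Q_def prod_inverse by (intro sum.cong refl) (simp add: mult_ac)
  have Wn: "W I x \<noteq> 0" unfolding W using d n P[of 1] k1 by simp
  have "stabnum \<tau> I I x = diag_factor I x * (\<Prod>s<k. P s x)" using stabnum_final[OF I reg] by (simp add: P_def k_def)
  hence st: "stabnum \<tau> I I x * inverse (W I x) = P 0 x * inverse (P k x)"
   unfolding W s1[symmetric] using d n(1) P[of k] tel by (simp add: field_simps)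
  have "M I I x = (M I I x * W I x) * inverse (W I x)" using Wn by simp
  also have "\<dots> = row_factor (card I) I x * (stabnum \<tau> I I x * inverse (W I x)) - V * inverse (W I x)"
   unfolding row_split[OF elim refl] V_def[symmetric] by (simp only: left_diff_distrib mult.assoc)
  also have "row_factor (card I) I x * (stabnum \<tau> I I x * inverse (W I x)) = N x * (S x * T x)"
   unfolding st rf T_def using P[of 0] by simp
  finally show ?case unfolding Qs by simp
 qed
qed

text \<open>By symmetry M K K has at most the double pole of M I I along lambda = y. The row at K
  shows that M K K times W K has at most a simple one, and W K is nonzero on a dense part of that
  hypersurface.\<close>

lemma poles_upto_M_nonvanishing:
 assumes K: "card K = card I" "K \<noteq> I" and H: "holo H" "GEN x. fprod (diff_forms K) x * stabnum \<tau> I K x = H x"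
  and gen: "gen_on {x. lv x \<in> \<Lambda>} H" and k: "card I \<ge> 1"
 shows "poles_upto (specs + dyns 0 (card I)) (M K K)"
proof -
 obtain \<pi> where \<pi>: "bij \<pi>" "\<pi> ` I = K" using bij_between_partitions[of I K "{}" "{}" "{}" "{}"] K(1) by auto
 obtain J1 where J1: "\<forall>p\<in>#J1. junk_form p" "poles (specs + {#Dyn 0, Dyn (- 1)#} + dyns 1 (card I) + J1) (M I I)"
  using poles_upto_M_final unfolding poles_upto_def by blast
 obtain J2 where J2: "\<forall>p\<in>#J2. junk_form p" "poles (specs + {#Dyn 0, Dyn (- 1)#} + J2) (%x. M K K x * W K x)"
  using poles_upto_row[OF K(1)] unfolding poles_upto_def by blast
 define J where "J = image_mset (perm_form \<pi>) J1"
 have J: "\<forall>p\<in>#J. junk_form p" using J1(1) junk_perm[OF \<pi>(1)] by (auto simp: J_def)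
 have "poles (image_mset (perm_form \<pi>) (specs + {#Dyn 0, Dyn (- 1)#} + dyns 1 (card I) + J1)) (M (\<pi> ` I) (\<pi> ` I))"
  using J1(1) by (intro poles_M_transfer[OF J1(2) \<pi>(1)]) (auto simp: ij' dest: valid_specs dyns_dyn junk_valid)
 hence MK: "poles (specs + {#Dyn 0, Dyn (- 1)#} + dyns 1 (card I) + J) (M K K)" by (simp add: perm_specs[OF \<pi>(1)] perm_dyns \<pi>(2) J_def)
 have d1: "dyns 1 (card I) = {#Dyn (- 1)#} + dyns 2 (card I)"
 proof -
  have "{1..card I} = insert 1 {2..card I}" using k by auto
  thus ?thesis by (simp add: dyns_def)
 qed
 define A where "A = specs + dyns 0 (card I) + J"
 have eA: "specs + {#Dyn 0, Dyn (- 1)#} + dyns 1 (card I) + J = A + {#Dyn (- 1)#}"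
  unfolding A_def dyns_0[OF k] d1 by (simp add: ac_simps)
 note MK' = MK[unfolded eA]
 define q where "q x = fprod J2 x * H (shift (- 1) x)" for x
 have "poles A (M K K)"
 proof (rule poles_remove[OF _ MK'])
  show "p \<in># {#Dyn (- 1)#} ==> valid_form p" for p :: "'n form" by simp
  show "holo q" unfolding q_def by (intro holo_intros holo_shift H(1))
  show "gen_on {x. ev w p x \<in> \<Lambda>} q" if "p \<in># {#Dyn (- 1)#}" for p :: "'n form"
  proof -
   have p: "p = Dyn (- 1)" using that by simp
   show ?thesis unfolding q_def p
    using J2(1) by (intro gen_on_mult gen_on_fprod gen_on_hyperplane_thf gen_on_shift gen holo_continuous holo_intros) (auto dest: junk_valid)
  qed
  show "ext (%x. q x * (fprod A x * M K K x))"
  proof (rule ext_cong)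
   have h: "holo (%x. fprod (diff_forms K) x * fprod (dyns 2 (card I)) x * fprod J x)" by (intro holo_intros)
   show "ext (%x. (fprod (diff_forms K) x * fprod (dyns 2 (card I)) x * fprod J x) * (fprod (specs + {#Dyn 0, Dyn (- 1)#} + J2) x * (M K K x * W K x)))"
    by (rule ext_mult[OF ext_holo[OF h] J2(2)[unfolded poles_def]])
   show "GEN x. (fprod (diff_forms K) x * fprod (dyns 2 (card I)) x * fprod J x) * (fprod (specs + {#Dyn 0, Dyn (- 1)#} + J2) x * (M K K x * W K x)) = q x * (fprod A x * M K K x)"
    using generic_shift[OF H(2), of "- 1"]
   proof eventually_elim
    case (elim x)
    have "fprod (diff_forms K) (shift (- 1) x) = fprod (diff_forms K) x"
     unfolding fprod_def by (intro arg_cong[of _ _ prod_mset] image_mset_cong) (auto simp: diff_forms_def shift_def case_prod_beta)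
    hence "H (shift (- 1) x) = fprod (diff_forms K) x * W K x" using elim unfolding W_def by simp
    thus ?case unfolding q_def A_def dyns_0[OF k] by (simp add: mult_ac)
   qed
  qed
 qed
 thus ?thesis unfolding A_def using J by (intro poles_uptoI[of _ J]) auto
qed

end

text \<open>Two bounds for the entry at an initial subset meet: one transported from K0, with the
  right dynamical forms but with junk, and one from the first sites, without forms z_a - z_b + y but
  with arbitrary dynamical forms. The result is transported to K.\<close>

lemma poles_M_diag:
 assumes ij': "i = 1" "j = 1"
 shows "poles (specs + diff_forms UNIV + dyns 0 CARD('n)) (M K K)"
proof -
 define k where "k = card K"
 have k: "k \<le> CARD('n)" unfolding k_def by (rule card_mono) auto
 have n: "CARD('n) \<ge> 1" by (simp add: Suc_leI)
 have "CARD('n) - k \<le> CARD('n)" by simp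
 then obtain A :: "'n set" where A: "initial A" "card A = CARD('n) - k" by (rule initial_exists)
 define I where "I = - A"
 have I: "initial (- I)" using A(1) by (simp add: I_def)
 have Ik: "card I = k" using A k unfolding I_def Compl_eq_Diff_UNIV by (simp add: card_Diff_subset)
 note I = I Ik
 have "\<exists>K0. card K0 = k \<and> poles_upto (specs + dyns 0 CARD('n)) (M K0 K0)"
 proof (cases "k = 0")
  case True
  hence "poles_upto (specs + {#Dyn 0, Dyn (- 1)#} + dyns 1 0) (M I I)"
   using poles_upto_M_final[OF ij' I(1)] I(2) by simp
  moreover have "specs + {#Dyn 0, Dyn (- 1)#} + dyns 1 0 \<subseteq># specs + dyns 0 CARD('n)"
   unfolding dyns_0[OF n] by (simp add: dyns_def)
  ultimately show ?thesis using I(2) poles_upto_mono by blast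
 next
  case False
  hence k1: "card I \<ge> 1" using I(2) by simp
  have up: "poles_upto (specs + dyns 0 CARD('n)) f" if "poles_upto (specs + dyns 0 (card I)) f" for f :: "'n pt => complex"
   by (rule poles_upto_mono[OF that]) (use dyns_subset[of 0 0 "card I" "CARD('n)"] I(2) k in simp)
  show ?thesis
  proof (cases "\<exists>K0 H. card K0 = k \<and> K0 \<noteq> I \<and> holo H \<and> (GEN x. fprod (diff_forms K0) x * stabnum \<tau> I K0 x = H x) \<and> gen_on {x. lv x \<in> \<Lambda>} H")
   case True
   then obtain K0 H where K0: "card K0 = k" "K0 \<noteq> I" and H: "holo H"
    "GEN x. fprod (diff_forms K0) x * stabnum \<tau> I K0 x = H x" "gen_on {x. lv x \<in> \<Lambda>} H" by blast
   have "poles_upto (specs + dyns 0 (card I)) (M K0 K0)"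
    by (rule poles_upto_M_nonvanishing[OF ij' I(1) _ K0(2) H k1]) (simp add: K0(1) I(2))
   thus ?thesis using up K0(1) by blast
  next
   case no: False
   have van: "(\<forall>H. holo H \<longrightarrow> (GEN x. fprod (diff_forms K') x * stabnum \<tau> I K' x = H x) \<longrightarrow> (\<forall>x. lv x \<in> \<Lambda> \<longrightarrow> H x = 0))
     \<and> poles (diff_forms K') (%x. inverse (th (lv x)) * stabnum \<tau> I K' x)"
    if K': "card K' = k" "K' \<noteq> I" for K'
   proof -
    obtain H where H: "holo H" "GEN x. fprod (diff_forms K') x * stabnum \<tau> I K' x = H x"
     "gen_on {x. lv x \<in> \<Lambda>} H \<or> (\<forall>x. lv x \<in> \<Lambda> \<longrightarrow> H x = 0) \<and> poles (diff_forms K') (%x. inverse (th (lv x)) * stabnum \<tau> I K' x)"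
     by (rule stabnum_dichotomy[where I = I and K = K'])
    have h: "(\<forall>x. lv x \<in> \<Lambda> \<longrightarrow> H x = 0) \<and> poles (diff_forms K') (%x. inverse (th (lv x)) * stabnum \<tau> I K' x)"
     using H no K' by blast
    have "H' x = H x" if H': "holo H'" "GEN x. fprod (diff_forms K') x * stabnum \<tau> I K' x = H' x" for H' x
    proof (rule generic_eq_imp_eq)
     show "GEN x. H' x = H x" using H'(2) H(2) by eventually_elim simp
    qed (use H' H in \<open>auto intro: holo_continuous\<close>)
    thus ?thesis using h by metis
   qed
   have van1: "poles_upto {#} (%x. inverse (P 1 x) * W I K' x)" if K': "card K' = card I" "K' \<noteq> I" for K'
   proof -
    have "poles_upto {#} (%x. inverse (th (lv x)) * stabnum \<tau> I K' x)"
     using van[of K'] K' I(2) junk_diff_forms by (intro poles_uptoI[of _ "diff_forms K'"]) auto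
    from poles_upto_shift[OF this, of "- 1"] show ?thesis
     by (simp add: P_def[OF ij' I(1)] W_def[OF ij' I(1)] shift_def case_prod_beta)
   qed
   \<comment> \<open>If k = 1 < n, the numerator at some {c} would be nonzero at a point with lambda
     in \<Lambda>, contrary to the present case.\<close>
   have "card I \<ge> 2 \<or> card I = 1 \<and> CARD('n) = 1"
   proof (rule ccontr)
    assume "\<not> ?thesis"
    hence c1: "card I = 1" "CARD('n) \<noteq> 1" using k1 by auto
    obtain e where e: "I = {e}" using c1(1) by (auto simp: card_1_singleton_iff)
    have "I \<noteq> UNIV" using c1 by auto
    then obtain c where c: "c \<noteq> e" using e by auto
    have max: "a \<le> e" for a using I(1) e unfolding initial_def by (cases "a = e") (auto simp: less_imp_le)
    obtain x where x: "lv x \<in> \<Lambda>" "stabnum \<tau> {e} {c} x \<noteq> 0" using stabnum_single(1)[OF max c] by blast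
    have "{S. S \<subseteq> {c} \<and> card S = 2} = {}" by (auto simp: subset_singleton_iff)
    hence "diff_forms {c} = {#}" unfolding diff_forms_def by (simp only: mset_set.empty image_mset_empty)
    hence "GEN x. fprod (diff_forms {c}) x * stabnum \<tau> I {c} x = stabnum \<tau> {e} {c} x" by (simp add: e)
    moreover have "card {c} = k" "{c} \<noteq> I" using c e I(2) c1(1) by auto
    ultimately have "stabnum \<tau> {e} {c} x = 0"
     using van[of "{c}"] stabnum_single(2)[OF max c] x(1) by blast
    thus False using x(2) by simp
   qed
   hence "poles_upto (specs + dyns 0 (card I)) (M I I)"
    using poles_upto_M_final_vanishing[OF ij' I(1)] van1 by blast
   thus ?thesis using up I(2) by blast
  qed
 qed
 then obtain K0 J where K0: "card K0 = k" "\<forall>p\<in>#J. junk_form p" "poles (specs + dyns 0 CARD('n) + J) (M K0 K0)"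
  unfolding poles_upto_def by blast
 obtain I0 :: "'n set" where I0: "initial I0" "card I0 = k" using initial_exists[OF k] by blast
 obtain A where A: "\<forall>p\<in>#A. \<exists>m. p = Dyn m" "poles (specs + diff_forms UNIV + A) (M I0 I0)"
  using poles_M_diag_initial[OF I0(1) ij'] by blast
 obtain \<pi> where \<pi>: "bij \<pi>" "\<pi> ` K0 = I0" using bij_between_partitions[of K0 I0 "{}" "{}" "{}" "{}"] K0(1) I0(2) by auto
 obtain \<rho> where \<rho>: "bij \<rho>" "\<rho> ` I0 = K" using bij_between_partitions[of I0 K "{}" "{}" "{}" "{}"] I0(2) by (auto simp: k_def)
 define J' where "J' = image_mset (perm_form \<pi>) J"
 have J': "\<forall>p\<in>#J'. junk_form p" using K0(2) junk_perm[OF \<pi>(1)] by (auto simp: J'_def)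
 have "poles (image_mset (perm_form \<pi>) (specs + dyns 0 CARD('n) + J)) (M (\<pi> ` K0) (\<pi> ` K0))"
  using K0(2) by (intro poles_M_transfer[OF K0(3) \<pi>(1)]) (auto simp: ij' dest: valid_specs dyns_dyn junk_valid)
 hence 1: "poles (specs + dyns 0 CARD('n) + J') (M I0 I0)" by (simp add: perm_specs[OF \<pi>(1)] perm_dyns \<pi>(2) J'_def)
 let ?T = "specs + diff_forms UNIV + dyns 0 CARD('n)"
 \<comment> \<open>The excess A consists of dynamical forms and J' of junk, so they have no form in
   common.\<close>
 have "poles ?T (M I0 I0)"
 proof (rule poles_coprime)
  show "poles (?T + A) (M I0 I0)" by (rule poles_mono[OF A(2)]) (simp add: ac_simps)
  show "poles (?T + J') (M I0 I0)" by (rule poles_mono[OF 1]) (simp add: ac_simps)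
  show "p \<in># A ==> p \<notin># J'" for p using A(1) J' by (metis junk_form.simps(4))
 qed (use A(1) J' junk_valid in auto)
 hence "poles (image_mset (perm_form \<rho>) ?T) (M (\<rho> ` I0) (\<rho> ` I0))"
  by (intro poles_M_transfer[OF _ \<rho>(1)]) (auto simp: ij' dest: valid_specs dyns_dyn valid_diff_forms)
 moreover have "image_mset (perm_form \<rho>) (diff_forms UNIV) = diff_forms UNIV"
 proof -
  have inj: "inj \<rho>" using \<rho>(1) by (rule bij_is_inj)
  have "(%S. \<rho> ` S) ` {S. S \<subseteq> UNIV \<and> card S = 2} = {S. S \<subseteq> UNIV \<and> card S = 2}"
  proof (intro equalityI subsetI)
   fix S assume "S \<in> (%S. \<rho> ` S) ` {S. S \<subseteq> UNIV \<and> card S = 2}"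
   thus "S \<in> {S. S \<subseteq> UNIV \<and> card S = 2}" using card_image[OF inj_on_subset[OF inj]] by auto
  next
   fix S :: "'n set" assume S: "S \<in> {S. S \<subseteq> UNIV \<and> card S = 2}"
   have e: "S = \<rho> ` (inv \<rho> ` S)" using \<rho>(1) by (simp add: bij_is_surj image_f_inv_f)
   hence "card (inv \<rho> ` S) = 2" using S card_image[OF inj_on_subset[OF inj], of "inv \<rho> ` S"] by auto
   thus "S \<in> (%S. \<rho> ` S) ` {S. S \<subseteq> UNIV \<and> card S = 2}" using e by blast
  qed
  moreover have "image_mset (%S. \<rho> ` S) (mset_set {S. S \<subseteq> UNIV \<and> card S = 2}) = mset_set ((%S. \<rho> ` S) ` {S. S \<subseteq> UNIV \<and> card S = 2})"
   by (rule image_mset_mset_set) (use inj in \<open>auto simp: inj_on_def inj_image_eq_iff\<close>)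
  moreover have "image_mset (perm_form \<rho>) (diff_forms UNIV) = image_mset Diff (image_mset (%S. \<rho> ` S) (mset_set {S. S \<subseteq> UNIV \<and> card S = 2}))"
   by (simp add: diff_forms_def multiset.map_comp comp_def)
  ultimately show ?thesis by (simp add: diff_forms_def)
 qed
 ultimately show ?thesis by (simp add: perm_specs[OF \<rho>(1)] perm_dyns \<rho>(2))
qed

end

section \<open>Cancellation of the poles along the diagonals\<close>

definition two_sets :: "'n set set" where "two_sets = {S. card S = 2}"

definition other_diffs :: "'n => 'n => ('n::finite) form multiset" where
 "other_diffs a b = image_mset Diff (mset_set (two_sets - {{a, b}}))"

context spectral
begin

definition polar_forms :: "('n::{finite,linorder}) form multiset" where
 "polar_forms = specs + dyns 0 CARD('n)"

text \<open>Clears all poles of the entries and contains th (z_a - z_b) exactly once, with a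
  definite sign. The other differences are squared because a permutation changes their thetas by
  signs.\<close>

definition core :: "'n => 'n => ('n::{finite,linorder}) pt => complex" where
 "core a b x = fprod polar_forms x * (fprod (other_diffs a b) x)\<^sup>2 * th (x$$a - x$$b)"

lemma valid_polar_forms: "p \<in># polar_forms ==> valid_form p"
 by (auto simp: polar_forms_def dest: valid_specs dyns_dyn)

lemma valid_other_diffs: "p \<in># other_diffs a b ==> valid_form p"
 by (auto simp: other_diffs_def two_sets_def)

lemma core_holo [holo_intros]: "holo_on (core a b) U"
 unfolding core_def by (intro holo_intros)

lemma fprod_perm_square:
 assumes "bij \<pi>" "\<And>p. p \<in># A ==> valid_form p"
 shows "(fprod (image_mset (perm_form \<pi>) A) (perm \<pi> x))\<^sup>2 = (fprod A x)\<^sup>2"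
 using assms(2)
proof (induction A)
 case (add p A)
 have "valid_form p" using add.prems by simp
 hence "thf (perm_form \<pi> p) (perm \<pi> x) = thf p x \<or> thf (perm_form \<pi> p) (perm \<pi> x) = - thf p x"
  using thf_perm[OF assms(1), of p] by blast
 hence "(thf (perm_form \<pi> p) (perm \<pi> x))\<^sup>2 = (thf p x)\<^sup>2"
  by (metis power2_minus)
 thus ?case using add by (simp add: power_mult_distrib)
qed simp

lemma perm_other_diffs:
 assumes "bij \<pi>" shows "image_mset (perm_form \<pi>) (other_diffs a b) = other_diffs (\<pi> a) (\<pi> b)"
proof -
 have inj: "inj \<pi>" using assms by (rule bij_is_inj)
 have ci: "card (\<pi> ` A) = card A" for A by (rule card_image[OF inj_on_subset[OF inj]]) simp
 have "(%S. \<pi> ` S) ` (two_sets - {{a, b}}) = two_sets - {{\<pi> a, \<pi> b}}"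
 proof (intro equalityI subsetI)
  fix S assume "S \<in> (%S. \<pi> ` S) ` (two_sets - {{a, b}})"
  then obtain T where T: "S = \<pi> ` T" "card T = 2" "T \<noteq> {a, b}" by (auto simp: two_sets_def)
  hence "S \<noteq> \<pi> ` {a, b}" using inj_image_eq_iff[OF inj, of T "{a, b}"] by blast
  thus "S \<in> two_sets - {{\<pi> a, \<pi> b}}" using T ci by (auto simp: two_sets_def)
 next
  fix S assume S: "S \<in> two_sets - {{\<pi> a, \<pi> b}}"
  have e: "S = \<pi> ` (inv \<pi> ` S)" using assms by (simp add: bij_is_surj image_f_inv_f)
  hence "card (inv \<pi> ` S) = 2" using S ci[of "inv \<pi> ` S"] by (simp add: two_sets_def)
  moreover have "inv \<pi> ` S \<noteq> {a, b}" using S e by auto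
  ultimately show "S \<in> (%S. \<pi> ` S) ` (two_sets - {{a, b}})" using e by (auto simp: two_sets_def)
 qed
 moreover have "image_mset (%S. \<pi> ` S) (mset_set (two_sets - {{a, b}})) = mset_set ((%S. \<pi> ` S) ` (two_sets - {{a, b}}))"
  by (rule image_mset_mset_set) (use inj in \<open>auto simp: inj_on_def inj_image_eq_iff\<close>)
 moreover have "image_mset (perm_form \<pi>) (other_diffs a b) = image_mset Diff (image_mset (%S. \<pi> ` S) (mset_set (two_sets - {{a, b}})))"
  by (simp add: other_diffs_def multiset.map_comp comp_def)
 ultimately show ?thesis by (simp add: other_diffs_def)
qed

lemma fprod_polar_perm:
 assumes "bij \<pi>" shows "fprod polar_forms (perm \<pi> x) = fprod polar_forms x"
proof -
 have "fprod (image_mset (perm_form \<pi>) A) (perm \<pi> x) = fprod A x" if "\<And>p. p \<in># A ==> (\<exists>a. p = Spec a) \<or> (\<exists>j. p = Dyn j)" for A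
  using that
 proof (induction A)
  case (add p A)
  have "thf (perm_form \<pi> p) (perm \<pi> x) = thf p x"
   using add.prems[of p] assms by (auto simp: fst_perm_nth)
  thus ?case using add by simp
 qed simp
 from this[of polar_forms] have "fprod (image_mset (perm_form \<pi>) polar_forms) (perm \<pi> x) = fprod polar_forms x"
  by (auto simp: polar_forms_def specs_def dest: dyns_dyn)
 moreover have "image_mset (perm_form \<pi>) polar_forms = polar_forms"
  by (simp add: polar_forms_def perm_specs[OF assms] perm_dyns)
 ultimately show ?thesis by simp
qed

lemma core_perm:
 assumes "bij \<pi>" shows "core (\<pi> a) (\<pi> b) (perm \<pi> x) = core a b x"
 using fprod_perm_square[OF assms valid_other_diffs, where A = "other_diffs a b" and x = x]
 by (simp add: core_def fprod_polar_perm[OF assms] perm_other_diffs[OF assms] fst_perm_nth[OF assms])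

lemma core_commute: "core b a x = - core a b x"
proof -
 have "th (x$$b - x$$a) = - th (x$$a - x$$b)" using theta_minus[of "x$$a - x$$b"] by simp
 thus ?thesis by (simp add: core_def other_diffs_def insert_commute)
qed

lemma two_sets_diffs:
 assumes "a \<noteq> b" shows "image_mset Diff (mset_set two_sets) = other_diffs a b + {#Diff {a, b}#}"
proof -
 have "mset_set two_sets = add_mset {a, b} (mset_set (two_sets - {{a, b}}))"
  using assms by (intro mset_set.remove) (auto simp: two_sets_def)
 thus ?thesis by (simp add: other_diffs_def)
qed

end

section \<open>Residues of the entries along z_a = z_b\<close>

context quantum_entry
begin

definition matching :: "'n set => 'n set => bool" where
 "matching K K' \<longleftrightarrow> int (card K) = int (card K') + (int i - int j)"

abbreviation act :: "int => ('n set => 'n pt => complex) => 'n set => 'n pt => complex" where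
 "act \<nu> S K x \<equiv> (\<Sum>K' | matching K K'. M K K' x * S K' (shift \<nu> x))"

definition dpairs :: "'n set => 'n set => 'n set set" where
 "dpairs K K' = (if i = 1 \<and> j = 1 \<and> K = K' then two_sets else move_pairs K K')"

lemma poles_M:
 assumes "matching K K'"
 shows "poles (polar_forms + image_mset Diff (mset_set (dpairs K K'))) (M K K')"
proof (cases "i = 1 \<and> j = 1 \<and> K = K'")
 case True
 hence "poles (specs + diff_forms UNIV + dyns 0 CARD('n)) (M K K')" using poles_M_diag by auto
 moreover have "specs + diff_forms UNIV + dyns 0 CARD('n) = polar_forms + image_mset Diff (mset_set (dpairs K K'))"
 proof -
  have "dpairs K K' = two_sets" using True unfolding dpairs_def by (rule if_P)
  thus ?thesis by (simp add: polar_forms_def diff_forms_def two_sets_def ac_simps)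
 qed
 ultimately show ?thesis by simp
next
 case False
 have n: "CARD('n) \<ge> 1" by (simp add: Suc_leI)
 have "poles (move_forms K K') (M K K')"
 proof (rule poles_M_move)
  show "int (card K) = int (card K') + (int i - int j)" using assms by (simp add: matching_def)
  have "i = j" if "K = K'" using assms that by (simp add: matching_def)
  thus "K \<noteq> K' \<or> i = 2 \<and> j = 2" using False ij by auto
 qed
 thus ?thesis
 proof (rule poles_mono)
  have "dpairs K K' = move_pairs K K'" using False unfolding dpairs_def by (rule if_not_P)
  thus "move_forms K K' \<subseteq># polar_forms + image_mset Diff (mset_set (dpairs K K'))"
   unfolding move_forms_def polar_forms_def dyns_0[OF n] by simp
 qed
qed

lemma dpairs_subset: "dpairs K K' \<subseteq> two_sets"
 by (auto simp: dpairs_def move_pairs_def two_sets_def)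

lemma ext_core_M:
 assumes "matching K K'" "a \<noteq> b"
 shows "ext (%x. core a b x * M K K' x)"
proof -
 have "mset_set (dpairs K K') \<subseteq># mset_set two_sets" using dpairs_subset by (intro subset_imp_msubset_mset_set) auto
 hence "polar_forms + image_mset Diff (mset_set (dpairs K K')) \<subseteq># polar_forms + (other_diffs a b + {#Diff {a, b}#})"
  unfolding two_sets_diffs[OF assms(2), symmetric] by (intro subset_mset.add_left_mono image_mset_subseteq_mono)
 hence p: "poles (polar_forms + (other_diffs a b + {#Diff {a, b}#})) (M K K')" using poles_mono[OF poles_M[OF assms(1)]] by blast
 have e: "ext (%x. c * fprod (other_diffs a b) x * (fprod (polar_forms + (other_diffs a b + {#Diff {a, b}#})) x * M K K' x))" for c
  by (rule ext_mult[OF ext_holo p[unfolded poles_def]]) (intro holo_intros)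
 from thf_Diff_cases[of a b] consider "\<forall>x. thf (Diff {a, b}) x = th (x$$a - x$$b)" | "\<forall>x. thf (Diff {a, b}) x = - th (x$$a - x$$b)" by blast
 thus ?thesis
 proof cases
  case 1
  have "(%x. core a b x * M K K' x) = (%x. 1 * fprod (other_diffs a b) x * (fprod (polar_forms + (other_diffs a b + {#Diff {a, b}#})) x * M K K' x))"
  proof (rule ext)
   fix x
   show "core a b x * M K K' x = 1 * fprod (other_diffs a b) x * (fprod (polar_forms + (other_diffs a b + {#Diff {a, b}#})) x * M K K' x)"
    using spec[OF 1, of x] by (simp add: core_def power2_eq_square mult_ac del: ev.simps)
  qed
  thus ?thesis using e[of 1] by simp
 next
  case 2
  have "(%x. core a b x * M K K' x) = (%x. (- 1) * fprod (other_diffs a b) x * (fprod (polar_forms + (other_diffs a b + {#Diff {a, b}#})) x * M K K' x))"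
  proof (rule ext)
   fix x
   show "core a b x * M K K' x = (- 1) * fprod (other_diffs a b) x * (fprod (polar_forms + (other_diffs a b + {#Diff {a, b}#})) x * M K K' x)"
    using spec[OF 2, of x] by (simp add: core_def power2_eq_square mult_ac del: ev.simps)
  qed
  thus ?thesis using e[of "- 1"] by simp
 qed
qed

text \<open>On z_a = z_b this is the residue of the entry up to a factor common to all entries. It
  is chosen because M is known only generically; the holomorphic representative is unique.\<close>

definition numer :: "'n => 'n => 'n set => 'n set => 'n pt => complex" where
 "numer a b K K' = (SOME N. holo N \<and> (GEN x. core a b x * M K K' x = N x))"

lemma numer:
 assumes "matching K K'" "a \<noteq> b"
 shows "holo (numer a b K K')" "GEN x. core a b x * M K K' x = numer a b K K' x"
 using someI_ex[OF ext_core_M[OF assms, unfolded ext_def], folded numer_def] by auto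

lemma holo_generic_eq:
 assumes "GEN x. f x = g x" "holo f" "holo g" shows "f x = g x"
 using generic_eq_imp_eq[OF assms(1)] holo_continuous assms by blast

lemma matching_image: "bij \<pi> ==> matching (\<pi> ` K) (\<pi> ` K') \<longleftrightarrow> matching K K'"
 by (simp add: matching_def card_image[OF inj_on_subset[OF bij_is_inj]])

lemma numer_perm:
 assumes \<pi>: "bij \<pi>" and m: "matching K K'" "a \<noteq> b"
 shows "numer (\<pi> a) (\<pi> b) (\<pi> ` K) (\<pi> ` K') (perm \<pi> x) = numer a b K K' x"
proof (rule holo_generic_eq)
 have m': "matching (\<pi> ` K) (\<pi> ` K')" "\<pi> a \<noteq> \<pi> b" using m \<pi> by (auto simp: matching_image bij_is_inj inj_eq)
 show "holo (%x. numer (\<pi> a) (\<pi> b) (\<pi> ` K) (\<pi> ` K') (perm \<pi> x))" by (intro holo_perm numer m')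
 show "holo (numer a b K K')" by (intro numer m)
 have "GEN x. M (\<pi> ` K) (\<pi> ` K') (perm \<pi> x) = M K K' x"
  using m by (intro M_perm \<pi>) (simp add: matching_def)
 with generic_perm[OF numer(2)[OF m'] \<pi>] numer(2)[OF m]
 show "GEN x. numer (\<pi> a) (\<pi> b) (\<pi> ` K) (\<pi> ` K') (perm \<pi> x) = numer a b K K' x"
  by eventually_elim (simp add: core_perm[OF \<pi>] flip: numer)
qed

text \<open>Without a pole along z_a = z_b the factor th (z_a - z_b) of \<open>core\<close> survives
  in the product.\<close>

lemma numer_vanish:
 assumes m: "matching K K'" "a \<noteq> b" and "{a, b} \<notin> dpairs K K'" and x: "x$$a = x$$b"
 shows "numer a b K K' x = 0"
proof -
 have "mset_set (dpairs K K') \<subseteq># mset_set (two_sets - {{a, b}})" using dpairs_subset assms(3) by (intro subset_imp_msubset_mset_set) auto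
 hence "polar_forms + image_mset Diff (mset_set (dpairs K K')) \<subseteq># polar_forms + other_diffs a b"
  unfolding other_diffs_def by (intro subset_mset.add_left_mono image_mset_subseteq_mono)
 hence "poles (polar_forms + other_diffs a b) (M K K')" using poles_mono[OF poles_M[OF m(1)]] by blast
 then obtain G where G: "holo G" "GEN x. fprod (polar_forms + other_diffs a b) x * M K K' x = G x"
  unfolding poles_def ext_def by blast
 have "numer a b K K' x = th (x$$a - x$$b) * fprod (other_diffs a b) x * G x" for x
 proof (rule holo_generic_eq)
  show "GEN x. numer a b K K' x = th (x$$a - x$$b) * fprod (other_diffs a b) x * G x"
   using G(2) numer(2)[OF m]
  proof eventually_elim
   case (elim x)
   show ?case unfolding elim(1)[symmetric] elim(2)[symmetric] by (simp add: core_def power2_eq_square mult_ac)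
  qed
  show "holo (numer a b K K')" by (intro numer m)
  show "holo (%x. th (x$$a - x$$b) * fprod (other_diffs a b) x * G x)" by (intro holo_intros G(1))
 qed
 thus ?thesis using x by (simp add: theta_0)
qed

end

text \<open>By \<open>dominated_initial\<close> K lies between A and A \<union> {p, q}, and it has
  one element more than A.\<close>

lemma dominated_two_step:
 fixes A K :: "'n::{finite,linorder} set"
 assumes "initial A" "initial (insert p (insert q A))" "p \<notin> A" "q \<notin> A" "p \<noteq> q" "dominated K (insert q A)"
 shows "K = insert q A \<or> K = insert p A"
proof -
 let ?B = "insert p (insert q A)"
 have "A - insert q A = {}" "insert q A - ?B = {}" by auto
 hence "card (A - K) = 0" "card (K - ?B) = 0"
  using dominated_initial(1)[OF assms(6,1)] dominated_initial(2)[OF assms(6,2)] by (metis card.empty le_zero_eq)+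
 hence s: "A \<subseteq> K" "K \<subseteq> ?B" by auto
 moreover have "card K = Suc (card A)" using dominated_card[OF assms(6)] assms(4) by simp
 ultimately show ?thesis
 proof (cases "p \<in> K \<and> q \<in> K")
  case True
  hence "K = ?B" using s by auto
  thus ?thesis using \<open>card K = Suc (card A)\<close> assms by simp
 next
  case False
  then consider "K = A" | "K = insert q A" | "K = insert p A" using s by blast
  thus ?thesis using \<open>card K = Suc (card A)\<close> by cases auto
 qed
qed

lemma generic_eq_isCont:
 fixes f g :: "('n::finite) pt => complex"
 assumes "GEN x. f x = g x" "isCont f x0" "isCont g x0"
 shows "f x0 = g x0"
proof (rule ccontr)
 assume ne: "f x0 \<noteq> g x0"
 obtain A where A: "closure A = UNIV" "\<forall>x\<in>A. f x = g x" using assms(1) unfolding eventually_generic by blast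
 have "isCont (%x. f x - g x) x0" using assms by (intro continuous_intros)
 moreover have "f x0 - g x0 \<in> - {0}" using ne by simp
 ultimately obtain U where U: "open U" "x0 \<in> U" "\<forall>x\<in>U. f x - g x \<in> - {0}"
  using assms unfolding continuous_at_open by (metis open_delete open_UNIV Compl_eq_Diff_UNIV)
 hence "U \<inter> A \<noteq> {}" using A(1) unfolding dense_iff by blast
 thus False using A(2) U(3) by auto
qed

context spectral
begin

lemma isCont_holo_shift: "isCont f (shift \<nu> x) ==> isCont (%x. f (shift \<nu> x)) x"
proof -
 assume f: "isCont f (shift \<nu> x)"
 have "isCont (shift \<nu>) x" using continuous_shift[of UNIV \<nu>] unfolding continuous_on_eq_continuous_at[OF open_UNIV] by blast
 thus ?thesis using f by (rule isCont_o2)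
qed

lemma isCont_stab:
 fixes I K :: "'n::{finite,linorder} set"
 assumes card: "card I = card K"
  and nz: "\<And>a b. a \<in> K ==> b \<in> K ==> a \<noteq> b ==> th (x$$a - x$$b) \<noteq> 0 \<and> th (x$$a - x$$b + yv x) \<noteq> 0"
  and psi: "psi \<tau> I (yv x) (lv x) \<noteq> 0"
 shows "isCont (stb I K) x"
proof -
 have e: "stb I K = (%x. inverse (psi \<tau> I (yv x) (lv x)) * (\<Sum>f\<in>Bij I K. wterm \<tau> I (%i. x$$f i) x))"
 proof
  fix x show "stb I K x = inverse (psi \<tau> I (yv x) (lv x)) * (\<Sum>f\<in>Bij I K. wterm \<tau> I (%i. x$$f i) x)"
   using stab_eq[OF card, of \<tau> "fst x" "yv x" "lv x"] by (simp add: divide_inverse)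
 qed
 have "isCont (%x. wterm \<tau> I (%i. x$$f i) x) x" if f: "f \<in> Bij I K" for f
 proof -
  define A where "A x = (\<Prod>i\<in>I. (\<Prod>a | a < i. th (x$$f i - x$$a + yv x)) * th (lv x + x$$f i - x$$i - of_int (wcount i I) * yv x)
    * (\<Prod>a | a > i. th (x$$f i - x$$a)))" for x :: "'n pt"
  define B where "B x = (\<Prod>ij\<in>pairs I. th (x$$f (fst ij) - x$$f (snd ij)) * th (x$$f (snd ij) - x$$f (fst ij) + yv x))" for x :: "'n pt"
  have "(%x. wterm \<tau> I (%i. x$$f i) x) = (%x. A x / B x)"
   by (simp add: wterm_def A_def B_def case_prod_beta fun_eq_iff)
  moreover have "isCont A x" "isCont B x"
   unfolding A_def B_def by (intro holo_isCont holo_intros)+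
  moreover have "B x \<noteq> 0"
  proof -
   have "th (x$$f a - x$$f b) \<noteq> 0 \<and> th (x$$f b - x$$f a + yv x) \<noteq> 0" if "a \<in> I" "b \<in> I" "a < b" for a b
   proof -
    have "f a \<in> K" "f b \<in> K" "f a \<noteq> f b" using f that unfolding Bij_def bij_betw_def by (auto dest: inj_onD)
    thus ?thesis using nz[of "f a" "f b"] nz[of "f b" "f a"] by simp
   qed
   thus ?thesis unfolding B_def by auto
  qed
  ultimately show ?thesis by (simp add: continuous_divide)
 qed
 moreover have "isCont (%x. psi \<tau> I (yv x) (lv x)) x"
  unfolding psi_def by (intro holo_isCont holo_intros)
 ultimately show ?thesis unfolding e using psi by (intro isCont_mult isCont_sum continuous_at_within_inverse) auto
qed

text \<open>If z_p = z_q, composing a bijection with the swap does not change the values substituted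
  for the variables.\<close>

lemma stab_swap_coincident:
 fixes K :: "'n::{finite,linorder} set"
 assumes "x$$p = x$$q"
 shows "stb K (swap p q ` K) x = stb K K x"
proof -
 obtain z y l where x: "x = (z, y, l)" by (metis prod_cases3)
 have b: "bij (swap p q)" by simp
 have z: "z$swap p q a = z$a" for a using assms by (auto simp: x Transposition.transpose_def)
 have c: "card K = card (swap p q ` K)" by (simp add: card_image inj_on_subset[OF inj_transpose])
 have "(\<Sum>f\<in>Bij K (swap p q ` K). wterm \<tau> K (%i. z$f i) (z, y, l)) = (\<Sum>f\<in>Bij K K. wterm \<tau> K (%i. z$f i) (z, y, l))"
  unfolding Bij_postcompose[OF b, symmetric]
 proof (intro sum.cong refl)
  fix f
  have "(\<Prod>i\<in>K. wfac \<tau> K i (z$(if i \<in> K then swap p q (f i) else undefined)) (z, y, l)) = (\<Prod>i\<in>K. wfac \<tau> K i (z$f i) (z, y, l))"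
   by (intro prod.cong) (auto simp: z)
  moreover have "wpairs \<tau> y K (%i. z$(if i \<in> K then swap p q (f i) else undefined)) = wpairs \<tau> y K (%i. z$f i)"
   by (rule wpairs_cong) (simp add: z)
  ultimately show "wterm \<tau> K (%i. z$(if i \<in> K then swap p q (f i) else undefined)) (z, y, l) = wterm \<tau> K (%i. z$f i) (z, y, l)"
   unfolding wterm_eq by simp
 qed
 thus ?thesis unfolding x stab_eq[OF c] stab_eq[OF refl] by simp
qed

end

context quantum_entry
begin

lemma gen_on_coincident:
 assumes "a \<noteq> b" "\<And>p. p \<in># A ==> valid_form p \<and> p \<noteq> Diff {a, b}"
 shows "gen_on {x :: 'n pt. x$$a = x$$b} (fprod A)"
proof (rule gen_on_fprod)
 fix p assume p: "p \<in># A"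
 have "valid_form (Diff {a, b})" using assms(1) by simp
 from ev_not_parallel[OF this, of p] assms(2)[OF p] obtain v where v: "ev 0 (Diff {a, b}) v = 0" "ev 0 p v \<noteq> 0" by metis
 have "v$$a = v$$b" using v(1) by (simp add: min_def max_def split: if_splits)
 thus "gen_on {x :: 'n pt. x$$a = x$$b} (thf p)"
  using v(2) by (intro gen_on_thf[of _ v]) (auto simp: cscale_def case_prod_beta)
qed

text \<open>
 The poles along \<open>z\<^sub>p = z\<^sub>q\<close> of the only two entries of row \<open>K\<close> that meet \<open>Stab(v\<^sub>K)\<close> must cancel, since
 the other side of the defining relation has no such pole.
\<close>

lemma numer_residue_initial:
 assumes ij': "i = 1" "j = 1" and A: "initial A" "initial (insert p (insert q A))" "p \<notin> A" "q \<notin> A" "p < q"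
  and x: "x$$p = x$$q"
 shows "numer q p (insert q A) (insert q A) x + numer q p (insert q A) (insert p A) x = 0"
proof -
 have ne: "p \<noteq> q" "q \<noteq> p" using A(5) by auto
 define K0 where "K0 = insert q A"
 define I0 where "I0 = insert p A"
 have sw: "swap p q ` K0 = I0" unfolding K0_def I0_def using swap_image_simps(3)[OF A(3,4)] .
 have card: "card K0 = card I0" using A(3,4) by (simp add: K0_def I0_def)
 have K0I0: "K0 \<noteq> I0" using A(3,4) ne by (auto simp: K0_def I0_def)
 have m: "matching K0 K0" "matching K0 I0" using card ij' unfolding matching_def by simp_all
 have ej: "eps j = - 1" by (simp add: eps_def ij')
 define R where "R x = L_stab K0 K0 x" for x
 have row: "M K0 K0 x * stb K0 K0 (shift (- 1) x) + M K0 I0 x * stb K0 I0 (shift (- 1) x) = R x" if x: "good x" for x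
 proof -
  have "(\<Sum>K' | card K' = card K0. M K0 K' x * stb K0 K' (shift (- 1) x)) = (\<Sum>K'\<in>{K0, I0}. M K0 K' x * stb K0 K' (shift (- 1) x))"
  proof (rule sum.mono_neutral_right)
   show "\<forall>K'\<in>{K'. card K' = card K0} - {K0, I0}. M K0 K' x * stb K0 K' (shift (- 1) x) = 0"
   proof
    fix K' assume K': "K' \<in> {K'. card K' = card K0} - {K0, I0}"
    hence "\<not> dominated K' K0"
     using dominated_two_step[OF A(1-4) ne(1), of K'] unfolding K0_def I0_def by blast
    thus "M K0 K' x * stb K0 K' (shift (- 1) x) = 0" using K' stab_eq_0[of K0 K'] by simp
   qed
  qed (use card in auto)
  thus ?thesis using goodD(3)[OF x, of K0 K0] K0I0 unfolding R_def ej by (simp add: ij')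
 qed
 have "\<forall>K. \<exists>B. (\<forall>p\<in>#B. \<exists>m. p = Dyn m) \<and> poles (specs + B) (%x. Lc x K0 K)"
  using poles_Lcoeff[OF ij(1), of j K0] by blast
 then obtain LB where LB: "\<And>K. (\<forall>p\<in>#LB K. \<exists>m. p = Dyn m) \<and> poles (specs + LB K) (%x. Lc x K0 K)" by metis
 define psiB :: "'n set => 'n form multiset" where
  "psiB K = (\<Sum>a\<in>K. {#Dyn (- (wcount a K + 1))#} + {#Dyn (- wcount a K)#})" for K
 have psiB: "poles (psiB K) (%x. inverse (psi \<tau> K (yv x) (lv x)))" for K
 proof -
  have "poles (psiB K) (%x. \<Prod>a\<in>K. inverse (th (lv x - of_int (wcount a K + 1) * yv x)) * inverse (th (lv x - of_int (wcount a K) * yv x)))"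
   unfolding psiB_def
  proof (rule poles_prod)
   fix a
   show "poles ({#Dyn (- (wcount a K + 1))#} + {#Dyn (- wcount a K)#}) (%x. inverse (th (lv x - of_int (wcount a K + 1) * yv x)) * inverse (th (lv x - of_int (wcount a K) * yv x)))"
    by (rule poles_mult[OF poles_inverse_Dyn'[of "wcount a K + 1"] poles_inverse_Dyn'[of "wcount a K"]])
  qed
  thus ?thesis by (simp add: psi_def prod_inversef[symmetric] comp_def)
 qed
 have psiBd: "\<forall>p\<in>#psiB K. \<exists>m. p = Dyn m" for K unfolding psiB_def by (auto simp: set_mset_sum)
 define B where "B = specs + (\<Sum>K | card K = card K0. LB K + psiB K) + diff_forms K0"
 have "poles B R"
  unfolding R_def
 proof (rule poles_sum)
  fix K :: "'n set" assume K: "K \<in> {K. card K = card K0}"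
  have "poles ((specs + LB K) + (diff_forms K0 + psiB K)) (%x. Lc x K0 K * (stabnum \<tau> K K0 x * inverse (psi \<tau> K (yv x) (lv x))))"
   using LB[of K] by (intro poles_mult poles_stabnum psiB) auto
  hence "poles ((specs + LB K) + (diff_forms K0 + psiB K)) (%x. Lc x K0 K * stb K K0 x)"
   using stab_stabnum[of K K0] K by (simp add: divide_inverse)
  thus "poles B (%x. Lc x K0 K * stb K K0 x)"
  proof (rule poles_mono)
   have "(\<Sum>K | card K = card K0. LB K + psiB K) = (LB K + psiB K) + (\<Sum>K\<in>{K. card K = card K0} - {K}. LB K + psiB K)"
    by (rule sum.remove) (use K in auto)
   thus "specs + LB K + (diff_forms K0 + psiB K) \<subseteq># B" unfolding B_def by (simp add: ac_simps)
  qed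
 qed
 then obtain G where G: "holo G" "GEN x. fprod B x * R x = G x" unfolding poles_def ext_def by blast
 \<comment> \<open>As p is not in K0, the numerators evaluated at K0 have no pole along z_p = z_q;
   so the right side of the row has none either.\<close>
 have vB: "p' \<in># B ==> valid_form p' \<and> p' \<noteq> Diff {q, p}" for p'
 proof -
  assume p': "p' \<in># B"
  then consider "p' \<in># specs" | "\<exists>m. p' = Dyn m" | "p' \<in># diff_forms K0"
   unfolding B_def using LB psiBd by (auto simp: set_mset_sum)
  thus ?thesis
  proof cases
   case 3
   thus ?thesis using A(3) ne by (auto simp: diff_forms_def K0_def)
  qed (auto simp: specs_def)
 qed
 \<comment> \<open>All divisors on which the stable envelopes might be discontinuous or the needed
   factors vanish; off them the relation is evaluated pointwise, and density does the rest. The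
   bound n + 4 safely covers w(a, K) + 1 after the shift by - y.\<close>
 define Q where "Q = B + other_diffs q p + image_mset (%(a, b). DiffY a b) (mset_set {(a, b). a \<noteq> b})
  + image_mset Dyn (mset_set {- (int CARD('n) + 4)..int CARD('n) + 4})"
 have genQ: "gen_on {x :: 'n pt. x$$q = x$$p} (fprod Q)"
  by (rule gen_on_coincident[OF ne(2)]) (use vB in \<open>auto simp: Q_def other_diffs_def two_sets_def\<close>)
 define S where "S x = numer q p K0 K0 x + numer q p K0 I0 x" for x
 have S: "holo S" unfolding S_def by (intro holo_intros numer m ne)
 have "fprod Q x0 * S x0 = 0" if x0: "x0 \<in> {x :: 'n pt. x$$q = x$$p}" for x0
 proof (cases "fprod Q x0 = 0")
  case False
  hence nz: "thf p' x0 \<noteq> 0" if "p' \<in># Q" for p' using that by (auto simp: fprod_def)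
  have dY: "th (x0$$a - x0$$b + yv x0) \<noteq> 0" if "a \<noteq> b" for a b
   using nz[of "DiffY a b"] that by (auto simp: Q_def)
  have dD: "th (x0$$a - x0$$b) \<noteq> 0" if "a \<noteq> b" "{a, b} \<noteq> {q, p}" for a b
  proof -
   have "Diff {a, b} \<in># Q" using that by (auto simp: Q_def other_diffs_def two_sets_def)
   hence "thf (Diff {a, b}) x0 \<noteq> 0" by (rule nz)
   thus ?thesis using thf_Diff[of a b x0] by auto
  qed
  have dl: "th (lv x0 + of_int m * yv x0) \<noteq> 0" if "\<bar>m\<bar> \<le> int CARD('n) + 4" for m
  proof -
   have "m \<in> {- (int CARD('n) + 4)..int CARD('n) + 4}" using that by auto
   hence "(Dyn m :: 'n form) \<in># image_mset Dyn (mset_set {- (int CARD('n) + 4)..int CARD('n) + 4})" by simp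
   hence "Dyn m \<in># Q" unfolding Q_def by (simp only: union_iff simp_thms)
   thus ?thesis using nz[of "Dyn m"] by simp
  qed
  let ?x = "shift (- 1) x0"
  have sx: "fst ?x = fst x0" "yv ?x = yv x0" "lv ?x = lv x0 - yv x0" by (simp_all add: shift_def case_prod_beta)
  have dw: "th (lv ?x - of_int (wcount a K + 1) * yv ?x) \<noteq> 0" "th (lv ?x - of_int (wcount a K) * yv ?x) \<noteq> 0" for a :: 'n and K
  proof -
   have "\<bar>- (wcount a K + 1) - 1\<bar> \<le> int CARD('n) + 4" "\<bar>- wcount a K - 1\<bar> \<le> int CARD('n) + 4" using wcount_bound[of a K] by auto
   from dl[OF this(1)] dl[OF this(2)] show "th (lv ?x - of_int (wcount a K + 1) * yv ?x) \<noteq> 0" "th (lv ?x - of_int (wcount a K) * yv ?x) \<noteq> 0"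
    unfolding sx by (simp_all add: algebra_simps)
  qed
  have psi: "psi \<tau> K0 (yv ?x) (lv ?x) \<noteq> 0" using dw by (simp add: psi_def)
  have c1: "isCont (%x. stb K0 K (shift (- 1) x)) x0" if "K = K0 \<or> K = I0" for K
  proof (intro isCont_holo_shift isCont_stab psi)
   show "card K0 = card K" using that card by auto
   show "th (?x$$a - ?x$$b) \<noteq> 0 \<and> th (?x$$a - ?x$$b + yv ?x) \<noteq> 0" if ab: "a \<in> K" "b \<in> K" "a \<noteq> b" for a b
    unfolding sx using \<open>K = K0 \<or> K = I0\<close> ab A(3,4) ne by (intro conjI dD dY) (auto simp: K0_def I0_def doubleton_eq_iff)
  qed
  have eq: "GEN x. fprod B x * (numer q p K0 K0 x * stb K0 K0 (shift (- 1) x) + numer q p K0 I0 x * stb K0 I0 (shift (- 1) x)) = core q p x * G x"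
   using good_generic G(2) numer(2)[OF m(1) ne(2)] numer(2)[OF m(2) ne(2)]
  proof eventually_elim
   case (elim x)
   show ?case unfolding elim(2)[symmetric] elim(3,4)[symmetric] row[OF elim(1), symmetric] by (simp add: algebra_simps)
  qed
  have "fprod B x0 * (numer q p K0 K0 x0 * stb K0 K0 ?x + numer q p K0 I0 x0 * stb K0 I0 ?x) = core q p x0 * G x0"
   by (rule generic_eq_isCont[OF eq])
    (intro isCont_mult isCont_add c1 holo_isCont fprod_holo numer m ne core_holo G(1); simp)+
  moreover have "core q p x0 = 0" using x0 by (simp add: core_def theta_0)
  moreover have "fprod B x0 \<noteq> 0" using False by (simp add: Q_def)
  moreover have "stb K0 I0 ?x = stb K0 K0 ?x"
   unfolding sw[symmetric] by (rule stab_swap_coincident) (use x0 sx in simp)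
  ultimately have "S x0 * stb K0 K0 ?x = 0" by (simp add: S_def distrib_right)
  moreover have "stb K0 K0 ?x \<noteq> 0"
  proof -
   have K0d: "th (x0$$a - x0$$b) \<noteq> 0" if "a \<in> K0" "b \<in> K0" "a \<noteq> b" for a b
    using that A(3) ne by (intro dD) (auto simp: K0_def doubleton_eq_iff)
   have off: "th (x0$$a - x0$$b) \<noteq> 0" if "a \<in> K0" "a < b" for a b
   proof (rule dD)
    show "a \<noteq> b" using that by auto
    show "{a, b} \<noteq> {q, p}" using that A(3,5) by (auto simp: K0_def doubleton_eq_iff)
   qed
   have "stb K0 K0 (fst ?x, yv ?x, lv ?x) = 1 / psi \<tau> K0 (yv ?x) (lv ?x) * (\<Prod>i\<in>K0. th (lv ?x - of_int (wcount i K0) * yv ?x)) *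
    (\<Prod>i\<in>K0. (\<Prod>a | a < i \<and> a \<notin> K0. th (?x$$i - ?x$$a + yv ?x)) * (\<Prod>a | a > i \<and> a \<notin> K0. th (?x$$i - ?x$$a)))"
    by (rule stab_diag) (unfold sx, use K0d dY in auto)
   moreover have "(\<Prod>i\<in>K0. th (lv ?x - of_int (wcount i K0) * yv ?x)) \<noteq> 0" using dw by simp
   moreover have "(\<Prod>i\<in>K0. (\<Prod>a | a < i \<and> a \<notin> K0. th (?x$$i - ?x$$a + yv ?x)) * (\<Prod>a | a > i \<and> a \<notin> K0. th (?x$$i - ?x$$a))) \<noteq> 0"
    unfolding sx using dY off by auto
   ultimately show ?thesis using psi by simp
  qed
  ultimately have "S x0 = 0" by simp
  thus ?thesis by simp
 qed simp
 hence "S x = 0"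
  by (rule gen_on_zero[OF genQ holo_continuous[OF S]]) (use x in auto)
 thus ?thesis unfolding S_def K0_def I0_def .
qed

end

lemma initial_nested:
 fixes A B :: "'n::{finite,linorder} set"
 assumes "initial A" "initial B" "card A \<le> card B"
 shows "A \<subseteq> B"
proof (rule ccontr)
 assume "\<not> A \<subseteq> B"
 then obtain a where a: "a \<in> A" "a \<notin> B" by blast
 have "B \<subset> A"
 proof
  show "B \<subseteq> A"
  proof
   fix b assume b: "b \<in> B"
   hence "b < a" using assms(2) a by (auto simp: initial_def)
   thus "b \<in> A" using assms(1) a unfolding initial_def by (metis ComplI less_asym)
  qed
 qed (use a in auto)
 thus False using psubset_card_mono[of A B] assms(3) by simp
qed

lemma swap_image_exchange:
 assumes "a \<in> K" "b \<notin> K" shows "swap a b ` K = insert b (K - {a})"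
proof -
 have "swap a b ` insert a (K - {a}) = insert b (K - {a})" by (rule swap_image_simps(2)) (use assms in auto)
 moreover have "insert a (K - {a}) = K" using assms by auto
 ultimately show ?thesis by (simp only:)
qed

lemma perm_swap_fixed:
 assumes "x$$a = x$$b" shows "perm (swap a b) x = x"
 using assms by (cases x) (auto simp: perm_swap vec_eq_iff Transposition.transpose_def)

context spectral
begin

text \<open>Every form of J may be removed by a second bound of its own.\<close>

lemma poles_remove_all:
 assumes "poles (A + J) f" "\<And>p. p \<in># J ==> valid_form p"
  and "\<And>p. p \<in># J ==> \<exists>C. (\<forall>q\<in>#C. valid_form q) \<and> p \<notin># C \<and> poles (A + C) f"
 shows "poles A f"
 using assms
proof (induction J)
 case (add p J)
 obtain C where C: "\<forall>q\<in>#C. valid_form q" "p \<notin># C" "poles (A + C) f" using add.prems(3)[of p] by auto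
 have "poles (A + J) f"
 proof (rule poles_coprime)
  show "poles (A + J + {#p#}) f" using add.prems(1) by simp
  show "poles (A + J + C) f" by (rule poles_mono[OF C(3)]) (simp add: ac_simps)
 qed (use add.prems(2) C in auto)
 thus ?case by (rule add.IH) (use add.prems in auto)
qed simp

end

context quantum_entry
begin

lemma numer_commute:
 assumes "matching K K'" "a \<noteq> b" shows "numer b a K K' x = - numer a b K K' x"
proof (rule holo_generic_eq)
 show "GEN x. numer b a K K' x = - numer a b K K' x"
  using numer(2)[OF assms] numer(2)[OF assms(1) assms(2)[symmetric]]
  by eventually_elim (simp add: core_commute[of b a] flip: numer)
qed (intro numer assms assms(2)[symmetric] holo_intros)+

text \<open>A permutation takes a, b and K to q, p and A \<union> {q} with A and A \<union> {p, q}
  both initial, the position treated by \<open>numer_residue_initial\<close>.\<close>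

lemma numer_residue:
 assumes ij': "i = 1" "j = 1" and ab: "a \<in> K" "b \<notin> K" and x: "x$$a = x$$b"
 shows "numer a b K K x + numer a b K (swap a b ` K) x = 0"
proof -
 have ne: "a \<noteq> b" using ab by auto
 have k: "card K \<ge> 1" using ab by (simp add: Suc_le_eq card_gt_0_iff) auto
 have "card (insert b K) \<le> CARD('n)" by (rule card_mono) auto
 hence kn: "card K + 1 \<le> CARD('n)" using ab by simp
 have le: "card K - 1 \<le> CARD('n)" "card K \<le> CARD('n)" using kn by auto
 obtain A :: "'n set" where A: "initial A" "card A = card K - 1" by (rule initial_exists[OF le(1)])
 obtain I :: "'n set" where I: "initial I" "card I = card K" by (rule initial_exists[OF le(2)])
 obtain B :: "'n set" where B: "initial B" "card B = card K + 1" by (rule initial_exists[OF kn])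
 have sub: "A \<subseteq> I" "I \<subseteq> B" using initial_nested[OF A(1) I(1)] initial_nested[OF I(1) B(1)] A I B by auto
 have "card (I - A) = 1" "card (B - I) = 1" using sub A I B k by (simp_all add: card_Diff_subset)
 then obtain p q where p: "I - A = {p}" and q: "B - I = {q}" by (metis card_1_singletonE)
 have pq: "p \<in> I" "p \<notin> A" "q \<in> B" "q \<notin> I" using p q by auto
 hence "p < q" using I(1) by (simp add: initial_def)
 moreover have "q \<notin> A" "I = insert p A" "B = insert p (insert q A)" using pq p q sub by auto
 ultimately have pA: "p \<notin> A" "q \<notin> A" "p < q" "I = insert p A" "B = insert p (insert q A)" using pq by simp_all
 obtain \<pi> :: "'n => 'n" where \<pi>: "bij \<pi>" "\<pi> ` {q} = {a}" "\<pi> ` A = K - {a}" "\<pi> ` {p} = {b}"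
  by (rule bij_between_partitions[of "{q}" "{a}" A "K - {a}" "{p}" "{b}"]) (use A ab pA ne in auto)
 define y where "y = perm (inv \<pi>) x"
 have y: "perm \<pi> y = x" unfolding y_def using \<pi>(1) by simp
 have im: "\<pi> q = a" "\<pi> p = b" "\<pi> ` insert q A = K" "\<pi> ` insert p A = swap a b ` K"
  unfolding swap_image_exchange[OF ab] using \<pi> ab by auto
 have yz: "y$$p = y$$q" using x fst_perm_nth[OF \<pi>(1), of y] im(1,2) unfolding y by metis
 have m: "matching (insert q A) (insert q A)" "matching (insert q A) (insert p A)"
  using pA(1,2) ij' unfolding matching_def by simp_all
 have "numer q p (insert q A) (insert q A) y + numer q p (insert q A) (insert p A) y = 0"
  by (rule numer_residue_initial[OF ij' A(1) _ pA(1,2,3) yz]) (use B(1) pA(5) in simp)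
 moreover have qp: "q \<noteq> p" using pA(3) by auto
 ultimately show ?thesis
  using numer_perm[OF \<pi>(1) m(1) qp, of y] numer_perm[OF \<pi>(1) m(2) qp, of y] unfolding im y by simp
qed

text \<open>When K separates a from b, only K' = K and K' = the swapped K can have a residue, and
  only for i = j = 1. These two residues are opposite, and g has the same value at both.\<close>

lemma numer_sum_zero_separated:
 assumes ab: "a \<in> K" "b \<notin> K" and x: "x$$a = x$$b" and g: "\<And>K'. g (swap a b ` K') = g K'"
 shows "(\<Sum>K' | matching K K'. numer a b K K' x * g K') = 0"
proof -
 have ne: "a \<noteq> b" using ab by auto
 define K1 where "K1 = swap a b ` K"
 have K1: "K1 = insert b (K - {a})" unfolding K1_def by (rule swap_image_exchange[OF ab])
 have cK1: "card K1 = card K" unfolding K1_def by (simp add: card_image inj_on_subset[OF inj_transpose])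
 have KK1: "K \<noteq> K1" using K1 ab by auto
 have zero: "numer a b K K' x = 0" if m: "matching K K'" and "\<not> (i = 1 \<and> j = 1 \<and> (K' = K \<or> K' = K1))" for K'
 proof (cases "{a, b} \<in> dpairs K K'")
  case True
  have "\<not> (i = 1 \<and> j = 1 \<and> K = K')" using that by auto
  hence "{a, b} \<in> move_pairs K K'" using True unfolding dpairs_def by (simp split: if_splits)
  hence e: "{a, b} = (K - K') \<union> (K' - K)" using ab by (auto simp: move_pairs_def)
  have "K' = K1"
  proof (rule set_eqI)
   fix c
   have "c \<in> {a, b} \<longleftrightarrow> c \<in> K - K' \<or> c \<in> K' - K" using e by auto
   thus "c \<in> K' \<longleftrightarrow> c \<in> K1" unfolding K1 using ab by (cases "c = a"; cases "c = b") auto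
  qed
  hence "i = j" using m cK1 unfolding matching_def by simp
  hence "i = 2 \<and> j = 2 \<and> K \<noteq> K'" using that(2) \<open>K' = K1\<close> KK1 ij by auto
  hence "GEN x. M K K' x = 0" using m unfolding matching_def by (intro M_zero) auto
  hence "GEN x. numer a b K K' x = 0"
   using numer(2)[OF m ne] by eventually_elim simp
  thus ?thesis by (rule holo_generic_eq) (intro numer m ne holo_intros)+
 qed (rule numer_vanish[OF m ne _ x])
 show ?thesis
 proof (cases "i = 1 \<and> j = 1")
  case True
  have m: "matching K K" "matching K K1" using True cK1 unfolding matching_def by simp_all
  have "(\<Sum>K' | matching K K'. numer a b K K' x * g K') = (\<Sum>K'\<in>{K, K1}. numer a b K K' x * g K')"
   by (rule sum.mono_neutral_right) (use m zero in auto)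
  also have "\<dots> = (numer a b K K x + numer a b K K1 x) * g K"
   using KK1 g[of K] by (simp add: K1_def distrib_right)
  also have "\<dots> = 0" using numer_residue[OF _ _ ab x] True by (simp add: K1_def)
  finally show ?thesis .
 next
  case False
  thus ?thesis using zero by (intro sum.neutral) auto
 qed
qed

text \<open>The cancellation of residues against any swap-invariant g: values of a section in
  \<open>poles_image\<close>, transversal derivatives in \<open>image_glue\<close>. If a and b lie
  on the same side of K, the swap fixes K and reverses the sign of \<open>numer\<close>, so the sum
  equals its negative.\<close>

lemma numer_sum_zero:
 assumes ne: "a \<noteq> b" and x: "x$$a = x$$b" and g: "\<And>K'. g (swap a b ` K') = g K'"
 shows "(\<Sum>K' | matching K K'. numer a b K K' x * g K') = 0"
proof -
 consider "a \<in> K" "b \<notin> K" | "b \<in> K" "a \<notin> K" | "a \<in> K \<longleftrightarrow> b \<in> K" by blast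
 thus ?thesis
 proof cases
  case 1
  thus ?thesis using x g by (rule numer_sum_zero_separated)
 next
  case 2
  have "(\<Sum>K' | matching K K'. numer a b K K' x * g K') = - (\<Sum>K' | matching K K'. numer b a K K' x * g K')"
   unfolding sum_negf[symmetric] by (intro sum.cong refl) (use numer_commute[OF _ ne] in simp)
  also have "(\<Sum>K' | matching K K'. numer b a K K' x * g K') = 0"
   using g by (intro numer_sum_zero_separated 2 x[symmetric]) (simp add: transpose_commute)
  finally show ?thesis by simp
 next
  case 3
  define \<sigma> where "\<sigma> = swap a b"
  have b: "bij \<sigma>" by (simp add: \<sigma>_def)
  have \<sigma>K: "\<sigma> ` K = K" unfolding \<sigma>_def using 3 by (rule_tac set_eqI) (auto simp: swap_image_mem Transposition.transpose_def)
  have px: "perm \<sigma> x = x" unfolding \<sigma>_def using x by (rule perm_swap_fixed)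
  have ab: "\<sigma> a = b" "\<sigma> b = a" by (simp_all add: \<sigma>_def)
  have anti: "numer a b K (\<sigma> ` K') x = - numer a b K K' x" if m: "matching K K'" for K'
  proof -
   have m': "matching K (\<sigma> ` K')" using matching_image[OF b, of K K'] m \<sigma>K by simp
   have "numer b a K (\<sigma> ` K') x = numer a b K K' x"
    using numer_perm[OF b m ne, of x] unfolding \<sigma>K px ab .
   thus ?thesis using numer_commute[OF m' ne, of x] by (simp add: minus_equation_iff)
  qed
  have ss: "\<sigma> ` \<sigma> ` A = A" for A by (simp add: \<sigma>_def image_comp)
  have "(\<Sum>K' | matching K K'. numer a b K K' x * g K') = (\<Sum>K' | matching K K'. numer a b K (\<sigma> ` K') x * g (\<sigma> ` K'))"
   by (rule sum.reindex_bij_witness[of _ "%A. \<sigma> ` A" "%A. \<sigma> ` A"]) (use ss matching_image[OF b, of K] \<sigma>K in auto)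
  also have "\<dots> = - (\<Sum>K' | matching K K'. numer a b K K' x * g K')"
   unfolding sum_negf[symmetric] by (intro sum.cong refl) (use anti g in \<open>simp add: \<sigma>_def\<close>)
  finally show ?thesis by (simp add: eq_neg_iff_add_eq_0)
 qed
qed

end

text \<open>Local representatives agree on overlaps, since each coincides with f on a dense open
  part. The global function may then take its value at x from the representative chosen for
  x.\<close>

lemma holo_patch:
 fixes f :: "('n::finite) pt => complex"
 assumes "\<And>x. \<exists>U g A. x \<in> U \<and> open U \<and> holo_on g U \<and> open A \<and> U \<subseteq> closure A \<and> (\<forall>u\<in>A \<inter> U. f u = g u)"
 obtains G where "holo G" "GEN x. f x = G x"
proof -
 have "\<forall>x. \<exists>U g A. x \<in> U \<and> open U \<and> holo_on g U \<and> open A \<and> U \<subseteq> closure A \<and> (\<forall>u\<in>A \<inter> U. f u = g u)" using assms by blast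
 then obtain U g A where *: "\<And>x. x \<in> U x \<and> open (U x) \<and> holo_on (g x) (U x) \<and> open (A x) \<and> U x \<subseteq> closure (A x) \<and> (\<forall>u\<in>A x \<inter> U x. f u = g x u)" by metis
 have cont: "continuous_on (U x) (g x)" for x
 proof (intro continuous_at_imp_continuous_on ballI)
  fix u assume "u \<in> U x"
  thus "isCont (g x) u" using *[of x] has_derivative_continuous unfolding holo_on_def by blast
 qed
 have meet: "W \<inter> A x \<noteq> {}" if "open W" "W \<noteq> {}" "W \<subseteq> U x" for W x
 proof -
  have "W \<inter> closure (A x) \<noteq> {}" using * that by blast
  thus ?thesis using that(1) open_Int_closure_eq_empty by blast
 qed
 have agree: "g x v = g y v" if v: "v \<in> U x" "v \<in> U y" for x y v
 proof (rule ccontr)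
  assume ne: "g x v \<noteq> g y v"
  let ?V = "U x \<inter> U y"
  have V: "open ?V" "v \<in> ?V" using * v by blast+
  have "continuous_on ?V (%u. g x u - g y u)"
   using cont[of x] cont[of y] by (intro continuous_on_diff) (auto intro: continuous_on_subset)
  hence "open ((%u. g x u - g y u) -` (- {0}) \<inter> ?V)" using V(1) by (simp add: continuous_on_open_vimage open_delete Compl_eq_Diff_UNIV)
  moreover define W where "W = (%u. g x u - g y u) -` (- {0}) \<inter> ?V"
  ultimately have W: "open W" "v \<in> W" "W \<subseteq> ?V" using ne V by auto
  have W1: "open (W \<inter> A x)" "W \<inter> A x \<noteq> {}" using W * meet[of W x] by blast+
  hence "(W \<inter> A x) \<inter> A y \<noteq> {}" using W by (intro meet) blast+
  then obtain u where u: "u \<in> W" "u \<in> A x" "u \<in> A y" by blast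
  hence "f u = g x u" "f u = g y u" using *[of x] *[of y] W(3) by blast+
  thus False using u(1) by (simp add: W_def)
 qed
 define G where "G x = g x x" for x
 have G: "G u = g x u" if "u \<in> U x" for u x unfolding G_def using agree[of u u x] that *[of u] by blast
 have "holo G"
  unfolding holo_on_def
 proof
  fix x
  obtain D where D: "(g x has_derivative D) (at x)" "\<And>c v. D (cscale c v) = c * D v" using *[of x] unfolding holo_on_def by blast
  have "(G has_derivative D) (at x)"
  proof (rule has_derivative_transform_within_open[OF D(1), of "U x"])
   show "open (U x)" "x \<in> U x" using *[of x] by blast+
   show "g x u = G u" if "u \<in> U x" for u by (rule G[OF that, symmetric])
  qed
  thus "\<exists>f'. (G has_derivative f') (at x) \<and> (\<forall>c v. f' (cscale c v) = c * f' v)" using D by blast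
 qed
 moreover have "GEN x. f x = G x"
  unfolding eventually_generic
 proof (intro exI conjI)
  show "open (\<Union>x. A x \<inter> U x)" using * by (intro open_UN ballI open_Int) blast+
  show "closure (\<Union>x. A x \<inter> U x) = UNIV"
   unfolding dense_iff
  proof (intro allI impI)
   fix V :: "'n pt set" assume V: "open V \<and> V \<noteq> {}"
   then obtain x where x: "x \<in> V" by blast
   have "(V \<inter> U x) \<inter> A x \<noteq> {}" by (rule meet) (use V x *[of x] in blast)+
   thus "V \<inter> (\<Union>x. A x \<inter> U x) \<noteq> {}" by blast
  qed
  show "\<forall>u\<in>\<Union>x. A x \<inter> U x. f u = G u"
  proof
   fix u assume "u \<in> (\<Union>x. A x \<inter> U x)"
   then obtain x where "u \<in> A x" "u \<in> U x" by blast
   thus "f u = G u" using *[of x] G[of u x] by simp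
  qed
 qed
 ultimately show ?thesis using that by blast
qed

text \<open>If the coordinates over I and J agree as multisets, some a in I - J and b in J - I have
  the same coordinate. Swapping them stays within the subsets with this multiset and decreases I -
  J, so gluing need only be checked for such swaps.\<close>

lemma inter_lift_chain:
 fixes I J :: "'n::finite set"
 assumes x: "x \<in> inter_lift {I, J}"
  and step: "\<And>K a b. card K = card I ==> a \<in> K ==> b \<notin> K ==> x$$a = x$$b ==> f (swap a b ` K) = f K"
 shows "f I = f J"
proof -
 let ?z = "%A. image_mset (%a. x$$a) (mset_set A)"
 have "?z K = ?z J ==> card K = card I ==> f K = f J" for K
 proof (induction "card (K - J)" arbitrary: K)
  case 0
  hence "K \<subseteq> J" by auto
  moreover have "card K = card J" using arg_cong[OF 0(2), of size] by simp
  ultimately show ?case by (metis card_subset_eq finite)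
 next
  case (Suc m)
  hence "K - J \<noteq> {}" by (metis card.empty nat.distinct(1))
  then obtain a where a: "a \<in> K" "a \<notin> J" by blast
  have split: "?z A = ?z (A \<inter> B) + ?z (A - B)" for A B :: "'n set"
  proof -
   have "mset_set A = mset_set (A \<inter> B) + mset_set (A - B)"
    using mset_set_Union[of "A \<inter> B" "A - B"] by (simp add: Int_Diff_Un Int_Diff_disjoint)
   thus ?thesis by simp
  qed
  have "?z (K \<inter> J) + ?z (K - J) = ?z (J \<inter> K) + ?z (J - K)"
   using split[of K J] split[of J K] Suc.prems(1) by simp
  hence e: "?z (K - J) = ?z (J - K)" by (simp add: Int_commute)
  have "x$$a \<in># ?z (K - J)" using a by auto
  hence "x$$a \<in># ?z (J - K)" using e by simp
  then obtain b where b: "b \<in> J" "b \<notin> K" "x$$a = x$$b" by auto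
  let ?K = "swap a b ` K"
  have K': "?K = insert b (K - {a})" by (rule swap_image_exchange[OF a(1) b(2)])
  have "?z ?K = ?z K"
  proof -
   have "mset_set K = add_mset a (mset_set (K - {a}))" using a by (simp add: mset_set.remove)
   thus ?thesis unfolding K' using b by simp
  qed
  moreover have cK: "card ?K = card K" by (simp add: card_image inj_on_subset[OF inj_transpose])
  moreover have "m = card (?K - J)"
  proof -
   have "?K - J = (K - J) - {a}" unfolding K' using b by auto
   thus ?thesis using Suc.hyps(2) a by simp
  qed
  ultimately have "f ?K = f J" using Suc.hyps(1)[of ?K] Suc.prems by simp
  moreover have "f ?K = f K" using step[of K a b] a b Suc.prems by simp
  ultimately show ?case by simp
 qed
 moreover have "\<forall>A\<in>{I, J}. \<forall>B\<in>{I, J}. ?z A = ?z B"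
  using x unfolding inter_lift_def by (cases x) (simp only: mem_Collect_eq prod.case fst_conv)
 hence "?z I = ?z J" by blast
 ultimately show ?thesis by simp
qed

context spectral
begin

lemma fprod_translate:
 assumes "\<gamma> \<in> lattice \<tau>"
 shows "\<exists>\<kappa>. holo \<kappa> \<and> (\<forall>x. fprod A (x + \<gamma>) = \<kappa> x * fprod A x)"
proof (induction A)
 case empty
 show ?case by (rule exI[of _ "%_. 1"]) (simp add: holo_const)
next
 case (add p A)
 then obtain \<kappa> where \<kappa>: "holo \<kappa>" "\<And>x. fprod A (x + \<gamma>) = \<kappa> x * fprod A x" by blast
 have "ev 0 p \<gamma> \<in> \<Lambda>"
  using assms by (cases p) (auto simp: lattice_def case_prod_beta intro!: lattice1_add lattice1_diff lattice1_of_int_mult)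
 then obtain s b where sb: "\<And>z. th (z + ev 0 p \<gamma>) = s * exp (b * z) * th z" using theta_add_lattice by blast
 have "thf p (x + \<gamma>) = s * exp (b * ev w p x) * thf p x" for x
 proof -
  have "ev w p (x + \<gamma>) = ev w p x + ev 0 p \<gamma>" using ev_affine[of w p] unfolding affine_fn_def by blast
  thus ?thesis using sb[of "ev w p x"] by (simp only:)
 qed
 hence "fprod (add_mset p A) (x + \<gamma>) = (s * exp (b * ev w p x) * \<kappa> x) * fprod (add_mset p A) x" for x
  by (simp add: \<kappa>(2) mult_ac del: ev.simps)
 moreover have "holo (%x. exp (b * ev w p x))"
  by (rule holo_compose_1[where g = exp and V = UNIV]) (auto intro!: holo_intros holomorphic_intros)
 hence "holo (%x. s * exp (b * ev w p x) * \<kappa> x)" by (intro holo_intros \<kappa>(1))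
 ultimately show ?case by blast
qed

lemma difference_affine: "affine_fn (%x. x$$a - x$$b) (%x. x$$a - x$$b)"
 by (auto simp: affine_fn_def cscale_def case_prod_beta algebra_simps intro!: linearI)

end

section \<open>The image of a holomorphic section: poles and gluing\<close>

context quantum_entry
begin

text \<open>Each diagonal is removed separately. The cleared sum is holomorphic and vanishes on z_a
  = z_b by \<open>numer_sum_zero\<close>, as the components of S agree there; so it is divisible by
  th (z_a - z_b). The bound obtained contains the other diagonals twice, but this one no
  longer.\<close>

lemma poles_image:
 fixes S :: "'n set => 'n pt => complex"
 assumes S: "\<And>K'. matching K K' ==> holo (S K')"
  and glue: "\<And>I J u. matching K I ==> matching K J ==> u \<in> inter_lift {I, J} ==> S I u = S J u"
  and quasi: "\<And>\<gamma>. \<gamma> \<in> lattice \<tau> ==> \<exists>E. continuous_on UNIV E \<and>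
   (GEN x. act \<nu> S K (x + \<gamma>) = E x * act \<nu> S K x)"
 shows "poles polar_forms (%x. act \<nu> S K x)"
proof (rule poles_remove_all)
 define F where "F x = act \<nu> S K x" for x
 have "poles (polar_forms + image_mset Diff (mset_set two_sets)) F"
  unfolding F_def
 proof (rule poles_sum)
  fix K' assume K': "K' \<in> {K'. matching K K'}"
  have "poles (polar_forms + image_mset Diff (mset_set two_sets)) (M K K')"
  proof (rule poles_mono[OF poles_M])
   show "polar_forms + image_mset Diff (mset_set (dpairs K K')) \<subseteq># polar_forms + image_mset Diff (mset_set two_sets)"
    using dpairs_subset by (intro subset_mset.add_left_mono image_mset_subseteq_mono subset_imp_msubset_mset_set) auto
  qed (use K' in simp)
  hence "poles (polar_forms + image_mset Diff (mset_set two_sets)) (%x. S K' (shift \<nu> x) * M K K' x)"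
   using S K' by (intro poles_mult_holo holo_shift) auto
  thus "poles (polar_forms + image_mset Diff (mset_set two_sets)) (%x. M K K' x * S K' (shift \<nu> x))" by (simp add: mult.commute)
 qed
 thus "poles (polar_forms + image_mset Diff (mset_set two_sets)) (%x. act \<nu> S K x)" unfolding F_def .
 show "p \<in># image_mset Diff (mset_set two_sets) ==> valid_form p" for p :: "'n form" by (auto simp: two_sets_def)
 show "\<exists>C. (\<forall>q\<in>#C. valid_form q) \<and> p \<notin># C \<and> poles (polar_forms + C) (%x. act \<nu> S K x)"
  if p: "p \<in># image_mset Diff (mset_set two_sets)" for p
 proof -
  obtain a b where ab: "p = Diff {a, b}" "a \<noteq> b" using p by (auto simp: two_sets_def card_2_iff)
  define \<Phi> where "\<Phi> x = (\<Sum>K' | matching K K'. numer a b K K' x * S K' (shift \<nu> x))" for x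
  have h: "holo \<Phi>" unfolding \<Phi>_def by (intro holo_sum holo_mult holo_shift numer ab(2) S) auto
  have \<Phi>: "GEN x. core a b x * F x = \<Phi> x"
  proof -
   have "GEN x. \<forall>K'\<in>{K'. matching K K'}. core a b x * M K K' x = numer a b K K' x"
    using numer(2)[OF _ ab(2)] by (intro eventually_ball_finite) auto
   thus ?thesis
    unfolding F_def \<Phi>_def sum_distrib_left by eventually_elim (intro sum.cong refl, simp add: mult.assoc[symmetric])
  qed
  have zero0: "\<Phi> x = 0" if x: "x$$a = x$$b" for x
  proof -
   define g where "g K' = (if matching K K' then S K' (shift \<nu> x) else 0)" for K'
   have "g (swap a b ` K') = g K'" for K'
   proof -
    have m: "matching K (swap a b ` K') \<longleftrightarrow> matching K K'" by (simp add: matching_def card_image inj_on_subset[OF inj_transpose])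
    have "S (swap a b ` K') (shift \<nu> x) = S K' (shift \<nu> x)" if "matching K K'"
    proof (rule glue)
     have "image_mset (%c. x$$c) (mset_set (swap a b ` K')) = image_mset (%c. x$$c) (image_mset (swap a b) (mset_set K'))"
      by (subst image_mset_mset_set) (auto intro: inj_on_subset[OF inj_transpose])
     also have "\<dots> = image_mset (%c. x$$c) (mset_set K')"
      unfolding multiset.map_comp using x by (intro image_mset_cong) (auto simp: Transposition.transpose_def)
     finally show "shift \<nu> x \<in> inter_lift {swap a b ` K', K'}" by (auto simp: inter_lift_def shift_def case_prod_beta)
    qed (use that m in auto)
    thus ?thesis using m by (simp add: g_def)
   qed
   hence "(\<Sum>K' | matching K K'. numer a b K K' x * g K') = 0" by (intro numer_sum_zero ab(2) x)
   moreover have "(\<Sum>K' | matching K K'. numer a b K K' x * g K') = \<Phi> x"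
    unfolding \<Phi>_def by (intro sum.cong) (auto simp: g_def)
   ultimately show ?thesis by simp
  qed
  have zero: "\<Phi> x = 0" if x: "x$$a - x$$b \<in> \<Lambda>" for x
  proof -
   \<comment> \<open>Moves the coordinate a alone, by the lattice vector that brings x onto z_a =
     z_b itself. Gluing gives information only there, while the division requires vanishing on all
     translates.\<close>
   define \<gamma> :: "'n pt" where "\<gamma> = ((\<chi> c. if c = a then x$$a - x$$b else 0), 0, 0)"
   have \<gamma>: "\<gamma> \<in> lattice \<tau>" using x by (auto simp: \<gamma>_def lattice_def lattice1_0)
   obtain E where E: "continuous_on UNIV E" "GEN x. F (x + \<gamma>) = E x * F x"
    using quasi[OF \<gamma>] unfolding F_def by blast
   obtain \<kappa>1 where k1: "holo \<kappa>1" "\<And>x. fprod polar_forms (x + \<gamma>) = \<kappa>1 x * fprod polar_forms x" using fprod_translate[OF \<gamma>] by blast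
   obtain \<kappa>2 where k2: "holo \<kappa>2" "\<And>x. fprod (other_diffs a b) (x + \<gamma>) = \<kappa>2 x * fprod (other_diffs a b) x" using fprod_translate[OF \<gamma>] by blast
   obtain s c where sc: "\<And>z. th (z + (x$$a - x$$b)) = s * exp (c * z) * th z" using theta_add_lattice[OF x] by blast
   define \<kappa> where "\<kappa> y = \<kappa>1 y * (\<kappa>2 y)\<^sup>2 * (s * exp (c * (y$$a - y$$b)))" for y
   have tr: "core a b (y + \<gamma>) = \<kappa> y * core a b y" for y
   proof -
    have "fst (y + \<gamma>)$a - fst (y + \<gamma>)$b = (y$$a - y$$b) + (x$$a - x$$b)"
     using ab(2) by (simp add: \<gamma>_def)
    hence "th (fst (y + \<gamma>)$a - fst (y + \<gamma>)$b) = s * exp (c * (y$$a - y$$b)) * th (y$$a - y$$b)" using sc by (simp only:)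
    thus ?thesis by (simp add: core_def \<kappa>_def k1 k2 power_mult_distrib mult_ac)
   qed
   have kc: "continuous_on UNIV \<kappa>" unfolding \<kappa>_def
    using holo_continuous[OF k1(1)] holo_continuous[OF k2(1)] by (intro continuous_intros)
   have "GEN y. \<Phi> (y + \<gamma>) = \<kappa> y * E y * \<Phi> y"
    using \<Phi> generic_translate[OF \<Phi>, of \<gamma>] E(2)
   proof eventually_elim
    case (elim y)
    show ?case unfolding elim(1)[symmetric] elim(2)[symmetric] elim(3) tr by (simp add: mult_ac)
   qed
   hence "\<Phi> ((x - \<gamma>) + \<gamma>) = \<kappa> (x - \<gamma>) * E (x - \<gamma>) * \<Phi> (x - \<gamma>)"
   proof (rule generic_eq_imp_eq)
    show "continuous_on UNIV (%y. \<Phi> (y + \<gamma>))"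
     by (rule continuous_on_compose2[OF holo_continuous[OF h]]) (auto intro!: continuous_on_add continuous_on_id continuous_on_const)
    show "continuous_on UNIV (%y. \<kappa> y * E y * \<Phi> y)" by (intro continuous_on_mult kc E(1) holo_continuous[OF h])
   qed
   moreover have "\<Phi> (x - \<gamma>) = 0" by (rule zero0) (use ab(2) in \<open>simp add: \<gamma>_def\<close>)
   ultimately show ?thesis by simp
  qed
  have v0: "fst (((\<chi> c. if c = a then 1 else 0), 0, 0) :: 'n pt)$a - fst (((\<chi> c. if c = a then 1 else 0), 0, 0) :: 'n pt)$b \<noteq> 0"
   using ab(2) by simp
  obtain G where G: "holo G" "\<And>x. \<Phi> x = th (x$$a - x$$b) * G x"
   by (rule holo_theta_divides[OF difference_affine v0 h]) (use zero in auto)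
  have "ext (%x. fprod (polar_forms + (other_diffs a b + other_diffs a b)) x * F x)"
  proof (rule ext_cong[OF ext_holo[OF G(1)]])
   show "GEN x. G x = fprod (polar_forms + (other_diffs a b + other_diffs a b)) x * F x"
    using \<Phi> regular_generic
   proof eventually_elim
    case (elim x)
    have "th (x$$a - x$$b) \<noteq> 0" by (rule regularD(1)[OF elim(2) ab(2)])
    moreover have "th (x$$a - x$$b) * G x = th (x$$a - x$$b) * (fprod (polar_forms + (other_diffs a b + other_diffs a b)) x * F x)"
     unfolding G(2)[symmetric] elim(1)[symmetric] by (simp add: core_def power2_eq_square mult_ac)
    ultimately show ?case by simp
   qed
  qed
  hence "poles (polar_forms + (other_diffs a b + other_diffs a b)) F" by (simp add: poles_def)
  moreover have "p \<notin># other_diffs a b + other_diffs a b" by (auto simp: ab other_diffs_def)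
  moreover have "\<forall>q\<in>#other_diffs a b + other_diffs a b. valid_form q" using valid_other_diffs by auto
  ultimately show ?thesis unfolding F_def by blast
 qed
qed

text \<open>
 The difference of the two components is \<open>\<Sum> numer \<cdot> t / \<theta>(z\<^sub>a - z\<^sub>b)\<close> with \<open>t\<close> vanishing on \<open>z\<^sub>a = z\<^sub>b\<close>; its
 value there is the sum over the transversal derivatives of \<open>t\<close>, which are symmetric.
\<close>

lemma image_glue:
 fixes S :: "'n set => 'n pt => complex"
 assumes S: "\<And>K'. matching K K' ==> holo (S K')"
  and glue: "\<And>I J u. matching K I ==> matching K J ==> u \<in> inter_lift {I, J} ==> S I u = S J u"
  and ab: "a \<in> K" "b \<notin> K"
  and \<Psi>: "holo \<Psi>" "GEN x. fprod polar_forms x * act \<nu> S K x = \<Psi> x"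
  and \<Psi>': "holo \<Psi>'" "GEN x. fprod polar_forms x * (\<Sum>K' | matching (swap a b ` K) K'. M (swap a b ` K) K' x * S K' (shift \<nu> x)) = \<Psi>' x"
  and x0: "x0$$a = x0$$b"
 shows "\<Psi>' x0 = \<Psi> x0"
proof -
 have ne: "a \<noteq> b" using ab by auto
 define \<sigma> where "\<sigma> = swap a b"
 have bij: "bij \<sigma>" and inv: "\<sigma> (\<sigma> c) = c" for c by (simp_all add: \<sigma>_def)
 have ss: "\<sigma> ` \<sigma> ` A = A" for A by (simp add: image_comp inv comp_def)
 have m: "matching (\<sigma> ` K) K' \<longleftrightarrow> matching K K'" "matching K (\<sigma> ` K') \<longleftrightarrow> matching K K'" for K'
  by (simp_all add: matching_def \<sigma>_def card_image inj_on_subset[OF inj_transpose])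
 have pp: "perm \<sigma> (perm \<sigma> x) = x" for x
 proof -
  have "\<sigma> \<circ> \<sigma> = id" by (auto simp: inv)
  thus ?thesis using perm_perm[OF bij bij, of x] by simp
 qed
 \<comment> \<open>The failure of the section to be invariant under the swap; the symmetry of M
   turns the difference of the two images into a sum over these.\<close>
 define t where "t K' x = S (\<sigma> ` K') (shift \<nu> (perm \<sigma> x)) - S K' (shift \<nu> x)" for K' x
 define \<Delta> where "\<Delta> x = \<Psi>' (perm \<sigma> x) - \<Psi> x" for x
 have th: "holo (t K')" if "matching K K'" for K'
 proof -
  have "holo (%x. S (\<sigma> ` K') (shift \<nu> (perm \<sigma> x)))"
   by (rule holo_perm[OF holo_shift]) (use S m that in blast)
  moreover have "holo (%x. S K' (shift \<nu> x))" by (rule holo_shift) (use S that in blast)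
  ultimately show ?thesis unfolding t_def by (rule holo_diff)
 qed
 have \<Delta>h: "holo \<Delta>" unfolding \<Delta>_def by (intro holo_diff holo_perm \<Psi>'(1) \<Psi>(1))
 let ?H = "%x. (fprod (other_diffs a b) x)\<^sup>2"
 have key: "?H x * th (x$$a - x$$b) * \<Delta> x = (\<Sum>K' | matching K K'. numer a b K K' x * t K' x)" for x
 proof (rule holo_generic_eq)
  have "GEN x. \<forall>K'\<in>{K'. matching K K'}. core a b x * M K K' x = numer a b K K' x"
   using numer(2)[OF _ ne] by (intro eventually_ball_finite) auto
  moreover have "GEN x. \<forall>K'\<in>{K'. matching K K'}. M (\<sigma> ` K) (\<sigma> ` K') (perm \<sigma> x) = M K K' x"
   using M_perm[OF bij] unfolding matching_def by (intro eventually_ball_finite) auto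
  ultimately show "GEN x. ?H x * th (x$$a - x$$b) * \<Delta> x = (\<Sum>K' | matching K K'. numer a b K K' x * t K' x)"
   using \<Psi>(2) generic_perm[OF \<Psi>'(2) bij]
  proof eventually_elim
   case (elim x)
   have "(\<Sum>K' | matching (\<sigma> ` K) K'. M (\<sigma> ` K) K' (perm \<sigma> x) * S K' (shift \<nu> (perm \<sigma> x)))
    = (\<Sum>K' | matching K K'. M (\<sigma> ` K) (\<sigma> ` K') (perm \<sigma> x) * S (\<sigma> ` K') (shift \<nu> (perm \<sigma> x)))"
    by (rule sum.reindex_bij_witness[of _ "%A. \<sigma> ` A" "%A. \<sigma> ` A"]) (use ss m in auto)
   also have "\<dots> = (\<Sum>K' | matching K K'. M K K' x * S (\<sigma> ` K') (shift \<nu> (perm \<sigma> x)))"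
    by (intro sum.cong refl) (use elim(2) in simp)
   finally have "\<Psi>' (perm \<sigma> x) = fprod polar_forms x * (\<Sum>K' | matching K K'. M K K' x * S (\<sigma> ` K') (shift \<nu> (perm \<sigma> x)))"
    using elim(4) unfolding \<sigma>_def[symmetric] fprod_polar_perm[OF bij] by simp
   hence "\<Delta> x = fprod polar_forms x * (\<Sum>K' | matching K K'. M K K' x * t K' x)"
    unfolding \<Delta>_def elim(3)[symmetric] t_def by (simp add: right_diff_distrib sum_subtractf)
   hence "?H x * th (x$$a - x$$b) * \<Delta> x = (\<Sum>K' | matching K K'. (core a b x * M K K' x) * t K' x)"
    by (simp add: core_def sum_distrib_left mult_ac)
   also have "\<dots> = (\<Sum>K' | matching K K'. numer a b K K' x * t K' x)"
    by (intro sum.cong refl) (use elim(1) in simp)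
   finally show ?case .
  qed
  show "holo (%x. ?H x * th (x$$a - x$$b) * \<Delta> x)" by (intro holo_intros \<Delta>h)
  show "holo (%x. \<Sum>K' | matching K K'. numer a b K K' x * t K' x)" by (intro holo_sum holo_mult numer th ne) auto
 qed
 have z: "fprod (other_diffs a b) x * \<Delta> x = 0" if x: "x \<in> {x. x$$a = x$$b}" for x
 proof -
  \<comment> \<open>The direction on which the swap acts as - 1, so that along this line the swap is
    c -> - c and z_a - z_b = 2 c.\<close>
  define v :: "'n pt" where "v = ((\<chi> c. if c = a then 1 else if c = b then - 1 else 0), 0, 0)"
  define l where "l c = x + cscale c v" for c
  have px: "perm \<sigma> x = x" unfolding \<sigma>_def using x by (intro perm_swap_fixed) simp
  have pv: "perm \<sigma> v = - v"
   using ne by (auto simp: v_def \<sigma>_def perm_swap vec_eq_iff Transposition.transpose_def)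
  have pl: "perm \<sigma> (l c) = l (- c)" for c
   unfolding l_def perm_linear(1,3) px pv by (simp add: cscale_def case_prod_beta vec_eq_iff)
  have dl: "fst (l c)$a - fst (l c)$b = 2 * c" for c
   using x ne by (simp add: l_def v_def cscale_def)
  have l0: "l 0 = x" by (simp add: l_def cscale_def case_prod_beta zero_prod_def[symmetric])
  have hl: "(%c. f (l c)) field_differentiable (at c0)" if "holo f" for f c0
   using holo_line[OF that, of x v] unfolding l_def holomorphic_on_def by auto
  define \<phi> where "\<phi> c = ?H (l c) * \<Delta> (l c)" for c
  have "holo (%x. ?H x * \<Delta> x)" by (intro holo_intros \<Delta>h)
  from hl[OF this] obtain \<phi>' where \<phi>': "(\<phi> has_field_derivative \<phi>') (at 0)" unfolding \<phi>_def field_differentiable_def by blast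
  have "((%c. th (2 * c)) has_field_derivative 1 * 2) (at 0)"
   by (rule DERIV_chain2[of th]) (use theta_deriv_0 in \<open>auto intro!: derivative_eq_intros\<close>)
  from DERIV_mult[OF this \<phi>'] have L: "((%c. th (2 * c) * \<phi> c) has_field_derivative 2 * \<phi> 0) (at 0)"
   by (simp add: theta_0)
  define T where "T K' c = t K' (l c)" for K' c
  define d where "d K' = deriv (T K') 0" for K'
  have T0: "T K' 0 = 0" if "matching K K'" for K'
  proof -
   have "shift \<nu> x \<in> inter_lift {\<sigma> ` K', K'}"
   proof -
    have "image_mset (%c. x$$c) (mset_set (\<sigma> ` K')) = image_mset (%c. x$$c) (image_mset \<sigma> (mset_set K'))"
     unfolding \<sigma>_def by (subst image_mset_mset_set) (auto intro: inj_on_subset[OF inj_transpose])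
    also have "\<dots> = image_mset (%c. x$$c) (mset_set K')"
     unfolding multiset.map_comp using x by (intro image_mset_cong) (auto simp: \<sigma>_def Transposition.transpose_def)
    finally show ?thesis by (auto simp: inter_lift_def shift_def case_prod_beta)
   qed
   hence "S (\<sigma> ` K') (shift \<nu> x) = S K' (shift \<nu> x)" using glue m that by blast
   thus ?thesis by (simp add: T_def l0 t_def px)
  qed
  have Td: "(T K' has_field_derivative d K') (at 0)" if "matching K K'" for K'
   unfolding d_def T_def using hl[OF th[OF that], of 0] by (simp add: field_differentiable_derivI)
  have R: "((%c. \<Sum>K' | matching K K'. numer a b K K' (l c) * T K' c) has_field_derivative (\<Sum>K' | matching K K'. numer a b K K' x * d K')) (at 0)"
  proof (rule DERIV_sum)
   fix K' assume "K' \<in> {K'. matching K K'}"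
   hence mK: "matching K K'" by simp
   obtain n' where n': "((%c. numer a b K K' (l c)) has_field_derivative n') (at 0)"
    using hl[OF numer(1)[OF mK ne], of 0] unfolding field_differentiable_def by blast
   from DERIV_mult[OF n' Td[OF mK]] show "((%c. numer a b K K' (l c) * T K' c) has_field_derivative numer a b K K' x * d K') (at 0)"
    by (simp add: T0[OF mK] l0 mult.commute)
  qed
  have "(%c. th (2 * c) * \<phi> c) = (%c. \<Sum>K' | matching K K'. numer a b K K' (l c) * T K' c)"
   unfolding T_def key[symmetric] dl \<phi>_def by (simp add: mult_ac fun_eq_iff)
  hence e: "2 * \<phi> 0 = (\<Sum>K' | matching K K'. numer a b K K' x * d K')" using DERIV_unique[OF L] R by simp
  \<comment> \<open>The swap changes the sign of t and reverses the line; the two signs cancel in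
    the first derivative.\<close>
  have dsym: "d (\<sigma> ` K') = d K'" if mK: "matching K K'" for K'
  proof -
   have "T (\<sigma> ` K') c = - T K' (- c)" for c
    unfolding T_def t_def ss pl by simp
   hence f: "T (\<sigma> ` K') = (%c. - T K' (- c))" by blast
   have "((%c. T K' (- c)) has_field_derivative d K' * - 1) (at 0)"
    by (rule DERIV_chain2[of "T K'"]) (use Td[OF mK] in \<open>auto intro!: derivative_eq_intros\<close>)
   from DERIV_minus[OF this] have "(T (\<sigma> ` K') has_field_derivative d K') (at 0)" unfolding f by simp
   thus ?thesis using Td m mK DERIV_unique by blast
  qed
  define g where "g K' = (if matching K K' then d K' else 0)" for K'
  have "g (swap a b ` K') = g K'" for K' using dsym[of K'] m(2)[of K'] unfolding g_def \<sigma>_def by simp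
  hence "(\<Sum>K' | matching K K'. numer a b K K' x * g K') = 0" using x by (intro numer_sum_zero ne) auto
  moreover have "(\<Sum>K' | matching K K'. numer a b K K' x * g K') = (\<Sum>K' | matching K K'. numer a b K K' x * d K')"
   by (intro sum.cong) (auto simp: g_def)
  ultimately have "\<phi> 0 = 0" using e by simp
  thus ?thesis by (auto simp: \<phi>_def l0)
 qed
 have "gen_on {x :: 'n pt. x$$a = x$$b} (fprod (other_diffs a b))"
  by (rule gen_on_coincident[OF ne]) (auto simp: other_diffs_def two_sets_def)
 from gen_on_zero[OF this holo_continuous[OF \<Delta>h] z] x0 have "\<Delta> x0 = 0" by simp
 thus ?thesis unfolding \<Delta>_def \<sigma>_def using perm_swap_fixed[OF x0] by simp
qed

end

section \<open>Sections\<close>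

lemma open_holo_nonzero:
 assumes "open U" "holo_on f U" shows "open {u \<in> U. f u \<noteq> 0}"
proof -
 have "continuous_on U f"
  using assms(2) unfolding holo_on_def by (meson has_derivative_continuous continuous_at_imp_continuous_on)
 from continuous_open_preimage[OF this assms(1), of "- {0}"] have "open (U \<inter> f -` (- {0}))" by blast
 moreover have "U \<inter> f -` (- {0}) = {u \<in> U. f u \<noteq> 0}" by blast
 ultimately show ?thesis by simp
qed

lemma quot_on_holo_eq:
 assumes q: "quot_on Z U f g h" and S: "holo S" "GEN x. f x = S x" and u: "u \<in> U"
 shows "h u * S u = g u"
proof (rule ccontr)
 assume "h u * S u \<noteq> g u"
 obtain A where A: "open A" "U \<subseteq> closure A" "\<forall>u\<in>A \<inter> U. h u * f u = g u" and U: "open U" and gh: "holo_on g U" "holo_on h U"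
  using q unfolding quot_on_def by blast
 obtain B where B: "open B" "closure B = UNIV" "\<forall>u\<in>B. f u = S u" using S(2) unfolding eventually_generic by blast
 let ?V = "{u \<in> U. h u * S u - g u \<noteq> 0}"
 have V: "open ?V" by (intro open_holo_nonzero U holo_intros gh holo_on_subset[OF S(1)]) simp
 have "u \<in> ?V" using u \<open>h u * S u \<noteq> g u\<close> by simp
 hence "?V \<inter> closure A \<noteq> {}" using A(2) u by blast
 hence "?V \<inter> A \<noteq> {}" using open_Int_closure_eq_empty[OF V] by blast
 moreover have "open (?V \<inter> A)" using V A(1) by blast
 ultimately have "(?V \<inter> A) \<inter> B \<noteq> {}" using B(2) unfolding dense_iff by blast
 then obtain v where "v \<in> A \<inter> U" "v \<in> B" "h v * S v - g v \<noteq> 0" by blast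
 moreover from this have "h v * f v = g v" "f v = S v" using A(3) B(3) by blast+
 ultimately show False by simp
qed

text \<open>The gluing condition is an identity of fractions. Neither denominator vanishes on an
  open part of Z, so both can be cancelled at points of Z arbitrarily near x, and continuity yields
  equality at x.\<close>

lemma quot_on_glue:
 assumes q: "quot_on Z U f g h" "quot_on Z U f' g' h'" and x: "x \<in> Z \<inter> U"
  and S: "holo S" "GEN x. f x = S x" "holo S'" "GEN x. f' x = S' x"
  and e: "\<forall>u\<in>Z \<inter> U. g u * h' u = g' u * h u"
 shows "S x = S' x"
proof (rule ccontr)
 assume ne: "S x \<noteq> S' x"
 have U: "open U" and h: "holo_on h U" "Z \<inter> U \<subseteq> closure {u \<in> Z \<inter> U. h u \<noteq> 0}" "Z \<inter> U \<subseteq> closure {u \<in> Z \<inter> U. h' u \<noteq> 0}"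
  using q unfolding quot_on_def by blast+
 let ?W = "{u \<in> U. S u - S' u \<noteq> 0}"
 have W: "open ?W" by (intro open_holo_nonzero U holo_intros holo_on_subset[OF S(1)] holo_on_subset[OF S(3)]) simp_all
 have "x \<in> ?W" using x ne by simp
 hence "?W \<inter> closure {u \<in> Z \<inter> U. h u \<noteq> 0} \<noteq> {}" using h(2) x by blast
 hence "?W \<inter> {u \<in> Z \<inter> U. h u \<noteq> 0} \<noteq> {}" using open_Int_closure_eq_empty[OF W] by blast
 then obtain u where u: "u \<in> Z \<inter> U" "u \<in> ?W" "h u \<noteq> 0" by blast
 let ?X = "?W \<inter> {u \<in> U. h u \<noteq> 0}"
 have X: "open ?X" using W open_holo_nonzero[OF U h(1)] by blast
 have "u \<in> ?X" using u by blast
 hence "?X \<inter> closure {u \<in> Z \<inter> U. h' u \<noteq> 0} \<noteq> {}" using h(3) u(1) by blast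
 hence "?X \<inter> {u \<in> Z \<inter> U. h' u \<noteq> 0} \<noteq> {}" using open_Int_closure_eq_empty[OF X] by blast
 then obtain v where v: "v \<in> Z \<inter> U" "S v \<noteq> S' v" "h v \<noteq> 0" "h' v \<noteq> 0" by auto
 have "h v * S v = g v" "h' v * S' v = g' v"
  using quot_on_holo_eq[OF q(1) S(1,2)] quot_on_holo_eq[OF q(2) S(3,4)] v(1) by blast+
 hence "h v * S v * h' v = h' v * S' v * h v" using e v(1) by simp
 thus False using v by simp
qed

text \<open>Without poles every component has a global holomorphic representative, and for these the
  gluing condition becomes equality of values.\<close>

lemma H_T_holomorphic:
 assumes s: "s \<in> H_T \<tau> k e {}"
 obtains S where "\<And>K. card K = k ==> holo (S K)" "\<And>K. card K = k ==> (GEN x. s K x = S K x)"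
  "\<And>I J u. card I = k ==> card J = k ==> u \<in> inter_lift {I, J} ==> S I u = S J u"
proof -
 have "\<exists>G. holo G \<and> (GEN x. s K x = G x)" if K: "card K = k" for K
 proof (rule holo_patch[of "s K"])
  fix x
  have "poles_bounded \<tau> {} (s K)" using s K unfolding H_T_def by blast
  then obtain U g where "x \<in> U" "quot_on UNIV U (s K) g (local_eqn \<tau> {} x)" unfolding poles_bounded_def by blast
  moreover have "local_eqn \<tau> {} x = (%u. 1)" by (simp add: local_eqn_def fun_eq_iff)
  ultimately have "x \<in> U" "open U" "holo_on g U" "\<exists>A. open A \<and> U \<subseteq> closure A \<and> (\<forall>u\<in>A \<inter> U. s K u = g u)"
   unfolding quot_on_def by simp_all
  thus "\<exists>U g A. x \<in> U \<and> open U \<and> holo_on g U \<and> open A \<and> U \<subseteq> closure A \<and> (\<forall>u\<in>A \<inter> U. s K u = g u)" by blast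
 qed blast
 hence "\<exists>S. \<forall>K. card K = k \<longrightarrow> holo (S K) \<and> (GEN x. s K x = S K x)"
  by (intro choice) blast
 then obtain S where S: "\<And>K. card K = k ==> holo (S K)" "\<And>K. card K = k ==> (GEN x. s K x = S K x)"
  by blast
 moreover have "S I u = S J u" if IJ: "card I = k" "card J = k" "u \<in> inter_lift {I, J}" for I J u
 proof -
  have "mero_sect \<tau> k e s" using s unfolding H_T_def by blast
  from this[unfolded mero_sect_def, THEN conjunct2, THEN conjunct2, rule_format, OF conjI[OF IJ(1,2)] IJ(3)]
  obtain U g h g' h' where q: "u \<in> U" "quot_on (inter_lift {I, J}) U (s I) g h" "quot_on (inter_lift {I, J}) U (s J) g' h'"
   "\<forall>u\<in>inter_lift {I, J} \<inter> U. g u * h' u = g' u * h u" by blast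
  show ?thesis by (rule quot_on_glue[OF q(2,3) _ S[OF IJ(1)] S[OF IJ(2)] q(4)]) (use q(1) IJ(3) in blast)
 qed
 ultimately show ?thesis using that by blast
qed

lemma holo_twist: "holo (twist \<tau> K \<gamma>)"
proof -
 have t: "holo (%x. twist_form K (b + x))" for b
 proof (rule holo_compose[where T' = "%x. x"])
  show "holo (twist_form K)" unfolding twist_form_def case_prod_beta by (intro holo_intros)
 qed (auto simp: add.assoc intro!: linearI)
 have p: "polar (twist_form K) b = (%x. 1 / 2 * (twist_form K (b + x) - twist_form K b - twist_form K (0 + x)))" for b
  by (rule ext) (simp only: polar_def add_0 divide_inverse mult.commute mult_1)
 have "holo (polar (twist_form K) b)" for b unfolding p by (intro holo_intros t)
 hence "holo (%x. c - 2 * pi * \<i> * polar (twist_form K) b x - d)" for b c d by (intro holo_intros)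
 thus ?thesis unfolding twist_def form_bundle_def Let_def
  by (rule holo_compose_1[where V = UNIV]) (auto intro!: holomorphic_intros)
qed

lemma twist_nonzero [simp]: "twist \<tau> K \<gamma> x \<noteq> 0"
 by (simp add: twist_def form_bundle_def Let_def)

lemma inter_lift_fst: "fst x = fst x' ==> x \<in> inter_lift F \<longleftrightarrow> x' \<in> inter_lift F"
 by (cases x; cases x') (simp add: inter_lift_def)

lemma gen_on_open: "gen_on UNIV q ==> open U ==> U \<subseteq> closure {u \<in> U. q u \<noteq> 0}"
 unfolding gen_on_def[symmetric] gen_on_iff by (metis IntE IntI UNIV_I open_Int)

lemma (in modulus) lattice_shift: "\<gamma> \<in> lattice \<tau> ==> shift \<nu> \<gamma> \<in> lattice \<tau>"
 by (auto simp: lattice_def shift_def intro!: lattice1_add lattice1_of_int_mult)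

context spectral
begin

text \<open>\<open>pole_divisor\<close> is a set of functions, so a product over it is a product
  over forms only if distinct forms are distinct functions.\<close>

lemma ev_inj:
 assumes "valid_form p" "valid_form p'" "ev w p = ev w p'" shows "p = p'"
proof (rule ccontr)
 assume "p \<noteq> p'"
 then obtain v where v: "ev 0 p v = 0" "ev 0 p' v \<noteq> 0" using ev_not_parallel assms by blast
 have "ev w p (0 + cscale 1 v) = ev w p' (0 + cscale 1 v)" "ev w p 0 = ev w p' 0" by (simp_all only: assms(3))
 thus False using v unfolding ev_line by simp
qed

lemma pole_divisor_eq:
 "pole_divisor w = ev w ` (range Spec \<union> Dyn ` {- int CARD('n)..int CARD('n)} :: ('n::{finite,linorder}) form set)"
proof -
 have "(%(z, y, l). z$a + y - w) = ev w (Spec a)" for a :: "'n::{finite,linorder}" by (auto simp: fun_eq_iff)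
 moreover have "(%(z, y, l). l + of_int j * y) = ev w (Dyn j :: 'n::{finite,linorder} form)" for j by (auto simp: fun_eq_iff)
 ultimately show ?thesis unfolding pole_divisor_def by auto
qed

lemma polar_forms_set: "polar_forms = mset_set (range Spec \<union> (%s. Dyn (- int s)) ` {0..CARD('n)} :: ('n::{finite,linorder}) form set)"
proof -
 have "image_mset Spec (mset_set UNIV) = mset_set (range (Spec :: 'n => _))"
  by (rule image_mset_mset_set) (auto simp: inj_on_def)
 moreover have "image_mset (%s. Dyn (- int s)) (mset_set {0..CARD('n)}) = mset_set ((%s. Dyn (- int s) :: 'n form) ` {0..CARD('n)})"
  by (rule image_mset_mset_set) (auto simp: inj_on_def)
 ultimately show ?thesis unfolding polar_forms_def specs_def dyns_def by (subst mset_set_Union) auto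
qed

text \<open>The forms of D involve y or lambda, whereas the intersections of components constrain
  only z; moving y or lambda leaves D without leaving Z.\<close>

lemma gen_on_polar:
 assumes "\<And>x c y l. x \<in> Z ==> x + cscale c (0, y, l) \<in> Z"
 shows "gen_on Z (fprod polar_forms)"
proof (rule gen_on_fprod)
 fix p :: "'a form" assume "p \<in># polar_forms"
 then consider a where "p = Spec a" | s where "p = Dyn s" by (auto simp: polar_forms_set)
 thus "gen_on Z (thf p)"
 proof cases
  case 1 thus ?thesis using assms by (intro gen_on_thf[of _ "(0, 1, 0)"]) auto
 next
  case 2 thus ?thesis using assms by (intro gen_on_thf[of _ "(0, 0, 1)"]) auto
 qed
qed

lemma polar_quot_on:
 assumes Z: "\<And>x c y l. x \<in> Z ==> x + cscale c (0, y, l) \<in> Z"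
  and \<Psi>: "holo \<Psi>" "GEN x. fprod polar_forms x * f x = \<Psi> x"
 shows "quot_on Z UNIV f \<Psi> (fprod polar_forms)"
proof -
 have "gen_on UNIV (fprod (polar_forms :: 'a form multiset))" by (rule gen_on_polar) simp
 moreover have "gen_on Z (fprod polar_forms)" by (rule gen_on_polar[OF Z])
 moreover obtain A where "open A" "closure A = UNIV" "\<forall>x\<in>A. fprod polar_forms x * f x = \<Psi> x"
  using \<Psi>(2) unfolding eventually_generic by blast
 ultimately show ?thesis unfolding quot_on_def gen_on_def Int_UNIV_right
  using \<Psi>(1) fprod_holo[of polar_forms UNIV] by blast
qed

text \<open>Near x, theta of a form of D is the local equation times a unit if the hypersurface
  passes through x, and a unit otherwise. So \<open>fprod polar_forms\<close> divides the local
  equation of D up to a unit.\<close>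

lemma poles_bounded_polar:
 fixes f :: "('n::{finite,linorder}) pt => complex"
 assumes \<Psi>: "holo \<Psi>" "GEN x. fprod polar_forms x * f x = \<Psi> x"
 shows "poles_bounded \<tau> (pole_divisor w) f"
 unfolding poles_bounded_def
proof
 fix x :: "'n pt"
 define P :: "'n form set" where "P = range Spec \<union> (%s. Dyn (- int s)) ` {0..CARD('n)}"
 define R :: "'n form set" where "R = range Spec \<union> Dyn ` {- int CARD('n)..int CARD('n)}"
 have PR: "P \<subseteq> R" "finite R" unfolding P_def R_def by auto
 have valid: "valid_form p" if "p \<in> R" for p using that by (auto simp: R_def)
 let ?L = "{p. ev w p x \<in> \<Lambda>}"
 have prod: "(\<Prod>q\<in>{q \<in> pole_divisor w. q x \<in> \<Lambda>}. q u - q x) = (\<Prod>p\<in>R \<inter> ?L. ev w p u - ev w p x)" for u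
 proof -
  have "{q \<in> pole_divisor w. q x \<in> \<Lambda>} = ev w ` (R \<inter> ?L)" unfolding pole_divisor_eq R_def by blast
  moreover have "inj_on (ev w) (R \<inter> ?L)" using ev_inj valid by (auto intro!: inj_onI)
  ultimately show ?thesis by (simp only: prod.reindex comp_def)
 qed
 have le: "local_eqn \<tau> (pole_divisor w) x = (%u. \<Prod>p\<in>R \<inter> ?L. ev w p u - ev w p x)"
  unfolding local_eqn_def prod ..
 have "\<forall>p. \<exists>\<eta>. \<eta> holomorphic_on UNIV \<and> (p \<in> ?L \<longrightarrow> (\<forall>z. th z = (z - ev w p x) * \<eta> z) \<and> \<eta> (ev w p x) \<noteq> 0)" for p :: "'n form"
  using theta_factor theta_entire by (metis mem_Collect_eq)
 then obtain \<eta> where \<eta>: "\<And>p :: 'n form. \<eta> p holomorphic_on UNIV" "\<And>p z. p \<in> ?L ==> th z = (z - ev w p x) * \<eta> p z"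
  "\<And>p. p \<in> ?L ==> \<eta> p (ev w p x) \<noteq> 0" by metis
 \<comment> \<open>The unit: the cofactors of the hypersurfaces through x, and the thetas of those
   that miss x.\<close>
 define V where "V u = (\<Prod>p\<in>P \<inter> ?L. \<eta> p (ev w p u)) * (\<Prod>p\<in>P - ?L. thf p u)" for u
 \<comment> \<open>The components of D through x that are not among \<open>polar_forms\<close>,
   namely some lambda + j y with j > 0; they are multiplied into the numerator.\<close>
 define X where "X u = (\<Prod>p\<in>(R - P) \<inter> ?L. ev w p u - ev w p x)" for u
 have fin: "finite P" using PR finite_subset by blast
 have \<eta>h: "holo (%u. \<eta> p (ev w p u))" for p
  by (rule holo_compose_1[where g = "\<eta> p" and V = UNIV]) (auto intro!: \<eta>(1) holo_intros)
 have Vh: "holo V" unfolding V_def by (intro holo_intros \<eta>h)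
 have Xh: "holo X" unfolding X_def by (intro holo_intros)
 have Vx: "V x \<noteq> 0" unfolding V_def using fin \<eta>(3) by (auto simp: theta_eq_0_iff)
 have fp: "fprod polar_forms u = (\<Prod>p\<in>P \<inter> ?L. ev w p u - ev w p x) * V u" for u
 proof -
  have "fprod polar_forms u = (\<Prod>p\<in>P. thf p u)"
   unfolding fprod_def polar_forms_set P_def[symmetric] by (simp only: prod_unfold_prod_mset)
  also have "\<dots> = (\<Prod>p\<in>P \<inter> ?L. thf p u) * (\<Prod>p\<in>P - ?L. thf p u)" by (rule prod.Int_Diff[OF fin])
  also have "(\<Prod>p\<in>P \<inter> ?L. thf p u) = (\<Prod>p\<in>P \<inter> ?L. (ev w p u - ev w p x) * \<eta> p (ev w p u))"
   by (rule prod.cong) (use \<eta>(2) in auto)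
  finally show ?thesis by (simp add: V_def prod.distrib mult_ac)
 qed
 have split: "(\<Prod>p\<in>R \<inter> ?L. ev w p u - ev w p x) = X u * (\<Prod>p\<in>P \<inter> ?L. ev w p u - ev w p x)" for u
 proof -
  have "R \<inter> ?L = ((R - P) \<inter> ?L) \<union> (P \<inter> ?L)" using PR by blast
  thus ?thesis unfolding X_def using PR fin by (subst prod.union_disjoint[symmetric]) auto
 qed
 define U where "U = {u \<in> UNIV. V u \<noteq> 0}"
 have U: "open U" unfolding U_def by (rule open_holo_nonzero[OF open_UNIV Vh])
 have gen: "gen_on UNIV (%u. \<Prod>p\<in>Q. ev w p u - ev w p x)" if "finite Q" "Q \<subseteq> R" for Q
  using that
 proof (induction Q)
  case (insert p Q)
  have "gen_on UNIV (%u. ev w p u - ev w p x)"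
  proof (rule gen_on_line)
   fix u :: "'n pt"
   obtain v where v: "ev 0 p v \<noteq> 0" using ev_direction valid insert.prems by blast
   define c where "c = (if ev w p u = ev w p x then 1 else 0 :: complex)"
   have "ev w p (u + cscale c v) \<noteq> ev w p x" unfolding ev_line c_def using v by auto
   thus "\<exists>v. (\<forall>c. u + cscale c v \<in> UNIV) \<and> ev w p (u + v) - ev w p x \<noteq> 0" by (intro exI[of _ "cscale c v"]) simp
  qed (intro holo_intros)
  hence "gen_on UNIV (%u. (ev w p u - ev w p x) * (\<Prod>p\<in>Q. ev w p u - ev w p x))"
   using insert by (intro gen_on_mult holo_continuous holo_intros) auto
  thus ?case using insert by simp
 qed simp
 have dense: "U \<subseteq> closure {u \<in> U. local_eqn \<tau> (pole_divisor w) x u \<noteq> 0}"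
  unfolding le using PR by (intro gen_on_open gen U) auto
 have "holo_on (%u. X u * \<Psi> u * inverse (V u)) U"
  by (intro holo_intros holo_on_subset[OF Xh] holo_on_subset[OF \<Psi>(1)] holo_compose_1[where g = inverse and V = "- {0}"] holo_on_subset[OF Vh])
   (auto simp: U_def intro!: holomorphic_intros)
 moreover have "holo_on (local_eqn \<tau> (pole_divisor w) x) U" unfolding le by (intro holo_intros)
 moreover obtain A where A: "open A" "closure A = UNIV" "\<forall>x\<in>A. fprod polar_forms x * f x = \<Psi> x"
  using \<Psi>(2) unfolding eventually_generic by blast
 have "local_eqn \<tau> (pole_divisor w) x u * f u = X u * \<Psi> u * inverse (V u)" if "u \<in> A \<inter> U" for u
 proof -
  have "\<Psi> u = (\<Prod>p\<in>P \<inter> ?L. ev w p u - ev w p x) * V u * f u" using A(3) that fp by auto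
  moreover have "V u \<noteq> 0" using that by (simp add: U_def)
  ultimately show ?thesis unfolding le split by simp
 qed
 ultimately have "quot_on UNIV U f (%u. X u * \<Psi> u * inverse (V u)) (local_eqn \<tau> (pole_divisor w) x)"
  unfolding quot_on_def Int_UNIV_left using A(1,2) dense U by blast
 moreover have "x \<in> U" using Vx by (simp add: U_def)
 ultimately show "\<exists>U g. x \<in> U \<and> quot_on UNIV U f g (local_eqn \<tau> (pole_divisor w) x)" by blast
qed

end

lemma H_T_mero: "s \<in> H_T \<tau> k e D ==> card K = k ==> mero_section \<tau> (tensor e (twist \<tau> K)) (s K)"
 by (simp add: H_T_def mero_sect_def)

section \<open>Automorphy, gluing and equivariance of the image\<close>

context quantum_entry
begin

abbreviation applied :: "('n set => 'n pt => complex) => 'n set => 'n pt => complex" where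
 "applied s K x \<equiv> (\<Sum>K' | matching K K'. M K K' x * s K' (shift (eps j) x))"

lemma diff_op_eq: "diff_op (2 * (int i - int j)) (eps j) M s K x = applied s K x"
 unfolding diff_op_def matching_def by simp

text \<open>The multiplier of M K K' contains the inverse of the shifted twist of K', which cancels
  against the twist in the multiplier of s K'. So all terms of the sum have the same
  multiplier.\<close>

lemma image_automorphy:
 assumes adm: "admissible_op \<tau> L (2 * (int i - int j)) (eps j) M"
  and k: "int (card K) = int k + (int i - int j)" and \<gamma>: "\<gamma> \<in> lattice \<tau>"
  and s: "\<And>K'. card K' = k ==> mero_section \<tau> (tensor e (twist \<tau> K')) (s K')"
 shows "GEN x. applied s K (x + \<gamma>) = tensor (tensor (pull (eps j) e) (L k)) (twist \<tau> K) \<gamma> x * applied s K x"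
proof -
 have "GEN x. M K K' (x + \<gamma>) * s K' (shift (eps j) (x + \<gamma>))
  = tensor (tensor (pull (eps j) e) (L k)) (twist \<tau> K) \<gamma> x * (M K K' x * s K' (shift (eps j) x))" if m: "matching K K'" for K'
 proof -
  have c: "card K' = k" using m k unfolding matching_def by simp
  have "int (card K) = int (card K') + 2 * (int i - int j) div 2" using m unfolding matching_def by simp
  hence "mero_section \<tau> (tensor (tensor (L k) (twist \<tau> K)) (dual (pull (eps j) (twist \<tau> K')))) (M K K')"
   using adm c unfolding admissible_op_def by blast
  hence "GEN x. M K K' (x + \<gamma>) = tensor (tensor (L k) (twist \<tau> K)) (dual (pull (eps j) (twist \<tau> K'))) \<gamma> x * M K K' x"
   using \<gamma> unfolding mero_section_def gen_eq_iff by blast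
  moreover have "GEN x. s K' (x + shift (eps j) \<gamma>) = tensor e (twist \<tau> K') (shift (eps j) \<gamma>) x * s K' x"
   using s[OF c] lattice_shift[OF \<gamma>] unfolding mero_section_def gen_eq_iff by blast
  from generic_shift[OF this]
  have "GEN x. s K' (shift (eps j) x + shift (eps j) \<gamma>) = tensor e (twist \<tau> K') (shift (eps j) \<gamma>) (shift (eps j) x) * s K' (shift (eps j) x)" .
  ultimately show ?thesis
  proof eventually_elim
   case (elim x)
   have "twist \<tau> K' (shift (eps j) \<gamma>) (shift (eps j) x) \<noteq> 0" by simp
   thus ?case unfolding shift_linear(1) elim tensor_def dual_def pull_def by (simp add: field_simps)
  qed
 qed
 hence "GEN x. \<forall>K'\<in>{K'. matching K K'}. M K K' (x + \<gamma>) * s K' (shift (eps j) (x + \<gamma>))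
  = tensor (tensor (pull (eps j) e) (L k)) (twist \<tau> K) \<gamma> x * (M K K' x * s K' (shift (eps j) x))"
  by (intro eventually_ball_finite) auto
 thus ?thesis by eventually_elim (simp add: sum_distrib_left)
qed

lemma image_cong_generic:
 assumes k: "int (card K) = int k + (int i - int j)"
  and S: "\<And>K'. card K' = k ==> (GEN x. s K' x = S K' x)"
 shows "GEN x. applied s K x = applied S K x"
proof -
 have "GEN x. s K' (shift (eps j) x) = S K' (shift (eps j) x)" if "matching K K'" for K'
  using that k by (intro generic_shift S) (simp add: matching_def)
 hence "GEN x. \<forall>K'\<in>{K'. matching K K'}. s K' (shift (eps j) x) = S K' (shift (eps j) x)"
  by (intro eventually_ball_finite) auto
 thus ?thesis by eventually_elim simp
qed

text \<open>The components get numerators over the single denominator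
  \<open>fprod polar_forms\<close>, so gluing them is gluing holomorphic functions. For subsets
  differing by a swap this is \<open>image_glue\<close>, and \<open>inter_lift_chain\<close> gives
  the general case.\<close>

lemma image_holomorphic:
 assumes adm: "admissible_op \<tau> L (2 * (int i - int j)) (eps j) M" and e: "line_bundle \<tau> e" "line_bundle \<tau> (L k)"
  and k: "int k' = int k + (int i - int j)" and s: "s \<in> H_T \<tau> k e {}"
 obtains \<Psi> where "\<And>K. card K = k' ==> holo (\<Psi> K)"
  "\<And>K. card K = k' ==> (GEN x. fprod polar_forms x * applied s K x = \<Psi> K x)"
  "\<And>I J x. card I = k' ==> card J = k' ==> x \<in> inter_lift {I, J} ==> \<Psi> I x = \<Psi> J x"
proof -
 obtain S where S: "\<And>K. card K = k ==> holo (S K)" "\<And>K. card K = k ==> (GEN x. s K x = S K x)"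
  "\<And>I J u. card I = k ==> card J = k ==> u \<in> inter_lift {I, J} ==> S I u = S J u"
  using H_T_holomorphic[OF s] by blast
 have cm: "card K' = k" if "matching K K'" "card K = k'" for K K' using that k unfolding matching_def by simp
 have kk: "int (card K) = int k + (int i - int j)" if "card K = k'" for K :: "'n set" using that k by simp
 have mero: "mero_section \<tau> (tensor e (twist \<tau> K')) (s K')" if "card K' = k" for K'
  using H_T_mero[OF s that] .
 have cong: "GEN x. applied s K x = applied S K x" if "card K = k'" for K
  by (rule image_cong_generic[OF kk[OF that] S(2)])
 have "poles polar_forms (applied S K)" if K: "card K = k'" for K
 proof (rule poles_image)
  fix \<gamma> :: "'n pt" assume \<gamma>: "\<gamma> \<in> lattice \<tau>"
  let ?E = "tensor (tensor (pull (eps j) e) (L k)) (twist \<tau> K) \<gamma>"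
  have "holo (e (shift (eps j) \<gamma>))" "holo (L k \<gamma>)" using e \<gamma> lattice_shift unfolding line_bundle_def by blast+
  hence "holo ?E" unfolding tensor_def pull_def by (intro holo_intros holo_shift holo_twist)
  moreover have "GEN x. applied s K (x + \<gamma>) = ?E x * applied s K x"
   by (rule image_automorphy[OF adm kk[OF K] \<gamma> mero])
  hence "GEN x. applied S K (x + \<gamma>) = ?E x * applied S K x"
   using cong[OF K] generic_translate[OF cong[OF K], of \<gamma>]
   by eventually_elim simp
  ultimately show "\<exists>E. continuous_on UNIV E \<and> (GEN x. applied S K (x + \<gamma>) = E x * applied S K x)"
   using holo_continuous by blast
 next
  show "holo (S K')" if "matching K K'" for K' using S(1) cm that K by blast
  show "S I u = S J u" if "matching K I" "matching K J" "u \<in> inter_lift {I, J}" for I J u using S(3) cm that K by blast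
 qed
 hence "\<exists>\<Psi>. \<forall>K. card K = k' \<longrightarrow> holo (\<Psi> K) \<and> (GEN x. fprod polar_forms x * applied S K x = \<Psi> K x)"
  unfolding poles_def ext_def by (intro choice) blast
 then obtain \<Psi> where \<Psi>: "\<And>K. card K = k' ==> holo (\<Psi> K)"
  "\<And>K. card K = k' ==> (GEN x. fprod polar_forms x * applied S K x = \<Psi> K x)" by blast
 have glue: "\<Psi> I x = \<Psi> J x" if I: "card I = k'" and x: "x \<in> inter_lift {I, J}" for I J x
 proof (rule inter_lift_chain[OF x, of "%K. \<Psi> K x"])
  fix K a b assume K: "card K = card I" "a \<in> K" "b \<notin> K" "x$$a = x$$b"
  have cK: "card K = k'" "card (swap a b ` K) = k'" using K(1) I by (simp_all add: card_image[OF inj_on_subset[OF inj_transpose]])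
  show "\<Psi> (swap a b ` K) x = \<Psi> K x"
   by (rule image_glue[OF _ _ K(2,3) \<Psi>[OF cK(1)] \<Psi>[OF cK(2)] K(4)]) (use S(1,3) cm cK(1) in blast)+
 qed
 have "GEN x. fprod polar_forms x * applied s K x = \<Psi> K x" if K: "card K = k'" for K
  using \<Psi>(2)[OF K] cong[OF K] by eventually_elim simp
 with \<Psi>(1) glue show ?thesis using that by blast
qed

lemma image_in_H_T:
 assumes adm: "admissible_op \<tau> L (2 * (int i - int j)) (eps j) M" and e: "line_bundle \<tau> e" "line_bundle \<tau> (L k)"
  and k: "int k' = int k + (int i - int j)" and s: "s \<in> H_T \<tau> k e {}"
 shows "applied s \<in> H_T \<tau> k' (tensor (pull (eps j) e) (L k)) (pole_divisor w)"
proof -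
 obtain \<Psi> where \<Psi>: "\<And>K. card K = k' ==> holo (\<Psi> K)"
  "\<And>K. card K = k' ==> (GEN x. fprod polar_forms x * applied s K x = \<Psi> K x)"
  and glue: "\<And>I J x. card I = k' ==> card J = k' ==> x \<in> inter_lift {I, J} ==> \<Psi> I x = \<Psi> J x"
  using image_holomorphic[OF assms] by blast
 have il: "x + cscale c (0, y, l) \<in> inter_lift F" if "x \<in> inter_lift F" for x c y l and F :: "'n set set"
  by (rule inter_lift_fst[THEN iffD1, OF _ that]) (simp add: cscale_def)
 \<comment> \<open>One fraction, valid on the whole cover, serves for every component and every
   intersection.\<close>
 note q = polar_quot_on[OF _ \<Psi>]
 have mero: "mero_section \<tau> (tensor e (twist \<tau> K')) (s K')" if "card K' = k" for K'
  using H_T_mero[OF s that] .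
 have "mero_sect \<tau> k' (tensor (pull (eps j) e) (L k)) (applied s)"
  unfolding mero_sect_def
 proof (intro conjI allI impI ballI)
  fix K :: "'n set" assume K: "card K = k'"
  have "mero (applied s K)" unfolding mero_def
  proof
   fix x :: "'n pt"
   show "\<exists>U g h. x \<in> U \<and> quot_on UNIV U (applied s K) g h"
    by (intro exI conjI, rule UNIV_I, rule q[OF _ K K]) simp
  qed
  moreover have "int (card K) = int k + (int i - int j)" using K k by simp
  ultimately show "mero_section \<tau> (tensor (tensor (pull (eps j) e) (L k)) (twist \<tau> K)) (applied s K)"
   unfolding mero_section_def gen_eq_iff using image_automorphy[OF adm] mero by blast
 next
  fix F :: "'n set set" and K and x :: "'n pt"
  assume "F \<noteq> {} \<and> F \<subseteq> {K. card K = k'}" "K \<in> F"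
  hence K: "card K = k'" by blast
  show "\<exists>U g h. x \<in> U \<and> quot_on (inter_lift F) U (applied s K) g h"
   by (intro exI conjI, rule UNIV_I, rule q[OF il K K])
 next
  fix I J :: "'n set" and x :: "'n pt" assume "card I = k' \<and> card J = k'"
  hence I: "card I = k'" and J: "card J = k'" by auto
  show "\<exists>U g h g' h'. x \<in> U \<and> quot_on (inter_lift {I, J}) U (applied s I) g h \<and> quot_on (inter_lift {I, J}) U (applied s J) g' h' \<and>
      (\<forall>u\<in>inter_lift {I, J} \<inter> U. g u * h' u = g' u * h u)"
  proof (intro exI conjI)
   show "quot_on (inter_lift {I, J}) UNIV (applied s I) (\<Psi> I) (fprod polar_forms)" by (rule q[OF il I I])
   show "quot_on (inter_lift {I, J}) UNIV (applied s J) (\<Psi> J) (fprod polar_forms)" by (rule q[OF il J J])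
   show "\<forall>u\<in>inter_lift {I, J} \<inter> UNIV. \<Psi> I u * fprod polar_forms u = \<Psi> J u * fprod polar_forms u"
    using glue[OF I J] by (metis IntD1)
  qed blast
 qed
 moreover have "poles_bounded \<tau> (pole_divisor w) (applied s K)" if "card K = k'" for K
  by (rule poles_bounded_polar[OF \<Psi>[OF that]])
 ultimately show ?thesis unfolding H_T_def by blast
qed

text \<open>M is invariant and shifts commute with permutations. The linearisation c is evaluated at
  the shifted point, which is the linearisation of the pulled-back bundle.\<close>

lemma image_equivariant:
 assumes \<sigma>: "bij \<sigma>" and k: "int (card K) = int k + (int i - int j)"
  and s: "\<And>K'. card K' = k ==> (GEN x. s (\<sigma> ` K') (perm \<sigma> x) = c x * s K' x)"
 shows "GEN x. applied s (\<sigma> ` K) (perm \<sigma> x) = c (shift (eps j) x) * applied s K x"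
proof -
 have "GEN x. M (\<sigma> ` K) (\<sigma> ` K') (perm \<sigma> x) * s (\<sigma> ` K') (shift (eps j) (perm \<sigma> x))
  = c (shift (eps j) x) * (M K K' x * s K' (shift (eps j) x))" if m: "matching K K'" for K'
 proof -
  have "card K' = k" using m k unfolding matching_def by simp
  from generic_shift[OF s[OF this], of "eps j"] M_perm[OF \<sigma> m[unfolded matching_def]]
  show ?thesis by eventually_elim (simp add: shift_perm mult_ac)
 qed
 hence "GEN x. \<forall>K'\<in>{K'. matching K K'}. M (\<sigma> ` K) (\<sigma> ` K') (perm \<sigma> x) * s (\<sigma> ` K') (shift (eps j) (perm \<sigma> x))
  = c (shift (eps j) x) * (M K K' x * s K' (shift (eps j) x))" by (intro eventually_ball_finite) auto
 thus ?thesis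
 proof eventually_elim
  case (elim x)
  have "applied s (\<sigma> ` K) (perm \<sigma> x)
   = (\<Sum>K' | matching K K'. M (\<sigma> ` K) (\<sigma> ` K') (perm \<sigma> x) * s (\<sigma> ` K') (shift (eps j) (perm \<sigma> x)))"
  proof (rule sum.reindex_bij_witness[of _ "%K. \<sigma> ` K" "%K. inv \<sigma> ` K"])
   have i: "\<sigma> ` inv \<sigma> ` K' = K'" for K' using \<sigma> by (simp add: bij_is_surj image_f_inv_f)
   fix K' assume "K' \<in> {K'. matching (\<sigma> ` K) K'}"
   thus "inv \<sigma> ` K' \<in> {K'. matching K K'}" using matching_image[OF \<sigma>, of K "inv \<sigma> ` K'"] i by simp
   show "\<sigma> ` inv \<sigma> ` K' = K'" by (rule i)
   show "M (\<sigma> ` K) (\<sigma> ` inv \<sigma> ` K') (perm \<sigma> x) * s (\<sigma> ` inv \<sigma> ` K') (shift (eps j) (perm \<sigma> x)) = M (\<sigma> ` K) K' (perm \<sigma> x) * s K' (shift (eps j) (perm \<sigma> x))"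
    by (simp only: i)
  next
   fix K' assume "K' \<in> {K'. matching K K'}"
   thus "\<sigma> ` K' \<in> {K'. matching (\<sigma> ` K) K'}" using matching_image[OF \<sigma>] by simp
   show "inv \<sigma> ` \<sigma> ` K' = K'" using \<sigma> by (simp add: bij_is_inj image_inv_f_f)
  qed
  also have "\<dots> = c (shift (eps j) x) * applied s K x" using elim by (simp add: sum_distrib_left)
  finally show ?case .
 qed
qed

end

theorem theorem6p2:
  fixes \<tau> w :: complex and i j :: nat
    and L :: "nat \<Rightarrow> ('n::{finite,linorder}) factor"
    and M :: "'n set \<Rightarrow> 'n set \<Rightarrow> 'n pt \<Rightarrow> complex"
  assumes "Im \<tau> > 0" and "i \<in> {1, 2}" and "j \<in> {1, 2}"
    and "L_operator \<tau> w i j L M"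
  shows "(\<forall>(e :: 'n factor) k k' s.
           line_bundle \<tau> e \<and> k \<le> CARD('n) \<and> k' \<le> CARD('n) \<and> int k' = int k + (int i - int j)
           \<and> s \<in> H_T \<tau> k e {} \<longrightarrow>
           diff_op (2 * (int i - int j)) (eps j) M s
             \<in> H_T \<tau> k' (tensor (pull (eps j) e) (L k)) (pole_divisor w)) \<and>
         (\<forall>(e :: 'n factor) (c :: ('n \<Rightarrow> 'n) \<Rightarrow> 'n pt \<Rightarrow> complex) k k' s.
           G_bundle \<tau> e c \<and> k \<le> CARD('n) \<and> k' \<le> CARD('n) \<and> int k' = int k + (int i - int j)
           \<and> s \<in> H_G \<tau> k e c {} \<longrightarrow>
           diff_op (2 * (int i - int j)) (eps j) M s
             \<in> H_G \<tau> k' (tensor (pull (eps j) e) (L k)) (\<lambda>\<sigma> x. c \<sigma> (shift (eps j) x)) (pole_divisor w))"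
proof -
 have L: "line_bundle \<tau> (L k)" if "k \<le> CARD('n)" for k
  using assms(4) that unfolding L_operator_def equivariant_bundle_def by blast
 have adm: "admissible_op \<tau> L (2 * (int i - int j)) (eps j) M" using assms(4) unfolding L_operator_def by blast
 interpret quantum_entry \<tau> w i j M
 proof
  fix I K :: "'n set" assume K: "int (card K) = int (card I) + (int i - int j)"
  hence "GEN x. diff_op (2 * (int i - int j)) (eps j) M (stab \<tau> I) K x
   = (\<Sum>K'' | card K'' = card K. Lcoeff \<tau> i j w x I K'' * stab \<tau> K'' K x)"
   using assms(4) unfolding L_operator_def gen_eq_iff by blast
  moreover have eq: "{K'. int (card K) = int (card K') + 2 * (int i - int j) div 2} = {K'. card K' = card I}"
   using K by auto
  ultimately show "GEN x. (\<Sum>K' | card K' = card I. M K K' x * stab \<tau> I K' (shift (eps j) x))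
    = (\<Sum>K'' | card K'' = card K. Lcoeff \<tau> i j w x I K'' * stab \<tau> K'' K x)"
   unfolding diff_op_def eq by blast
 qed (use assms in auto)
 have op: "diff_op (2 * (int i - int j)) (eps j) M s = applied s" for s
  by (intro ext) (rule diff_op_eq)
 have T: "applied s \<in> H_T \<tau> k' (tensor (pull (eps j) e) (L k)) (pole_divisor w)"
  if "line_bundle \<tau> e" "k \<le> CARD('n)" "int k' = int k + (int i - int j)" "s \<in> H_T \<tau> k e {}" for e k k' s
  by (rule image_in_H_T[OF adm that(1) L[OF that(2)] that(3,4)])
 have G: "applied s \<in> H_G \<tau> k' (tensor (pull (eps j) e) (L k)) (%\<sigma> x. c \<sigma> (shift (eps j) x)) (pole_divisor w)"
  if e: "G_bundle \<tau> e c" and k: "k \<le> CARD('n)" "int k' = int k + (int i - int j)" and s: "s \<in> H_G \<tau> k e c {}" for e c k k' s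
 proof -
  have "line_bundle \<tau> e" using e unfolding G_bundle_def equivariant_bundle_def by blast
  moreover have "s \<in> H_T \<tau> k e {}" using s unfolding H_G_def by blast
  ultimately have "applied s \<in> H_T \<tau> k' (tensor (pull (eps j) e) (L k)) (pole_divisor w)" using T k by blast
  moreover have "GEN x. applied s (\<sigma> ` K) (perm \<sigma> x) = c \<sigma> (shift (eps j) x) * applied s K x"
   if \<sigma>: "bij \<sigma>" and K: "card K = k'" for \<sigma> K
  proof (rule image_equivariant[OF \<sigma>])
   show "int (card K) = int k + (int i - int j)" using K k(2) by simp
   show "GEN x. s (\<sigma> ` K') (perm \<sigma> x) = c \<sigma> x * s K' x" if "card K' = k" for K'
    using s \<sigma> that unfolding H_G_def gen_eq_iff by blast
  qed
  ultimately show ?thesis unfolding H_G_def gen_eq_iff by blast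
 qed
 show ?thesis unfolding op using T G by blast
qed

end
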